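(* Let $k$ be a field of characteristic $0$, $\mathfrak g$ a finite-dimensional reductive Lie algebra over $k$, $\mathfrak h\subset\mathfrak g$ a Cartan subalgebra and $W$ the Weyl group of $\mathfrak g$. Let $C$ be a coaugmented conilpotent cocommutative DG coalgebra over $k$, and let $$\Phi_{\mathfrak g}(C):\ \mathcal C^c(\mathfrak g^*(C),\mathfrak g^*;k)\to\mathcal C^c(\mathfrak h^*(C),\mathfrak h^*;k)$$ be the morphism of commutative DG algebras induced by the Lie coalgebra homomorphism $\mathfrak g^*\twoheadrightarrow\mathfrak h^*$ dual to the inclusion $\mathfrak h\hookrightarrow\mathfrak g$. Then the image of $\Phi_{\mathfrak g}(C)$ lies in the DG subalgebra $\mathcal C^c(\mathfrak h^*(C),\mathfrak h^*;k)^W$ of chains invariant under the action of $W$.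
   Context: DG objects are homologically graded (differential of degree $-1$), $V[i]_j=V_{j-i}$. For a finite-dimensional Lie algebra $\mathfrak l$ and a cocommutative DG coalgebra $D$, $\mathfrak l^*(D):=\mathfrak l^*\otimes D$ is a DG Lie coalgebra. For a DG Lie coalgebra $\mathfrak G$, $\mathcal C^c(\mathfrak G;k)$ is the commutative DG algebra $(\mathbf{Sym}(\mathfrak G[-1]),d_1+d_2)$ where $\mathbf{Sym}$ is the graded symmetric algebra, $d_1$ is induced by the differential of $\mathfrak G$ and $d_2$ is the derivation determined (up to the sign $\Delta_{-1}(1)=-1\otimes1$ on $k[-1]$) by the cobracket $\mathfrak G\to\wedge^2\mathfrak G$ via $k[-1]\otimes k[-1]\otimes\wedge^2\mathfrak G\cong\mathbf{Sym}^2(\mathfrak G[-1])$. For a surjection of DG Lie coalgebras $\mathfrak G\to\mathfrak l^*$, $\mathcal C^c(\mathfrak G,\mathfrak l^*;k)$ is the DG subalgebra of $\mathfrak l$-invariants in $(\mathbf{Sym}(\mathrm{Ker}(\mathfrak G\to\mathfrak l^* )[-1]),d_1+d_2)$. The surjection $\mathfrak l^*(C)\to\mathfrak l^*$ is induced by the counit of $C$; its kernel is $\mathfrak l^*(\bar C)$, where $\bar C$ is the cokernel of the coaugmentation. Thus $\mathcal C^c(\mathfrak g^*(C),\mathfrak g^*;k)=\mathcal C^c(\mathfrak g^*(\bar C);k)^{\mathrm{ad}\,\mathfrak g}=\mathcal C^c(\mathfrak g^*(\bar C);k)^{G}$, where $G$ is the reductive group attached to $\mathfrak g$, and $\mathcal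 C^c(\mathfrak h^*(C),\mathfrak h^*;k)=\mathcal C^c(\mathfrak h^*(\bar C);k)$. $W$ is the quotient of the normalizer of $\mathfrak h$ in $G$ by the centralizer, and acts on $\mathcal C^c(\mathfrak h^*(\bar C);k)$ through its natural action on $\mathfrak h^*$. *)

theory Defs
  imports
    "HOL-Library.Poly_Mapping"
    "HOL-Algebra.Algebraic_Closure_Type"
    "HOL-Algebra.QuotRing"
    "HOL-Algebra.Coset"
    "HOL-Analysis.Determinants"
begin

section \<open>Free algebras and their quotients\<close>

text \<open>
  Words form a monoid under concatenation, so the monoid algebra \<^typ>\<open>'x list \<Rightarrow>\<^sub>0 'r\<close>
  of \<^theory>\<open>HOL-Library.Poly_Mapping\<close> is the free associative unital \<open>'r\<close>-algebra on \<open>'x\<close>.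
\<close>

instantiation list :: (type) monoid_add
begin
definition zero_list :: "'a list" where "zero_list = []"
definition plus_list :: "'a list \<Rightarrow> 'a list \<Rightarrow> 'a list" where "plus_list = (@)"
instance by standard (simp_all add: zero_list_def plus_list_def)
end

definition cst :: "'r \<Rightarrow> 'x list \<Rightarrow>\<^sub>0 'r::ring_1"
  where "cst r = Poly_Mapping.single [] r"

definition wrd :: "'x list \<Rightarrow> 'x list \<Rightarrow>\<^sub>0 'r::ring_1"
  where "wrd w = Poly_Mapping.single w 1"

abbreviation gen :: "'x \<Rightarrow> 'x list \<Rightarrow>\<^sub>0 'r::ring_1"
  where "gen x \<equiv> wrd [x]"

text \<open>The extension of \<open>f\<close> from words to formal sums, semilinear along \<open>\<iota>\<close>.\<close>

definition linext ::
    "('r::ring_1 \<Rightarrow> 's::ring_1) \<Rightarrow> ('x list \<Rightarrow> 'y list \<Rightarrow>\<^sub>0 's) \<Rightarrow> ('x list \<Rightarrow>\<^sub>0 'r) \<Rightarrow> 'y list \<Rightarrow>\<^sub>0 's"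
  where "linext \<iota> f p = (\<Sum>w\<in>Poly_Mapping.keys p. cst (\<iota> (Poly_Mapping.lookup p w)) * f w)"

definition free_alg :: "'x set \<Rightarrow> ('x list \<Rightarrow>\<^sub>0 'r::ring_1) ring"
  where "free_alg S = \<lparr>carrier = {p. Poly_Mapping.keys p \<subseteq> lists S},
           monoid.mult = (\<lambda>p q. p * q), one = 1, ring.zero = 0, add = (\<lambda>p q. p + q)\<rparr>"

text \<open>
  The map induced by \<open>f\<close> on cosets, with values in cosets of \<open>J\<close> in \<open>R\<close>; it is used only for
  additive \<open>f\<close> that map the ideal of the source into \<open>J\<close>.
\<close>

definition quot_map :: "('b, 'm) ring_scheme \<Rightarrow> 'b set \<Rightarrow> ('a \<Rightarrow> 'b) \<Rightarrow> 'a set \<Rightarrow> 'b set"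
  where "quot_map R J f A = the_elem ((\<lambda>x. J +>\<^bsub>R\<^esub> f x) ` A)"

definition ksgn :: "int \<Rightarrow> 'r::ring_1"
  where "ksgn n = (if even n then 1 else - 1)"

section \<open>DG algebras\<close>

record ('r, 'a) dg_alg = "'a ring" +
  dg_smult :: "'r \<Rightarrow> 'a \<Rightarrow> 'a"
  dg_piece :: "int \<Rightarrow> 'a set"
  dg_diff :: "'a \<Rightarrow> 'a"

definition dg_restrict :: "('r, 'a) dg_alg \<Rightarrow> 'a set \<Rightarrow> ('r, 'a) dg_alg"
  where "dg_restrict A S = A\<lparr>carrier := S, dg_piece := \<lambda>n. dg_piece A n \<inter> S\<rparr>"

definition dg_subalgebra :: "('r, 'a) dg_alg \<Rightarrow> 'a set \<Rightarrow> bool"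
  where "dg_subalgebra A S \<longleftrightarrow>
     S \<subseteq> carrier A \<and> \<one>\<^bsub>A\<^esub> \<in> S \<and> \<zero>\<^bsub>A\<^esub> \<in> S \<and>
     (\<forall>x\<in>S. \<forall>y\<in>S. x \<oplus>\<^bsub>A\<^esub> y \<in> S \<and> x \<otimes>\<^bsub>A\<^esub> y \<in> S) \<and>
     (\<forall>r. \<forall>x\<in>S. dg_smult A r x \<in> S) \<and>
     (\<forall>x\<in>S. dg_diff A x \<in> S) \<and>
     (\<forall>x\<in>S. \<exists>N y. finite N \<and> (\<forall>n\<in>N. y n \<in> dg_piece A n \<inter> S) \<and> x = (\<Oplus>\<^bsub>A\<^esub>n\<in>N. y n))"

section \<open>Coaugmented conilpotent cocommutative DG coalgebras\<close>

text \<open>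
  A graded vector space is a family \<open>co_piece C i\<close> of vector spaces, realised as subspaces of one
  ambient vector space; the graded space meant is the external direct sum, so the pieces need not
  be independent inside the ambient space.  A homogeneous element is written as a letter
  \<open>(i, c)\<close> with \<open>c \<in> co_piece C i\<close>.  The value \<open>co_mult C i c\<close> is a formal sum of two-letter
  words representing \<open>\<Delta>(c)\<close> in \<open>C \<otimes> C\<close>.
\<close>

record (overloaded) ('k, 'c) coalg =
  co_scale :: "'k \<Rightarrow> 'c \<Rightarrow> 'c"
  co_piece :: "int \<Rightarrow> 'c set"
  co_diff :: "int \<Rightarrow> 'c \<Rightarrow> 'c"
  co_mult :: "int \<Rightarrow> 'c \<Rightarrow> (int \<times> 'c) list \<Rightarrow>\<^sub>0 'k"
  co_unit :: "'c \<Rightarrow> 'k"    \<comment> \<open>the counit on the piece of degree 0; it vanishes in all other degrees\<close>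
  co_aug :: "'c"           \<comment> \<open>the image of 1 under the coaugmentation\<close>

definition co_letters :: "('k, 'c) coalg \<Rightarrow> (int \<times> 'c) set"
  where "co_letters C = {(i, c). c \<in> co_piece C i}"

text \<open>
  The tensor algebra of \<open>C\<close> is the free algebra on letters modulo linearity of letters, and the
  tensor powers of \<open>C\<close> are its homogeneous parts with respect to word length.  Formal sums
  represent the same tensor iff they are related by \<open>tens_eq C\<close>.
\<close>

definition tens_rel :: "('k::field, 'c::ab_group_add) coalg \<Rightarrow> ((int \<times> 'c) list \<Rightarrow>\<^sub>0 'k) set"
  where "tens_rel C = Idl\<^bsub>free_alg (co_letters C)\<^esub>
     ({gen (i, a + b) - gen (i, a) - gen (i, b) | i a b. a \<in> co_piece C i \<and> b \<in> co_piece C i} \<union>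
      {gen (i, co_scale C r a) - cst r * gen (i, a) | i r a. a \<in> co_piece C i})"

definition tens_eq ::
    "('k::field, 'c::ab_group_add) coalg \<Rightarrow> ((int \<times> 'c) list \<Rightarrow>\<^sub>0 'k) \<Rightarrow> ((int \<times> 'c) list \<Rightarrow>\<^sub>0 'k) \<Rightarrow> bool"
  where "tens_eq C s t \<longleftrightarrow> s - t \<in> tens_rel C"

text \<open>The linear map given on two-letter words \<open>[x, y]\<close> by \<open>f x y\<close>.\<close>

definition on2 :: "('x \<Rightarrow> 'x \<Rightarrow> 'y list \<Rightarrow>\<^sub>0 'r) \<Rightarrow> ('x list \<Rightarrow>\<^sub>0 'r) \<Rightarrow> 'y list \<Rightarrow>\<^sub>0 'r::ring_1"
  where "on2 f = linext id (\<lambda>w. f (w ! 0) (w ! 1))"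

definition lt_mult :: "('k, 'c) coalg \<Rightarrow> int \<times> 'c \<Rightarrow> (int \<times> 'c) list \<Rightarrow>\<^sub>0 'k"
  where "lt_mult C x = co_mult C (fst x) (snd x)"

definition lt_unit :: "('k::field, 'c) coalg \<Rightarrow> int \<times> 'c \<Rightarrow> 'k"
  where "lt_unit C x = (if fst x = 0 then co_unit C (snd x) else 0)"

definition lt_diff :: "('k, 'c) coalg \<Rightarrow> int \<times> 'c \<Rightarrow> int \<times> 'c"
  where "lt_diff C x = (fst x - 1, co_diff C (fst x) (snd x))"

text \<open>
  The cokernel of the coaugmentation is represented by the kernel of the counit, to which it is
  isomorphic along \<open>lt_proj\<close>; the comultiplication of the cokernel is \<open>red_mult\<close>.  On the
  kernel of the counit it is \<open>\<Delta>(c) - u \<otimes> c - c \<otimes> u\<close> where \<open>u = co_aug C\<close>.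
\<close>

definition red_piece :: "('k::field, 'c) coalg \<Rightarrow> int \<Rightarrow> 'c set"
  where "red_piece C i = {c \<in> co_piece C i. lt_unit C (i, c) = 0}"

definition lt_proj :: "('k::field, 'c::ab_group_add) coalg \<Rightarrow> int \<times> 'c \<Rightarrow> int \<times> 'c"
  where "lt_proj C x =
     (fst x, if fst x = 0 then snd x - co_scale C (co_unit C (snd x)) (co_aug C) else snd x)"

definition red_mult :: "('k::field, 'c::ab_group_add) coalg \<Rightarrow> int \<times> 'c \<Rightarrow> (int \<times> 'c) list \<Rightarrow>\<^sub>0 'k"
  where "red_mult C x = on2 (\<lambda>y z. gen (lt_proj C y) * gen (lt_proj C z)) (lt_mult C x)"

text \<open>
  Applies the reduced comultiplication to the last tensor factor; its \<open>n\<close>-th iterate on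
  one-letter words is the iterated reduced comultiplication with values in the tensor power
  \<open>n + 1\<close>.
\<close>

definition red_step ::
    "('k::field, 'c::ab_group_add) coalg \<Rightarrow> ((int \<times> 'c) list \<Rightarrow>\<^sub>0 'k) \<Rightarrow> (int \<times> 'c) list \<Rightarrow>\<^sub>0 'k"
  where "red_step C = linext id (\<lambda>w. wrd (butlast w) * red_mult C (last w))"

locale coaug_conilp_cocomm_dg_coalgebra =
  fixes C :: "('k::field, 'c::ab_group_add) coalg"
  assumes vs: "vector_space (co_scale C)"
    and piece: "module.subspace (co_scale C) (co_piece C i)"
    and diff_in: "c \<in> co_piece C i \<Longrightarrow> co_diff C i c \<in> co_piece C (i - 1)"
    and diff_add: "a \<in> co_piece C i \<Longrightarrow> b \<in> co_piece C i \<Longrightarrow>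
          co_diff C i (a + b) = co_diff C i a + co_diff C i b"
    and diff_scale: "a \<in> co_piece C i \<Longrightarrow> co_diff C i (co_scale C r a) = co_scale C r (co_diff C i a)"
    and diff_diff: "c \<in> co_piece C i \<Longrightarrow> co_diff C (i - 1) (co_diff C i c) = 0"
    and mult_in: "c \<in> co_piece C i \<Longrightarrow> Poly_Mapping.keys (co_mult C i c) \<subseteq>
          {[(p, a), (q, b)] | p q a b. p + q = i \<and> a \<in> co_piece C p \<and> b \<in> co_piece C q}"
    and mult_add: "a \<in> co_piece C i \<Longrightarrow> b \<in> co_piece C i \<Longrightarrow>
          tens_eq C (co_mult C i (a + b)) (co_mult C i a + co_mult C i b)"
    and mult_scale: "a \<in> co_piece C i \<Longrightarrow>
          tens_eq C (co_mult C i (co_scale C r a)) (cst r * co_mult C i a)"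
    and mult_diff: "c \<in> co_piece C i \<Longrightarrow>
          tens_eq C (co_mult C (i - 1) (co_diff C i c))
            (on2 (\<lambda>x y. gen (lt_diff C x) * gen y + cst (ksgn (fst x)) * gen x * gen (lt_diff C y))
              (co_mult C i c))"
    and coassoc: "c \<in> co_piece C i \<Longrightarrow>
          tens_eq C (on2 (\<lambda>x y. lt_mult C x * gen y) (co_mult C i c))
            (on2 (\<lambda>x y. gen x * lt_mult C y) (co_mult C i c))"
    and cocomm: "c \<in> co_piece C i \<Longrightarrow>
          tens_eq C (on2 (\<lambda>x y. cst (ksgn (fst x * fst y)) * gen y * gen x) (co_mult C i c))
            (co_mult C i c)"
    and unit_add: "a \<in> co_piece C 0 \<Longrightarrow> b \<in> co_piece C 0 \<Longrightarrow>
          co_unit C (a + b) = co_unit C a + co_unit C b"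
    and unit_scale: "a \<in> co_piece C 0 \<Longrightarrow> co_unit C (co_scale C r a) = r * co_unit C a"
    and unit_diff: "c \<in> co_piece C 1 \<Longrightarrow> co_unit C (co_diff C 1 c) = 0"
    and unit_left: "c \<in> co_piece C i \<Longrightarrow>
          tens_eq C (on2 (\<lambda>x y. cst (lt_unit C x) * gen y) (co_mult C i c)) (gen (i, c))"
    and unit_right: "c \<in> co_piece C i \<Longrightarrow>
          tens_eq C (on2 (\<lambda>x y. cst (lt_unit C y) * gen x) (co_mult C i c)) (gen (i, c))"
    and aug_in: "co_aug C \<in> co_piece C 0"
    and aug_unit: "co_unit C (co_aug C) = 1"
    and aug_diff: "co_diff C 0 (co_aug C) = 0"
    and aug_mult: "tens_eq C (co_mult C 0 (co_aug C)) (gen (0, co_aug C) * gen (0, co_aug C))"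
    and conilpotent: "c \<in> red_piece C i \<Longrightarrow> \<exists>n. tens_eq C ((red_step C ^^ n) (gen (i, c))) 0"

section \<open>Lie algebras\<close>

record ('k, 'g) lie_alg =
  lie_scale :: "'k \<Rightarrow> 'g \<Rightarrow> 'g"
  lie_br :: "'g \<Rightarrow> 'g \<Rightarrow> 'g"

locale fd_lie_algebra =
  fixes L :: "('k::field, 'g::ab_group_add) lie_alg"
  assumes vs: "vector_space (lie_scale L)"
    and fin_dim: "\<exists>B. finite B \<and> module.span (lie_scale L) B = UNIV"
    and br_add_left: "lie_br L (x + y) z = lie_br L x z + lie_br L y z"
    and br_add_right: "lie_br L x (y + z) = lie_br L x y + lie_br L x z"
    and br_scale_left: "lie_br L (lie_scale L r x) y = lie_scale L r (lie_br L x y)"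
    and br_scale_right: "lie_br L x (lie_scale L r y) = lie_scale L r (lie_br L x y)"
    and br_self: "lie_br L x x = 0"
    and jacobi: "lie_br L x (lie_br L y z) + lie_br L y (lie_br L z x) + lie_br L z (lie_br L x y) = 0"

definition lie_ideal :: "('k::field, 'g::ab_group_add) lie_alg \<Rightarrow> 'g set \<Rightarrow> bool"
  where "lie_ideal L I \<longleftrightarrow> module.subspace (lie_scale L) I \<and> (\<forall>x. \<forall>y\<in>I. lie_br L x y \<in> I)"

text \<open>Reductive: the adjoint representation is semisimple.\<close>

definition reductive_lie :: "('k::field, 'g::ab_group_add) lie_alg \<Rightarrow> bool"
  where "reductive_lie L \<longleftrightarrow>
     (\<forall>I. lie_ideal L I \<longrightarrow> (\<exists>J. lie_ideal L J \<and> I \<inter> J = {0} \<and> (\<forall>x. \<exists>y\<in>I. \<exists>z\<in>J. x = y + z)))"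

definition lie_subalgebra :: "('k::field, 'g::ab_group_add) lie_alg \<Rightarrow> 'g set \<Rightarrow> bool"
  where "lie_subalgebra L h \<longleftrightarrow>
     module.subspace (lie_scale L) h \<and> (\<forall>x\<in>h. \<forall>y\<in>h. lie_br L x y \<in> h)"

primrec lower_central :: "('k::field, 'g::ab_group_add) lie_alg \<Rightarrow> 'g set \<Rightarrow> nat \<Rightarrow> 'g set"
  where "lower_central L h 0 = h"
  | "lower_central L h (Suc n) =
       module.span (lie_scale L) {lie_br L x y | x y. x \<in> h \<and> y \<in> lower_central L h n}"

definition cartan_subalgebra :: "('k::field, 'g::ab_group_add) lie_alg \<Rightarrow> 'g set \<Rightarrow> bool"
  where "cartan_subalgebra L h \<longleftrightarrow>
     lie_subalgebra L h \<and> (\<exists>n. lower_central L h n = {0}) \<and> {x. \<forall>y\<in>h. lie_br L x y \<in> h} = h"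

section \<open>Chevalley--Eilenberg algebras\<close>

text \<open>
  Everything in this section is written for coefficients in an extension \<open>\<iota> :: 'k \<Rightarrow> 'r\<close> of the
  ground field; the objects over \<open>'k\<close> itself are those with \<open>\<iota> = id\<close>.  For a subalgebra \<open>l\<close> the
  space \<open>lie_dual \<iota> L l\<close> is \<open>Hom(l, 'r) = 'r \<otimes> l\<^sup>*\<close>, with functionals extended by zero outside \<open>l\<close>.
\<close>

definition lie_dual ::
    "('k \<Rightarrow> 'r::field) \<Rightarrow> ('k::field, 'g::ab_group_add) lie_alg \<Rightarrow> 'g set \<Rightarrow> ('g \<Rightarrow> 'r) set"
  where "lie_dual \<iota> L l = {\<phi>. (\<forall>x\<in>l. \<forall>y\<in>l. \<phi> (x + y) = \<phi> x + \<phi> y) \<and>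
      (\<forall>r. \<forall>x\<in>l. \<phi> (lie_scale L r x) = \<iota> r * \<phi> x) \<and> (\<forall>x. x \<notin> l \<longrightarrow> \<phi> x = 0)}"

text \<open>The letter \<open>(\<phi>, i, c)\<close> stands for \<open>\<phi> \<otimes> c\<close>, placed in \<open>l\<^sup>*(C)[-1]\<close> for the reduced coalgebra.\<close>

type_synonym ('g, 'r, 'c) ce_letter = "('g \<Rightarrow> 'r) \<times> int \<times> 'c"

definition ce_letters ::
    "('k \<Rightarrow> 'r::field) \<Rightarrow> ('k::field, 'g::ab_group_add) lie_alg \<Rightarrow> 'g set \<Rightarrow> ('k, 'c) coalg
      \<Rightarrow> ('g, 'r, 'c) ce_letter set"
  where "ce_letters \<iota> L l C = {(\<phi>, i, c). \<phi> \<in> lie_dual \<iota> L l \<and> c \<in> red_piece C i}"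

text \<open>\<open>V[-1]\<^sub>j = V\<^sub>j\<^sub>+\<^sub>1\<close>\<close>

definition ce_deg :: "('g, 'r, 'c) ce_letter \<Rightarrow> int"
  where "ce_deg x = fst (snd x) - 1"

definition ce_word_deg :: "('g, 'r, 'c) ce_letter list \<Rightarrow> int"
  where "ce_word_deg w = (\<Sum>x\<leftarrow>w. ce_deg x)"

text \<open>
  The defining relations of the graded symmetric algebra of \<open>l\<^sup>* \<otimes> D\<close> with \<open>D\<close> the reduced
  coalgebra: bilinearity of the letters gives the tensor algebra of \<open>l\<^sup>* \<otimes> D\<close>, the graded
  commutators its graded symmetric quotient.
\<close>

definition ce_rel ::
    "('k \<Rightarrow> 'r::field) \<Rightarrow> ('k::field, 'g::ab_group_add) lie_alg \<Rightarrow> 'g set \<Rightarrow> ('k, 'c::ab_group_add) coalg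
      \<Rightarrow> (('g, 'r, 'c) ce_letter list \<Rightarrow>\<^sub>0 'r) set"
  where "ce_rel \<iota> L l C = Idl\<^bsub>free_alg (ce_letters \<iota> L l C)\<^esub>
     ({gen (\<lambda>x. \<phi> x + \<psi> x, i, c) - gen (\<phi>, i, c) - gen (\<psi>, i, c) | \<phi> \<psi> i c.
          \<phi> \<in> lie_dual \<iota> L l \<and> \<psi> \<in> lie_dual \<iota> L l \<and> c \<in> red_piece C i} \<union>
      {gen (\<lambda>x. r * \<phi> x, i, c) - cst r * gen (\<phi>, i, c) | r \<phi> i c.
          \<phi> \<in> lie_dual \<iota> L l \<and> c \<in> red_piece C i} \<union>
      {gen (\<phi>, i, a + b) - gen (\<phi>, i, a) - gen (\<phi>, i, b) | \<phi> i a b.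
          \<phi> \<in> lie_dual \<iota> L l \<and> a \<in> red_piece C i \<and> b \<in> red_piece C i} \<union>
      {gen (\<phi>, i, co_scale C s c) - cst (\<iota> s) * gen (\<phi>, i, c) | s \<phi> i c.
          \<phi> \<in> lie_dual \<iota> L l \<and> c \<in> red_piece C i} \<union>
      {gen x * gen y - cst (ksgn (ce_deg x * ce_deg y)) * gen y * gen x | x y.
          x \<in> ce_letters \<iota> L l C \<and> y \<in> ce_letters \<iota> L l C})"

text \<open>
  The cobracket of \<open>l\<^sup>*\<close>, i.e. the dual of the bracket: a formal sum of pairs representing the
  element of \<open>l\<^sup>* \<otimes> l\<^sup>*\<close> that corresponds to the form \<open>(x, y) \<mapsto> \<phi> [x, y]\<close>.  It exists, and is
  unique as a tensor, because \<open>l\<close> is finite-dimensional.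
\<close>

definition lie_cobr ::
    "('k \<Rightarrow> 'r::field) \<Rightarrow> ('k::field, 'g::ab_group_add) lie_alg \<Rightarrow> 'g set \<Rightarrow> ('g \<Rightarrow> 'r)
      \<Rightarrow> (('g \<Rightarrow> 'r) \<times> ('g \<Rightarrow> 'r)) \<Rightarrow>\<^sub>0 'r"
  where "lie_cobr \<iota> L l \<phi> = (SOME t. Poly_Mapping.keys t \<subseteq> lie_dual \<iota> L l \<times> lie_dual \<iota> L l \<and>
      (\<forall>x\<in>l. \<forall>y\<in>l. (\<Sum>p\<in>Poly_Mapping.keys t. Poly_Mapping.lookup t p * fst p x * snd p y)
         = \<phi> (lie_br L x y)))"

text \<open>
  With \<open>V[-1] = k[-1] \<otimes> V\<close> the differential of \<open>V\<close> acquires the sign \<open>-1\<close> from passing \<open>k[-1]\<close>.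
\<close>

definition ce_d1 ::
    "('k, 'c) coalg \<Rightarrow> ('g, 'r, 'c) ce_letter \<Rightarrow> ('g, 'r, 'c) ce_letter list \<Rightarrow>\<^sub>0 'r::field"
  where "ce_d1 C x = - gen (fst x, lt_diff C (snd x))"

text \<open>
  In the quadratic part the sign \<open>-1\<close> is that of \<open>1 \<mapsto> -1 \<otimes> 1\<close> on \<open>k[-1]\<close>, and the Koszul sign
  comes from moving the second factor \<open>k[-1]\<close> past the first factor of the cobracket.  The
  factor 1/2 is that of the identification of the antisymmetric tensor \<open>\<Sum>\<alpha> \<otimes> \<beta>\<close> with
  \<open>1/2 \<Sum>\<alpha> \<and> \<beta>\<close> in the exterior square.
\<close>

definition ce_d2 ::
    "('k \<Rightarrow> 'r::field) \<Rightarrow> ('k::field, 'g::ab_group_add) lie_alg \<Rightarrow> 'g set \<Rightarrow> ('k, 'c::ab_group_add) coalg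
      \<Rightarrow> ('g, 'r, 'c) ce_letter \<Rightarrow> ('g, 'r, 'c) ce_letter list \<Rightarrow>\<^sub>0 'r"
  where "ce_d2 \<iota> L l C x =
     - linext \<iota> (\<lambda>w. \<Sum>p\<in>Poly_Mapping.keys (lie_cobr \<iota> L l (fst x)).
          cst (Poly_Mapping.lookup (lie_cobr \<iota> L l (fst x)) p * ksgn (fst (w ! 0)) / 2)
            * gen (fst p, w ! 0) * gen (snd p, w ! 1))
        (red_mult C (snd x))"

text \<open>The derivation of degree \<open>e\<close> given on letters by \<open>D\<close>.\<close>

definition ce_der ::
    "int \<Rightarrow> (('g, 'r, 'c) ce_letter \<Rightarrow> ('g, 'r, 'c) ce_letter list \<Rightarrow>\<^sub>0 'r::field)
      \<Rightarrow> (('g, 'r, 'c) ce_letter list \<Rightarrow>\<^sub>0 'r) \<Rightarrow> ('g, 'r, 'c) ce_letter list \<Rightarrow>\<^sub>0 'r"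
  where "ce_der e D = linext id (\<lambda>w. \<Sum>j<length w.
      cst (ksgn (e * ce_word_deg (take j w))) * wrd (take j w) * D (w ! j) * wrd (drop (Suc j) w))"

definition ce_map ::
    "('k \<Rightarrow> 'r::field) \<Rightarrow> ('k::field, 'g::ab_group_add) lie_alg \<Rightarrow> 'g set \<Rightarrow> ('k, 'c::ab_group_add) coalg
      \<Rightarrow> ('a \<Rightarrow> ('g, 'r, 'c) ce_letter list \<Rightarrow>\<^sub>0 'r) \<Rightarrow> 'a set
      \<Rightarrow> (('g, 'r, 'c) ce_letter list \<Rightarrow>\<^sub>0 'r) set"
  where "ce_map \<iota> L l C = quot_map (free_alg (ce_letters \<iota> L l C)) (ce_rel \<iota> L l C)"

text \<open>This is \<open>\<C>\<^sup>c(l\<^sup>*(D))\<close> for the reduced coalgebra \<open>D\<close> of \<open>C\<close>.\<close>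

definition ce_alg ::
    "('k \<Rightarrow> 'r::field) \<Rightarrow> ('k::field, 'g::ab_group_add) lie_alg \<Rightarrow> 'g set \<Rightarrow> ('k, 'c::ab_group_add) coalg
      \<Rightarrow> ('r, (('g, 'r, 'c) ce_letter list \<Rightarrow>\<^sub>0 'r) set) dg_alg"
  where "ce_alg \<iota> L l C =
     (let F = free_alg (ce_letters \<iota> L l C); I = ce_rel \<iota> L l C in
      ring.extend (F Quot I)
        (dg_alg.fields
          (\<lambda>r. ce_map \<iota> L l C (\<lambda>x. cst r * x))
          (\<lambda>n. {I +>\<^bsub>F\<^esub> x | x. x \<in> carrier F \<and> (\<forall>w\<in>Poly_Mapping.keys x. ce_word_deg w = n)})
          (ce_map \<iota> L l C (ce_der (- 1) (\<lambda>x. ce_d1 C x + ce_d2 \<iota> L l C x)))))"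

definition coad :: "('k, 'g) lie_alg \<Rightarrow> 'g set \<Rightarrow> 'g \<Rightarrow> ('g \<Rightarrow> 'r::field) \<Rightarrow> 'g \<Rightarrow> 'r"
  where "coad L l z \<phi> = (\<lambda>x. if x \<in> l then - \<phi> (lie_br L z x) else 0)"

definition ce_lie_act ::
    "('k \<Rightarrow> 'r::field) \<Rightarrow> ('k::field, 'g::ab_group_add) lie_alg \<Rightarrow> 'g set \<Rightarrow> ('k, 'c::ab_group_add) coalg
      \<Rightarrow> 'g \<Rightarrow> (('g, 'r, 'c) ce_letter list \<Rightarrow>\<^sub>0 'r) set \<Rightarrow> (('g, 'r, 'c) ce_letter list \<Rightarrow>\<^sub>0 'r) set"
  where "ce_lie_act \<iota> L l C z = ce_map \<iota> L l C (ce_der 0 (\<lambda>x. gen (coad L l z (fst x), snd x)))"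

text \<open>The relative algebra \<open>\<C>\<^sup>c(l\<^sup>*(C), l\<^sup>*; k)\<close>.\<close>

definition rel_ce_alg ::
    "('k::field, 'g::ab_group_add) lie_alg \<Rightarrow> 'g set \<Rightarrow> ('k, 'c::ab_group_add) coalg
      \<Rightarrow> ('k, (('g, 'k, 'c) ce_letter list \<Rightarrow>\<^sub>0 'k) set) dg_alg"
  where "rel_ce_alg L l C = dg_restrict (ce_alg id L l C)
     {A \<in> carrier (ce_alg id L l C). \<forall>z\<in>l. ce_lie_act id L l C z A = \<zero>\<^bsub>ce_alg id L l C\<^esub>}"

text \<open>The map \<open>\<Phi>\<close> induced by restriction of functionals from the Lie algebra to \<open>h\<close>.\<close>

definition ce_restrict ::
    "('k::field, 'g::ab_group_add) lie_alg \<Rightarrow> 'g set \<Rightarrow> ('k, 'c::ab_group_add) coalg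
      \<Rightarrow> (('g, 'k, 'c) ce_letter list \<Rightarrow>\<^sub>0 'k) set \<Rightarrow> (('g, 'k, 'c) ce_letter list \<Rightarrow>\<^sub>0 'k) set"
  where "ce_restrict L h C = ce_map id L h C
     (linext id (\<lambda>w. wrd (map (\<lambda>x. (\<lambda>y. if y \<in> h then fst x y else 0, snd x)) w)))"

text \<open>Extension of scalars to the algebraic closure of the ground field.\<close>

definition ce_base_change ::
    "('k::field, 'g::ab_group_add) lie_alg \<Rightarrow> 'g set \<Rightarrow> ('k, 'c::ab_group_add) coalg
      \<Rightarrow> (('g, 'k, 'c) ce_letter list \<Rightarrow>\<^sub>0 'k) set
      \<Rightarrow> (('g, 'k alg_closure, 'c) ce_letter list \<Rightarrow>\<^sub>0 'k alg_closure) set"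
  where "ce_base_change L l C = ce_map to_ac L l C
     (linext to_ac (\<lambda>w. wrd (map (\<lambda>x. (to_ac \<circ> fst x, snd x)) w)))"

section \<open>Linear algebraic groups\<close>

text \<open>Polynomial functions of the matrix entries.\<close>

inductive_set polyfun :: "('a::field ^ 'm ^ 'm \<Rightarrow> 'a) set"
  where "(\<lambda>A. c) \<in> polyfun"
  | "(\<lambda>A. A $ i $ j) \<in> polyfun"
  | "p \<in> polyfun \<Longrightarrow> q \<in> polyfun \<Longrightarrow> (\<lambda>A. p A + q A) \<in> polyfun"
  | "p \<in> polyfun \<Longrightarrow> q \<in> polyfun \<Longrightarrow> (\<lambda>A. p A * q A) \<in> polyfun"

definition mat_group :: "('a::field ^ 'm ^ 'm) set \<Rightarrow> ('a ^ 'm ^ 'm) monoid"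
  where "mat_group S = \<lparr>carrier = S, monoid.mult = (**), one = mat 1\<rparr>"

text \<open>
  Algebraic groups over an algebraically closed field are identified with their groups of
  rational points.
\<close>

definition zariski_closed :: "('a::field ^ 'm ^ 'm) set \<Rightarrow> bool"
  where "zariski_closed S \<longleftrightarrow> (\<exists>P\<subseteq>polyfun. S = {A. invertible A \<and> (\<forall>p\<in>P. p A = 0)})"

definition zariski_connected :: "('a::field ^ 'm ^ 'm) set \<Rightarrow> bool"
  where "zariski_connected S \<longleftrightarrow> \<not> (\<exists>A B. zariski_closed A \<and> zariski_closed B \<and>
     A \<noteq> {} \<and> B \<noteq> {} \<and> A \<inter> B = {} \<and> A \<union> B = S)"

definition linear_alg_group :: "('a::alg_closed_field ^ 'm ^ 'm) set \<Rightarrow> bool"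
  where "linear_alg_group G \<longleftrightarrow>
     zariski_closed G \<and> subgroup G (mat_group {A. invertible A})"

definition unipotent_set :: "('a::field ^ 'm ^ 'm) set \<Rightarrow> bool"
  where "unipotent_set U \<longleftrightarrow> (\<forall>A\<in>U. \<exists>n. (((**) (A - mat 1)) ^^ n) (mat 1) = 0)"

text \<open>Connected, with trivial unipotent radical.\<close>

definition reductive_group :: "('a::alg_closed_field ^ 'm ^ 'm) set \<Rightarrow> bool"
  where "reductive_group G \<longleftrightarrow> linear_alg_group G \<and> zariski_connected G \<and>
     (\<forall>U. linear_alg_group U \<and> zariski_connected U \<and> U \<lhd> mat_group G \<and> unipotent_set U
        \<longrightarrow> U = {mat 1})"

definition mat_scale :: "'a::field \<Rightarrow> 'a ^ 'm ^ 'm \<Rightarrow> 'a ^ 'm ^ 'm"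
  where "mat_scale r A = (\<chi> i j. r * A $ i $ j)"

text \<open>
  The tangent space at the identity, i.e. the matrices \<open>Y\<close> such that \<open>1 + \<epsilon> Y\<close> annihilates the ideal
  of \<open>G\<close> when \<open>\<epsilon>\<^sup>2 = 0\<close>.  Over an infinite field there is exactly one polynomial \<open>q\<close> with
  \<open>q(t) = p(1 + t Y)\<close> for all \<open>t\<close>, and its linear coefficient is the derivative of \<open>p\<close> at 1 along \<open>Y\<close>.
\<close>

definition group_lie :: "('a::alg_closed_field ^ 'm ^ 'm) set \<Rightarrow> ('a ^ 'm ^ 'm) set"
  where "group_lie G = {Y. \<forall>p\<in>polyfun. (\<forall>A\<in>G. p A = 0) \<longrightarrow>
     (\<forall>q. (\<forall>t. poly q t = p (mat 1 + mat_scale t Y)) \<longrightarrow> poly.coeff q 1 = 0)}"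

text \<open>
  \<open>\<rho>\<close> identifies the extension of scalars of \<open>L\<close> to the algebraic closure with the Lie algebra of
  \<open>G\<close>: it is a homomorphism of Lie algebras over the ground field that sends a basis of \<open>L\<close> to a
  basis of the Lie algebra of \<open>G\<close>.
\<close>

definition lie_alg_of_group ::
    "('k::field, 'g::ab_group_add) lie_alg \<Rightarrow> ('k alg_closure ^ 'm ^ 'm) set
      \<Rightarrow> ('g \<Rightarrow> 'k alg_closure ^ 'm ^ 'm) \<Rightarrow> bool"
  where "lie_alg_of_group L G \<rho> \<longleftrightarrow>
     (\<forall>x y. \<rho> (x + y) = \<rho> x + \<rho> y) \<and>
     (\<forall>r x. \<rho> (lie_scale L r x) = mat_scale (to_ac r) (\<rho> x)) \<and>
     (\<forall>x y. \<rho> (lie_br L x y) = \<rho> x ** \<rho> y - \<rho> y ** \<rho> x) \<and>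
     (\<exists>B. \<not> module.dependent (lie_scale L) B \<and> module.span (lie_scale L) B = UNIV \<and>
        inj_on \<rho> B \<and> \<not> module.dependent mat_scale (\<rho> ` B) \<and>
        module.span mat_scale (\<rho> ` B) = group_lie G)"

section \<open>The Weyl group\<close>

text \<open>
  No splitting is assumed, so the group \<open>W\<close> is in general only a finite etale group scheme over the
  ground field.  It is described by its points over the algebraic closure, and invariance of an
  element over the ground field means invariance after extension of scalars.  If \<open>h\<close> is split, \<open>W\<close>
  acts over the ground field and this is invariance in the usual sense.
\<close>

definition ext_span :: "('g \<Rightarrow> 'a::field ^ 'm ^ 'm) \<Rightarrow> 'g set \<Rightarrow> ('a ^ 'm ^ 'm) set"
  where "ext_span \<rho> h = module.span mat_scale (\<rho> ` h)"

definition cartan_normalizer ::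
    "('a::field ^ 'm ^ 'm) set \<Rightarrow> ('g \<Rightarrow> 'a ^ 'm ^ 'm) \<Rightarrow> 'g set \<Rightarrow> ('a ^ 'm ^ 'm) set"
  where "cartan_normalizer G \<rho> h =
     {A \<in> G. (\<lambda>Y. A ** Y ** matrix_inv A) ` ext_span \<rho> h = ext_span \<rho> h}"

definition cartan_centralizer ::
    "('a::field ^ 'm ^ 'm) set \<Rightarrow> ('g \<Rightarrow> 'a ^ 'm ^ 'm) \<Rightarrow> 'g set \<Rightarrow> ('a ^ 'm ^ 'm) set"
  where "cartan_centralizer G \<rho> h = {A \<in> G. \<forall>Y\<in>ext_span \<rho> h. A ** Y ** matrix_inv A = Y}"

definition weyl_group ::
    "('a::field ^ 'm ^ 'm) set \<Rightarrow> ('g \<Rightarrow> 'a ^ 'm ^ 'm) \<Rightarrow> 'g set \<Rightarrow> ('a ^ 'm ^ 'm) set monoid"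
  where "weyl_group G \<rho> h = mat_group (cartan_normalizer G \<rho> h) Mod cartan_centralizer G \<rho> h"

text \<open>
  The action of \<open>A\<close> in the normalizer on a functional \<open>\<phi>\<close> on \<open>h\<close> with values in the algebraic
  closure: extend \<open>\<phi>\<close> linearly to the span of \<open>\<rho> ` h\<close> and precompose with the inverse of \<open>Ad A\<close>.
  Only the values on that span matter.
\<close>

definition norm_act ::
    "('g \<Rightarrow> 'a::field ^ 'm ^ 'm) \<Rightarrow> 'g set \<Rightarrow> 'a ^ 'm ^ 'm \<Rightarrow> ('g \<Rightarrow> 'a) \<Rightarrow> 'g \<Rightarrow> 'a"
  where "norm_act \<rho> h A \<phi> = (\<lambda>x. if x \<in> h then
     (SOME \<psi>. Vector_Spaces.linear mat_scale (*) \<psi> \<and> (\<forall>y\<in>h. \<psi> (\<rho> y) = \<phi> y))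
       (matrix_inv A ** \<rho> x ** A) else 0)"

definition weyl_act ::
    "('k::field, 'g::ab_group_add) lie_alg \<Rightarrow> 'g set \<Rightarrow> ('k, 'c::ab_group_add) coalg
      \<Rightarrow> ('g \<Rightarrow> 'k alg_closure ^ 'm ^ 'm) \<Rightarrow> ('k alg_closure ^ 'm ^ 'm) set
      \<Rightarrow> (('g, 'k alg_closure, 'c) ce_letter list \<Rightarrow>\<^sub>0 'k alg_closure) set
      \<Rightarrow> (('g, 'k alg_closure, 'c) ce_letter list \<Rightarrow>\<^sub>0 'k alg_closure) set"
  where "weyl_act L h C \<rho> w = ce_map to_ac L h C
     (linext id (\<lambda>u. wrd (map (\<lambda>x. (norm_act \<rho> h (SOME A. A \<in> w) (fst x), snd x)) u)))"

definition weyl_invariants ::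
    "('k::field, 'g::ab_group_add) lie_alg \<Rightarrow> 'g set \<Rightarrow> ('k, 'c::ab_group_add) coalg
      \<Rightarrow> ('k alg_closure ^ 'm ^ 'm) set \<Rightarrow> ('g \<Rightarrow> 'k alg_closure ^ 'm ^ 'm)
      \<Rightarrow> (('g, 'k, 'c) ce_letter list \<Rightarrow>\<^sub>0 'k) set set"
  where "weyl_invariants L h C G \<rho> = {A \<in> carrier (rel_ce_alg L h C).
     \<forall>w\<in>carrier (weyl_group G \<rho> h).
       weyl_act L h C \<rho> w (ce_base_change L h C A) = ce_base_change L h C A}"

end

theory Submission
  imports Defs "HOL-Library.Function_Algebras"
begin

text \<open>
  A \<open>g\<close>-invariant element \<open>u\<close> of the Chevalley--Eilenberg algebra is \<open>G\<close>-invariant.  Indeed, a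
  coordinate of \<open>det(A)\<^sup>n A \<cdot> u\<close> is, for large \<open>n\<close>, a polynomial function on \<open>G\<close>, and it is a
  semi-invariant of the left invariant vector fields with the same weight as \<open>det(A)\<^sup>n\<close>.  In
  characteristic 0 such semi-invariants are proportional on a connected group: the Euler operator
  of the vector fields puts a semi-invariant that vanishes at 1 into every power of the maximal ideal,
  so it vanishes near 1 by Krull's intersection theorem, and by translation the quotient of two
  semi-invariants is locally constant.  Restriction to \<open>h\<close> intertwines the actions of the normalizer
  of \<open>h\<close> on the two algebras, so it maps \<open>G\<close>-invariants to \<open>W\<close>-invariants.  The latter are closed
  under the differential since conjugation by the normalizer preserves the bracket.
\<close>

section \<open>Noetherian rings\<close>

text \<open>The entries of the inverse of \<open>A\<close> are not polynomial in \<open>A\<close>; a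
  power of \<open>det A\<close> clears these denominators, and as \<open>det\<close> is itself a
  semi-invariant it only shifts the weight. The obstacle is that \<open>group_lie G\<close> is known
  only through the functions vanishing on \<open>G\<close>: neither an exponential map nor the
  equality of its dimension with that of \<open>G\<close> is at hand. Duality replaces both. The
  differentials at 1 of the functions vanishing on \<open>G\<close> fill the annihilator of
  \<open>group_lie G\<close>, so linear forms dual to a basis of \<open>group_lie G\<close> span the
  cotangent space, and from them the Euler operator is built. A second difficulty is one of
  representatives. Elements of the algebras are cosets in a free algebra, the cobracket is an
  arbitrarily chosen tensor, and the comultiplication is additive only up to tensor relations. Most
  identities therefore hold modulo the ideal of relations, and every operation must be shown to
  preserve that ideal. Finally, Weyl invariance is tested over the algebraic closure, so extension
  of scalars has to be compatible with the differential, the Lie action and restriction to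
  \<open>h\<close>.\<close>

definition subring_set :: "'a::comm_ring_1 set \<Rightarrow> bool"
  where "subring_set S \<longleftrightarrow> 1 \<in> S \<and> (\<forall>x\<in>S. \<forall>y\<in>S. x - y \<in> S \<and> x * y \<in> S)"

lemma subring_setD:
  assumes "subring_set S"
  shows "1 \<in> S" "0 \<in> S" "x \<in> S \<Longrightarrow> y \<in> S \<Longrightarrow> x - y \<in> S" "x \<in> S \<Longrightarrow> y \<in> S \<Longrightarrow> x * y \<in> S"
    "x \<in> S \<Longrightarrow> - x \<in> S" "x \<in> S \<Longrightarrow> y \<in> S \<Longrightarrow> x + y \<in> S" "x \<in> S \<Longrightarrow> x ^ n \<in> S"
proof -
  show 1: "1 \<in> S" and d: "x \<in> S \<Longrightarrow> y \<in> S \<Longrightarrow> x - y \<in> S"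
    and m: "x \<in> S \<Longrightarrow> y \<in> S \<Longrightarrow> x * y \<in> S" for x y
    using assms by (auto simp: subring_set_def)
  show z: "0 \<in> S"
    using d[OF 1 1] by simp
  show u: "x \<in> S \<Longrightarrow> - x \<in> S" for x
    using d[OF z] by fastforce
  show "x \<in> S \<Longrightarrow> y \<in> S \<Longrightarrow> x + y \<in> S" for y
    using d[OF _ u] by fastforce
  show "x \<in> S \<Longrightarrow> x ^ n \<in> S"
    by (induction n) (auto simp: 1 m)
qed

definition ideal_of :: "'a::comm_ring_1 set \<Rightarrow> 'a set \<Rightarrow> bool"
  where "ideal_of S J \<longleftrightarrow> J \<subseteq> S \<and> 0 \<in> J \<and> (\<forall>x\<in>J. \<forall>y\<in>J. x + y \<in> J) \<and> (\<forall>r\<in>S. \<forall>x\<in>J. r * x \<in> J)"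

lemma ideal_ofI:
  assumes "J \<subseteq> S" "0 \<in> J" "\<And>x y. x \<in> J \<Longrightarrow> y \<in> J \<Longrightarrow> x + y \<in> J" "\<And>r x. r \<in> S \<Longrightarrow> x \<in> J \<Longrightarrow> r * x \<in> J"
  shows "ideal_of S J"
  using assms by (auto simp: ideal_of_def)

lemma ideal_ofD:
  assumes "ideal_of S J"
  shows "x \<in> J \<Longrightarrow> x \<in> S" "0 \<in> J" "x \<in> J \<Longrightarrow> y \<in> J \<Longrightarrow> x + y \<in> J" "r \<in> S \<Longrightarrow> x \<in> J \<Longrightarrow> r * x \<in> J"
    "r \<in> S \<Longrightarrow> x \<in> J \<Longrightarrow> x * r \<in> J"
  using assms by (auto simp: ideal_of_def mult.commute)

lemma ideal_of_diff:
  assumes "subring_set S" "ideal_of S J" "x \<in> J" "y \<in> J"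
  shows "x - y \<in> J"
proof -
  have "(- 1) * y \<in> J"
    using assms subring_setD by (blast intro: ideal_ofD(4))
  then have "x + (- 1) * y \<in> J"
    using assms by (blast intro: ideal_ofD(3))
  then show ?thesis
    by simp
qed

text \<open>Subsets are used instead of types because the ring of interest, \<open>polyfun\<close>,
  is a subset of a function type. The ascending chain condition is the form that Hilbert's argument
  produces and that yields maximal ideals in Krull's theorem.\<close>

definition noetherian_set :: "'a::comm_ring_1 set \<Rightarrow> bool"
  where "noetherian_set S \<longleftrightarrow>
    (\<forall>f :: nat \<Rightarrow> 'a set. (\<forall>n. ideal_of S (f n)) \<and> (\<forall>n. f n \<subseteq> f (Suc n)) \<longrightarrow> (\<exists>N. \<forall>n\<ge>N. f n = f N))"

text \<open>The image of \<open>S[X]\<close> under evaluation at \<open>t\<close>. No independence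
  of \<open>t\<close> is required, so the step also covers coordinate functions that satisfy
  relations, as over a finite field.\<close>

definition adjoin :: "'a::comm_ring_1 set \<Rightarrow> 'a \<Rightarrow> 'a set"
  where "adjoin S t = {poly p t | p. \<forall>i. poly.coeff p i \<in> S}"

lemma coeff_mult_in:
  assumes "subring_set S" "\<forall>i. poly.coeff p i \<in> S" "\<forall>i. poly.coeff q i \<in> S"
  shows "poly.coeff (p * q) i \<in> S"
proof -
  have "sum f A \<in> S" if "\<And>i. i \<in> A \<Longrightarrow> f i \<in> S" for f :: "nat \<Rightarrow> 'a" and A
    using that by (induction A rule: infinite_finite_induct) (auto intro: subring_setD[OF assms(1)])
  then show ?thesis
    using assms by (simp add: coeff_mult subring_setD)
qed

lemma subring_set_adjoin:
  assumes "subring_set S"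
  shows "subring_set (adjoin S t)"
  unfolding subring_set_def
proof (intro conjI ballI)
  show "1 \<in> adjoin S t"
    unfolding adjoin_def using subring_setD[OF assms]
    by (auto intro!: exI[of _ 1] simp: coeff_pCons one_pCons split: nat.split)
  fix x y assume "x \<in> adjoin S t" "y \<in> adjoin S t"
  then obtain p q where pq: "x = poly p t" "y = poly q t"
    "\<forall>i. poly.coeff p i \<in> S" "\<forall>i. poly.coeff q i \<in> S"
    by (auto simp: adjoin_def)
  show "x - y \<in> adjoin S t"
    unfolding adjoin_def using pq subring_setD[OF assms] by (auto intro!: exI[of _ "p - q"])
  show "x * y \<in> adjoin S t"
    unfolding adjoin_def using pq coeff_mult_in[OF assms] by (auto intro!: exI[of _ "p * q"])
qed

lemma adjoin_superset:
  assumes "subring_set S"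
  shows "S \<subseteq> adjoin S t" "t \<in> adjoin S t"
  unfolding adjoin_def
proof -
  have "\<forall>i. poly.coeff [:x:] i \<in> S" if "x \<in> S" for x
    using that subring_setD[OF assms] by (simp add: coeff_pCons split: nat.split)
  moreover have "poly [:x:] t = x" for x
    by simp
  ultimately show "S \<subseteq> {poly p t | p. \<forall>i. poly.coeff p i \<in> S}"
    by (smt (verit) mem_Collect_eq subsetI)
  show "t \<in> {poly p t | p. \<forall>i. poly.coeff p i \<in> S}"
    using subring_setD[OF assms]
    by (auto intro!: exI[of _ "[:0, 1:]"] simp: coeff_pCons split: nat.split)
qed

lemma adjoin_subset:
  assumes "subring_set T" "S \<subseteq> T" "t \<in> T"
  shows "adjoin S t \<subseteq> T"
proof -
  have "poly p t \<in> T" if "\<forall>i. poly.coeff p i \<in> S" for p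
    using that
  proof (induction p)
    case 0
    then show ?case
      using subring_setD[OF assms(1)] by simp
  next
    case (pCons a p)
    have "a \<in> S" "\<forall>i. poly.coeff p i \<in> S"
      using pCons.prems by (metis coeff_pCons_0, metis coeff_pCons_Suc)
    then show ?case
      using pCons.IH assms subring_setD[OF assms(1)] by auto
  qed
  then show ?thesis
    by (auto simp: adjoin_def)
qed

text \<open>Hilbert's argument: the ideals of leading coefficients in each degree determine a chain.\<close>

lemma noetherian_set_adjoin:
  assumes S: "subring_set S" and N: "noetherian_set S"
  shows "noetherian_set (adjoin S t)"
  unfolding noetherian_set_def
proof (intro allI impI)
  fix J :: "nat \<Rightarrow> 'a set"
  assume "(\<forall>n. ideal_of (adjoin S t) (J n)) \<and> (\<forall>n. J n \<subseteq> J (Suc n))"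
  then have J: "\<And>n. ideal_of (adjoin S t) (J n)" and "\<And>n. J n \<subseteq> J (Suc n)"
    by auto
  then have Jmono: "J m \<subseteq> J n" if "m \<le> n" for m n
    using that by (simp add: lift_Suc_mono_le)
  note St = subring_set_adjoin[OF S, of t]
  define P where "P = {p. \<forall>i. poly.coeff p i \<in> S}"
  define L where "L n d = {poly.coeff p d | p. p \<in> P \<and> Polynomial.degree p \<le> d \<and> poly p t \<in> J n}" for n d
  have L: "ideal_of S (L n d)" for n d
  proof (rule ideal_ofI)
    show "L n d \<subseteq> S"
      by (auto simp: L_def P_def)
    show "0 \<in> L n d"
      using ideal_ofD(2)[OF J] subring_setD[OF S] by (auto simp: L_def P_def intro!: exI[of _ 0])
    show "x + y \<in> L n d" if "x \<in> L n d" "y \<in> L n d" for x y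
    proof -
      from that obtain p q where "x = poly.coeff p d" "y = poly.coeff q d" "p \<in> P" "q \<in> P"
        "Polynomial.degree p \<le> d" "Polynomial.degree q \<le> d" "poly p t \<in> J n" "poly q t \<in> J n"
        by (auto simp: L_def)
      then show ?thesis
        unfolding L_def P_def using subring_setD[OF S] ideal_ofD(3)[OF J]
        by (auto intro!: exI[of _ "p + q"] degree_add_le)
    qed
    show "r * x \<in> L n d" if r: "r \<in> S" and "x \<in> L n d" for r x
    proof -
      from that obtain p where p: "x = poly.coeff p d" "p \<in> P" "Polynomial.degree p \<le> d" "poly p t \<in> J n"
        by (auto simp: L_def)
      have "r * poly p t \<in> J n"
        using r p adjoin_superset[OF S] by (blast intro: ideal_ofD(4)[OF J])
      then show ?thesis
        unfolding L_def P_def using p r subring_setD[OF S]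
        by (auto intro!: exI[of _ "Polynomial.smult r p"] simp: P_def intro: order_trans[OF degree_smult_le])
    qed
  qed
  have L1: "L m d \<subseteq> L n d" if "m \<le> n" for m n d
    using Jmono[OF that] by (auto simp: L_def)
  have "L n d \<subseteq> L n (Suc d)" for n d
  proof
    fix x assume "x \<in> L n d"
    then obtain p where p: "x = poly.coeff p d" "p \<in> P" "Polynomial.degree p \<le> d" "poly p t \<in> J n"
      by (auto simp: L_def)
    have "t * poly p t \<in> J n"
      using p adjoin_superset[OF S] by (blast intro: ideal_ofD(4)[OF J])
    moreover have "Polynomial.degree (pCons 0 p) \<le> Suc d"
      using p(3) degree_pCons_le le_trans Suc_le_mono by blast
    ultimately show "x \<in> L n (Suc d)"
      unfolding L_def using p subring_setD[OF S]
      by (auto intro!: exI[of _ "pCons 0 p"] simp: P_def coeff_pCons split: nat.split)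
  qed
  then have L2: "L n d \<subseteq> L n e" if "d \<le> e" for n d e
    using that lift_Suc_mono_le[of "L n"] by blast
  have stab: "\<exists>N. \<forall>n\<ge>N. f n = f N" if "\<And>n. ideal_of S (f n)" "\<And>n. f n \<subseteq> f (Suc n)" for f :: "nat \<Rightarrow> 'a set"
    using N that by (auto simp: noetherian_set_def)
  obtain N where N: "\<And>n. n \<ge> N \<Longrightarrow> L n n = L N N"
    using stab[of "\<lambda>n. L n n"] L L1 L2 by (meson le_Suc_eq order.refl order.trans)
  \<comment> \<open>The diagonal chain settles all degrees from \<open>N\<close> on at once. Only
    finitely many chains, those of degree \<open>d < N\<close>, remain, and \<open>K\<close> below
    dominates their stationarity indices.\<close>
  have big: "L n d = L N N" if "n \<ge> N" "d \<ge> N" for n d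
  proof
    show "L N N \<subseteq> L n d"
      using L1[of N n N] L2[of N d n] that by blast
    have "L n d \<subseteq> L (max n d) (max n d)"
      using L1[of n "max n d" d] L2[of d "max n d" "max n d"] by auto
    then show "L n d \<subseteq> L N N"
      using N[of "max n d"] that by auto
  qed
  have "\<exists>M. \<forall>n\<ge>M. L n d = L M d" for d
    using stab[of "\<lambda>n. L n d"] L L1 by (meson le_Suc_eq order.refl)
  then obtain M where M: "\<And>d n. n \<ge> M d \<Longrightarrow> L n d = L (M d) d"
    by metis
  define K where "K = Max (insert N (M ` {..<N}))"
  have K: "K \<ge> N" "\<And>d. d < N \<Longrightarrow> K \<ge> M d"
    by (auto simp: K_def)
  have same: "L n d = L K d" if "n \<ge> K" for n d
  proof (cases "d < N")
    case True
    then show ?thesis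
      using M[of d n] M[of d K] K(2)[of d] that by simp
  next
    case False
    then show ?thesis
      using big[of n d] big[of K d] K(1) that by simp
  qed
  \<comment> \<open>Induction on a strict degree bound: a polynomial \<open>q\<close> with value in
    \<open>J K\<close> and the same coefficient at \<open>d\<close> cancels the top term of
    \<open>p\<close>.\<close>
  have sub: "poly p t \<in> J K" if "n \<ge> K" "p \<in> P" "Polynomial.degree p < d" "poly p t \<in> J n" for n d p
    using that(2-)
  proof (induction d arbitrary: p)
    case (Suc d)
    have "poly.coeff p d \<in> L n d"
      using Suc.prems by (auto simp: L_def)
    then have "poly.coeff p d \<in> L K d"
      using same[OF that(1)] by simp
    then obtain q where q: "poly.coeff p d = poly.coeff q d" "q \<in> P" "Polynomial.degree q \<le> d" "poly q t \<in> J K"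
      by (auto simp: L_def)
    have "poly q t \<in> J n"
      using q Jmono[OF that(1)] by auto
    then have pq: "poly (p - q) t \<in> J n"
      using Suc.prems ideal_of_diff[OF St J] by simp
    have PQ: "p - q \<in> P"
      using Suc.prems q subring_setD[OF S] by (auto simp: P_def)
    have "poly (p - q) t \<in> J K"
    proof (cases "p - q = 0")
      case True
      then show ?thesis
        using ideal_ofD(2)[OF J] by simp
    next
      case False
      have "Polynomial.degree (p - q) \<le> d"
        using Suc.prems(2) q(3) by (simp add: degree_diff_le)
      moreover have "poly.coeff (p - q) d = 0"
        using q by simp
      ultimately have "Polynomial.degree (p - q) < d"
        using False by (metis le_neq_implies_less leading_coeff_0_iff)
      then show ?thesis
        using Suc.IH[OF PQ] pq by blast
    qed
    then have "poly (p - q) t + poly q t \<in> J K"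
      using q by (blast intro: ideal_ofD(3)[OF J])
    then show ?case
      by simp
  qed simp
  show "\<exists>N. \<forall>n\<ge>N. J n = J N"
  proof (intro exI allI impI equalityI)
    fix n assume n: "K \<le> n"
    show "J K \<subseteq> J n"
      using Jmono[OF n] .
    show "J n \<subseteq> J K"
    proof
      fix x assume x: "x \<in> J n"
      then have "x \<in> adjoin S t"
        using ideal_ofD(1)[OF J] by blast
      then obtain p where "x = poly p t" "p \<in> P"
        by (auto simp: adjoin_def P_def)
      then show "x \<in> J K"
        using sub[OF n, of p "Suc (Polynomial.degree p)"] x by simp
    qed
  qed
qed

text \<open>Otherwise every member has a strictly larger one, and iterating a choice function from
  \<open>Q0\<close> gives a chain that never becomes stationary.\<close>

lemma noetherian_set_maximal:
  assumes N: "noetherian_set S" and Q0: "Q0 \<in> \<Q>" and id: "\<And>Q. Q \<in> \<Q> \<Longrightarrow> ideal_of S Q"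
  obtains Q where "Q \<in> \<Q>" "\<And>Q'. Q' \<in> \<Q> \<Longrightarrow> Q \<subseteq> Q' \<Longrightarrow> Q' = Q"
proof (rule ccontr)
  assume "\<not> thesis"
  then have "\<forall>Q\<in>\<Q>. \<exists>Q'\<in>\<Q>. Q \<subset> Q'"
    using that by blast
  then obtain s where s: "\<And>Q. Q \<in> \<Q> \<Longrightarrow> s Q \<in> \<Q> \<and> Q \<subset> s Q"
    by metis
  define f where "f n = (s ^^ n) Q0" for n :: nat
  have f: "f n \<in> \<Q>" for n
    by (induction n) (auto simp: f_def Q0 s)
  have lt: "f n \<subset> f (Suc n)" for n
    using s[OF f[of n]] by (simp add: f_def)
  then obtain N where "\<And>n. n \<ge> N \<Longrightarrow> f n = f N"
    using N id f unfolding noetherian_set_def by (metis psubset_imp_subset)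
  from this[of "Suc N"] have "f (Suc N) = f N"
    by simp
  then show False
    using lt[of N] by simp
qed

section \<open>Powers of an ideal and Krull's intersection theorem\<close>

text \<open>The \<open>n\<close>-th power of the ideal of \<open>R\<close> generated by
  \<open>V\<close>, as an inductive predicate so that facts about it follow by induction over sums
  of \<open>n\<close>-fold products. The clause \<open>zero\<close> is separate because for empty
  \<open>V\<close> and \<open>n > 0\<close> there are no products at all.\<close>

inductive ideal_pow :: "'a::comm_ring_1 set \<Rightarrow> 'a set \<Rightarrow> nat \<Rightarrow> 'a \<Rightarrow> bool"
  for R V where
  base: "a \<in> R \<Longrightarrow> ideal_pow R V 0 a"
| step: "x \<in> V \<Longrightarrow> ideal_pow R V n b \<Longrightarrow> ideal_pow R V (Suc n) (x * b)"
| zero: "ideal_pow R V n 0"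
| add: "ideal_pow R V n a \<Longrightarrow> ideal_pow R V n b \<Longrightarrow> ideal_pow R V n (a + b)"

lemma ideal_pow_scale:
  assumes "subring_set R" "ideal_pow R V n a" "r \<in> R"
  shows "ideal_pow R V n (r * a)"
  using assms(2)
proof induction
  case (step x n b)
  then have "ideal_pow R V (Suc n) (x * (r * b))"
    by (blast intro: ideal_pow.step)
  then show ?case
    by (simp add: mult.left_commute)
qed (auto simp: algebra_simps intro: ideal_pow.intros subring_setD[OF assms(1)] assms(3))

lemma ideal_pow_mult:
  assumes "subring_set R" "ideal_pow R V n a" "ideal_pow R V m b"
  shows "ideal_pow R V (n + m) (a * b)"
  using assms(2)
proof induction
  case (base a)
  then show ?case
    using ideal_pow_scale[OF assms(1,3)] by simp
qed (auto simp: algebra_simps intro: ideal_pow.intros)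

lemma ideal_pow_uminus:
  assumes "subring_set R" "ideal_pow R V n a"
  shows "ideal_pow R V n (- a)"
  using ideal_pow_scale[OF assms, of "- 1"] subring_setD[OF assms(1)] by simp

lemma ideal_pow_diff:
  assumes "subring_set R" "ideal_pow R V n a" "ideal_pow R V n b"
  shows "ideal_pow R V n (a - b)"
  using ideal_pow.add[OF assms(2) ideal_pow_uminus[OF assms(1,3)]] by simp

lemma ideal_pow_in:
  assumes "subring_set R" "V \<subseteq> R" "ideal_pow R V n a"
  shows "a \<in> R"
  using assms(3) by induction (use assms subring_setD[OF assms(1)] in auto)

lemma ideal_pow_sum:
  assumes "\<And>i. i \<in> A \<Longrightarrow> ideal_pow R V n (f i)"
  shows "ideal_pow R V n (sum f A)"
  using assms by (induction A rule: infinite_finite_induct) (auto intro: ideal_pow.intros)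

text \<open>Pigeonhole: a list of length \<open>k + s\<close> over \<open>insert x V\<close>
  contains \<open>x\<close> at least \<open>k\<close> times or has at least \<open>s\<close> entries
  from \<open>V\<close>. Thus a high power of a finitely generated ideal lies in \<open>Q\<close> as
  soon as each generator has a power in \<open>Q\<close>.\<close>

lemma prod_list_in_ideal:
  assumes R: "subring_set R" and Q: "ideal_of R Q" and V: "finite V" "V \<subseteq> R"
    and pw: "\<And>x. x \<in> V \<Longrightarrow> \<exists>k. x ^ k \<in> Q"
  shows "\<exists>s. \<forall>xs\<in>lists V. length xs \<ge> s \<longrightarrow> prod_list xs \<in> Q"
  using V pw
proof (induction V)
  case empty
  then show ?case
    by (intro exI[of _ 1]) auto
next
  case (insert x V)
  have "\<exists>s. \<forall>xs\<in>lists V. length xs \<ge> s \<longrightarrow> prod_list xs \<in> Q"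
    using insert.IH insert.prems by simp
  then obtain s where s: "\<And>xs. xs \<in> lists V \<Longrightarrow> length xs \<ge> s \<Longrightarrow> prod_list xs \<in> Q"
    by blast
  obtain k where k: "x ^ k \<in> Q"
    using insert.prems(2)[of x] by auto
  have inR: "prod_list xs \<in> R" if "xs \<in> lists (insert x V)" for xs
    using that insert.prems(1) by (induction xs) (auto intro: subring_setD[OF R])
  have split: "prod_list xs = x ^ length (filter ((=) x) xs) * prod_list (filter ((\<noteq>) x) xs)" for xs
    by (induction xs) (auto simp: algebra_simps)
  have "prod_list xs \<in> Q" if xs: "xs \<in> lists (insert x V)" and len: "length xs \<ge> k + s" for xs
  proof (cases "length (filter ((=) x) xs) \<ge> k")
    case True
    then have "x ^ length (filter ((=) x) xs) = x ^ k * x ^ (length (filter ((=) x) xs) - k)"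
      by (simp flip: power_add)
    moreover have "x ^ (length (filter ((=) x) xs) - k) * prod_list (filter ((\<noteq>) x) xs) \<in> R"
      using xs insert.prems(1) by (intro subring_setD[OF R] inR) auto
    ultimately show ?thesis
      using split[of xs] ideal_ofD(5)[OF Q _ k] by (simp add: mult.assoc)
  next
    case False
    then have "length (filter ((\<noteq>) x) xs) \<ge> s"
      using sum_length_filter_compl[of "(=) x" xs] len by simp
    moreover have "filter ((\<noteq>) x) xs \<in> lists V"
      using xs by auto
    ultimately have "prod_list (filter ((\<noteq>) x) xs) \<in> Q"
      using s by blast
    then show ?thesis
      using split[of xs] ideal_ofD(4)[OF Q] insert.prems(1) subring_setD(7)[OF R] by simp
  qed
  then show ?case
    by blast
qed

text \<open>
  For \<open>x\<close> in the ideal \<open>m\<close> generated by \<open>V\<close>, the chain \<open>(Q : x\<^sup>k)\<close> becomes stationary, and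
  maximality of \<open>Q\<close> among the ideals meeting \<open>R g + I\<close> inside \<open>m g + I\<close> forces \<open>x\<^sup>k \<in> Q\<close>.
\<close>

lemma krull_intersection:
  assumes R: "subring_set R" and N: "noetherian_set R" and V: "finite V" "V \<subseteq> R"
    and I: "ideal_of R I" and g: "g \<in> R"
    and inter: "\<And>n. \<exists>a. ideal_pow R V n a \<and> g - a \<in> I"
  obtains a where "ideal_pow R V 1 a" "(1 - a) * g \<in> I"
proof -
  note Rs = subring_setD[OF R] and Is = ideal_ofD[OF I]
  \<comment> \<open>With m the ideal generated by \<open>V\<close>, these are the ideals m g + I and
    R g + I. Since \<open>g \<in> B\<close>, it will be enough to find an ideal that contains
    \<open>g\<close> and meets \<open>B\<close> inside \<open>M\<close>.\<close>
  define M where "M = {a * g + i | a i. ideal_pow R V 1 a \<and> i \<in> I}"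
  define B where "B = {r * g + i | r i. r \<in> R \<and> i \<in> I}"
  have MI: "ideal_of R M"
  proof (rule ideal_ofI)
    show "M \<subseteq> R"
      using g ideal_pow_in[OF R V(2)] by (auto simp: M_def intro!: Rs dest: Is(1))
    show "0 \<in> M"
      unfolding M_def using Is(2) ideal_pow.zero by force
    show "x + y \<in> M" if xy: "x \<in> M" "y \<in> M" for x y
    proof -
      obtain a i b j where *: "x = a * g + i" "ideal_pow R V 1 a" "i \<in> I"
        "y = b * g + j" "ideal_pow R V 1 b" "j \<in> I"
        using xy by (auto simp: M_def)
      have "x + y = (a + b) * g + (i + j)"
        by (simp add: * algebra_simps)
      then show ?thesis
        unfolding M_def using * Is(3) ideal_pow.add by blast
    qed
    show "r * x \<in> M" if r: "r \<in> R" and x: "x \<in> M" for r x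
    proof -
      obtain a i where *: "x = a * g + i" "ideal_pow R V 1 a" "i \<in> I"
        using x by (auto simp: M_def)
      have "r * x = (r * a) * g + (r * i)"
        by (simp add: * algebra_simps)
      then show ?thesis
        unfolding M_def using * Is(4)[OF r] ideal_pow_scale[OF R _ r] by blast
    qed
  qed
  have xB: "x * b \<in> M" if "x \<in> V" "b \<in> B" for x b
  proof -
    obtain r i where *: "b = r * g + i" "r \<in> R" "i \<in> I"
      using \<open>b \<in> B\<close> by (auto simp: B_def)
    have "x * b = (x * r) * g + x * i"
      by (simp add: * algebra_simps)
    moreover have "ideal_pow R V 1 (x * r)"
      using ideal_pow.step[OF \<open>x \<in> V\<close> ideal_pow.base[OF \<open>r \<in> R\<close>]] by simp
    ultimately show ?thesis
      unfolding M_def using * Is(4) V(2) \<open>x \<in> V\<close> by blast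
  qed
  have IM: "I \<subseteq> M"
    unfolding M_def using ideal_pow.zero by force
  define \<Q> where "\<Q> = {Q. ideal_of R Q \<and> M \<subseteq> Q \<and> Q \<inter> B \<subseteq> M}"
  have M\<Q>: "M \<in> \<Q>"
    using MI by (auto simp: \<Q>_def)
  have id\<Q>: "\<And>Q. Q \<in> \<Q> \<Longrightarrow> ideal_of R Q"
    by (simp add: \<Q>_def)
  obtain Q where Q: "Q \<in> \<Q>" and max: "\<And>Q'. Q' \<in> \<Q> \<Longrightarrow> Q \<subseteq> Q' \<Longrightarrow> Q' = Q"
    using noetherian_set_maximal[OF N M\<Q> id\<Q>] by metis
  have QI: "ideal_of R Q" and MQ: "M \<subseteq> Q" and QB: "Q \<inter> B \<subseteq> M"
    using Q by (auto simp: \<Q>_def)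
  note Qs = ideal_ofD[OF QI]
  have "\<exists>k. x ^ k \<in> Q" if x: "x \<in> V" for x
  proof -
    have xR: "x \<in> R"
      using x V by auto
    \<comment> \<open>The colon ideal \<open>(Q : x^k)\<close>. Once it is stationary,
      \<open>x^(k+1) r \<in> Q\<close> implies \<open>x^k r \<in> Q\<close>.\<close>
    define c where "c k = {r \<in> R. x ^ k * r \<in> Q}" for k
    have "ideal_of R (c k)" for k
    proof (rule ideal_ofI)
      show "a * r \<in> c k" if "a \<in> R" "r \<in> c k" for a r
        using that Qs(4)[of a "x ^ k * r"] Rs(4) by (simp add: c_def mult.left_commute)
    qed (auto simp: c_def distrib_left intro: Rs Qs)
    moreover have "c k \<subseteq> c (Suc k)" for k
      using Qs(4)[OF xR] by (auto simp: c_def mult.assoc)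
    ultimately have "\<exists>k. \<forall>n\<ge>k. c n = c k"
      using N[unfolded noetherian_set_def, rule_format, of c] by blast
    then obtain k where "\<And>n. n \<ge> k \<Longrightarrow> c n = c k"
      by blast
    from this[of "Suc k"] have k: "c (Suc k) = c k"
      by simp
    define Q' where "Q' = {q + x ^ k * r | q r. q \<in> Q \<and> r \<in> R}"
    have Q'I: "ideal_of R Q'"
    proof (rule ideal_ofI)
      show "Q' \<subseteq> R"
        using xR by (auto simp: Q'_def intro!: Rs dest: Qs(1))
      show "0 \<in> Q'"
        unfolding Q'_def using Qs(2) Rs(2) by force
      show "u + v \<in> Q'" if uv: "u \<in> Q'" "v \<in> Q'" for u v
      proof -
        obtain q r q' r' where "u = q + x ^ k * r" "v = q' + x ^ k * r'" "q \<in> Q" "q' \<in> Q" "r \<in> R" "r' \<in> R"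
          using uv by (auto simp: Q'_def)
        moreover from this have "u + v = (q + q') + x ^ k * (r + r')"
          by (simp add: algebra_simps)
        ultimately show ?thesis
          unfolding Q'_def using Qs(3) Rs(6) by blast
      qed
      show "a * u \<in> Q'" if au: "a \<in> R" "u \<in> Q'" for a u
      proof -
        obtain q r where "u = q + x ^ k * r" "q \<in> Q" "r \<in> R"
          using au by (auto simp: Q'_def)
        moreover from this have "a * u = a * q + x ^ k * (a * r)"
          by (simp add: algebra_simps)
        ultimately show ?thesis
          unfolding Q'_def using Qs(4)[OF au(1)] Rs(4)[OF au(1)] by blast
      qed
    qed
    have QQ': "Q \<subseteq> Q'"
      unfolding Q'_def using Rs(2) by force
    \<comment> \<open>For \<open>y = q + x^k r\<close> in \<open>B\<close> the product
      \<open>x y\<close> lies in \<open>M\<close>, hence in \<open>Q\<close>, so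
      \<open>x^(k+1) r \<in> Q\<close> and stationarity gives \<open>x^k r \<in> Q\<close>. Thus
      \<open>Q'\<close> is again admissible, and maximality absorbs \<open>x^k\<close> into
      \<open>Q\<close>.\<close>
    have "Q' \<inter> B \<subseteq> M"
    proof
      fix y assume "y \<in> Q' \<inter> B"
      then obtain q r where y: "y = q + x ^ k * r" "q \<in> Q" "r \<in> R" "y \<in> B"
        by (auto simp: Q'_def)
      have "x * y \<in> Q"
        using xB[OF x y(4)] MQ by blast
      moreover have "x * q \<in> Q"
        using Qs(4)[OF xR y(2)] .
      ultimately have "x * y - x * q \<in> Q"
        by (rule ideal_of_diff[OF R QI])
      then have "r \<in> c (Suc k)"
        using y by (simp add: c_def algebra_simps)
      then have "r \<in> c k"
        using k by simp
      then have "x ^ k * r \<in> Q"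
        by (simp add: c_def)
      then have "y \<in> Q"
        using y Qs(3) by simp
      then show "y \<in> M"
        using QB y(4) by blast
    qed
    then have "Q' = Q"
      using max[of Q'] Q'I QQ' MQ by (auto simp: \<Q>_def)
    moreover have "x ^ k \<in> Q'"
      unfolding Q'_def using Qs(2) Rs(1) by force
    ultimately show ?thesis
      by blast
  qed
  then obtain s where s: "\<And>xs. xs \<in> lists V \<Longrightarrow> length xs \<ge> s \<Longrightarrow> prod_list xs \<in> Q"
    using prod_list_in_ideal[OF R QI V] by blast
  \<comment> \<open>The list \<open>ys\<close> collects the generators stripped off
    \<open>b\<close>; the inequality keeps the total number of factors at least
    \<open>s\<close>.\<close>
  have pow_in: "prod_list ys * b \<in> Q" if "ideal_pow R V n b" "ys \<in> lists V" "length ys + n \<ge> s" for n b ys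
    using that
  proof (induction arbitrary: ys)
    case (base a)
    then show ?case
      using s[of ys] Qs(5) by simp
  next
    case (step x n b)
    have "ys @ [x] \<in> lists V" "length (ys @ [x]) + n \<ge> s"
      using step by auto
    then have "prod_list (ys @ [x]) * b \<in> Q"
      by (rule step.IH)
    then show ?case
      by (simp add: mult.assoc)
  next
    case zero
    then show ?case
      using Qs(2) by simp
  next
    case (add n a b)
    then show ?case
      using Qs(3) by (simp add: distrib_left)
  qed
  \<comment> \<open>At the exponent \<open>s\<close> the power of m lies in \<open>Q\<close>, so
    \<open>g\<close>, congruent modulo \<open>I\<close> to an element of it, lies in
    \<open>Q \<inter> B\<close> and therefore in \<open>M\<close>.\<close>
  obtain a where a: "ideal_pow R V s a" "g - a \<in> I"
    using inter by blast
  have "a \<in> Q"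
    using pow_in[OF a(1), of "[]"] by simp
  moreover have "g - a \<in> Q"
    using a(2) IM MQ by blast
  ultimately have "(g - a) + a \<in> Q"
    by (blast intro: Qs(3))
  then have "g \<in> Q"
    by simp
  moreover have "g \<in> B"
    unfolding B_def using Rs(1) Is(2) by force
  ultimately have "g \<in> M"
    using QB by blast
  then obtain b i where b: "g = b * g + i" "ideal_pow R V 1 b" "i \<in> I"
    by (auto simp: M_def)
  have "(1 - b) * g = g - b * g"
    by (simp add: algebra_simps)
  also have "\<dots> = i"
    using b(1) by (metis add_diff_cancel_left')
  finally have "(1 - b) * g = i" .
  then show thesis
    using that b by simp
qed

section \<open>Polynomial functions and invariant vector fields\<close>

interpretation mat_vs: vector_space mat_scale
  by standard (simp_all add: mat_scale_def vec_eq_iff algebra_simps)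

text \<open>Duality in place of dimension counts: it produces a tangent vector from a covector
  missing from a space of differentials, and later a coordinate that detects a class modulo the
  relations.\<close>

lemma (in vector_space) separating_functional:
  assumes "subspace W" "x \<notin> W"
  shows "\<exists>f. Vector_Spaces.linear scale (*) f \<and> (\<forall>w\<in>W. f w = 0) \<and> f x = 1"
proof -
  interpret vector_space_pair scale "(*) :: 'a \<Rightarrow> 'a \<Rightarrow> 'a"
    by unfold_locales
  obtain B where B: "B \<subseteq> W" "independent B" "W \<subseteq> span B"
    using maximal_independent_subset by blast
  have W: "span B = W"
    using B assms(1) by (metis span_subspace)
  have ind: "independent (insert x B)"
    using B W assms(2) by (intro independent_insertI) simp_all
  obtain f where f: "Vector_Spaces.linear scale (*) f" "\<forall>b\<in>insert x B. f b = (if b = x then 1 else 0)"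
    using linear_independent_extend[OF ind, of "\<lambda>b. if b = x then 1 else 0"] by blast
  have "x \<notin> B"
    using B(1) assms(2) by auto
  have "f w = 0" if "w \<in> W" for w
    by (rule linear_eq_on[of f "\<lambda>_. 0" w B])
      (use f \<open>x \<notin> B\<close> that W in \<open>auto simp: linear_zero\<close>)
  then show ?thesis
    using f by auto
qed

lemma mult_line: "A ** (mat 1 + mat_scale t Y) = A + mat_scale t (A ** Y)"
  by (simp add: matrix_add_ldistrib)
    (simp add: matrix_matrix_mult_def mat_scale_def vec_eq_iff sum_distrib_left mult.left_commute)

text \<open>The left invariant vector field with value \<open>Y\<close> at 1, applied to
  \<open>p\<close>. It is the linear coefficient of a polynomial in \<open>t\<close>, the same
  notion of derivative as in \<open>group_lie\<close>; in characteristic 0 the field is infinite, so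
  that polynomial is unique.\<close>

definition pder :: "'a::field ^ 'm ^ 'm \<Rightarrow> ('a ^ 'm ^ 'm \<Rightarrow> 'a) \<Rightarrow> 'a ^ 'm ^ 'm \<Rightarrow> 'a"
  where "pder Y p A = poly.coeff (THE q. \<forall>t. poly q t = p (A ** (mat 1 + mat_scale t Y))) 1"

lemma pderI:
  fixes p :: "'a::field_char_0 ^ 'm ^ 'm \<Rightarrow> 'a"
  assumes "\<And>t. poly q t = p (A ** (mat 1 + mat_scale t Y))"
  shows "pder Y p A = poly.coeff q 1"
proof -
  have "(THE q. \<forall>t. poly q t = p (A ** (mat 1 + mat_scale t Y))) = q"
    using assms by (intro the_equality) (auto simp: poly_eq_poly_eq_iff[symmetric])
  then show ?thesis
    by (simp add: pder_def)
qed

lemma polyfun_line: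
  fixes p :: "'a::field ^ 'm ^ 'm \<Rightarrow> 'a"
  assumes "p \<in> polyfun"
  obtains q where "\<And>t. poly q t = p (A ** (mat 1 + mat_scale t Y))" "poly.coeff q 0 = p A"
proof -
  have "\<exists>q. \<forall>t. poly q t = p (A ** (mat 1 + mat_scale t Y))"
    using assms
  proof induction
    case (1 c)
    show ?case
      by (intro exI[of _ "[:c:]"]) simp
  next
    case (2 i j)
    show ?case
      by (intro exI[of _ "[:A $ i $ j, (A ** Y) $ i $ j:]"]) (simp add: mult_line, simp add: mat_scale_def)
  next
    case (3 p q)
    then show ?case
      by (metis poly_add)
  next
    case (4 p q)
    then show ?case
      by (metis poly_mult)
  qed
  then obtain q where q: "\<And>t. poly q t = p (A ** (mat 1 + mat_scale t Y))"
    by blast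
  moreover have "poly.coeff q 0 = p A"
    using q[of 0] by (simp add: poly_0_coeff_0 mat_scale_def)
       (simp add: vec_lambda_eta flip: zero_vec_def)
  ultimately show thesis
    using that by blast
qed

lemma pder_const [simp]: "pder Y (\<lambda>A. c) A = (0 :: 'a::field_char_0)"
  by (subst pderI[of "[:c:]"]) auto

lemma pder_coord [simp]: "pder Y (\<lambda>A. A $ i $ j) A = ((A ** Y) $ i $ j :: 'a::field_char_0)"
  by (subst pderI[of "[:A $ i $ j, (A ** Y) $ i $ j:]"]) (simp add: mult_line, simp_all add: mat_scale_def)

lemma pder_add:
  fixes p q :: "'a::field_char_0 ^ 'm ^ 'm \<Rightarrow> 'a"
  assumes "p \<in> polyfun" "q \<in> polyfun"
  shows "pder Y (\<lambda>A. p A + q A) A = pder Y p A + pder Y q A"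
proof -
  obtain u where u: "\<And>t. poly u t = p (A ** (mat 1 + mat_scale t Y))"
    using polyfun_line[OF assms(1)] by metis
  obtain v where v: "\<And>t. poly v t = q (A ** (mat 1 + mat_scale t Y))"
    using polyfun_line[OF assms(2)] by metis
  show ?thesis
    using pderI[of "u + v" "\<lambda>A. p A + q A" A Y] pderI[of u p A Y, OF u] pderI[of v q A Y, OF v]
    by (simp add: u v)
qed

lemma pder_mult:
  fixes p q :: "'a::field_char_0 ^ 'm ^ 'm \<Rightarrow> 'a"
  assumes "p \<in> polyfun" "q \<in> polyfun"
  shows "pder Y (\<lambda>A. p A * q A) A = pder Y p A * q A + p A * pder Y q A"
proof -
  obtain u where u: "\<And>t. poly u t = p (A ** (mat 1 + mat_scale t Y))" "poly.coeff u 0 = p A"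
    using polyfun_line[OF assms(1)] by metis
  obtain v where v: "\<And>t. poly v t = q (A ** (mat 1 + mat_scale t Y))" "poly.coeff v 0 = q A"
    using polyfun_line[OF assms(2)] by metis
  have "poly.coeff (u * v) 1 = poly.coeff u 0 * poly.coeff v 1 + poly.coeff u 1 * poly.coeff v 0"
    by (simp add: coeff_mult)
  then show ?thesis
    using pderI[of "u * v" "\<lambda>A. p A * q A" A Y] pderI[of u p A Y, OF u(1)] pderI[of v q A Y, OF v(1)]
    by (simp add: u v)
qed

lemma polyfun_sum:
  "(\<And>i. i \<in> I \<Longrightarrow> f i \<in> polyfun) \<Longrightarrow> (\<lambda>A. \<Sum>i\<in>I. f i A) \<in> polyfun"
  by (induction I rule: infinite_finite_induct) (auto intro: polyfun.intros)

lemma polyfun_prod: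
  "(\<And>i. i \<in> I \<Longrightarrow> f i \<in> polyfun) \<Longrightarrow> (\<lambda>A. \<Prod>i\<in>I. f i A) \<in> polyfun"
  by (induction I rule: infinite_finite_induct) (auto intro: polyfun.intros)

lemma polyfun_power: "f \<in> polyfun \<Longrightarrow> (\<lambda>A. f A ^ n) \<in> polyfun"
  by (induction n) (auto intro: polyfun.intros)

lemma polyfun_cmult: "f \<in> polyfun \<Longrightarrow> (\<lambda>A. c * f A) \<in> polyfun"
  by (intro polyfun.intros)

lemma polyfun_diff:
  assumes "p \<in> polyfun" "q \<in> polyfun"
  shows "(\<lambda>A. p A - q A) \<in> polyfun"
  using polyfun.intros(3)[OF assms(1) polyfun_cmult[OF assms(2), of "- 1"]] by simp

lemma polyfun_coord_mult:
  "(\<lambda>A. (B ** A) $ i $ j) \<in> polyfun" "(\<lambda>A. (A ** B) $ i $ j) \<in> polyfun"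
  unfolding matrix_matrix_mult_def
  by (auto intro!: polyfun_sum polyfun.intros)

lemma polyfun_left: "p \<in> polyfun \<Longrightarrow> (\<lambda>A. p (B ** A)) \<in> polyfun"
  by (induction rule: polyfun.induct) (auto intro: polyfun.intros polyfun_coord_mult)

lemma polyfun_det: "det \<in> polyfun"
  unfolding det_def by (auto intro!: polyfun_sum polyfun_cmult polyfun_prod polyfun.intros)

text \<open>Left invariance of the field, by which statements at a point of the group are
  transported to 1.\<close>

lemma pder_left: "pder Y (\<lambda>A. p (B ** A)) A = pder Y p (B ** A)"
  by (simp add: pder_def matrix_mul_assoc)

lemma pder_polyfun:
  fixes p :: "'a::field_char_0 ^ 'm ^ 'm \<Rightarrow> 'a"
  assumes "p \<in> polyfun"
  shows "pder Y p \<in> polyfun"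
  using assms
proof induction
  case (1 c)
  have "pder Y (\<lambda>A. c) = (\<lambda>A. 0)"
    by (auto simp: fun_eq_iff)
  then show ?case
    by (auto intro: polyfun.intros)
next
  case (2 i j)
  have "pder Y (\<lambda>A. A $ i $ j) = (\<lambda>A. (A ** Y) $ i $ j)"
    by (auto simp: fun_eq_iff)
  then show ?case
    by (simp add: polyfun_coord_mult)
next
  case (3 p q)
  have "pder Y (\<lambda>A. p A + q A) = (\<lambda>A. pder Y p A + pder Y q A)"
    using 3 by (auto simp: fun_eq_iff pder_add)
  then show ?case
    using 3 by (auto intro: polyfun.intros)
next
  case (4 p q)
  have "pder Y (\<lambda>A. p A * q A) = (\<lambda>A. pder Y p A * q A + p A * pder Y q A)"
    using 4 by (auto simp: fun_eq_iff pder_mult)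
  then show ?case
    using 4 by (auto intro: polyfun.intros)
qed

lemma pder_cmult:
  fixes p :: "'a::field_char_0 ^ 'm ^ 'm \<Rightarrow> 'a"
  assumes "p \<in> polyfun"
  shows "pder Y (\<lambda>A. c * p A) A = c * pder Y p A"
  using pder_mult[OF polyfun.intros(1) assms, of Y c] by simp

lemma pder_diff:
  fixes p q :: "'a::field_char_0 ^ 'm ^ 'm \<Rightarrow> 'a"
  assumes "p \<in> polyfun" "q \<in> polyfun"
  shows "pder Y (\<lambda>A. p A - q A) A = pder Y p A - pder Y q A"
  using pder_add[OF assms(1) polyfun_cmult[OF assms(2), of "- 1"]] pder_cmult[OF assms(2), of Y "- 1"]
  by simp

lemma pder_sum:
  fixes f :: "'i \<Rightarrow> 'a::field_char_0 ^ 'm ^ 'm \<Rightarrow> 'a"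
  assumes "\<And>i. i \<in> I \<Longrightarrow> f i \<in> polyfun"
  shows "pder Y (\<lambda>A. \<Sum>i\<in>I. f i A) A = (\<Sum>i\<in>I. pder Y (f i) A)"
  using assms
  by (induction I rule: infinite_finite_induct) (auto simp: pder_add polyfun_sum)

lemma pder_power_eigen:
  fixes p :: "'a::field_char_0 ^ 'm ^ 'm \<Rightarrow> 'a"
  assumes "p \<in> polyfun" "pder Y p A = c * p A"
  shows "pder Y (\<lambda>A. p A ^ n) A = of_nat n * c * p A ^ n"
proof (induction n)
  case (Suc n)
  then show ?case
    using pder_mult[OF assms(1) polyfun_power[OF assms(1)], of Y n A] assms(2)
    by (simp add: algebra_simps)
qed simp

text \<open>By multiplicativity of \<open>det\<close>, the polynomial along a line through
  \<open>A\<close> is \<open>det A\<close> times the one along the line through 1.\<close>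

lemma pder_det:
  fixes A Y :: "'a::field_char_0 ^ 'm ^ 'm"
  shows "pder Y det A = pder Y det (mat 1) * det A"
proof -
  obtain q where q: "\<And>t. poly q t = det ((mat 1 :: 'a ^ 'm ^ 'm) ** (mat 1 + mat_scale t Y))"
    using polyfun_line[OF polyfun_det] by metis
  have "pder Y det (mat 1) = poly.coeff q 1"
    by (rule pderI) (rule q)
  moreover have "pder Y det A = poly.coeff (Polynomial.smult (det A) q) 1"
    by (rule pderI) (simp add: q det_mul)
  ultimately show ?thesis
    by simp
qed

section \<open>Noetherianity of the ring of polynomial functions\<close>

lemma subring_set_polyfun: "subring_set (polyfun :: ('a::field ^ 'm ^ 'm \<Rightarrow> 'a) set)"
proof -
  have "(1 :: 'a ^ 'm ^ 'm \<Rightarrow> 'a) \<in> polyfun"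
    using polyfun.intros(1)[of 1] by (simp add: one_fun_def)
  moreover have "x - y \<in> polyfun" if "x \<in> polyfun" "y \<in> polyfun" for x y :: "'a ^ 'm ^ 'm \<Rightarrow> 'a"
    using polyfun_diff[OF that] by (simp add: fun_diff_def)
  moreover have "x * y \<in> polyfun" if "x \<in> polyfun" "y \<in> polyfun" for x y :: "'a ^ 'm ^ 'm \<Rightarrow> 'a"
    using polyfun.intros(4)[OF that] by (simp add: times_fun_def)
  ultimately show ?thesis
    by (simp add: subring_set_def)
qed

text \<open>The constants form a field, whose only ideals are 0 and the field itself; the finitely
  many matrix coordinates are then adjoined one at a time.\<close>

lemma noetherian_polyfun: "noetherian_set (polyfun :: ('a::field ^ 'm ^ 'm \<Rightarrow> 'a) set)"
proof -
  define K where "K = range (\<lambda>(c::'a) (A::'a ^ 'm ^ 'm). c)"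
  have KK: "subring_set K"
    by (auto simp: subring_set_def K_def fun_eq_iff)
  have NK: "noetherian_set K"
    unfolding noetherian_set_def
  proof (intro allI impI)
    fix f :: "nat \<Rightarrow> ('a ^ 'm ^ 'm \<Rightarrow> 'a) set"
    assume f: "(\<forall>n. ideal_of K (f n)) \<and> (\<forall>n. f n \<subseteq> f (Suc n))"
    then have mono: "f m \<subseteq> f n" if "m \<le> n" for m n
      using that by (simp add: lift_Suc_mono_le)
    have dich: "f n = {0} \<or> f n = K" for n
    proof (cases "f n = {0}")
      case False
      have fn: "ideal_of K (f n)"
        using f by blast
      then obtain c where c: "(\<lambda>A. c) \<in> f n" "c \<noteq> 0"
        using False ideal_ofD[OF fn] by (force simp: K_def fun_eq_iff)
      have "(\<lambda>A. d) \<in> f n" for d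
      proof -
        have "(\<lambda>A. d / c) * (\<lambda>A. c) \<in> f n"
          using c by (intro ideal_ofD(4)[OF fn]) (auto simp: K_def)
        moreover have "(\<lambda>A. d / c) * (\<lambda>A. c) = (\<lambda>A::'a ^ 'm ^ 'm. d)"
          using c by (auto simp: fun_eq_iff)
        ultimately show ?thesis
          by simp
      qed
      then have "f n = K"
        using ideal_ofD(1)[OF fn] by (auto simp: K_def)
      then show ?thesis
        by simp
    qed simp
    show "\<exists>N. \<forall>n\<ge>N. f n = f N"
    proof (cases "\<exists>N. f N = K")
      case True
      then obtain N where N: "f N = K"
        by blast
      have "f n = f N" if "n \<ge> N" for n
        using mono[OF that] dich[of n] N ideal_ofD(2)[of K "f N"] f by fastforce
      then show ?thesis
        by blast
    next
      case False
      then show ?thesis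
        using dich by metis
    qed
  qed
  \<comment> \<open>The inclusion in \<open>polyfun\<close> is carried along so that the ring
    finally obtained equals \<open>polyfun\<close>.\<close>
  have step: "\<exists>S. subring_set S \<and> noetherian_set S \<and> K \<subseteq> S \<and> T \<subseteq> S \<and> S \<subseteq> polyfun"
    if "finite T" "T \<subseteq> polyfun" for T
    using that
  proof (induction T rule: finite_induct)
    case empty
    have "K \<subseteq> polyfun"
      by (auto simp: K_def intro: polyfun.intros)
    then show ?case
      using KK NK by blast
  next
    case (insert t T)
    then obtain S where S: "subring_set S" "noetherian_set S" "K \<subseteq> S" "T \<subseteq> S" "S \<subseteq> polyfun"
      by auto
    show ?case
      using subring_set_adjoin[OF S(1), of t] noetherian_set_adjoin[OF S(1,2), of t]
        adjoin_superset[OF S(1), of t] S(3,4) adjoin_subset[OF subring_set_polyfun S(5), of t]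
        insert.prems by (intro exI[of _ "adjoin S t"]) auto
  qed
  have "range (\<lambda>(i, j) (A::'a ^ 'm ^ 'm). A $ i $ j) \<subseteq> polyfun"
    by (auto intro: polyfun.intros)
  with step[of "range (\<lambda>(i, j) (A::'a ^ 'm ^ 'm). A $ i $ j)"]
  obtain S where S: "subring_set S" "noetherian_set S" "K \<subseteq> S"
    "range (\<lambda>(i, j) (A::'a ^ 'm ^ 'm). A $ i $ j) \<subseteq> S" "S \<subseteq> polyfun"
    by auto
  have "p \<in> S" if "p \<in> polyfun" for p
    using that
  proof (induction rule: polyfun.induct)
    case (1 c)
    then show ?case
      using S(3) by (auto simp: K_def)
  next
    case (2 i j)
    then show ?case
      using S(4) by auto
  next
    case (3 p q)
    then show ?case
      using subring_setD(6)[OF S(1), of p q] by (simp add: plus_fun_def)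
  next
    case (4 p q)
    then show ?case
      using subring_setD(4)[OF S(1), of p q] by (simp add: times_fun_def)
  qed
  then have "S = polyfun"
    using S(5) by auto
  then show ?thesis
    using S(2) by simp
qed

section \<open>Taylor expansion at the identity matrix\<close>

definition mat_unit :: "'m \<Rightarrow> 'm \<Rightarrow> 'a::field ^ 'm ^ 'm"
  where "mat_unit i j = (\<chi> a b. if a = i \<and> b = j then 1 else 0)"

lemma sum_mat_unit:
  "(\<Sum>a\<in>UNIV. \<Sum>b\<in>UNIV. f a b * mat_unit a b $ i $ j) = (f i j :: 'a::field)"
proof -
  have "(\<Sum>b\<in>UNIV. f a b * mat_unit a b $ i $ j) = (if a = i then f i j else 0)" for a
    by (cases "a = i") (simp_all add: mat_unit_def if_distrib cong: if_cong)
  then show ?thesis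
    by simp
qed

lemma linear_mat_expand:
  fixes f :: "'a::field ^ 'm ^ 'm \<Rightarrow> 'a"
  assumes "Vector_Spaces.linear mat_scale (*) f"
  shows "f M = (\<Sum>i\<in>UNIV. \<Sum>j\<in>UNIV. f (mat_unit i j) * M $ i $ j)"
proof -
  interpret f: Vector_Spaces.linear mat_scale "(*)" f
    by (rule assms)
  have "M = (\<Sum>i\<in>UNIV. \<Sum>j\<in>UNIV. mat_scale (M $ i $ j) (mat_unit i j))"
    by (simp add: vec_eq_iff mat_scale_def sum_mat_unit)
  then have "f M = f (\<Sum>i\<in>UNIV. \<Sum>j\<in>UNIV. mat_scale (M $ i $ j) (mat_unit i j))"
    by simp
  also have "\<dots> = (\<Sum>i\<in>UNIV. \<Sum>j\<in>UNIV. f (mat_unit i j) * M $ i $ j)"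
    by (simp add: f.sum f.scale mult.commute)
  finally show ?thesis .
qed

text \<open>Linearity in the direction \<open>Y\<close> is invisible in the definition of
  \<open>pder\<close>, which treats each line separately; it is recovered by induction over the
  construction of \<open>p\<close>.\<close>

lemma pder_one_expand:
  fixes p :: "'a::field_char_0 ^ 'm ^ 'm \<Rightarrow> 'a"
  assumes "p \<in> polyfun"
  shows "pder Y p (mat 1) = (\<Sum>i\<in>UNIV. \<Sum>j\<in>UNIV. pder (mat_unit i j) p (mat 1) * Y $ i $ j)"
  using assms
proof induction
  case (2 i j)
  have "(\<Sum>a\<in>UNIV. \<Sum>b\<in>UNIV. mat_unit a b $ i $ j * Y $ a $ b) = Y $ i $ j"
    using sum_mat_unit[of "\<lambda>a b. Y $ a $ b" i j] by (simp add: mult.commute)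
  then show ?case
    by simp
next
  case (3 p q)
  then show ?case
    by (simp add: pder_add distrib_right sum.distrib)
next
  case (4 p q)
  show ?case
    unfolding pder_mult[OF 4(1,2)] 4(3,4)
    by (simp add: sum_distrib_left sum_distrib_right sum.distrib distrib_right mult.assoc mult.left_commute)
       (simp add: mult.commute mult.left_commute)
qed simp

text \<open>Coordinates centred at the identity. They generate the maximal ideal m of the polynomial
  functions vanishing at 1, so \<open>one_pow n\<close> below is membership in the
  \<open>n\<close>-th power of m.\<close>

definition coords_one :: "('a::field ^ 'm ^ 'm \<Rightarrow> 'a) set"
  where "coords_one = range (\<lambda>(i, j) A. A $ i $ j - mat 1 $ i $ j)"

lemma coords_one: "finite coords_one" "coords_one \<subseteq> polyfun"
  by (auto simp: coords_one_def intro!: polyfun_diff polyfun.intros)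

abbreviation one_pow :: "nat \<Rightarrow> ('a::field ^ 'm ^ 'm \<Rightarrow> 'a) \<Rightarrow> bool"
  where "one_pow \<equiv> ideal_pow polyfun coords_one"

lemmas one_pow_scale = ideal_pow_scale[OF subring_set_polyfun]
  and one_pow_mult = ideal_pow_mult[OF subring_set_polyfun]
  and one_pow_diff = ideal_pow_diff[OF subring_set_polyfun]
  and one_pow_polyfun = ideal_pow_in[OF subring_set_polyfun coords_one(2)]

lemma one_pow_cmult:
  assumes "one_pow n p"
  shows "one_pow n (\<lambda>A. c * p A)"
  using one_pow_scale[OF assms polyfun.intros(1), of c] by (simp add: times_fun_def)

lemma one_pow_coord: "one_pow 1 (\<lambda>A. A $ i $ j - mat 1 $ i $ j)"
proof -
  have "one_pow (Suc 0) ((\<lambda>A. A $ i $ j - mat 1 $ i $ j) * 1)"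
    by (intro ideal_pow.step ideal_pow.base subring_setD(1)[OF subring_set_polyfun])
       (auto simp: coords_one_def)
  then show ?thesis
    by simp
qed

lemma one_pow_const_diff:
  fixes p :: "'a::field ^ 'm ^ 'm \<Rightarrow> 'a"
  assumes "p \<in> polyfun"
  shows "one_pow 1 (\<lambda>A. p A - p (mat 1))"
  using assms
proof induction
  case (1 c)
  then show ?case
    using ideal_pow.zero[of polyfun coords_one 1] by (simp add: zero_fun_def)
next
  case (2 i j)
  then show ?case
    by (rule one_pow_coord)
next
  case (3 p q)
  then show ?case
    using ideal_pow.add[OF 3(3,4)] by (simp add: plus_fun_def algebra_simps)
next
  case (4 p q)
  have "(\<lambda>A. p A * q A - p (mat 1) * q (mat 1)) =
      q * (\<lambda>A. p A - p (mat 1)) + (\<lambda>A. p (mat 1) * (q A - q (mat 1)))"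
    by (auto simp: fun_eq_iff algebra_simps)
  then show ?case
    using 4 by (auto intro!: ideal_pow.add one_pow_scale one_pow_cmult)
qed

text \<open>For a product the remainder is \<open>(p - p(1)) (q - q(1))\<close>, a product of two
  elements of m, plus multiples of the remainders of \<open>p\<close> and \<open>q\<close>.\<close>

lemma one_pow_taylor:
  fixes p :: "'a::field_char_0 ^ 'm ^ 'm \<Rightarrow> 'a"
  assumes "p \<in> polyfun"
  shows "one_pow 2 (\<lambda>A. p A - p (mat 1) -
    (\<Sum>i\<in>UNIV. \<Sum>j\<in>UNIV. pder (mat_unit i j) p (mat 1) * (A $ i $ j - mat 1 $ i $ j)))"
  using assms
proof induction
  case (1 c)
  then show ?case
    using ideal_pow.zero[of polyfun coords_one 2] by (simp add: zero_fun_def)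
next
  case (2 i j)
  have "(\<Sum>a\<in>UNIV. \<Sum>b\<in>UNIV. mat_unit a b $ i $ j * (A $ a $ b - mat 1 $ a $ b)) = A $ i $ j - mat 1 $ i $ j" for A :: "'a ^ 'm ^ 'm"
    using sum_mat_unit[of "\<lambda>a b. A $ a $ b - mat 1 $ a $ b" i j] by (simp add: mult.commute)
  then show ?case
    using ideal_pow.zero[of polyfun coords_one 2] by (simp add: zero_fun_def)
next
  case (3 p q)
  define S where "S r A = (\<Sum>i\<in>UNIV. \<Sum>j\<in>UNIV. pder (mat_unit i j) r (mat 1) * (A $ i $ j - mat 1 $ i $ j))"
    for r and A :: "'a ^ 'm ^ 'm"
  have S: "S (\<lambda>A. p A + q A) A = S p A + S q A" for A
    unfolding S_def pder_add[OF 3(1,2)] by (simp add: distrib_right sum.distrib)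
  show ?case
    using ideal_pow.add[OF 3(3,4)] S
    unfolding S_def[symmetric] by (simp add: plus_fun_def algebra_simps)
next
  case (4 p q)
  define S where "S r A = (\<Sum>i\<in>UNIV. \<Sum>j\<in>UNIV. pder (mat_unit i j) r (mat 1) * (A $ i $ j - mat 1 $ i $ j))"
    for r and A :: "'a ^ 'm ^ 'm"
  have S: "S (\<lambda>A. p A * q A) A = S p A * q (mat 1) + p (mat 1) * S q A" for A
    unfolding S_def pder_mult[OF 4(1,2)] sum_distrib_left sum_distrib_right sum.distrib[symmetric]
    by (intro sum.cong refl) (simp add: algebra_simps)
  have "(\<lambda>A. p A * q A - p (mat 1) * q (mat 1) - S (\<lambda>A. p A * q A) A) =
      (\<lambda>A. p A - p (mat 1)) * (\<lambda>A. q A - q (mat 1)) +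
      ((\<lambda>A. q (mat 1) * (p A - p (mat 1) - S p A)) + (\<lambda>A. p (mat 1) * (q A - q (mat 1) - S q A)))"
    by (auto simp: fun_eq_iff S algebra_simps)
  moreover have "one_pow 2 \<dots>"
    using one_pow_mult[OF one_pow_const_diff[OF 4(1)] one_pow_const_diff[OF 4(2)]]
      one_pow_cmult[OF 4(3), of "q (mat 1)"] one_pow_cmult[OF 4(4), of "p (mat 1)"]
    unfolding S_def[symmetric] by (auto intro: ideal_pow.add simp: numeral_2_eq_2)
  ultimately show ?case
    unfolding S_def by simp
qed

section \<open>Semi-invariants of connected groups\<close>

lemma group_lie_iff:
  fixes S :: "('a::{field_char_0, alg_closed_field} ^ 'm ^ 'm) set"
  shows "Y \<in> group_lie S \<longleftrightarrow> (\<forall>p\<in>polyfun. (\<forall>A\<in>S. p A = 0) \<longrightarrow> pder Y p (mat 1) = (0::'a))"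
proof -
  have "(\<forall>q. (\<forall>t. poly q t = p (mat 1 + mat_scale t Y)) \<longrightarrow> poly.coeff q 1 = 0) \<longleftrightarrow> pder Y p (mat 1) = 0"
    if "p \<in> polyfun" for p :: "'a ^ 'm ^ 'm \<Rightarrow> 'a"
  proof -
    obtain q where q: "\<And>t. poly q t = p (mat 1 ** (mat 1 + mat_scale t Y))"
      using polyfun_line[OF \<open>p \<in> polyfun\<close>] by metis
    have "q' = q" if "\<forall>t. poly q' t = p (mat 1 + mat_scale t Y)" for q'
      using that q by (auto simp: poly_eq_poly_eq_iff[symmetric])
    then show ?thesis
      using pderI[of q p "mat 1" Y] q by auto
  qed
  then show ?thesis
    by (auto simp: group_lie_def)
qed

lemma linear_alg_groupD:
  assumes "linear_alg_group G"
  shows "mat 1 \<in> G" "A \<in> G \<Longrightarrow> B \<in> G \<Longrightarrow> A ** B \<in> G" "A \<in> G \<Longrightarrow> invertible A" "A \<in> G \<Longrightarrow> matrix_inv A \<in> G"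
proof -
  have sub: "subgroup G (mat_group {A. invertible A})"
    using assms by (simp add: linear_alg_group_def)
  show "mat 1 \<in> G" "A \<in> G \<Longrightarrow> B \<in> G \<Longrightarrow> A ** B \<in> G" and inv: "A \<in> G \<Longrightarrow> invertible A"
    using subgroup.one_closed[OF sub] subgroup.m_closed[OF sub, of A B] subgroup.subset[OF sub]
    by (auto simp: mat_group_def)
  show "matrix_inv A \<in> G" if A: "A \<in> G"
  proof -
    obtain B where B: "A ** B = mat 1" "B ** A = mat 1"
      using inv[OF A] by (auto simp: invertible_def)
    have AA: "A ** matrix_inv A = mat 1" "matrix_inv A ** A = mat 1"
      using someI[of "\<lambda>B. A ** B = mat 1 \<and> B ** A = mat 1" B] B
      by (auto simp: matrix_inv_def)
    let ?C = "inv\<^bsub>mat_group {A. invertible A}\<^esub> A"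
    have "invertible (matrix_inv A)"
      using AA by (auto simp: invertible_def)
    then have ex: "\<exists>!C. C \<in> {A. invertible A} \<and> A ** C = mat 1 \<and> C ** A = mat 1"
      using AA by (auto intro!: ex1I[of _ "matrix_inv A"]) (metis matrix_mul_assoc matrix_mul_lid matrix_mul_rid)
    have "A ** ?C = mat 1"
      using theI'[OF ex] by (simp add: m_inv_def mat_group_def)
    then have "?C = matrix_inv A"
      using AA by (metis matrix_mul_assoc matrix_mul_lid matrix_mul_rid)
    then show ?thesis
      using subgroup.m_inv_closed[OF sub A] by simp
  qed
qed

lemma matrix_inv_works:
  assumes "invertible A"
  shows "A ** matrix_inv A = mat 1" "matrix_inv A ** A = mat 1"
  using someI_ex[OF assms[unfolded invertible_def]] by (auto simp: matrix_inv_def)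

text \<open>
  The Euler operator \<open>\<Sum> z\<^sub>Y \<partial>\<^sub>Y\<close> of a system of parameters \<open>z\<^sub>Y\<close> acts on \<open>m\<^sup>n / m\<^sup>n\<^sup>+\<^sup>1\<close>
  of the local ring of \<open>G\<close> at 1 as multiplication by \<open>n\<close>.  As the characteristic is 0, a
  semi-invariant that vanishes at 1 lies in every power of \<open>m\<close>, without any smoothness of \<open>G\<close>.
\<close>

lemma semi_invariant_vanishes_near_one:
  fixes G :: "('a::{field_char_0, alg_closed_field} ^ 'm ^ 'm) set"
  assumes G: "linear_alg_group G"
    and B: "finite B" "mat_vs.independent B" "mat_vs.span B = group_lie G"
    and g: "g \<in> polyfun" "g (mat 1) = 0"
    and eigen: "\<And>Y. Y \<in> B \<Longrightarrow> \<exists>c. \<forall>A\<in>G. pder Y g A = c * g A"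
  obtains b where "b \<in> polyfun" "b (mat 1) \<noteq> 0" "\<And>A. A \<in> G \<Longrightarrow> b A * g A = 0"
proof -
  interpret vector_space_pair mat_scale "(*) :: 'a \<Rightarrow> 'a \<Rightarrow> 'a"
    by unfold_locales
  note GD = linear_alg_groupD[OF G]
  note P = subring_setD[OF subring_set_polyfun]
  define I where "I = {p \<in> polyfun. \<forall>A\<in>G. p A = 0}"
  have I: "ideal_of polyfun I"
    by (rule ideal_ofI) (auto simp: I_def intro: P)
  note ID = ideal_ofD[OF I]
  \<comment> \<open>Fields tangent to \<open>G\<close> preserve its vanishing ideal: left
    translation by \<open>A\<close> moves the claim at \<open>A\<close> to the definition of
    \<open>group_lie\<close> at 1.\<close>
  have pderI: "pder Y p \<in> I" if p: "p \<in> I" and Y: "Y \<in> group_lie G" for p Y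
  proof -
    have "pder Y p A = 0" if A: "A \<in> G" for A
    proof -
      have "(\<lambda>B. p (A ** B)) \<in> polyfun" "\<forall>B\<in>G. p (A ** B) = 0"
        using p GD(2)[OF A] by (auto simp: I_def intro: polyfun_left)
      then have "pder Y (\<lambda>B. p (A ** B)) (mat 1) = 0"
        using Y by (simp add: group_lie_iff)
      then show ?thesis
        by (simp add: pder_left)
    qed
    then show ?thesis
      using p by (auto simp: I_def pder_polyfun)
  qed
  have BG: "Y \<in> B \<Longrightarrow> Y \<in> group_lie G" for Y
    using B(3) mat_vs.span_base by blast
  have "\<exists>f. Vector_Spaces.linear mat_scale (*) f \<and> (\<forall>Y'\<in>B. f Y' = (if Y' = Y then 1 else 0))" for Y
    using linear_independent_extend[OF B(2), of "\<lambda>Y'. if Y' = Y then 1 else 0"] by blast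
  then obtain \<xi> where \<xi>: "\<And>Y. Vector_Spaces.linear mat_scale (*) (\<xi> Y)"
    "\<And>Y Y'. Y' \<in> B \<Longrightarrow> \<xi> Y Y' = (if Y' = Y then 1 else 0 :: 'a)"
    by metis
  \<comment> \<open>Linear parameters at 1 whose differentials are dual to the basis
    \<open>B\<close>.\<close>
  define z where "z Y A = (\<Sum>i\<in>UNIV. \<Sum>j\<in>UNIV. \<xi> Y (mat_unit i j) * (A $ i $ j - mat 1 $ i $ j))" for Y A
  have sum_fun: "(\<lambda>A. \<Sum>i\<in>S. f i A) = (\<Sum>i\<in>S. f i)" for S :: "'i set" and f :: "'i \<Rightarrow> 'a ^ 'm ^ 'm \<Rightarrow> 'a"
    by (induction S rule: infinite_finite_induct) (auto simp: fun_eq_iff)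
  have z1: "one_pow 1 (z Y)" for Y
    unfolding z_def[abs_def] sum_fun by (intro ideal_pow_sum one_pow_cmult one_pow_coord)
  \<comment> \<open>\<open>cl n p\<close> says that \<open>p\<close> lies in the \<open>n\<close>-th
    power of m modulo \<open>I\<close>, i.e. that its restriction to \<open>G\<close> vanishes at 1
    to order \<open>n\<close>.\<close>
  define cl where "cl n p \<longleftrightarrow> (\<exists>a. one_pow n a \<and> p - a \<in> I)" for n p
  have clI: "cl n p" if "one_pow n a" "p - a \<in> I" for n p a
    using that by (auto simp: cl_def)
  have cl_pow: "cl n a" if "one_pow n a" for n a
    using clI[OF that, of a] ID(2) by simp
  have cl_I: "cl n p" if "p \<in> I" for n p
    using clI[OF ideal_pow.zero, of p n] that by simp
  have cl_add: "cl n (p + q)" if pq: "cl n p" "cl n q" for n p q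
  proof -
    obtain a b where "one_pow n a" "p - a \<in> I" "one_pow n b" "q - b \<in> I"
      using pq by (auto simp: cl_def)
    then have "one_pow n (a + b)" "(p - a) + (q - b) \<in> I"
      by (auto intro: ideal_pow.add ID(3))
    then show ?thesis
      by (intro clI[of n "a + b"]) (simp_all add: algebra_simps)
  qed
  have cl_mult: "cl (m + n) (a * p)" if p: "cl n p" and a: "one_pow m a" for n m p a
  proof -
    obtain b where b: "one_pow n b" "p - b \<in> I"
      using p by (auto simp: cl_def)
    have "a * (p - b) \<in> I"
      using ID(4)[OF one_pow_polyfun[OF a] b(2)] .
    then have "a * p - a * b \<in> I"
      by (simp add: algebra_simps)
    then show ?thesis
      using one_pow_mult[OF a b(1)] by (intro clI[of "m + n" "a * b"])
  qed
  have cl_scale: "cl n (a * p)" if "cl n p" "a \<in> polyfun" for n p a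
    using cl_mult[OF that(1) ideal_pow.base[OF that(2)]] by simp
  have cl_diff: "cl n (p - q)" if "cl n p" "cl n q" for n p q
    using cl_add[OF that(1) cl_scale[OF that(2) P(5)[OF P(1)]]] by simp
  have cl_sum: "cl n (\<Sum>i\<in>S. f i)" if "\<And>i. i \<in> S \<Longrightarrow> cl n (f i)" for n S and f :: "'a ^ 'm ^ 'm \<Rightarrow> 'a ^ 'm ^ 'm \<Rightarrow> 'a"
    using that by (induction S rule: infinite_finite_induct) (auto intro: cl_add cl_pow ideal_pow.zero)
  \<comment> \<open>The parameters \<open>z Y\<close> span the cotangent space of \<open>G\<close>
    at 1. The proof shows that a covector annihilating \<open>group_lie G\<close> is the
    differential of some function in \<open>I\<close>.\<close>
  have cotangent: "cl 2 (\<lambda>A. p A - p (mat 1) - (\<Sum>Y\<in>B. pder Y p (mat 1) * z Y A))" if p: "p \<in> polyfun" for p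
  proof -
    \<comment> \<open>\<open>\<mu>\<close> is the part of the differential of \<open>p\<close> not
      accounted for by the parameters, and \<open>W\<close> is the space of differentials at 1 of
      functions in \<open>I\<close>.\<close>
    define \<mu> where "\<mu> i j = pder (mat_unit i j) p (mat 1) - (\<Sum>Y\<in>B. pder Y p (mat 1) * \<xi> Y (mat_unit i j))" for i j
    define W where "W = {(\<chi> i j. pder (mat_unit i j) q (mat 1)) | q. q \<in> I}"
    have "mat_vs.subspace W"
    proof (rule mat_vs.subspaceI)
      show "0 \<in> W"
        unfolding W_def using ID(2) pder_const[of _ 0]
        by (auto intro!: exI[of _ 0] simp: vec_eq_iff zero_fun_def)
      show "u + v \<in> W" if uv: "u \<in> W" "v \<in> W" for u v
      proof -
        obtain q r where qr: "u = (\<chi> i j. pder (mat_unit i j) q (mat 1))" "q \<in> I"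
          "v = (\<chi> i j. pder (mat_unit i j) r (mat 1))" "r \<in> I"
          using uv by (auto simp: W_def)
        have "u + v = (\<chi> i j. pder (mat_unit i j) (q + r) (mat 1))"
          using qr ID(1) by (simp add: vec_eq_iff plus_fun_def pder_add)
        then show ?thesis
          unfolding W_def using ID(3)[OF qr(2,4)] by blast
      qed
      show "mat_scale c u \<in> W" if u: "u \<in> W" for c u
      proof -
        obtain q where q: "u = (\<chi> i j. pder (mat_unit i j) q (mat 1))" "q \<in> I"
          using u by (auto simp: W_def)
        have "mat_scale c u = (\<chi> i j. pder (mat_unit i j) (\<lambda>A. c * q A) (mat 1))"
          using q ID(1) by (simp add: vec_eq_iff mat_scale_def pder_cmult)
        moreover have "(\<lambda>A. c * q A) \<in> I"
          using q by (auto simp: I_def polyfun_cmult)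
        ultimately show ?thesis
          unfolding W_def by blast
      qed
    qed
    moreover have "(\<chi> i j. \<mu> i j) \<in> W"
    proof (rule ccontr)
      assume "(\<chi> i j. \<mu> i j) \<notin> W"
      then obtain f where f: "Vector_Spaces.linear mat_scale (*) f" "\<And>w. w \<in> W \<Longrightarrow> f w = 0"
        "f (\<chi> i j. \<mu> i j) = 1"
        using mat_vs.separating_functional[OF \<open>mat_vs.subspace W\<close>] by blast
      \<comment> \<open>A functional on covectors is a matrix. As \<open>f\<close> kills
        \<open>W\<close>, the matrix \<open>Y0\<close> is tangent to \<open>G\<close>, hence in the
        span of \<open>B\<close>; but \<open>\<mu>\<close> vanishes on \<open>B\<close>, which
        contradicts the value 1 of \<open>f\<close> at \<open>\<mu>\<close>.\<close>
      define Y0 where "Y0 = (\<chi> i j. f (mat_unit i j))"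
      have fY: "f M = (\<Sum>i\<in>UNIV. \<Sum>j\<in>UNIV. M $ i $ j * Y0 $ i $ j)" for M
        using linear_mat_expand[OF f(1), of M] by (simp add: Y0_def mult.commute)
      have "pder Y0 q (mat 1) = 0" if "q \<in> I" for q
      proof -
        have "f (\<chi> i j. pder (mat_unit i j) q (mat 1)) = 0"
          by (rule f(2)) (use that in \<open>auto simp: W_def\<close>)
        then show ?thesis
          unfolding fY using that ID(1)[of q] by (simp add: pder_one_expand)
      qed
      then have "Y0 \<in> group_lie G"
        by (auto simp: group_lie_iff I_def)
      then have Y0: "Y0 \<in> mat_vs.span B"
        using B(3) by simp
      define h where "h M = (\<Sum>i\<in>UNIV. \<Sum>j\<in>UNIV. \<mu> i j * M $ i $ j)" for M :: "'a ^ 'm ^ 'm"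
      have h: "Vector_Spaces.linear mat_scale (*) h"
        unfolding Vector_Spaces.linear_iff h_def
        by (auto simp: mat_scale_def algebra_simps sum.distrib sum_distrib_left mat_vs.vector_space_axioms vector_space_over_itself.vector_space_axioms)
      have hB: "h Y = 0" if Y: "Y \<in> B" for Y
      proof -
        have "h Y = pder Y p (mat 1) - (\<Sum>i\<in>UNIV. \<Sum>j\<in>UNIV. \<Sum>Y'\<in>B. pder Y' p (mat 1) * (\<xi> Y' (mat_unit i j) * Y $ i $ j))"
          unfolding h_def \<mu>_def pder_one_expand[OF p, of Y]
          by (simp add: left_diff_distrib sum_subtractf sum_distrib_right mult.assoc)
        also have "(\<Sum>i\<in>UNIV. \<Sum>j\<in>UNIV. \<Sum>Y'\<in>B. pder Y' p (mat 1) * (\<xi> Y' (mat_unit i j) * Y $ i $ j)) =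
            (\<Sum>i\<in>UNIV. \<Sum>Y'\<in>B. \<Sum>j\<in>UNIV. pder Y' p (mat 1) * (\<xi> Y' (mat_unit i j) * Y $ i $ j))"
          by (intro sum.cong refl sum.swap)
        also have "\<dots> = (\<Sum>Y'\<in>B. \<Sum>i\<in>UNIV. \<Sum>j\<in>UNIV. pder Y' p (mat 1) * (\<xi> Y' (mat_unit i j) * Y $ i $ j))"
          by (rule sum.swap)
        also have "\<dots> = (\<Sum>Y'\<in>B. pder Y' p (mat 1) * \<xi> Y' Y)"
          by (simp add: linear_mat_expand[OF \<xi>(1), of _ Y] sum_distrib_left)
        also have "\<dots> = pder Y p (mat 1)"
          using Y B(1) by (simp add: \<xi>(2)[OF Y] if_distrib cong: if_cong)
        finally show ?thesis
          by simp
      qed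
      have "h Y0 = 0"
        by (rule linear_eq_on[OF h linear_zero Y0]) (use hB in auto)
      then show False
        using f(3) unfolding fY h_def by simp
    qed
    then obtain q where q: "q \<in> I" "\<And>i j. \<mu> i j = pder (mat_unit i j) q (mat 1)"
      by (auto simp: W_def vec_eq_iff)
    define S where "S r A = (\<Sum>i\<in>UNIV. \<Sum>j\<in>UNIV. pder (mat_unit i j) r (mat 1) * (A $ i $ j - mat 1 $ i $ j))"
      for r and A :: "'a ^ 'm ^ 'm"
    have "S p A - S q A = (\<Sum>Y\<in>B. pder Y p (mat 1) * z Y A)" for A
    proof -
      have "S p A - S q A = (\<Sum>i\<in>UNIV. \<Sum>j\<in>UNIV. \<Sum>Y\<in>B. pder Y p (mat 1) * (\<xi> Y (mat_unit i j) * (A $ i $ j - mat 1 $ i $ j)))"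
        unfolding S_def q(2)[symmetric] \<mu>_def sum_subtractf[symmetric] left_diff_distrib[symmetric]
        by (simp add: sum_distrib_right mult.assoc)
      also have "\<dots> = (\<Sum>i\<in>UNIV. \<Sum>Y\<in>B. \<Sum>j\<in>UNIV. pder Y p (mat 1) * (\<xi> Y (mat_unit i j) * (A $ i $ j - mat 1 $ i $ j)))"
        by (intro sum.cong refl sum.swap)
      also have "\<dots> = (\<Sum>Y\<in>B. \<Sum>i\<in>UNIV. \<Sum>j\<in>UNIV. pder Y p (mat 1) * (\<xi> Y (mat_unit i j) * (A $ i $ j - mat 1 $ i $ j)))"
        by (rule sum.swap)
      finally show ?thesis
        by (simp add: z_def sum_distrib_left)
    qed
    then have eq: "(\<lambda>A. p A - p (mat 1) - (\<Sum>Y\<in>B. pder Y p (mat 1) * z Y A)) =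
        ((\<lambda>A. p A - p (mat 1) - S p A) - (\<lambda>A. q A - q (mat 1) - S q A)) + q"
      using q(1) GD(1) by (auto simp: fun_eq_iff I_def algebra_simps)
    have "one_pow 2 (\<lambda>A. p A - p (mat 1) - S p A)" "one_pow 2 (\<lambda>A. q A - q (mat 1) - S q A)"
      using one_pow_taylor[OF p] one_pow_taylor[OF ID(1)[OF q(1)]] by (simp_all add: S_def)
    then show ?thesis
      unfolding eq using q(1) by (intro cl_add cl_diff cl_pow cl_I)
  qed
  \<comment> \<open>The Euler operator of the parameters \<open>z Y\<close>: a derivation that
    preserves \<open>I\<close>.\<close>
  define E where "E p = (\<Sum>Y\<in>B. z Y * pder Y p)" for p
  have E_add: "E (p + q) = E p + E q" if "p \<in> polyfun" "q \<in> polyfun" for p q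
    unfolding E_def sum.distrib[symmetric]
    using that by (intro sum.cong refl) (auto simp: fun_eq_iff plus_fun_def pder_add algebra_simps)
  have E_mult: "E (p * q) = E p * q + p * E q" if "p \<in> polyfun" "q \<in> polyfun" for p q
    unfolding E_def sum_distrib_left sum_distrib_right sum.distrib[symmetric]
    using that by (intro sum.cong refl) (auto simp: fun_eq_iff times_fun_def pder_mult algebra_simps)
  have E_zero: "E 0 = 0"
    using E_add[of 0 0] P(2) by simp
  have E_I: "E p \<in> I" if "p \<in> I" for p
  proof -
    have "(\<Sum>Y\<in>S. z Y * pder Y p) \<in> I" if "S \<subseteq> B" for S
      using that \<open>p \<in> I\<close>
      by (induction S rule: infinite_finite_induct)
         (auto intro!: ID(2,3) ID(4) pderI BG one_pow_polyfun[OF z1])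
    then show ?thesis
      by (simp add: E_def)
  qed
  have E_base: "cl 1 (E p)" if "p \<in> polyfun" for p
    unfolding E_def using one_pow_scale[OF z1 pder_polyfun[OF that]]
    by (intro cl_sum cl_pow) (simp add: mult.commute)
  have const_in: "(\<lambda>A. c) \<in> polyfun" for c :: 'a
    by (rule polyfun.intros)
  \<comment> \<open>Replacing \<open>pder Y x\<close> by its value at 1 costs an element of m, hence
    one of its square after multiplication by \<open>z Y\<close>; what remains is the cotangent
    expansion of \<open>x\<close>.\<close>
  have E_coord: "cl 2 (E x - x)" if x: "x \<in> coords_one" for x
  proof -
    have xp: "x \<in> polyfun" and x0: "x (mat 1) = 0"
      using x coords_one(2) by (auto simp: coords_one_def)
    have "E x - x = (\<Sum>Y\<in>B. z Y * (\<lambda>A. pder Y x A - pder Y x (mat 1))) -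
        (\<lambda>A. x A - x (mat 1) - (\<Sum>Y\<in>B. pder Y x (mat 1) * z Y A))"
      unfolding E_def
      by (auto simp: fun_eq_iff x0 sum_fun[symmetric] algebra_simps sum_subtractf)
    moreover have "cl 2 (\<Sum>Y\<in>B. z Y * (\<lambda>A. pder Y x A - pder Y x (mat 1)))"
      using one_pow_mult[OF z1 one_pow_const_diff[OF pder_polyfun[OF xp]]]
      by (intro cl_sum cl_pow) (simp add: numeral_2_eq_2)
    ultimately show ?thesis
      using cotangent[OF xp] by (auto intro: cl_diff)
  qed
  \<comment> \<open>In a product \<open>x * b\<close> the eigenvalue 1 of the generator and the
    eigenvalue \<open>n\<close> of \<open>b\<close> add up by the Leibniz rule.\<close>
  have euler: "cl (Suc n) (E p - of_nat n * p)" if "one_pow n p" for n p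
    using that
  proof induction
    case (base a)
    then show ?case
      using E_base[of a] by simp
  next
    case (step x n b)
    have xp: "x \<in> polyfun" and bp: "b \<in> polyfun"
      using step coords_one(2) one_pow_polyfun by auto
    have x1: "one_pow 1 x"
      using step.hyps(1) one_pow_coord by (auto simp: coords_one_def)
    have "E (x * b) - of_nat (Suc n) * (x * b) = b * (E x - x) + x * (E b - of_nat n * b)"
      unfolding E_mult[OF xp bp] by (simp add: algebra_simps)
    moreover have "cl (Suc (Suc n)) (b * (E x - x))"
      using cl_mult[OF E_coord[OF step.hyps(1)] step.hyps(2)] by simp
    moreover have "cl (Suc (Suc n)) (x * (E b - of_nat n * b))"
      using cl_mult[OF step.IH x1] by (simp only: plus_1_eq_Suc)
    ultimately show ?case
      by (metis cl_add)
  next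
    case (zero n)
    show ?case
      unfolding E_zero mult_zero_right diff_zero by (rule cl_pow[OF ideal_pow.zero])
  next
    case (add n a b)
    have "E (a + b) - of_nat n * (a + b) = (E a - of_nat n * a) + (E b - of_nat n * b)"
      unfolding E_add[OF one_pow_polyfun[OF add.hyps(1)] one_pow_polyfun[OF add.hyps(2)]]
      by (simp add: algebra_simps)
    then show ?case
      using cl_add[OF add.IH] by metis
  qed
  \<comment> \<open>Semi-invariance turns each \<open>pder Y g\<close> into a constant times
    \<open>g\<close> on \<open>G\<close>, so that \<open>E g\<close> is a multiple of
    \<open>g\<close> by an element of m, modulo \<open>I\<close>.\<close>
  have Eg: "\<exists>i\<in>I. \<exists>w. one_pow 1 w \<and> E g = w * g + i"
  proof -
    obtain c where c: "\<And>Y A. Y \<in> B \<Longrightarrow> A \<in> G \<Longrightarrow> pder Y g A = c Y * g A"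
      using eigen by metis
    have "one_pow 1 (\<Sum>Y\<in>B. (\<lambda>A. c Y * z Y A))"
      by (intro ideal_pow_sum one_pow_cmult z1)
    moreover have "E g - (\<Sum>Y\<in>B. (\<lambda>A. c Y * z Y A)) * g \<in> I"
    proof -
      have "(E g - (\<Sum>Y\<in>B. (\<lambda>A. c Y * z Y A)) * g) A = 0" if "A \<in> G" for A
        using c that by (simp add: E_def sum_fun[symmetric] sum_distrib_left sum_distrib_right mult_ac)
      moreover have "E g - (\<Sum>Y\<in>B. (\<lambda>A. c Y * z Y A)) * g \<in> polyfun"
        unfolding E_def sum_fun[symmetric]
        using g(1) one_pow_polyfun[OF z1] pder_polyfun[OF g(1)]
        by (intro P polyfun_sum polyfun_cmult) auto
      ultimately show ?thesis
        by (simp add: I_def)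
    qed
    ultimately show ?thesis
      by (intro bexI[of _ "E g - (\<Sum>Y\<in>B. (\<lambda>A. c Y * z Y A)) * g"] exI[of _ "\<Sum>Y\<in>B. (\<lambda>A. c Y * z Y A)"]) auto
  qed
  \<comment> \<open>If \<open>g\<close> has order at least \<open>n + 1\<close>, then
    \<open>E g\<close> has order at least \<open>n + 2\<close> by \<open>Eg\<close>, while
    \<open>E g\<close> is \<open>(n + 1) g\<close> up to that order. Dividing by
    \<open>n + 1\<close> uses characteristic 0.\<close>
  have clg: "cl (Suc n) g" for n
  proof (induction n)
    case 0
    show ?case
      using one_pow_const_diff[OF g(1)] g(2) by (intro cl_pow) simp
  next
    case (Suc n)
    then obtain a where a: "one_pow (Suc n) a" "g - a \<in> I"
      by (auto simp: cl_def)
    obtain i w where w: "i \<in> I" "one_pow 1 w" "E g = w * g + i"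
      using Eg by blast
    have ap: "a \<in> polyfun"
      using one_pow_polyfun[OF a(1)] .
    have "E g = E (g - a) + E a"
      using E_add[OF P(3)[OF g(1) ap] ap] by (simp only: diff_add_cancel)
    then have "of_nat (Suc n) * a = (w * g + i - E (g - a)) - (E a - of_nat (Suc n) * a)"
      unfolding w(3) by (simp only: algebra_simps)
    moreover have "cl (Suc (Suc n)) (w * g)"
      using cl_mult[OF Suc w(2)] by simp
    ultimately have "cl (Suc (Suc n)) (of_nat (Suc n) * a)"
      using euler[OF a(1)] cl_I[OF w(1)] cl_I[OF E_I[OF a(2)]] cl_add cl_diff by metis
    then have "cl (Suc (Suc n)) ((\<lambda>A. 1 / of_nat (Suc n)) * (of_nat (Suc n) * a))"
      by (rule cl_scale) (rule const_in)
    moreover have "(\<lambda>A. 1 / of_nat (Suc n)) * (of_nat (Suc n) * a) = a"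
      using of_nat_neq_0[of n, where 'a='a] by (auto simp: fun_eq_iff simp del: of_nat_Suc)
    ultimately have "cl (Suc (Suc n)) ((g - a) + a)"
      using cl_I[OF a(2)] cl_add by metis
    then show ?case
      by simp
  qed
  have "\<exists>a. one_pow n a \<and> g - a \<in> I" for n
  proof (cases n)
    case 0
    then show ?thesis
      using cl_pow[OF ideal_pow.base[OF g(1)]] by (simp add: cl_def)
  next
    case (Suc k)
    then show ?thesis
      using clg[of k] by (simp add: cl_def)
  qed
  from krull_intersection[OF subring_set_polyfun noetherian_polyfun coords_one I g(1) this]
  obtain a where a: "one_pow 1 a" "(1 - a) * g \<in> I"
    by blast
  \<comment> \<open>Elements of m vanish at 1, so \<open>1 - a\<close> takes the value 1 there and
    can serve as the factor \<open>b\<close>.\<close>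
  have "a (mat 1) = 0"
  proof -
    have "n > 0 \<longrightarrow> b (mat 1) = 0" if "one_pow n b" for n b
      using that by induction (auto simp: coords_one_def)
    then show ?thesis
      using a(1) by auto
  qed
  then show thesis
    using that[of "1 - a"] a(2) P(1,3) one_pow_polyfun[OF a(1)] by (auto simp: I_def)
qed

text \<open>By translation, the quotient of two semi-invariants of the same weight is locally constant.\<close>

lemma semi_invariant_ratio_constant:
  fixes G :: "('a::{field_char_0, alg_closed_field} ^ 'm ^ 'm) set"
  assumes G: "linear_alg_group G" "zariski_connected G"
    and B: "finite B" "mat_vs.independent B" "mat_vs.span B = group_lie G"
    and p: "p \<in> polyfun" and q: "q \<in> polyfun" "\<And>A. A \<in> G \<Longrightarrow> q A \<noteq> 0"
    and eigen: "\<And>Y. Y \<in> B \<Longrightarrow> \<exists>c. \<forall>A\<in>G. pder Y p A = c * p A \<and> pder Y q A = c * q A"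
    and A: "A \<in> G"
  shows "p A * q (mat 1) = p (mat 1) * q A"
proof -
  note GD = linear_alg_groupD[OF G(1)]
  obtain S where S: "S \<subseteq> polyfun" "G = {A. invertible A \<and> (\<forall>p\<in>S. p A = 0)}"
    using G(1) by (auto simp: linear_alg_group_def zariski_closed_def)
  \<comment> \<open>Up to the factor \<open>q B * q (B ** A)\<close> this is the difference of the
    values of \<open>p / q\<close> at \<open>B ** A\<close> and at \<open>B\<close>. For fixed
    \<open>B\<close> it is a semi-invariant in \<open>A\<close> that vanishes at 1.\<close>
  define g where "g B A = q B * p (B ** A) - p B * q (B ** A)" for B A
  have "\<exists>b. b \<in> polyfun \<and> b (mat 1) \<noteq> 0 \<and> (\<forall>A\<in>G. b A * g M A = 0)" if M: "M \<in> G" for M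
  proof -
    have gp: "g M \<in> polyfun"
      unfolding g_def using p q by (intro polyfun_diff polyfun_cmult polyfun_left)
    have "\<exists>c. \<forall>A\<in>G. pder Y (g M) A = c * g M A" if Y: "Y \<in> B" for Y
    proof -
      obtain c where c: "\<And>A. A \<in> G \<Longrightarrow> pder Y p A = c * p A" "\<And>A. A \<in> G \<Longrightarrow> pder Y q A = c * q A"
        using eigen[OF Y] by blast
      have "pder Y (g M) A = c * g M A" if "A \<in> G" for A
        unfolding g_def using p q c GD(2)[OF M that]
        by (simp add: pder_diff pder_cmult polyfun_cmult polyfun_left pder_left algebra_simps)
      then show ?thesis
        by blast
    qed
    moreover have "g M (mat 1) = 0"
      by (simp add: g_def)
    ultimately show ?thesis
      using semi_invariant_vanishes_near_one[OF G(1) B gp] by metis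
  qed
  then obtain b where b: "\<And>M. M \<in> G \<Longrightarrow> b M \<in> polyfun" "\<And>M. M \<in> G \<Longrightarrow> b M (mat 1) \<noteq> 0"
    "\<And>M A. M \<in> G \<Longrightarrow> A \<in> G \<Longrightarrow> b M A * g M A = 0"
    by metis
  define H where "H = {A \<in> G. g (mat 1) A = 0}"
  \<comment> \<open>If \<open>p / q\<close> has at \<open>M\<close> the same value as at 1, then
    comparison with the value at 1 and comparison with the value at \<open>M\<close> are the same
    condition.\<close>
  have trans: "g (mat 1) A = 0 \<longleftrightarrow> g M (matrix_inv M ** A) = 0" if "M \<in> H" for M A
  proof -
    have M: "M \<in> G" "q (mat 1) * p M = p (mat 1) * q M"
      using that by (auto simp: H_def g_def)
    have MA: "M ** (matrix_inv M ** A) = A"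
      using matrix_inv_works[OF GD(3)[OF M(1)]] by (simp add: matrix_mul_assoc)
    have "q (mat 1) * g M (matrix_inv M ** A) = q M * g (mat 1) A"
      using M(2) unfolding g_def MA by (simp add: algebra_simps)
    then show ?thesis
      using q(2)[OF M(1)] q(2)[OF GD(1)] by auto
  qed
  have "zariski_closed H"
    unfolding zariski_closed_def
  proof (intro exI conjI)
    show "insert (g (mat 1)) S \<subseteq> polyfun"
      unfolding g_def[abs_def] using S p q by (auto intro!: polyfun_diff polyfun_cmult polyfun_left)
    show "H = {A. invertible A \<and> (\<forall>p\<in>insert (g (mat 1)) S. p A = 0)}"
      using S(2) by (auto simp: H_def)
  qed
  \<comment> \<open>Outside \<open>H\<close> every translated \<open>b M\<close> must vanish, since
    its product with a nonzero number is 0. At a point \<open>A\<close> of \<open>H\<close> the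
    choice \<open>M = A\<close> gives the nonzero value \<open>b A (mat 1)\<close>.\<close>
  moreover have "zariski_closed (G - H)"
    unfolding zariski_closed_def
  proof (intro exI conjI)
    show "S \<union> (\<lambda>M A. b M (matrix_inv M ** A)) ` H \<subseteq> polyfun"
      using S b(1) by (auto simp: H_def intro!: polyfun_left)
    have "b M (matrix_inv M ** A) = 0" if "A \<in> G - H" "M \<in> H" for A M
      using b(3)[of M "matrix_inv M ** A"] trans[OF that(2), of A] that GD(2,4) by (auto simp: H_def)
    moreover have "A \<in> G - H" if "A \<in> G" "\<forall>M\<in>H. b M (matrix_inv M ** A) = 0" for A
      using that b(2) matrix_inv_works(2)[OF GD(3)[of A]] by (auto simp: H_def)
    ultimately have "G - H = {A \<in> G. \<forall>M\<in>H. b M (matrix_inv M ** A) = 0}"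
      by blast
    also have "\<dots> = {A. invertible A \<and> (\<forall>p\<in>S \<union> (\<lambda>M A. b M (matrix_inv M ** A)) ` H. p A = 0)}"
      unfolding S(2) by auto
    finally show "G - H = \<dots>" .
  qed
  moreover have "mat 1 \<in> H"
    using GD(1) by (simp add: H_def g_def)
  ultimately have "G - H = {}"
    using G(2) unfolding zariski_connected_def by (auto simp: H_def)
  then have "A \<in> H"
    using A by blast
  then show ?thesis
    by (simp add: H_def g_def algebra_simps)
qed

section \<open>Free algebras\<close>

lemma one_list_algebra: "(1 :: 'x list \<Rightarrow>\<^sub>0 'r::ring_1) = wrd []"
  by (simp add: wrd_def zero_list_def[symmetric])

lemma wrd_Nil [simp]: "wrd [] = (1 :: 'x list \<Rightarrow>\<^sub>0 'r::ring_1)"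
  by (simp add: one_list_algebra)

lemma wrd_append: "wrd (u @ v) = (wrd u * wrd v :: 'x list \<Rightarrow>\<^sub>0 'r::ring_1)"
  by (simp add: wrd_def mult_single plus_list_def)

lemma wrd_Cons: "wrd (x # v) = (gen x * wrd v :: 'x list \<Rightarrow>\<^sub>0 'r::ring_1)"
  using wrd_append[of "[x]" v] by simp

lemma cst_simps [simp]:
  "cst 0 = (0 :: 'x list \<Rightarrow>\<^sub>0 'r::ring_1)"
  "cst 1 = (1 :: 'x list \<Rightarrow>\<^sub>0 'r)"
  by (simp_all add: cst_def one_list_algebra wrd_def)

lemma cst_add: "cst (a + b) = (cst a + cst b :: 'x list \<Rightarrow>\<^sub>0 'r::ring_1)"
  by (simp add: cst_def single_add)

lemma cst_mult: "cst (a * b) = (cst a * cst b :: 'x list \<Rightarrow>\<^sub>0 'r::ring_1)"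
  by (simp add: cst_def mult_single plus_list_def)

lemma cst_minus: "cst (- a) = (- cst a :: 'x list \<Rightarrow>\<^sub>0 'r::ring_1)"
  by (simp add: cst_def single_uminus)

lemma cst_wrd: "cst r * wrd w = (Poly_Mapping.single w r :: 'x list \<Rightarrow>\<^sub>0 'r::ring_1)"
  by (simp add: cst_def wrd_def mult_single plus_list_def)

lemma list_algebra_expand:
  "p = (\<Sum>w\<in>Poly_Mapping.keys p. cst (Poly_Mapping.lookup p w) * wrd w :: 'x list \<Rightarrow>\<^sub>0 'r::ring_1)"
  by (rule poly_mapping_eqI)
    (auto simp: cst_wrd lookup_sum lookup_single when_def in_keys_iff if_distrib cong: if_cong)

abbreviation falg :: "'x set \<Rightarrow> ('x list \<Rightarrow>\<^sub>0 'r::ring_1) set"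
  where "falg S \<equiv> carrier (free_alg S)"

lemma falg_iff: "p \<in> falg S \<longleftrightarrow> Poly_Mapping.keys p \<subseteq> lists S"
  by (simp add: free_alg_def)

lemma free_alg_simps [simp]:
  "\<zero>\<^bsub>free_alg S\<^esub> = 0" "\<one>\<^bsub>free_alg S\<^esub> = 1"
  "p \<oplus>\<^bsub>free_alg S\<^esub> q = p + q" "p \<otimes>\<^bsub>free_alg S\<^esub> q = p * q"
  by (simp_all add: free_alg_def)

lemma falg_induct [consumes 1, case_names zero word add]:
  fixes p :: "'x list \<Rightarrow>\<^sub>0 'r::ring_1"
  assumes p: "p \<in> falg S" and zero: "P 0"
    and word: "\<And>r w. w \<in> lists S \<Longrightarrow> P (cst r * wrd w)"
    and add: "\<And>a b. a \<in> falg S \<Longrightarrow> b \<in> falg S \<Longrightarrow> P a \<Longrightarrow> P b \<Longrightarrow> P (a + b)"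
  shows "P p"
proof -
  have "P (\<Sum>w\<in>W. cst (f w) * wrd w) \<and> (\<Sum>w\<in>W. cst (f w) * wrd w) \<in> falg S" if "W \<subseteq> lists S" for W and f :: "'x list \<Rightarrow> 'r"
    using that
  proof (induction W rule: infinite_finite_induct)
    case (insert w W)
    have "cst (f w) * wrd w \<in> falg S"
      using insert.prems by (auto simp: falg_iff cst_wrd)
    moreover have "cst (f w) * wrd w + (\<Sum>w\<in>W. cst (f w) * wrd w) \<in> falg S"
      using keys_add[of "cst (f w) * wrd w" "\<Sum>w\<in>W. cst (f w) * wrd w"] insert calculation
      unfolding falg_iff by blast
    ultimately show ?case
      using insert word[of w "f w"] add by auto
  qed (auto simp: zero falg_iff)
  then have "P (\<Sum>w\<in>Poly_Mapping.keys p. cst (Poly_Mapping.lookup p w) * wrd w)"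
    using p by (auto simp: falg_iff)
  then show ?thesis
    by (simp flip: list_algebra_expand)
qed

lemma cst_central: "cst r * p = (p * cst r :: 'x list \<Rightarrow>\<^sub>0 'r::comm_ring_1)"
proof -
  have "p \<in> falg UNIV"
    by (simp add: falg_iff)
  then show ?thesis
  proof (induction rule: falg_induct)
    case (word s w)
    show ?case
      by (simp add: cst_def wrd_def mult_single plus_list_def mult.commute)
  qed (auto simp: algebra_simps)
qed

lemma cst_left_commute: "p * (cst r * q) = (cst r * (p * q) :: 'x list \<Rightarrow>\<^sub>0 'r::comm_ring_1)"
  by (simp only: mult.assoc[symmetric] cst_central[of r p])

lemma falg_closed:
  fixes p q :: "'x list \<Rightarrow>\<^sub>0 'r::ring_1"
  shows "0 \<in> (falg S :: ('x list \<Rightarrow>\<^sub>0 'r) set)" "1 \<in> (falg S :: ('x list \<Rightarrow>\<^sub>0 'r) set)"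
    "cst r \<in> (falg S :: ('x list \<Rightarrow>\<^sub>0 'r) set)"
    "p \<in> falg S \<Longrightarrow> q \<in> falg S \<Longrightarrow> p + q \<in> falg S"
    "p \<in> falg S \<Longrightarrow> q \<in> falg S \<Longrightarrow> p - q \<in> falg S"
    "p \<in> falg S \<Longrightarrow> - p \<in> falg S"
    "p \<in> falg S \<Longrightarrow> q \<in> falg S \<Longrightarrow> p * q \<in> falg S"
    "w \<in> lists S \<Longrightarrow> wrd w \<in> (falg S :: ('x list \<Rightarrow>\<^sub>0 'r) set)"
    "(\<And>i. i \<in> A \<Longrightarrow> f i \<in> (falg S :: ('x list \<Rightarrow>\<^sub>0 'r) set)) \<Longrightarrow> sum f A \<in> falg S"
proof -
  show add: "p \<in> falg S \<Longrightarrow> q \<in> falg S \<Longrightarrow> p + q \<in> falg S" for p q :: "'x list \<Rightarrow>\<^sub>0 'r"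
    using keys_add[of p q] by (auto simp: falg_iff)
  show "p \<in> falg S \<Longrightarrow> q \<in> falg S \<Longrightarrow> p - q \<in> falg S"
    using keys_diff[of p q] by (auto simp: falg_iff)
  show "p \<in> falg S \<Longrightarrow> q \<in> falg S \<Longrightarrow> p * q \<in> falg S"
    using keys_mult[of p q] by (fastforce simp: falg_iff plus_list_def)
  show zero: "0 \<in> (falg S :: ('x list \<Rightarrow>\<^sub>0 'r) set)"
    by (simp add: falg_iff)
  show "(\<And>i. i \<in> A \<Longrightarrow> f i \<in> (falg S :: ('x list \<Rightarrow>\<^sub>0 'r) set)) \<Longrightarrow> sum f A \<in> falg S"
    by (induction A rule: infinite_finite_induct) (auto intro: add zero)
  show one: "1 \<in> (falg S :: ('x list \<Rightarrow>\<^sub>0 'r) set)"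
    by (simp add: falg_iff one_list_algebra wrd_def)
qed (auto simp: falg_iff wrd_def cst_def)

lemma ring_free_alg: "ring (free_alg S :: ('x list \<Rightarrow>\<^sub>0 'r::ring_1) ring)"
proof (intro ringI abelian_groupI monoidI)
  fix x :: "'x list \<Rightarrow>\<^sub>0 'r"
  assume "x \<in> falg S"
  then show "\<exists>y\<in>falg S. y \<oplus>\<^bsub>free_alg S\<^esub> x = \<zero>\<^bsub>free_alg S\<^esub>"
    by (intro bexI[of _ "- x"]) (auto intro: falg_closed)
qed (auto simp: algebra_simps intro: falg_closed)

lemma ideal_freeD:
  fixes J :: "('x list \<Rightarrow>\<^sub>0 'r::ring_1) set"
  assumes "ideal J (free_alg S)"
  shows "0 \<in> J" "x \<in> J \<Longrightarrow> y \<in> J \<Longrightarrow> x + y \<in> J" "x \<in> J \<Longrightarrow> y \<in> J \<Longrightarrow> x - y \<in> J"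
    "x \<in> J \<Longrightarrow> - x \<in> J"
    "a \<in> falg S \<Longrightarrow> x \<in> J \<Longrightarrow> a * x \<in> J" "a \<in> falg S \<Longrightarrow> x \<in> J \<Longrightarrow> x * a \<in> J"
    "x \<in> J \<Longrightarrow> cst r * x \<in> J"
    "x \<in> J \<Longrightarrow> x \<in> falg S"
    "(\<And>i. i \<in> A \<Longrightarrow> f i \<in> J) \<Longrightarrow> sum f A \<in> J"
proof -
  interpret ideal J "free_alg S"
    by fact
  have sub: "subgroup J (add_monoid (free_alg S))"
    by (rule a_subgroup)
  show zero: "0 \<in> J"
    using subgroup.one_closed[OF sub] by simp
  show add: "x \<in> J \<Longrightarrow> y \<in> J \<Longrightarrow> x + y \<in> J" for x y
    using subgroup.m_closed[OF sub, of x y] by simp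
  show l: "a \<in> falg S \<Longrightarrow> x \<in> J \<Longrightarrow> a * x \<in> J" for a x
    using I_l_closed[of x a] by simp
  show "a \<in> falg S \<Longrightarrow> x \<in> J \<Longrightarrow> x * a \<in> J"
    using I_r_closed[of x a] by simp
  show "x \<in> J \<Longrightarrow> x \<in> falg S"
    using a_subset by auto
  show cs: "x \<in> J \<Longrightarrow> cst r * x \<in> J" for r x
    by (intro l falg_closed)
  show um: "x \<in> J \<Longrightarrow> - x \<in> J" for x
    using cs[of x "- 1"] by (simp add: cst_minus)
  show "x \<in> J \<Longrightarrow> y \<in> J \<Longrightarrow> x - y \<in> J"
    using add[OF _ um, of x y] by simp
  show "(\<And>i. i \<in> A \<Longrightarrow> f i \<in> J) \<Longrightarrow> sum f A \<in> J"
    by (induction A rule: infinite_finite_induct) (auto intro: zero add)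
qed

lemma ideal_freeI:
  fixes J :: "('x list \<Rightarrow>\<^sub>0 'r::ring_1) set"
  assumes "J \<subseteq> falg S" "0 \<in> J" "\<And>x y. x \<in> J \<Longrightarrow> y \<in> J \<Longrightarrow> x + y \<in> J"
    "\<And>a x. a \<in> falg S \<Longrightarrow> x \<in> J \<Longrightarrow> a * x \<in> J" "\<And>a x. a \<in> falg S \<Longrightarrow> x \<in> J \<Longrightarrow> x * a \<in> J"
  shows "ideal J (free_alg S)"
proof (rule idealI[OF ring_free_alg])
  interpret ring "free_alg S :: ('x list \<Rightarrow>\<^sub>0 'r) ring"
    by (rule ring_free_alg)
  have um: "- x \<in> J" if "x \<in> J" for x
    using assms(4)[OF falg_closed(3)[of "- 1"] that] by (simp add: cst_minus)
  have minus: "\<ominus>\<^bsub>free_alg S\<^esub> x = - x" if "x \<in> falg S" for x :: "'x list \<Rightarrow>\<^sub>0 'r"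
    using that by (intro minus_equality) (auto intro: falg_closed)
  have "inv\<^bsub>add_monoid (free_alg S)\<^esub> x \<in> J" if "x \<in> J" for x
    using minus[of x] um[OF that] that assms(1) unfolding a_inv_def by auto
  then show "subgroup J (add_monoid (free_alg S))"
    by (intro group.subgroupI[OF a_group]) (use assms(1-3) in \<open>auto simp del: add.inv_closed\<close>)
qed (use assms in auto)

lemma ideal_Idl: "G \<subseteq> falg S \<Longrightarrow> ideal (Idl\<^bsub>free_alg S\<^esub> G) (free_alg S)"
  by (intro ring.genideal_ideal ring_free_alg)

lemma Idl_base: "G \<subseteq> falg S \<Longrightarrow> g \<in> G \<Longrightarrow> g \<in> Idl\<^bsub>free_alg S\<^esub> G"
  using ring.genideal_self[OF ring_free_alg] by blast

text \<open>The elements of the ideal that satisfy \<open>P\<close> form an ideal containing the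
  generators, so minimality applies.\<close>

lemma Idl_induct [consumes 2, case_names gen zero add left right]:
  assumes G: "G \<subseteq> falg S" and x: "x \<in> Idl\<^bsub>free_alg S\<^esub> G"
    and gen: "\<And>g. g \<in> G \<Longrightarrow> P g" and zero: "P 0"
    and add: "\<And>x y. x \<in> Idl\<^bsub>free_alg S\<^esub> G \<Longrightarrow> y \<in> Idl\<^bsub>free_alg S\<^esub> G \<Longrightarrow> P x \<Longrightarrow> P y \<Longrightarrow> P (x + y)"
    and left: "\<And>a x. a \<in> falg S \<Longrightarrow> x \<in> Idl\<^bsub>free_alg S\<^esub> G \<Longrightarrow> P x \<Longrightarrow> P (a * x)"
    and right: "\<And>a x. a \<in> falg S \<Longrightarrow> x \<in> Idl\<^bsub>free_alg S\<^esub> G \<Longrightarrow> P x \<Longrightarrow> P (x * a)"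
  shows "P x"
proof -
  note D = ideal_freeD[OF ideal_Idl[OF G]]
  have "ideal {x \<in> Idl\<^bsub>free_alg S\<^esub> G. P x} (free_alg S)"
    by (rule ideal_freeI) (auto intro: D zero add left right)
  then have "Idl\<^bsub>free_alg S\<^esub> G \<subseteq> {x \<in> Idl\<^bsub>free_alg S\<^esub> G. P x}"
    by (rule ring.genideal_minimal[OF ring_free_alg]) (use gen Idl_base[OF G] in blast)
  then show ?thesis
    using x by blast
qed

section \<open>Semilinear maps and substitutions of letters\<close>

definition field_hom :: "('k::field \<Rightarrow> 'r::field) \<Rightarrow> bool"
  where "field_hom \<iota> \<longleftrightarrow> \<iota> 0 = 0 \<and> \<iota> 1 = 1 \<and> (\<forall>a b. \<iota> (a + b) = \<iota> a + \<iota> b) \<and> (\<forall>a b. \<iota> (a * b) = \<iota> a * \<iota> b)"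

lemma field_homD:
  assumes "field_hom \<iota>"
  shows "\<iota> 0 = 0" "\<iota> 1 = 1" "\<iota> (a + b) = \<iota> a + \<iota> b" "\<iota> (a * b) = \<iota> a * \<iota> b" "\<iota> (- a) = - \<iota> a"
    "\<iota> (a - b) = \<iota> a - \<iota> b" "\<iota> (sum f A) = (\<Sum>i\<in>A. \<iota> (f i))" "\<iota> (ksgn n) = ksgn n"
    "\<iota> (a / b) = \<iota> a / \<iota> b" "\<iota> (of_nat m) = of_nat m"
proof -
  show z: "\<iota> 0 = 0" and o: "\<iota> 1 = 1" and a: "\<And>a b. \<iota> (a + b) = \<iota> a + \<iota> b" and m: "\<And>a b. \<iota> (a * b) = \<iota> a * \<iota> b"
    using assms by (simp_all add: field_hom_def)
  show u: "\<iota> (- a) = - \<iota> a" for a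
    using a[of a "- a"] z by (simp add: add_eq_0_iff2)
  show "\<iota> (a - b) = \<iota> a - \<iota> b"
    using a[of a "- b"] u by simp
  show "\<iota> (sum f A) = (\<Sum>i\<in>A. \<iota> (f i))"
    by (induction A rule: infinite_finite_induct) (auto simp: z a)
  show "\<iota> (ksgn n) = ksgn n"
    by (simp add: ksgn_def o u)
  have "\<iota> (inverse b) = inverse (\<iota> b)"
    using m[of b "inverse b"] z o by (cases "b = 0") (auto simp: inverse_unique)
  then show "\<iota> (a / b) = \<iota> a / \<iota> b"
    by (simp add: divide_inverse m)
  show "\<iota> (of_nat m) = of_nat m"
    by (induction m) (auto simp: z o a)
qed

lemma field_hom_id: "field_hom id"
  by (simp add: field_hom_def)

lemma field_hom_to_ac: "field_hom to_ac"
  by (simp add: field_hom_def)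

text \<open>Scalars are twisted by a field homomorphism, so that linear maps and extension of
  scalars to the closure are treated together.\<close>

definition semilinear :: "('r::field \<Rightarrow> 's::field) \<Rightarrow> (('x list \<Rightarrow>\<^sub>0 'r) \<Rightarrow> 'y list \<Rightarrow>\<^sub>0 's) \<Rightarrow> bool"
  where "semilinear \<kappa> f \<longleftrightarrow> (\<forall>p q. f (p + q) = f p + f q) \<and> (\<forall>r p. f (cst r * p) = cst (\<kappa> r) * f p)"

lemma semilinearD:
  assumes "semilinear \<kappa> f"
  shows "f (p + q) = f p + f q" "f (cst r * p) = cst (\<kappa> r) * f p" "f 0 = 0" "f (- p) = - f p"
    "f (p - q) = f p - f q" "f (sum h A) = (\<Sum>i\<in>A. f (h i))"
proof -
  show a: "f (p + q) = f p + f q" for p q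
    using assms by (simp add: semilinear_def)
  show "f (cst r * p) = cst (\<kappa> r) * f p"
    using assms by (simp add: semilinear_def)
  show z: "f 0 = 0"
    using a[of 0 0] by simp
  show u: "f (- p) = - f p" for p
    using a[of p "- p"] z by (simp add: add_eq_0_iff2)
  show "f (p - q) = f p - f q"
    using a[of p "- q"] u by simp
  show "f (sum h A) = (\<Sum>i\<in>A. f (h i))"
    by (induction A rule: infinite_finite_induct) (auto simp: z a)
qed

lemma semilinear_compose:
  "semilinear \<kappa> f \<Longrightarrow> semilinear \<mu> g \<Longrightarrow> semilinear (\<lambda>r. \<mu> (\<kappa> r)) (\<lambda>p. g (f p))"
  by (simp add: semilinear_def)

lemma linext_semilinear:
  fixes f :: "'x list \<Rightarrow> 'y list \<Rightarrow>\<^sub>0 's::field"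
  assumes "field_hom \<iota>"
  shows "semilinear \<iota> (linext \<iota> f)"
proof -
  note H = field_homD[OF assms]
  have add: "linext \<iota> f (p + q) = linext \<iota> f p + linext \<iota> f q" for p q
    unfolding linext_def
    by (rule setsum_keys_plus_distrib) (auto simp: H cst_add distrib_right)
  have single: "linext \<iota> f (Poly_Mapping.single w r) = cst (\<iota> r) * f w" for w r
    by (simp add: linext_def H)
  have "linext \<iota> f (cst r * p) = cst (\<iota> r) * linext \<iota> f p" for r p
  proof -
    have "p \<in> falg UNIV"
      by (simp add: falg_iff)
    then show ?thesis
    proof (induction rule: falg_induct)
      case zero
      then show ?case
        by (simp add: linext_def)
    next
      case (word s w)
      have "cst r * (cst s * wrd w) = Poly_Mapping.single w (r * s)"
        by (simp add: cst_wrd cst_mult mult.assoc flip: cst_wrd)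
      then show ?case
        by (simp add: cst_wrd single H cst_mult mult.assoc)
    next
      case (add a b)
      then show ?case
        by (simp add: distrib_left \<open>\<And>p q. linext \<iota> f (p + q) = linext \<iota> f p + linext \<iota> f q\<close>)
    qed
  qed
  then show ?thesis
    using add by (simp add: semilinear_def)
qed

lemma linext_wrd: "field_hom \<iota> \<Longrightarrow> linext \<iota> f (wrd w) = f w"
  by (simp add: linext_def wrd_def field_homD)

text \<open>Two maps that agree modulo an ideal on words agree on all formal sums; commutation with
  the differential is checked in this way.\<close>

lemma semilinear_congruent:
  fixes f g :: "('x list \<Rightarrow>\<^sub>0 'r::field) \<Rightarrow> 'y list \<Rightarrow>\<^sub>0 's::field"
  assumes f: "semilinear \<kappa> f" and g: "semilinear \<kappa> g" and J: "ideal J (free_alg T)"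
    and words: "\<And>w. w \<in> lists S \<Longrightarrow> f (wrd w) - g (wrd w) \<in> J" and p: "p \<in> falg S"
  shows "f p - g p \<in> J"
  using p
proof (induction rule: falg_induct)
  case (word r w)
  have "cst (\<kappa> r) * (f (wrd w) - g (wrd w)) \<in> J"
    using words[OF word] by (rule ideal_freeD[OF J])
  then show ?case
    by (simp add: semilinearD[OF f] semilinearD[OF g] algebra_simps)
next
  case (add a b)
  then have "(f a - g a) + (f b - g b) \<in> J"
    using ideal_freeD(2)[OF J] by blast
  then show ?case
    by (simp add: semilinearD[OF f] semilinearD[OF g] algebra_simps)
qed (simp add: semilinearD[OF f] semilinearD[OF g] ideal_freeD[OF J])

lemma semilinear_mapsto:
  fixes f :: "('x list \<Rightarrow>\<^sub>0 'r::field) \<Rightarrow> 'y list \<Rightarrow>\<^sub>0 's::field"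
  assumes f: "semilinear \<kappa> f" and words: "\<And>w. w \<in> lists S \<Longrightarrow> f (wrd w) \<in> falg T" and p: "p \<in> falg S"
  shows "f p \<in> falg T"
  using p
proof (induction rule: falg_induct)
  case (word r w)
  then show ?case
    by (simp add: semilinearD[OF f] falg_closed words)
qed (auto simp: semilinearD[OF f] intro: falg_closed)

text \<open>Restriction to \<open>h\<close>, extension of scalars and the conjugation actions all
  have this form; being multiplicative, such a map is controlled by its effect on letters.\<close>

definition letter_map :: "('r::field \<Rightarrow> 's::field) \<Rightarrow> ('x \<Rightarrow> 'y) \<Rightarrow> ('x list \<Rightarrow>\<^sub>0 'r) \<Rightarrow> 'y list \<Rightarrow>\<^sub>0 's"
  where "letter_map \<kappa> f = linext \<kappa> (\<lambda>w. wrd (map f w))"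

lemma letter_map:
  assumes \<kappa>: "field_hom \<kappa>"
  shows "semilinear \<kappa> (letter_map \<kappa> f)" "letter_map \<kappa> f (wrd w) = wrd (map f w)"
    "letter_map \<kappa> f (cst r) = cst (\<kappa> r)" "letter_map \<kappa> f 1 = 1"
    "letter_map \<kappa> f (p * q) = letter_map \<kappa> f p * letter_map \<kappa> f q"
proof -
  show s: "semilinear \<kappa> (letter_map \<kappa> f)"
    unfolding letter_map_def by (rule linext_semilinear[OF \<kappa>])
  note sD = semilinearD[OF s]
  show w: "letter_map \<kappa> f (wrd w) = wrd (map f w)" for w
    unfolding letter_map_def by (rule linext_wrd[OF \<kappa>])
  show one: "letter_map \<kappa> f 1 = 1"
    using w[of "[]"] by simp
  show "letter_map \<kappa> f (cst r) = cst (\<kappa> r)"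
    using sD(2)[of r 1] one by simp
  have wq: "letter_map \<kappa> f (wrd w * q) = wrd (map f w) * letter_map \<kappa> f q" for w q
  proof -
    have "q \<in> falg UNIV"
      by (simp add: falg_iff)
    then show ?thesis
    proof (induction rule: falg_induct)
      case (word r v)
      have "letter_map \<kappa> f (wrd w * (cst r * wrd v)) = letter_map \<kappa> f (cst r * wrd (w @ v))"
        by (simp add: cst_left_commute wrd_append)
      also have "\<dots> = cst (\<kappa> r) * wrd (map f (w @ v))"
        by (simp only: sD w)
      also have "\<dots> = cst (\<kappa> r) * (wrd (map f w) * wrd (map f v))"
        by (simp add: wrd_append)
      also have "\<dots> = wrd (map f w) * (cst (\<kappa> r) * wrd (map f v))"
        by (simp add: cst_left_commute)
      finally show ?case
        by (simp add: sD w)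
    qed (simp_all add: sD distrib_left)
  qed
  have "p \<in> falg UNIV"
    by (simp add: falg_iff)
  then show "letter_map \<kappa> f (p * q) = letter_map \<kappa> f p * letter_map \<kappa> f q"
    by (induction rule: falg_induct) (simp_all add: sD wq w mult.assoc distrib_right)
qed

lemma letter_map_falg:
  assumes "field_hom \<kappa>" "\<And>x. x \<in> S \<Longrightarrow> f x \<in> T" "p \<in> falg S"
  shows "letter_map \<kappa> f p \<in> falg T"
  by (rule semilinear_mapsto[OF letter_map(1)[OF assms(1)] _ assms(3)])
    (auto simp: letter_map(2)[OF assms(1)] assms(2) intro!: falg_closed)

section \<open>Cosets and quotients of the free algebra\<close>

lemma coset_eq_iff:
  fixes J :: "('x list \<Rightarrow>\<^sub>0 'r::ring_1) set"
  assumes J: "ideal J (free_alg S)"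
  shows "J +>\<^bsub>free_alg S\<^esub> x = J +>\<^bsub>free_alg S\<^esub> y \<longleftrightarrow> x - y \<in> J"
proof -
  note D = ideal_freeD[OF J]
  have mem: "z \<in> J +>\<^bsub>free_alg S\<^esub> x \<longleftrightarrow> z - x \<in> J" for x z
  proof
    show "z - x \<in> J" if "z \<in> J +>\<^bsub>free_alg S\<^esub> x"
      using that by (auto simp: a_r_coset_def')
    show "z \<in> J +>\<^bsub>free_alg S\<^esub> x" if "z - x \<in> J"
      using that by (auto simp: a_r_coset_def' intro!: bexI[of _ "z - x"])
  qed
  show ?thesis
  proof
    assume "J +>\<^bsub>free_alg S\<^esub> x = J +>\<^bsub>free_alg S\<^esub> y"
    then have "x \<in> J +>\<^bsub>free_alg S\<^esub> y"
      using mem[of x x] D(1) by simp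
    then show "x - y \<in> J"
      using mem by blast
  next
    assume xy: "x - y \<in> J"
    have "z - x \<in> J \<longleftrightarrow> z - y \<in> J" for z
      using D(2)[of "z - x" "x - y"] D(3)[of "z - y" "x - y"] xy by auto
    then show "J +>\<^bsub>free_alg S\<^esub> x = J +>\<^bsub>free_alg S\<^esub> y"
      using mem by blast
  qed
qed

lemma coset_zero: "J +>\<^bsub>free_alg S\<^esub> 0 = J"
  by (auto simp: a_r_coset_def')

text \<open>The set of image cosets is a singleton because \<open>f\<close> maps \<open>I\<close>
  into \<open>J\<close>, so \<open>the_elem\<close> returns the expected coset.\<close>

lemma quot_map_coset:
  assumes I: "ideal I (free_alg S)" and J: "ideal J (free_alg T)"
    and add: "\<And>p q. f (p + q) = f p + f q" and maps: "\<And>p. p \<in> I \<Longrightarrow> f p \<in> J"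
  shows "quot_map (free_alg T) J f (I +>\<^bsub>free_alg S\<^esub> x) = J +>\<^bsub>free_alg T\<^esub> f x"
proof -
  have "(\<lambda>x. J +>\<^bsub>free_alg T\<^esub> f x) ` (I +>\<^bsub>free_alg S\<^esub> x) = {J +>\<^bsub>free_alg T\<^esub> f x}"
  proof -
    have "J +>\<^bsub>free_alg T\<^esub> f (i + x) = J +>\<^bsub>free_alg T\<^esub> f x" if "i \<in> I" for i
      using maps[OF that] by (simp add: coset_eq_iff[OF J] add)
    then show ?thesis
      using ideal_freeD(1)[OF I] by (auto simp: a_r_coset_def')
  qed
  then show ?thesis
    by (simp add: quot_map_def)
qed

lemma Quot_simps:
  fixes J :: "('x list \<Rightarrow>\<^sub>0 'r::ring_1) set"
  assumes J: "ideal J (free_alg S)"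
  shows "carrier (free_alg S Quot J) = (\<lambda>x. J +>\<^bsub>free_alg S\<^esub> x) ` falg S"
    "\<zero>\<^bsub>free_alg S Quot J\<^esub> = J" "\<one>\<^bsub>free_alg S Quot J\<^esub> = J +>\<^bsub>free_alg S\<^esub> 1"
    "x \<in> falg S \<Longrightarrow> y \<in> falg S \<Longrightarrow> (J +>\<^bsub>free_alg S\<^esub> x) \<oplus>\<^bsub>free_alg S Quot J\<^esub> (J +>\<^bsub>free_alg S\<^esub> y) = J +>\<^bsub>free_alg S\<^esub> (x + y)"
    "x \<in> falg S \<Longrightarrow> y \<in> falg S \<Longrightarrow> (J +>\<^bsub>free_alg S\<^esub> x) \<otimes>\<^bsub>free_alg S Quot J\<^esub> (J +>\<^bsub>free_alg S\<^esub> y) = J +>\<^bsub>free_alg S\<^esub> (x * y)"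
proof -
  interpret ideal J "free_alg S"
    by fact
  show "x \<in> falg S \<Longrightarrow> y \<in> falg S \<Longrightarrow> (J +>\<^bsub>free_alg S\<^esub> x) \<oplus>\<^bsub>free_alg S Quot J\<^esub> (J +>\<^bsub>free_alg S\<^esub> y) = J +>\<^bsub>free_alg S\<^esub> (x + y)"
    using abelian_subgroup.a_rcos_sum[OF abelian_subgroupI3[OF is_additive_subgroup is_abelian_group], of x y]
    by (simp add: FactRing_def)
  show "x \<in> falg S \<Longrightarrow> y \<in> falg S \<Longrightarrow> (J +>\<^bsub>free_alg S\<^esub> x) \<otimes>\<^bsub>free_alg S Quot J\<^esub> (J +>\<^bsub>free_alg S\<^esub> y) = J +>\<^bsub>free_alg S\<^esub> (x * y)"
    using rcoset_mult_add[of x y] by (simp add: FactRing_def)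
qed (auto simp: FactRing_def A_RCOSETS_def')

lemma wrd_cst_commute: "wrd w * (cst r * q) = (cst r * (wrd w * q) :: 'x list \<Rightarrow>\<^sub>0 'r::comm_ring_1)"
  by (rule cst_left_commute)

lemma cst_cst: "cst r * (cst s * p) = (cst (r * s) * p :: 'x list \<Rightarrow>\<^sub>0 'r::comm_ring_1)"
  by (simp add: cst_mult mult.assoc)

text \<open>The commutativity rules act on scalar coefficients alone, because the free algebra is
  not commutative.\<close>

lemmas cst_collect = mult.assoc wrd_cst_commute cst_cst cst_mult[symmetric] mult.commute mult.left_commute

section \<open>Koszul signs, derivations and the grading\<close>

lemma ksgn_add: "ksgn (a + b) = (ksgn a * ksgn b :: 'r::ring_1)"
  by (auto simp: ksgn_def)

lemma ksgn_0 [simp]: "ksgn 0 = 1"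
  by (simp add: ksgn_def)

lemma ksgn_square [simp]: "ksgn a * ksgn a = (1 :: 'r::ring_1)" "ksgn a * (ksgn a * r) = (r :: 'r)"
  by (auto simp: ksgn_def)

lemma ce_word_deg_simps [simp]:
  "ce_word_deg [] = 0" "ce_word_deg (x # w) = ce_deg x + ce_word_deg w"
  "ce_word_deg (u @ v) = ce_word_deg u + ce_word_deg v"
  by (simp_all add: ce_word_deg_def)

lemma ce_der_semilinear: "semilinear id (ce_der e D)"
  unfolding ce_der_def by (rule linext_semilinear[OF field_hom_id])

lemmas ce_der_simps = semilinearD[OF ce_der_semilinear, unfolded id_apply]

lemma ce_der_1 [simp]: "ce_der e D 1 = 0"
  unfolding ce_der_def wrd_Nil[symmetric] linext_wrd[OF field_hom_id] by simp

lemma ce_der_cst [simp]: "ce_der e D (cst r) = 0"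
  using ce_der_simps(2)[of e D r 1] by simp

lemma ce_der_Cons:
  "ce_der e D (wrd (x # w)) = D x * wrd w + cst (ksgn (e * ce_deg x)) * (gen x * ce_der e D (wrd w))"
proof -
  have *: "ce_der e D (wrd w) = (\<Sum>j<length w.
      cst (ksgn (e * ce_word_deg (take j w))) * wrd (take j w) * D (w ! j) * wrd (drop (Suc j) w))" for w
    unfolding ce_der_def by (rule linext_wrd[OF field_hom_id])
  have "ce_der e D (wrd (x # w)) = D x * wrd w + (\<Sum>j<length w.
      cst (ksgn (e * (ce_deg x + ce_word_deg (take j w)))) * wrd (x # take j w) * D (w ! j) * wrd (drop (Suc j) w))"
    unfolding * length_Cons sum.lessThan_Suc_shift by simp
  also have "(\<Sum>j<length w. cst (ksgn (e * (ce_deg x + ce_word_deg (take j w)))) * wrd (x # take j w) * D (w ! j) * wrd (drop (Suc j) w))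
      = cst (ksgn (e * ce_deg x)) * (gen x * ce_der e D (wrd w))"
    unfolding * sum_distrib_left
    by (intro sum.cong refl)
       (simp add: distrib_left ksgn_add wrd_Cons[of x "take _ w"] cst_collect)
  finally show ?thesis .
qed

lemma ce_der_gen [simp]: "ce_der e D (gen x) = D x"
  using ce_der_Cons[of e D x "[]"] by simp

text \<open>The sign automorphism of the graded algebra. It allows the graded Leibniz rule to be
  stated for arbitrary factors instead of homogeneous ones.\<close>

definition gsgn :: "int \<Rightarrow> (('g, 'r, 'c) ce_letter list \<Rightarrow>\<^sub>0 'r::field) \<Rightarrow> ('g, 'r, 'c) ce_letter list \<Rightarrow>\<^sub>0 'r"
  where "gsgn e = linext id (\<lambda>w. cst (ksgn (e * ce_word_deg w)) * wrd w)"

lemma gsgn_semilinear: "semilinear id (gsgn e)"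
  unfolding gsgn_def by (rule linext_semilinear[OF field_hom_id])

lemmas gsgn_simps = semilinearD[OF gsgn_semilinear, unfolded id_apply]

lemma gsgn_wrd: "gsgn e (wrd w) = cst (ksgn (e * ce_word_deg w)) * wrd w"
  unfolding gsgn_def by (rule linext_wrd[OF field_hom_id])

lemma falg_UNIV: "p \<in> falg UNIV"
  by (simp add: falg_iff)

lemma ce_der_mult: "ce_der e D (p * q) = ce_der e D p * q + gsgn e p * ce_der e D q"
proof -
  have ww: "ce_der e D (wrd u * wrd v) = ce_der e D (wrd u) * wrd v + gsgn e (wrd u) * ce_der e D (wrd v)" for u v
  proof (induction u)
    case (Cons x u)
    have "ce_der e D (wrd (x # u) * wrd v) = ce_der e D (wrd (x # (u @ v)))"
      by (simp flip: wrd_append)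
    also have "\<dots> = D x * (wrd u * wrd v) + cst (ksgn (e * ce_deg x)) * (gen x * ce_der e D (wrd u * wrd v))"
      by (simp add: ce_der_Cons wrd_append)
    also have "\<dots> = (D x * wrd u + cst (ksgn (e * ce_deg x)) * (gen x * ce_der e D (wrd u))) * wrd v +
        cst (ksgn (e * ce_word_deg (x # u))) * (gen x * wrd u) * ce_der e D (wrd v)"
      by (simp add: Cons.IH gsgn_wrd distrib_left distrib_right ksgn_add cst_collect)
    also have "\<dots> = ce_der e D (wrd (x # u)) * wrd v + gsgn e (wrd (x # u)) * ce_der e D (wrd v)"
      unfolding ce_der_Cons gsgn_wrd by (simp only: wrd_Cons[of x u])
    finally show ?case .
  qed (simp add: gsgn_wrd[of _ "[]", simplified])
  have wq: "ce_der e D (wrd u * q) = ce_der e D (wrd u) * q + gsgn e (wrd u) * ce_der e D q" for u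
    using falg_UNIV[of q]
    by (induction rule: falg_induct) (simp_all add: ce_der_simps wrd_cst_commute cst_left_commute[of "ce_der e D (wrd u)"]
        cst_left_commute[of "gsgn e (wrd u)"] ww distrib_left)
  show ?thesis
    using falg_UNIV[of p]
    by (induction rule: falg_induct) (simp_all add: ce_der_simps gsgn_simps mult.assoc wq distrib_left distrib_right)
qed

lemma gsgn_mult: "gsgn e (p * q) = gsgn e p * gsgn e q"
proof -
  have wq: "gsgn e (wrd u * q) = gsgn e (wrd u) * gsgn e q" for u
    using falg_UNIV[of q]
    by (induction rule: falg_induct)
       (simp_all add: gsgn_simps gsgn_wrd distrib_left ksgn_add cst_collect flip: wrd_append)
  show ?thesis
    using falg_UNIV[of p]
    by (induction rule: falg_induct) (simp_all add: gsgn_simps mult.assoc wq distrib_right)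
qed

lemma gsgn_cst [simp]: "gsgn e (cst r) = (cst r :: ('g, 'r::field, 'c) ce_letter list \<Rightarrow>\<^sub>0 'r)"
proof -
  have "gsgn e 1 = (1 :: ('g, 'r, 'c) ce_letter list \<Rightarrow>\<^sub>0 'r)"
    using gsgn_wrd[of e "[]"] by simp
  then have "gsgn e (cst r * (1 :: ('g, 'r, 'c) ce_letter list \<Rightarrow>\<^sub>0 'r)) = cst r * 1"
    by (simp only: gsgn_simps(2))
  then show ?thesis
    by simp
qed

lemma gsgn_0 [simp]: "gsgn 0 p = p"
  using falg_UNIV[of p] by (induction rule: falg_induct) (simp_all add: gsgn_simps gsgn_wrd)

text \<open>Projection to the component of degree \<open>n\<close>. A set of representatives stable
  under all projections yields the decompositions into homogeneous elements that
  \<open>dg_subalgebra\<close> asks for.\<close>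

definition gproj :: "int \<Rightarrow> (('g, 'r, 'c) ce_letter list \<Rightarrow>\<^sub>0 'r::field) \<Rightarrow> ('g, 'r, 'c) ce_letter list \<Rightarrow>\<^sub>0 'r"
  where "gproj n = linext id (\<lambda>w. if ce_word_deg w = n then wrd w else 0)"

lemma gproj_semilinear: "semilinear id (gproj n)"
  unfolding gproj_def by (rule linext_semilinear[OF field_hom_id])

lemmas gproj_simps = semilinearD[OF gproj_semilinear, unfolded id_apply]

lemma gproj_wrd: "gproj n (wrd w) = (if ce_word_deg w = n then wrd w else 0)"
  unfolding gproj_def by (rule linext_wrd[OF field_hom_id])

lemma gproj_wrd_mult:
  "gproj n (wrd w * p) = wrd w * gproj (n - ce_word_deg w) p"
  "gproj n (p * wrd w) = gproj (n - ce_word_deg w) p * wrd w"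
proof -
  have 1: "gproj n (wrd w * wrd v) = wrd w * gproj (n - ce_word_deg w) (wrd v)" for v
    by (auto simp: gproj_wrd simp flip: wrd_append)
  show "gproj n (wrd w * p) = wrd w * gproj (n - ce_word_deg w) p"
    using falg_UNIV[of p]
    by (induction rule: falg_induct) (simp_all add: gproj_simps wrd_cst_commute distrib_left 1)
  have 2: "gproj n (wrd v * wrd w) = gproj (n - ce_word_deg w) (wrd v) * wrd w" for v
    by (auto simp: gproj_wrd simp flip: wrd_append)
  show "gproj n (p * wrd w) = gproj (n - ce_word_deg w) p * wrd w"
    using falg_UNIV[of p]
    by (induction rule: falg_induct) (simp_all add: gproj_simps distrib_right mult.assoc 2)
qed

lemma gproj_falg: "p \<in> falg S \<Longrightarrow> gproj n p \<in> falg S"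
  by (rule semilinear_mapsto[OF gproj_semilinear]) (auto simp: gproj_wrd intro: falg_closed)

definition homog :: "('g, 'r, 'c) ce_letter set \<Rightarrow> int \<Rightarrow> (('g, 'r::field, 'c) ce_letter list \<Rightarrow>\<^sub>0 'r) \<Rightarrow> bool"
  where "homog S n p \<longleftrightarrow> p \<in> falg S \<and> (\<forall>w\<in>Poly_Mapping.keys p. ce_word_deg w = n)"

lemma homog_closed:
  shows "homog S n 0" "homog S n p \<Longrightarrow> homog S n q \<Longrightarrow> homog S n (p + q)"
    "homog S n p \<Longrightarrow> homog S n (cst r * p)" "homog S n p \<Longrightarrow> homog S n (- p)"
    "w \<in> lists S \<Longrightarrow> ce_word_deg w = n \<Longrightarrow> homog S n (wrd w)"
    "(\<And>i. i \<in> A \<Longrightarrow> homog S n (f i)) \<Longrightarrow> homog S n (sum f A)"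
proof -
  show z: "homog S n 0"
    by (simp add: homog_def falg_closed)
  show a: "homog S n p \<Longrightarrow> homog S n q \<Longrightarrow> homog S n (p + q)" for p q
    using keys_add[of p q] by (auto simp: homog_def falg_closed)
  show "homog S n (cst r * p)" if "homog S n p"
  proof -
    have "Poly_Mapping.keys (cst r * p) \<subseteq> Poly_Mapping.keys p"
      using keys_mult[of "cst r" p] by (auto simp: cst_def plus_list_def split: if_splits)
    then show ?thesis
      using that by (auto simp: homog_def falg_closed)
  qed
  show "homog S n p \<Longrightarrow> homog S n (- p)"
    by (simp add: homog_def falg_closed)
  show "w \<in> lists S \<Longrightarrow> ce_word_deg w = n \<Longrightarrow> homog S n (wrd w)"
    by (auto simp: homog_def wrd_def falg_iff)
  show "(\<And>i. i \<in> A \<Longrightarrow> homog S n (f i)) \<Longrightarrow> homog S n (sum f A)"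
    by (induction A rule: infinite_finite_induct) (auto intro: z a)
qed

lemma homog_induct [consumes 1, case_names zero word add]:
  assumes p: "homog S n p" and zero: "P 0"
    and word: "\<And>r w. w \<in> lists S \<Longrightarrow> ce_word_deg w = n \<Longrightarrow> P (cst r * wrd w)"
    and add: "\<And>a b. P a \<Longrightarrow> P b \<Longrightarrow> P (a + b)"
  shows "P p"
proof -
  have sum: "P (\<Sum>w\<in>W. cst (f w) * wrd w)" if "W \<subseteq> {w \<in> lists S. ce_word_deg w = n}" for W and f
    using that by (induction W rule: infinite_finite_induct) (auto intro: zero word add)
  have "P (\<Sum>w\<in>Poly_Mapping.keys p. cst (Poly_Mapping.lookup p w) * wrd w)"
    by (rule sum) (use p in \<open>auto simp: homog_def falg_iff\<close>)
  then show ?thesis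
    by (simp flip: list_algebra_expand)
qed

lemma homog_gproj:
  assumes "p \<in> falg S"
  shows "homog S n (gproj n p)"
  using assms
proof (induction rule: falg_induct)
  case (word r w)
  then show ?case
    by (auto simp: gproj_simps gproj_wrd intro: homog_closed)
qed (auto simp: gproj_simps intro: homog_closed)

lemma gproj_sum:
  assumes "finite N" "\<And>w. w \<in> Poly_Mapping.keys p \<Longrightarrow> ce_word_deg w \<in> N"
  shows "(\<Sum>n\<in>N. gproj n p) = p"
proof -
  have "(\<Sum>n\<in>N. gproj n (\<Sum>w\<in>Poly_Mapping.keys p. cst (Poly_Mapping.lookup p w) * wrd w)) =
      (\<Sum>w\<in>Poly_Mapping.keys p. \<Sum>n\<in>N. cst (Poly_Mapping.lookup p w) * gproj n (wrd w))"
    unfolding gproj_simps by (rule sum.swap)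
  also have "\<dots> = (\<Sum>w\<in>Poly_Mapping.keys p. cst (Poly_Mapping.lookup p w) * wrd w)"
    using assms by (intro sum.cong refl) (simp add: gproj_wrd if_distrib cong: if_cong)
  finally show ?thesis
    by (simp flip: list_algebra_expand)
qed

section \<open>The relations of the Chevalley--Eilenberg algebra\<close>

text \<open>The generating set from \<open>ce_rel\<close>, named so that introduction and case rules
  can refer to it.\<close>

definition ce_gens ::
    "('k \<Rightarrow> 'r::field) \<Rightarrow> ('k::field, 'g::ab_group_add) lie_alg \<Rightarrow> 'g set \<Rightarrow> ('k, 'c::ab_group_add) coalg
      \<Rightarrow> (('g, 'r, 'c) ce_letter list \<Rightarrow>\<^sub>0 'r) set"
  where "ce_gens \<iota> L l C =
     ({gen (\<lambda>x. \<phi> x + \<psi> x, i, c) - gen (\<phi>, i, c) - gen (\<psi>, i, c) | \<phi> \<psi> i c.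
          \<phi> \<in> lie_dual \<iota> L l \<and> \<psi> \<in> lie_dual \<iota> L l \<and> c \<in> red_piece C i} \<union>
      {gen (\<lambda>x. r * \<phi> x, i, c) - cst r * gen (\<phi>, i, c) | r \<phi> i c.
          \<phi> \<in> lie_dual \<iota> L l \<and> c \<in> red_piece C i} \<union>
      {gen (\<phi>, i, a + b) - gen (\<phi>, i, a) - gen (\<phi>, i, b) | \<phi> i a b.
          \<phi> \<in> lie_dual \<iota> L l \<and> a \<in> red_piece C i \<and> b \<in> red_piece C i} \<union>
      {gen (\<phi>, i, co_scale C s c) - cst (\<iota> s) * gen (\<phi>, i, c) | s \<phi> i c.
          \<phi> \<in> lie_dual \<iota> L l \<and> c \<in> red_piece C i} \<union>
      {gen x * gen y - cst (ksgn (ce_deg x * ce_deg y)) * gen y * gen x | x y.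
          x \<in> ce_letters \<iota> L l C \<and> y \<in> ce_letters \<iota> L l C})"

lemma ce_gensI:
  "\<phi> \<in> lie_dual \<iota> L l \<Longrightarrow> \<psi> \<in> lie_dual \<iota> L l \<Longrightarrow> c \<in> red_piece C i \<Longrightarrow>
    gen (\<lambda>x. \<phi> x + \<psi> x, i, c) - gen (\<phi>, i, c) - gen (\<psi>, i, c) \<in> ce_gens \<iota> L l C"
  "\<phi> \<in> lie_dual \<iota> L l \<Longrightarrow> c \<in> red_piece C i \<Longrightarrow>
    gen (\<lambda>x. r * \<phi> x, i, c) - cst r * gen (\<phi>, i, c) \<in> ce_gens \<iota> L l C"
  "\<phi> \<in> lie_dual \<iota> L l \<Longrightarrow> a \<in> red_piece C i \<Longrightarrow> b \<in> red_piece C i \<Longrightarrow>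
    gen (\<phi>, i, a + b) - gen (\<phi>, i, a) - gen (\<phi>, i, b) \<in> ce_gens \<iota> L l C"
  "\<phi> \<in> lie_dual \<iota> L l \<Longrightarrow> c \<in> red_piece C i \<Longrightarrow>
    gen (\<phi>, i, co_scale C s c) - cst (\<iota> s) * gen (\<phi>, i, c) \<in> ce_gens \<iota> L l C"
  "x \<in> ce_letters \<iota> L l C \<Longrightarrow> y \<in> ce_letters \<iota> L l C \<Longrightarrow>
    gen x * gen y - cst (ksgn (ce_deg x * ce_deg y)) * gen y * gen x \<in> ce_gens \<iota> L l C"
  unfolding ce_gens_def by blast+

lemma ce_gens_cases [consumes 1]:
  assumes "g \<in> ce_gens \<iota> L l C"
    and "\<And>\<phi> \<psi> i c. \<phi> \<in> lie_dual \<iota> L l \<Longrightarrow> \<psi> \<in> lie_dual \<iota> L l \<Longrightarrow> c \<in> red_piece C i \<Longrightarrow>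
      P (gen (\<lambda>x. \<phi> x + \<psi> x, i, c) - gen (\<phi>, i, c) - gen (\<psi>, i, c))"
    and "\<And>r \<phi> i c. \<phi> \<in> lie_dual \<iota> L l \<Longrightarrow> c \<in> red_piece C i \<Longrightarrow>
      P (gen (\<lambda>x. r * \<phi> x, i, c) - cst r * gen (\<phi>, i, c))"
    and "\<And>\<phi> i a b. \<phi> \<in> lie_dual \<iota> L l \<Longrightarrow> a \<in> red_piece C i \<Longrightarrow> b \<in> red_piece C i \<Longrightarrow>
      P (gen (\<phi>, i, a + b) - gen (\<phi>, i, a) - gen (\<phi>, i, b))"
    and "\<And>s \<phi> i c. \<phi> \<in> lie_dual \<iota> L l \<Longrightarrow> c \<in> red_piece C i \<Longrightarrow>
      P (gen (\<phi>, i, co_scale C s c) - cst (\<iota> s) * gen (\<phi>, i, c))"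
    and "\<And>x y. x \<in> ce_letters \<iota> L l C \<Longrightarrow> y \<in> ce_letters \<iota> L l C \<Longrightarrow>
      P (gen x * gen y - cst (ksgn (ce_deg x * ce_deg y)) * gen y * gen x)"
  shows "P g"
  using assms(1) unfolding ce_gens_def
  by (elim UnE CollectE exE conjE) (simp_all only: assms(2-6))

lemma ce_rel_eq: "ce_rel \<iota> L l C = Idl\<^bsub>free_alg (ce_letters \<iota> L l C)\<^esub> (ce_gens \<iota> L l C)"
  by (simp add: ce_rel_def ce_gens_def)

text \<open>A single context for the algebras over the ground field, with
  \<open>\<iota> = id\<close>, and over its closure, with \<open>\<iota> = to_ac\<close>.\<close>

locale ce_setup =
  fixes \<iota> :: "'k::field \<Rightarrow> 'r::field"
    and L :: "('k, 'g::ab_group_add) lie_alg"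
    and l :: "'g set"
    and C :: "('k, 'c::ab_group_add) coalg"
  assumes \<iota>: "field_hom \<iota>"
    and L: "fd_lie_algebra L"
    and l: "lie_subalgebra L l"
    and C: "coaug_conilp_cocomm_dg_coalgebra C"
begin

sublocale lie: fd_lie_algebra L
  by (rule L)

sublocale lvs: vector_space "lie_scale L"
  by (rule lie.vs)

sublocale cvs: vector_space "co_scale C"
  by (rule coaug_conilp_cocomm_dg_coalgebra.vs[OF C])

lemmas co = coaug_conilp_cocomm_dg_coalgebra.piece[OF C]
  coaug_conilp_cocomm_dg_coalgebra.unit_add[OF C]
  coaug_conilp_cocomm_dg_coalgebra.unit_scale[OF C]

lemma l_sub: "lvs.subspace l"
  using l by (simp add: lie_subalgebra_def)

lemma l_closed:
  "0 \<in> l" "x \<in> l \<Longrightarrow> y \<in> l \<Longrightarrow> x + y \<in> l" "x \<in> l \<Longrightarrow> lie_scale L r x \<in> l" "x \<in> l \<Longrightarrow> - x \<in> l"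
  "x \<in> l \<Longrightarrow> y \<in> l \<Longrightarrow> lie_br L x y \<in> l" "(\<And>i. i \<in> A \<Longrightarrow> f i \<in> l) \<Longrightarrow> sum f A \<in> l"
  using l l_sub lvs.subspace_0 lvs.subspace_add lvs.subspace_scale lvs.subspace_neg
  by (auto simp: lie_subalgebra_def intro: lvs.subspace_sum[OF l_sub])

abbreviation S where "S \<equiv> ce_letters \<iota> L l C"
abbreviation I where "I \<equiv> ce_rel \<iota> L l C"
abbreviation V where "V \<equiv> lie_dual \<iota> L l"

lemma S_iff: "(\<phi>, i, c) \<in> S \<longleftrightarrow> \<phi> \<in> V \<and> c \<in> red_piece C i"
  by (simp add: ce_letters_def)

lemma piece_closed:
  "0 \<in> co_piece C i" "a \<in> co_piece C i \<Longrightarrow> b \<in> co_piece C i \<Longrightarrow> a + b \<in> co_piece C i"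
  "a \<in> co_piece C i \<Longrightarrow> co_scale C r a \<in> co_piece C i"
  "a \<in> co_piece C i \<Longrightarrow> b \<in> co_piece C i \<Longrightarrow> a - b \<in> co_piece C i"
  using co(1) cvs.subspace_0 cvs.subspace_add cvs.subspace_scale cvs.subspace_diff by auto

lemma red_closed:
  "0 \<in> red_piece C i" "a \<in> red_piece C i \<Longrightarrow> b \<in> red_piece C i \<Longrightarrow> a + b \<in> red_piece C i"
  "a \<in> red_piece C i \<Longrightarrow> co_scale C r a \<in> red_piece C i"
proof -
  have "co_unit C 0 = 0"
    using co(3)[of 0 0] piece_closed(1)[of 0] by simp
  then show "0 \<in> red_piece C i"
    by (simp add: red_piece_def lt_unit_def piece_closed)
  show "a \<in> red_piece C i \<Longrightarrow> b \<in> red_piece C i \<Longrightarrow> a + b \<in> red_piece C i"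
    by (auto simp: red_piece_def lt_unit_def piece_closed co(2) split: if_splits)
  show "a \<in> red_piece C i \<Longrightarrow> co_scale C r a \<in> red_piece C i"
    by (auto simp: red_piece_def lt_unit_def piece_closed co(3) split: if_splits)
qed

lemma VD:
  assumes "\<phi> \<in> V"
  shows "x \<in> l \<Longrightarrow> y \<in> l \<Longrightarrow> \<phi> (x + y) = \<phi> x + \<phi> y" "x \<in> l \<Longrightarrow> \<phi> (lie_scale L r x) = \<iota> r * \<phi> x"
    "x \<notin> l \<Longrightarrow> \<phi> x = 0" "\<phi> 0 = 0" "x \<in> l \<Longrightarrow> \<phi> (- x) = - \<phi> x"
    "(\<And>i. i \<in> A \<Longrightarrow> f i \<in> l) \<Longrightarrow> \<phi> (sum f A) = (\<Sum>i\<in>A. \<phi> (f i))"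
proof -
  show a: "x \<in> l \<Longrightarrow> y \<in> l \<Longrightarrow> \<phi> (x + y) = \<phi> x + \<phi> y" for x y
    using assms by (auto simp: lie_dual_def)
  show "x \<in> l \<Longrightarrow> \<phi> (lie_scale L r x) = \<iota> r * \<phi> x" "x \<notin> l \<Longrightarrow> \<phi> x = 0"
    using assms by (auto simp: lie_dual_def)
  show z: "\<phi> 0 = 0"
    using a[of 0 0] l_closed(1) by (metis add.right_neutral add_left_cancel)
  show "\<phi> (- x) = - \<phi> x" if "x \<in> l"
    using a[of x "- x"] l_closed(4) that z by (simp add: add_eq_0_iff2)
  show "(\<And>i. i \<in> A \<Longrightarrow> f i \<in> l) \<Longrightarrow> \<phi> (sum f A) = (\<Sum>i\<in>A. \<phi> (f i))"
    by (induction A rule: infinite_finite_induct) (auto simp: z a l_closed)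
qed

lemma V_closed:
  "(\<lambda>x. 0) \<in> V" "\<phi> \<in> V \<Longrightarrow> \<psi> \<in> V \<Longrightarrow> (\<lambda>x. \<phi> x + \<psi> x) \<in> V" "\<phi> \<in> V \<Longrightarrow> (\<lambda>x. r * \<phi> x) \<in> V"
  "(\<And>i. i \<in> A \<Longrightarrow> f i \<in> V) \<Longrightarrow> (\<lambda>x. \<Sum>i\<in>A. f i x) \<in> V"
proof -
  show z: "(\<lambda>x. 0) \<in> V" and a: "\<phi> \<in> V \<Longrightarrow> \<psi> \<in> V \<Longrightarrow> (\<lambda>x. \<phi> x + \<psi> x) \<in> V" for \<phi> \<psi>
    by (auto simp: lie_dual_def algebra_simps)
  show "\<phi> \<in> V \<Longrightarrow> (\<lambda>x. r * \<phi> x) \<in> V"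
    by (auto simp: lie_dual_def algebra_simps)
  show "(\<And>i. i \<in> A \<Longrightarrow> f i \<in> V) \<Longrightarrow> (\<lambda>x. \<Sum>i\<in>A. f i x) \<in> V"
    by (induction A rule: infinite_finite_induct) (auto intro: z a)
qed

lemma gens_falg: "ce_gens \<iota> L l C \<subseteq> falg S"
proof
  fix g assume "g \<in> ce_gens \<iota> L l C"
  then show "g \<in> falg S"
    by (rule ce_gens_cases) (auto simp: S_iff red_closed V_closed intro!: falg_closed)
qed

lemma ideal_I: "ideal I (free_alg S)"
  unfolding ce_rel_eq by (rule ideal_Idl[OF gens_falg])

lemmas ID = ideal_freeD[OF ideal_I]

lemma gens_I: "g \<in> ce_gens \<iota> L l C \<Longrightarrow> g \<in> I"
  unfolding ce_rel_eq by (rule Idl_base[OF gens_falg])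

lemma I_induct [consumes 1, case_names add_fun scale_fun add_vec scale_vec comm zero add left right]:
  assumes x: "x \<in> I"
    and "\<And>\<phi> \<psi> i c. \<phi> \<in> V \<Longrightarrow> \<psi> \<in> V \<Longrightarrow> c \<in> red_piece C i \<Longrightarrow> P (gen (\<lambda>x. \<phi> x + \<psi> x, i, c) - gen (\<phi>, i, c) - gen (\<psi>, i, c))"
    and "\<And>r \<phi> i c. \<phi> \<in> V \<Longrightarrow> c \<in> red_piece C i \<Longrightarrow> P (gen (\<lambda>x. r * \<phi> x, i, c) - cst r * gen (\<phi>, i, c))"
    and "\<And>\<phi> i a b. \<phi> \<in> V \<Longrightarrow> a \<in> red_piece C i \<Longrightarrow> b \<in> red_piece C i \<Longrightarrow> P (gen (\<phi>, i, a + b) - gen (\<phi>, i, a) - gen (\<phi>, i, b))"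
    and "\<And>s \<phi> i c. \<phi> \<in> V \<Longrightarrow> c \<in> red_piece C i \<Longrightarrow> P (gen (\<phi>, i, co_scale C s c) - cst (\<iota> s) * gen (\<phi>, i, c))"
    and "\<And>x y. x \<in> S \<Longrightarrow> y \<in> S \<Longrightarrow> P (gen x * gen y - cst (ksgn (ce_deg x * ce_deg y)) * gen y * gen x)"
    and "P 0" and "\<And>x y. x \<in> I \<Longrightarrow> y \<in> I \<Longrightarrow> P x \<Longrightarrow> P y \<Longrightarrow> P (x + y)"
    and "\<And>a x. a \<in> falg S \<Longrightarrow> x \<in> I \<Longrightarrow> P x \<Longrightarrow> P (a * x)"
    and "\<And>a x. a \<in> falg S \<Longrightarrow> x \<in> I \<Longrightarrow> P x \<Longrightarrow> P (x * a)"
  shows "P x"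
  by (rule Idl_induct[OF gens_falg, of x P])
    (use assms in \<open>simp_all only: ce_rel_eq[symmetric]\<close>, erule ce_gens_cases, use assms in blast)

definition eqv :: "(('g, 'r, 'c) ce_letter list \<Rightarrow>\<^sub>0 'r) \<Rightarrow> (('g, 'r, 'c) ce_letter list \<Rightarrow>\<^sub>0 'r) \<Rightarrow> bool"
    (infix \<open>\<simeq>\<^sub>c\<close> 50)
  where "p \<simeq>\<^sub>c q \<longleftrightarrow> p - q \<in> I"

lemma eqv_refl [simp]: "p \<simeq>\<^sub>c p"
  by (simp add: eqv_def ID)

lemma eqv_sym: "p \<simeq>\<^sub>c q \<Longrightarrow> q \<simeq>\<^sub>c p"
  using ID(4)[of "p - q"] by (simp add: eqv_def)

lemma eqv_trans [trans]: "p \<simeq>\<^sub>c q \<Longrightarrow> q \<simeq>\<^sub>c r \<Longrightarrow> p \<simeq>\<^sub>c r"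
  using ID(2)[of "p - q" "q - r"] by (simp add: eqv_def)

lemma eqv_eq_trans [trans]: "p \<simeq>\<^sub>c q \<Longrightarrow> q = r \<Longrightarrow> p \<simeq>\<^sub>c r"
  and eq_eqv_trans [trans]: "p = q \<Longrightarrow> q \<simeq>\<^sub>c r \<Longrightarrow> p \<simeq>\<^sub>c r"
  by simp_all

lemma eqv_add: "p \<simeq>\<^sub>c p' \<Longrightarrow> q \<simeq>\<^sub>c q' \<Longrightarrow> p + q \<simeq>\<^sub>c p' + q'"
  using ID(2)[of "p - p'" "q - q'"] by (simp add: eqv_def algebra_simps)

lemma eqv_uminus: "p \<simeq>\<^sub>c p' \<Longrightarrow> - p \<simeq>\<^sub>c - p'"
  using ID(4)[of "p - p'"] by (simp add: eqv_def)

lemma eqv_cst: "p \<simeq>\<^sub>c p' \<Longrightarrow> cst r * p \<simeq>\<^sub>c cst r * p'"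
  using ID(7)[of "p - p'" r] by (simp add: eqv_def algebra_simps)

lemma eqv_left: "p \<simeq>\<^sub>c p' \<Longrightarrow> a \<in> falg S \<Longrightarrow> a * p \<simeq>\<^sub>c a * p'"
  using ID(5)[of a "p - p'"] by (simp add: eqv_def algebra_simps)

lemma eqv_right: "p \<simeq>\<^sub>c p' \<Longrightarrow> a \<in> falg S \<Longrightarrow> p * a \<simeq>\<^sub>c p' * a"
  using ID(6)[of a "p - p'"] by (simp add: eqv_def algebra_simps)

lemma eqv_mult: "p \<simeq>\<^sub>c p' \<Longrightarrow> q \<simeq>\<^sub>c q' \<Longrightarrow> p' \<in> falg S \<Longrightarrow> q \<in> falg S \<Longrightarrow> p * q \<simeq>\<^sub>c p' * q'"
  using eqv_trans eqv_left eqv_right by blast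

lemma eqv_sum: "(\<And>i. i \<in> A \<Longrightarrow> f i \<simeq>\<^sub>c g i) \<Longrightarrow> sum f A \<simeq>\<^sub>c sum g A"
  by (induction A rule: infinite_finite_induct) (auto intro: eqv_add)

lemma eqv_zero_iff: "p \<simeq>\<^sub>c 0 \<longleftrightarrow> p \<in> I"
  by (simp add: eqv_def)

lemma gen_falg: "x \<in> S \<Longrightarrow> gen x \<in> falg S"
  by (auto intro: falg_closed)

lemma gen_add_fun: "\<phi> \<in> V \<Longrightarrow> \<psi> \<in> V \<Longrightarrow> c \<in> red_piece C i \<Longrightarrow> gen (\<lambda>x. \<phi> x + \<psi> x, i, c) \<simeq>\<^sub>c gen (\<phi>, i, c) + gen (\<psi>, i, c)"
  using gens_I[OF ce_gensI(1)] by (simp add: eqv_def diff_diff_eq mult.assoc)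

lemma gen_scale_fun: "\<phi> \<in> V \<Longrightarrow> c \<in> red_piece C i \<Longrightarrow> gen (\<lambda>x. r * \<phi> x, i, c) \<simeq>\<^sub>c cst r * gen (\<phi>, i, c)"
  using gens_I[OF ce_gensI(2)] by (simp add: eqv_def diff_diff_eq mult.assoc)

lemma gen_add_vec: "\<phi> \<in> V \<Longrightarrow> a \<in> red_piece C i \<Longrightarrow> b \<in> red_piece C i \<Longrightarrow> gen (\<phi>, i, a + b) \<simeq>\<^sub>c gen (\<phi>, i, a) + gen (\<phi>, i, b)"
  using gens_I[OF ce_gensI(3)] by (simp add: eqv_def diff_diff_eq mult.assoc)

lemma gen_scale_vec: "\<phi> \<in> V \<Longrightarrow> c \<in> red_piece C i \<Longrightarrow> gen (\<phi>, i, co_scale C s c) \<simeq>\<^sub>c cst (\<iota> s) * gen (\<phi>, i, c)"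
  using gens_I[OF ce_gensI(4)] by (simp add: eqv_def diff_diff_eq mult.assoc)

lemma gen_comm: "x \<in> S \<Longrightarrow> y \<in> S \<Longrightarrow> gen x * gen y \<simeq>\<^sub>c cst (ksgn (ce_deg x * ce_deg y)) * (gen y * gen x)"
  using gens_I[OF ce_gensI(5)] by (simp add: eqv_def diff_diff_eq mult.assoc)

lemma wrd_comm:
  assumes y: "y \<in> S"
  shows "w \<in> lists S \<Longrightarrow> wrd w * gen y \<simeq>\<^sub>c cst (ksgn (ce_word_deg w * ce_deg y)) * (gen y * wrd w)"
proof (induction w)
  case (Cons x w)
  then have xw: "x \<in> S" "wrd w \<in> falg S"
    by (auto intro: falg_closed)
  have "gen x * (wrd w * gen y) \<simeq>\<^sub>c gen x * (cst (ksgn (ce_word_deg w * ce_deg y)) * (gen y * wrd w))"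
    using Cons by (intro eqv_left gen_falg) auto
  also have "\<dots> = cst (ksgn (ce_word_deg w * ce_deg y)) * ((gen x * gen y) * wrd w)"
    by (simp add: wrd_cst_commute mult.assoc)
  also have "\<dots> \<simeq>\<^sub>c cst (ksgn (ce_word_deg w * ce_deg y)) * (cst (ksgn (ce_deg x * ce_deg y)) * (gen y * gen x) * wrd w)"
    using xw y by (intro eqv_cst eqv_right gen_comm)
  finally show ?case
    by (simp add: wrd_Cons[of x w] distrib_left distrib_right ksgn_add cst_collect)
qed simp

lemma homog_comm:
  assumes "y \<in> S" "homog S n p"
  shows "p * gen y \<simeq>\<^sub>c cst (ksgn (n * ce_deg y)) * (gen y * p)"
  using assms(2)
proof (induction rule: homog_induct)
  case (word r w)
  then show ?case
    using eqv_cst[OF wrd_comm[OF assms(1) word(1)], of r] by (simp add: cst_collect)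
next
  case (add a b)
  then show ?case
    using eqv_add[OF add] by (simp add: distrib_left distrib_right)
qed simp

lemma gsgn_I: "p \<in> I \<Longrightarrow> gsgn e p \<in> I"
proof (induction rule: I_induct)
  case (add_fun \<phi> \<psi> i c)
  have "gsgn e (gen (\<lambda>x. \<phi> x + \<psi> x, i, c) - gen (\<phi>, i, c) - gen (\<psi>, i, c)) =
      cst (ksgn (e * (i - 1))) * (gen (\<lambda>x. \<phi> x + \<psi> x, i, c) - gen (\<phi>, i, c) - gen (\<psi>, i, c))"
    by (simp add: gsgn_simps gsgn_wrd ce_deg_def algebra_simps)
  then show ?case
    using ID(7) gen_add_fun[OF add_fun] by (simp add: eqv_def diff_diff_eq)
next
  case (scale_fun r \<phi> i c)
  have "gsgn e (gen (\<lambda>x. r * \<phi> x, i, c) - cst r * gen (\<phi>, i, c)) =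
      cst (ksgn (e * (i - 1))) * (gen (\<lambda>x. r * \<phi> x, i, c) - cst r * gen (\<phi>, i, c))"
    by (simp add: gsgn_simps gsgn_wrd ce_deg_def right_diff_distrib cst_collect)
  then show ?case
    using ID(7) gen_scale_fun[OF scale_fun] by (simp add: eqv_def)
next
  case (add_vec \<phi> i a b)
  have "gsgn e (gen (\<phi>, i, a + b) - gen (\<phi>, i, a) - gen (\<phi>, i, b)) =
      cst (ksgn (e * (i - 1))) * (gen (\<phi>, i, a + b) - gen (\<phi>, i, a) - gen (\<phi>, i, b))"
    by (simp add: gsgn_simps gsgn_wrd ce_deg_def algebra_simps)
  then show ?case
    using ID(7) gen_add_vec[OF add_vec] by (simp add: eqv_def diff_diff_eq)
next
  case (scale_vec s \<phi> i c)
  have "gsgn e (gen (\<phi>, i, co_scale C s c) - cst (\<iota> s) * gen (\<phi>, i, c)) =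
      cst (ksgn (e * (i - 1))) * (gen (\<phi>, i, co_scale C s c) - cst (\<iota> s) * gen (\<phi>, i, c))"
    by (simp add: gsgn_simps gsgn_wrd ce_deg_def right_diff_distrib cst_collect)
  then show ?case
    using ID(7) gen_scale_vec[OF scale_vec] by (simp add: eqv_def)
next
  case (comm x y)
  have "gsgn e (gen x * gen y - cst (ksgn (ce_deg x * ce_deg y)) * gen y * gen x) =
      cst (ksgn (e * (ce_deg x + ce_deg y))) * (gen x * gen y - cst (ksgn (ce_deg x * ce_deg y)) * gen y * gen x)"
    by (simp add: gsgn_simps gsgn_mult gsgn_wrd right_diff_distrib distrib_left ksgn_add cst_collect)
  then show ?case
    using ID(7) gen_comm[OF comm] by (simp add: eqv_def mult.assoc)
next
  case (left a x)
  have "gsgn e a \<in> falg S"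
    by (rule semilinear_mapsto[OF gsgn_semilinear _ left(1)]) (auto simp: gsgn_wrd intro: falg_closed)
  then show ?case
    using left by (simp add: gsgn_mult ID)
next
  case (right a x)
  have "gsgn e a \<in> falg S"
    by (rule semilinear_mapsto[OF gsgn_semilinear _ right(1)]) (auto simp: gsgn_wrd intro: falg_closed)
  then show ?case
    using right by (simp add: gsgn_mult ID)
qed (simp_all add: gsgn_simps ID)

lemma gproj_I: "p \<in> I \<Longrightarrow> gproj n p \<in> I"
proof -
  \<comment> \<open>The degree is quantified inside the induction because multiplication by a word
    shifts it.\<close>
  have "\<forall>n. gproj n p \<in> I" if "p \<in> I"
    using that
  proof (induction rule: I_induct)
    case (add_fun \<phi> \<psi> i c)
    then show ?case
      using gen_add_fun[OF add_fun] by (simp add: gproj_simps gproj_wrd ce_deg_def eqv_def diff_diff_eq ID(1))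
  next
    case (scale_fun r \<phi> i c)
    then show ?case
      using gen_scale_fun[OF scale_fun] by (simp add: gproj_simps gproj_wrd ce_deg_def eqv_def ID(1))
  next
    case (add_vec \<phi> i a b)
    then show ?case
      using gen_add_vec[OF add_vec] by (simp add: gproj_simps gproj_wrd ce_deg_def eqv_def diff_diff_eq ID(1))
  next
    case (scale_vec s \<phi> i c)
    then show ?case
      using gen_scale_vec[OF scale_vec] by (simp add: gproj_simps gproj_wrd ce_deg_def eqv_def ID(1))
  next
    case (comm x y)
    have "gproj n (gen x * gen y) = (if ce_deg x + ce_deg y = n then gen x * gen y else 0)"
      "gproj n (gen y * gen x) = (if ce_deg x + ce_deg y = n then gen y * gen x else 0)" for n
      by (auto simp: gproj_wrd simp flip: wrd_append)
    then show ?case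
      using gen_comm[OF comm] by (simp add: gproj_simps mult.assoc eqv_def ID(1))
  next
    case (left a x)
    from left(1) have "gproj n (a * x) \<in> I" for n
    proof (induction rule: falg_induct)
      case (word r w)
      then show ?case
        using left(3) by (simp add: gproj_simps gproj_wrd_mult mult.assoc ID falg_closed)
    qed (simp_all add: gproj_simps distrib_right ID)
    then show ?case
      by blast
  next
    case (right a x)
    from right(1) have "gproj n (x * a) \<in> I" for n
    proof (induction rule: falg_induct)
      case (word r w)
      then show ?case
        using right(3) by (simp add: cst_left_commute[of x] gproj_simps gproj_wrd_mult ID falg_closed)
    qed (simp_all add: gproj_simps distrib_left ID)
    then show ?case
      by blast
  qed (simp_all add: gproj_simps ID)
  then show "p \<in> I \<Longrightarrow> gproj n p \<in> I"
    by blast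
qed

lemma ce_der_falg:
  assumes D: "\<And>x. x \<in> S \<Longrightarrow> D x \<in> falg S" and p: "p \<in> falg S"
  shows "ce_der e D p \<in> falg S"
proof (rule semilinear_mapsto[OF ce_der_semilinear _ p])
  fix w assume "w \<in> lists S"
  then show "ce_der e D (wrd w) \<in> falg S"
  proof (induction w)
    case (Cons x w)
    then show ?case
      using Cons_in_lists_iff[of x w S] by (auto simp: ce_der_Cons intro!: falg_closed D)
  qed (simp add: falg_closed)
qed

text \<open>Compatibility with the commutation relations comes from homogeneity: modulo
  \<open>I\<close> a homogeneous element commutes with a letter up to the Koszul sign. The linearity
  relations have to be supplied for \<open>D\<close> on letters.\<close>

lemma ce_der_I:
  assumes homog: "\<And>x. x \<in> S \<Longrightarrow> homog S (ce_deg x + e) (D x)"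
    and add_fun: "\<And>\<phi> \<psi> i c. \<phi> \<in> V \<Longrightarrow> \<psi> \<in> V \<Longrightarrow> c \<in> red_piece C i \<Longrightarrow> D (\<lambda>x. \<phi> x + \<psi> x, i, c) \<simeq>\<^sub>c D (\<phi>, i, c) + D (\<psi>, i, c)"
    and scale_fun: "\<And>r \<phi> i c. \<phi> \<in> V \<Longrightarrow> c \<in> red_piece C i \<Longrightarrow> D (\<lambda>x. r * \<phi> x, i, c) \<simeq>\<^sub>c cst r * D (\<phi>, i, c)"
    and add_vec: "\<And>\<phi> i a b. \<phi> \<in> V \<Longrightarrow> a \<in> red_piece C i \<Longrightarrow> b \<in> red_piece C i \<Longrightarrow> D (\<phi>, i, a + b) \<simeq>\<^sub>c D (\<phi>, i, a) + D (\<phi>, i, b)"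
    and scale_vec: "\<And>s \<phi> i c. \<phi> \<in> V \<Longrightarrow> c \<in> red_piece C i \<Longrightarrow> D (\<phi>, i, co_scale C s c) \<simeq>\<^sub>c cst (\<iota> s) * D (\<phi>, i, c)"
    and p: "p \<in> I"
  shows "ce_der e D p \<in> I"
  using p
proof (induction rule: I_induct)
  case (add_fun \<phi> \<psi> i c)
  then show ?case
    using assms(2)[OF add_fun] by (simp add: ce_der_simps eqv_def diff_diff_eq)
next
  case (scale_fun r \<phi> i c)
  then show ?case
    using assms(3)[OF scale_fun] by (simp add: ce_der_simps eqv_def)
next
  case (add_vec \<phi> i a b)
  then show ?case
    using assms(4)[OF add_vec] by (simp add: ce_der_simps eqv_def diff_diff_eq)
next
  case (scale_vec s \<phi> i c)
  then show ?case
    using assms(5)[OF scale_vec] by (simp add: ce_der_simps eqv_def)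
next
  case (comm x y)
  let ?s = "ksgn (ce_deg x * ce_deg y) :: 'r"
  have "ce_der e D (gen x * gen y) = D x * gen y + cst (ksgn (e * ce_deg x)) * (gen x * D y)"
    by (simp add: ce_der_mult gsgn_wrd mult.assoc)
  also have "\<dots> \<simeq>\<^sub>c cst (ksgn ((ce_deg x + e) * ce_deg y)) * (gen y * D x) +
      cst (ksgn (e * ce_deg x)) * (cst (ksgn ((ce_deg y + e) * ce_deg x)) * (D y * gen x))"
  proof (intro eqv_add eqv_cst homog_comm comm homog)
    have "cst (ksgn ((ce_deg y + e) * ce_deg x)) * (D y * gen x) \<simeq>\<^sub>c
        cst (ksgn ((ce_deg y + e) * ce_deg x)) * (cst (ksgn ((ce_deg y + e) * ce_deg x)) * (gen x * D y))"
      by (intro eqv_cst homog_comm comm homog)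
    then have "cst (ksgn ((ce_deg y + e) * ce_deg x)) * (D y * gen x) \<simeq>\<^sub>c gen x * D y"
      by (simp add: mult.assoc[symmetric] cst_mult[symmetric])
    then show "gen x * D y \<simeq>\<^sub>c cst (ksgn ((ce_deg y + e) * ce_deg x)) * (D y * gen x)"
      by (rule eqv_sym)
  qed
  also have "\<dots> = cst ?s * (D y * gen x + cst (ksgn (e * ce_deg y)) * (gen y * D x))"
    by (simp add: distrib_left distrib_right ksgn_add cst_collect add.commute)
  also have "\<dots> = ce_der e D (cst ?s * gen y * gen x)"
    by (simp add: ce_der_mult gsgn_wrd mult.assoc ce_der_simps)
  finally show ?case
    by (simp add: eqv_def ce_der_simps)
next
  case (left a x)
  have "ce_der e D a \<in> falg S"
    using homog by (intro ce_der_falg left) (auto simp: homog_def)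
  moreover have "gsgn e a \<in> falg S"
    by (rule semilinear_mapsto[OF gsgn_semilinear _ left(1)]) (auto simp: gsgn_wrd intro: falg_closed)
  ultimately show ?case
    using left by (simp add: ce_der_mult ID)
next
  case (right a x)
  have "ce_der e D a \<in> falg S"
    using homog by (intro ce_der_falg right) (auto simp: homog_def)
  then show ?case
    using right gsgn_I[of x e] by (simp add: ce_der_mult ID)
qed (simp_all add: ce_der_simps ID)

end

section \<open>Dual bases and the cobracket\<close>

definition lie_basis :: "('k::field, 'g::ab_group_add) lie_alg \<Rightarrow> 'g set \<Rightarrow> 'g set"
  where "lie_basis L l = (SOME B. finite B \<and> \<not> module.dependent (lie_scale L) B \<and> module.span (lie_scale L) B = l)"

definition lie_coord :: "('k::field, 'g::ab_group_add) lie_alg \<Rightarrow> 'g set \<Rightarrow> 'g \<Rightarrow> 'g \<Rightarrow> 'k"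
  where "lie_coord L l b x = (if x \<in> l then module.representation (lie_scale L) (lie_basis L l) x b else 0)"

text \<open>Different indices may give the same key and coefficients may cancel, so the evaluation
  is computed by additivity and not from the set of keys.\<close>

lemma keys_sum_single:
  "(\<Sum>p\<in>Poly_Mapping.keys (\<Sum>a\<in>A. Poly_Mapping.single (f a) (r a)).
      Poly_Mapping.lookup (\<Sum>a\<in>A. Poly_Mapping.single (f a) (r a)) p * g p) = (\<Sum>a\<in>A. r a * (g (f a) :: 'r::field))"
proof -
  define ev where "ev t = (\<Sum>p\<in>Poly_Mapping.keys t. Poly_Mapping.lookup t p * g p)" for t
  have add: "ev (s + t) = ev s + ev t" for s t
    unfolding ev_def by (rule setsum_keys_plus_distrib) (auto simp: distrib_right)
  have "ev (\<Sum>a\<in>A. Poly_Mapping.single (f a) (r a)) = (\<Sum>a\<in>A. r a * g (f a))"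
    by (induction A rule: infinite_finite_induct) (auto simp: add, auto simp: ev_def)
  then show ?thesis
    by (simp add: ev_def)
qed

lemma wrd_pair: "wrd [x, y] = (gen x * gen y :: 'x list \<Rightarrow>\<^sub>0 'r::ring_1)"
  by (rule wrd_Cons)

lemma cst_sum: "cst (sum f A) = (\<Sum>a\<in>A. cst (f a))"
  by (induction A rule: infinite_finite_induct) (auto simp: cst_add)

definition red_letters :: "('k::field, 'c) coalg \<Rightarrow> (int \<times> 'c) set"
  where "red_letters C = {(i, c). c \<in> red_piece C i}"

context ce_setup
begin

abbreviation \<B> where "\<B> \<equiv> lie_basis L l"
abbreviation RL where "RL \<equiv> red_letters C"

lemma RL_iff [simp]: "(i, c) \<in> RL \<longleftrightarrow> c \<in> red_piece C i"
  by (simp add: red_letters_def)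

lemma S_RL: "(\<phi>, y) \<in> S \<longleftrightarrow> \<phi> \<in> V \<and> y \<in> RL"
  by (cases y) (simp add: S_iff)

lemma basis: "finite \<B>" "lvs.independent \<B>" "lvs.span \<B> = l"
proof -
  obtain B0 where B0: "finite B0" "lvs.span B0 = UNIV"
    using lie.fin_dim by blast
  obtain B where B: "B \<subseteq> l" "lvs.independent B" "l \<subseteq> lvs.span B"
    using lvs.maximal_independent_subset by blast
  have "finite B"
    using lvs.independent_span_bound[OF B0(1) B(2)] B0(2) by auto
  moreover have "lvs.span B = l"
    using B l_sub by (metis lvs.span_subspace)
  ultimately have "\<exists>B. finite B \<and> lvs.independent B \<and> lvs.span B = l"
    using B by blast
  from someI_ex[OF this] show "finite \<B>" "lvs.independent \<B>" "lvs.span \<B> = l"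
    by (auto simp: lie_basis_def)
qed

lemma basis_l: "b \<in> \<B> \<Longrightarrow> b \<in> l"
  using basis(3) lvs.span_base by blast

definition dual :: "'g \<Rightarrow> 'g \<Rightarrow> 'r"
  where "dual b x = \<iota> (lie_coord L l b x)"

lemma coord_expand: "x \<in> l \<Longrightarrow> x = (\<Sum>b\<in>\<B>. lie_scale L (lie_coord L l b x) b)"
  using lvs.sum_representation_eq[OF basis(2), of x \<B>] basis by (simp add: lie_coord_def)

lemma dual_V: "dual b \<in> V"
  using basis l_closed field_homD[OF \<iota>]
  by (auto simp: lie_dual_def dual_def lie_coord_def lvs.representation_add lvs.representation_scale)

lemma V_expand: "\<phi> \<in> V \<Longrightarrow> x \<in> l \<Longrightarrow> \<phi> x = (\<Sum>b\<in>\<B>. \<phi> b * dual b x)"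
proof -
  assume \<phi>: "\<phi> \<in> V" and x: "x \<in> l"
  have "\<phi> x = \<phi> (\<Sum>b\<in>\<B>. lie_scale L (lie_coord L l b x) b)"
    using coord_expand[OF x] by simp
  also have "\<dots> = (\<Sum>b\<in>\<B>. \<phi> (lie_scale L (lie_coord L l b x) b))"
    by (rule VD(6)[OF \<phi>]) (auto intro: basis_l l_closed)
  also have "\<dots> = (\<Sum>b\<in>\<B>. \<phi> b * dual b x)"
    by (intro sum.cong refl) (simp add: VD(2)[OF \<phi>] basis_l dual_def mult.commute)
  finally show ?thesis .
qed

lemma V_expand_fun: "\<phi> \<in> V \<Longrightarrow> \<phi> = (\<lambda>x. \<Sum>b\<in>\<B>. \<phi> b * dual b x)"
proof
  fix x assume \<phi>: "\<phi> \<in> V"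
  show "\<phi> x = (\<Sum>b\<in>\<B>. \<phi> b * dual b x)"
    using V_expand[OF \<phi>] VD(3)[OF \<phi>, of x] field_homD(1)[OF \<iota>]
    by (cases "x \<in> l") (auto simp: dual_def lie_coord_def)
qed

lemma gen_zero_fun: "c \<in> red_piece C i \<Longrightarrow> gen (\<lambda>x. 0, i, c) \<simeq>\<^sub>c 0"
  using gen_scale_fun[OF V_closed(1), of c i 0] by simp

lemma gen_sum_fun:
  "(\<And>a. a \<in> A \<Longrightarrow> f a \<in> V) \<Longrightarrow> c \<in> red_piece C i \<Longrightarrow>
    gen (\<lambda>x. \<Sum>a\<in>A. r a * f a x, i, c) \<simeq>\<^sub>c (\<Sum>a\<in>A. cst (r a) * gen (f a, i, c))"
proof (induction A rule: infinite_finite_induct)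
  case (insert a A)
  have "gen (\<lambda>x. r a * f a x + (\<Sum>a\<in>A. r a * f a x), i, c) \<simeq>\<^sub>c
      gen (\<lambda>x. r a * f a x, i, c) + gen (\<lambda>x. \<Sum>a\<in>A. r a * f a x, i, c)"
    using insert by (intro gen_add_fun V_closed) auto
  also have "\<dots> \<simeq>\<^sub>c cst (r a) * gen (f a, i, c) + (\<Sum>a\<in>A. cst (r a) * gen (f a, i, c))"
    using insert by (intro eqv_add gen_scale_fun) auto
  finally show ?case
    using insert by simp
qed (auto intro: gen_zero_fun)

lemma gen_expand:
  assumes "\<phi> \<in> V" "y \<in> RL"
  shows "gen (\<phi>, y) \<simeq>\<^sub>c (\<Sum>b\<in>\<B>. cst (\<phi> b) * gen (dual b, y))"
proof -
  obtain i c where y: "y = (i, c)" "c \<in> red_piece C i"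
    using assms(2) by (cases y) auto
  have "gen (\<lambda>x. \<Sum>b\<in>\<B>. \<phi> b * dual b x, i, c) \<simeq>\<^sub>c (\<Sum>b\<in>\<B>. cst (\<phi> b) * gen (dual b, i, c))"
    by (rule gen_sum_fun) (auto simp: y dual_V)
  then show ?thesis
    using V_expand_fun[OF assms(1)] by (simp add: y)
qed

text \<open>Modulo the relations a combination of two-letter products depends only on the bilinear
  form it represents, since its coefficients in the dual basis are the values of that form at pairs
  of basis vectors. This removes the arbitrariness of the tensor in \<open>lie_cobr\<close>.\<close>

lemma tens_expand:
  assumes "\<And>a. a \<in> A \<Longrightarrow> \<alpha> a \<in> V" "\<And>a. a \<in> A \<Longrightarrow> \<gamma> a \<in> V" "y \<in> RL" "z \<in> RL"
  shows "(\<Sum>a\<in>A. cst (r a) * (gen (\<alpha> a, y) * gen (\<gamma> a, z))) \<simeq>\<^sub>c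
    (\<Sum>b\<in>\<B>. \<Sum>b'\<in>\<B>. cst (\<Sum>a\<in>A. r a * \<alpha> a b * \<gamma> a b') * (gen (dual b, y) * gen (dual b', z)))"
proof -
  have "gen (\<alpha> a, y) * gen (\<gamma> a, z) \<simeq>\<^sub>c
      (\<Sum>b\<in>\<B>. cst (\<alpha> a b) * gen (dual b, y)) * (\<Sum>b'\<in>\<B>. cst (\<gamma> a b') * gen (dual b', z))" if "a \<in> A" for a
    using that assms by (intro eqv_mult gen_expand) (auto intro!: falg_closed simp: S_RL dual_V)
  then have "(\<Sum>a\<in>A. cst (r a) * (gen (\<alpha> a, y) * gen (\<gamma> a, z))) \<simeq>\<^sub>c
      (\<Sum>a\<in>A. cst (r a) * ((\<Sum>b\<in>\<B>. cst (\<alpha> a b) * gen (dual b, y)) * (\<Sum>b'\<in>\<B>. cst (\<gamma> a b') * gen (dual b', z))))"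
    by (intro eqv_sum eqv_cst)
  also have "\<dots> = (\<Sum>a\<in>A. \<Sum>b\<in>\<B>. \<Sum>b'\<in>\<B>. cst (r a * \<alpha> a b * \<gamma> a b') * (gen (dual b, y) * gen (dual b', z)))"
    by (simp only: sum_distrib_left sum_distrib_right cst_collect)
       (intro sum.cong refl sum.swap)
  also have "\<dots> = (\<Sum>b\<in>\<B>. \<Sum>a\<in>A. \<Sum>b'\<in>\<B>. cst (r a * \<alpha> a b * \<gamma> a b') * (gen (dual b, y) * gen (dual b', z)))"
    by (rule sum.swap)
  also have "\<dots> = (\<Sum>b\<in>\<B>. \<Sum>b'\<in>\<B>. \<Sum>a\<in>A. cst (r a * \<alpha> a b * \<gamma> a b') * (gen (dual b, y) * gen (dual b', z)))"
    by (intro sum.cong refl sum.swap)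
  also have "\<dots> = (\<Sum>b\<in>\<B>. \<Sum>b'\<in>\<B>. cst (\<Sum>a\<in>A. r a * \<alpha> a b * \<gamma> a b') * (gen (dual b, y) * gen (dual b', z)))"
    by (simp add: sum_distrib_right cst_sum)
  finally show ?thesis .
qed

text \<open>
  The bracket dual to \<open>\<phi>\<close>, written in a basis of \<open>l\<close>; modulo the relations it replaces the tensor
  chosen by \<open>lie_cobr\<close>.
\<close>

definition br_tens :: "('g \<Rightarrow> 'r) \<Rightarrow> int \<times> 'c \<Rightarrow> int \<times> 'c \<Rightarrow> ('g, 'r, 'c) ce_letter list \<Rightarrow>\<^sub>0 'r"
  where "br_tens \<phi> y z = (\<Sum>b\<in>\<B>. \<Sum>b'\<in>\<B>. cst (\<phi> (lie_br L b b')) * (gen (dual b, y) * gen (dual b', z)))"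

lemma tens_br_tens:
  assumes "\<And>a. a \<in> A \<Longrightarrow> \<alpha> a \<in> V" "\<And>a. a \<in> A \<Longrightarrow> \<gamma> a \<in> V" "y \<in> RL" "z \<in> RL"
    and "\<And>u v. u \<in> l \<Longrightarrow> v \<in> l \<Longrightarrow> (\<Sum>a\<in>A. r a * \<alpha> a u * \<gamma> a v) = \<phi> (lie_br L u v)"
  shows "(\<Sum>a\<in>A. cst (r a) * (gen (\<alpha> a, y) * gen (\<gamma> a, z))) \<simeq>\<^sub>c br_tens \<phi> y z"
proof -
  have "(\<Sum>b\<in>\<B>. \<Sum>b'\<in>\<B>. cst (\<Sum>a\<in>A. r a * \<alpha> a b * \<gamma> a b') * (gen (dual b, y) * gen (dual b', z))) = br_tens \<phi> y z"
    unfolding br_tens_def using assms(5) basis_l by (intro sum.cong refl) simp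
  moreover have "(\<Sum>a\<in>A. cst (r a) * (gen (\<alpha> a, y) * gen (\<gamma> a, z))) \<simeq>\<^sub>c
    (\<Sum>b\<in>\<B>. \<Sum>b'\<in>\<B>. cst (\<Sum>a\<in>A. r a * \<alpha> a b * \<gamma> a b') * (gen (dual b, y) * gen (dual b', z)))"
    by (rule tens_expand) (use assms(1-4) in auto)
  ultimately show ?thesis
    by simp
qed

lemma br_expand:
  assumes \<phi>: "\<phi> \<in> V" and u: "u \<in> l" and v: "v \<in> l"
  shows "(\<Sum>(b, b')\<in>\<B> \<times> \<B>. \<phi> (lie_br L b b') * (dual b u * dual b' v)) = \<phi> (lie_br L u v)"
proof -
  have "(\<Sum>(b, b')\<in>\<B> \<times> \<B>. \<phi> (lie_br L b b') * (dual b u * dual b' v)) =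
      (\<Sum>b\<in>\<B>. \<Sum>b'\<in>\<B>. \<phi> (lie_br L b b') * dual b' v * dual b u)"
    unfolding sum.cartesian_product[symmetric] by (intro sum.cong refl) (simp add: mult_ac)
  also have "\<dots> = (\<Sum>b\<in>\<B>. (\<Sum>b'\<in>\<B>. \<phi> (lie_br L b b') * dual b' v) * dual b u)"
    by (simp only: sum_distrib_right)
  also have "\<dots> = (\<Sum>b\<in>\<B>. \<phi> (lie_br L b v) * dual b u)"
  proof (intro sum.cong refl)
    fix b assume b: "b \<in> \<B>"
    have "(\<lambda>v. if v \<in> l then \<phi> (lie_br L b v) else 0) \<in> V"
      using basis_l[OF b] by (auto simp: lie_dual_def l_closed lie.br_add_right lie.br_scale_right VD(1,2)[OF \<phi>])
    from V_expand[OF this v] show "(\<Sum>b'\<in>\<B>. \<phi> (lie_br L b b') * dual b' v) * dual b u = \<phi> (lie_br L b v) * dual b u"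
      using v by (simp add: basis_l)
  qed
  also have "\<dots> = \<phi> (lie_br L u v)"
  proof -
    have "(\<lambda>u. if u \<in> l then \<phi> (lie_br L u v) else 0) \<in> V"
      using v by (auto simp: lie_dual_def l_closed lie.br_add_left lie.br_scale_left VD(1,2)[OF \<phi>])
    from V_expand[OF this u] show ?thesis
      using u by (simp add: basis_l)
  qed
  finally show ?thesis .
qed

lemma lie_cobr:
  assumes \<phi>: "\<phi> \<in> V"
  shows "Poly_Mapping.keys (lie_cobr \<iota> L l \<phi>) \<subseteq> V \<times> V"
    "u \<in> l \<Longrightarrow> v \<in> l \<Longrightarrow> (\<Sum>p\<in>Poly_Mapping.keys (lie_cobr \<iota> L l \<phi>).
        Poly_Mapping.lookup (lie_cobr \<iota> L l \<phi>) p * fst p u * snd p v) = \<phi> (lie_br L u v)"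
proof -
  \<comment> \<open>The cobracket written in the dual basis shows that the tensor chosen in
    \<open>lie_cobr\<close> exists.\<close>
  define t where "t = (\<Sum>(b, b')\<in>\<B> \<times> \<B>. Poly_Mapping.single (dual b, dual b') (\<phi> (lie_br L b b')))"
  have "Poly_Mapping.keys t \<subseteq> V \<times> V"
    unfolding t_def using keys_sum[of "\<lambda>(b, b'). Poly_Mapping.single (dual b, dual b') (\<phi> (lie_br L b b'))" "\<B> \<times> \<B>"]
    by (auto simp: dual_V split: if_splits)
  moreover have "(\<Sum>p\<in>Poly_Mapping.keys t. Poly_Mapping.lookup t p * fst p u * snd p v) = \<phi> (lie_br L u v)"
    if u: "u \<in> l" and v: "v \<in> l" for u v
  proof -
    have "(\<Sum>p\<in>Poly_Mapping.keys t. Poly_Mapping.lookup t p * (fst p u * snd p v)) =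
        (\<Sum>(b, b')\<in>\<B> \<times> \<B>. \<phi> (lie_br L b b') * (dual b u * dual b' v))"
      using keys_sum_single[of "\<lambda>(b, b'). (dual b, dual b')" "\<lambda>(b, b'). \<phi> (lie_br L b b')" "\<B> \<times> \<B>" "\<lambda>p. fst p u * snd p v"]
      unfolding t_def by (simp add: case_prod_unfold)
    also have "\<dots> = \<phi> (lie_br L u v)"
      by (rule br_expand[OF \<phi> u v])
    finally show ?thesis
      by (simp add: mult.assoc)
  qed
  ultimately have "\<exists>t. Poly_Mapping.keys t \<subseteq> V \<times> V \<and>
      (\<forall>x\<in>l. \<forall>y\<in>l. (\<Sum>p\<in>Poly_Mapping.keys t. Poly_Mapping.lookup t p * fst p x * snd p y) = \<phi> (lie_br L x y))"
    by blast
  from someI_ex[OF this]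
  show "Poly_Mapping.keys (lie_cobr \<iota> L l \<phi>) \<subseteq> V \<times> V"
    "u \<in> l \<Longrightarrow> v \<in> l \<Longrightarrow> (\<Sum>p\<in>Poly_Mapping.keys (lie_cobr \<iota> L l \<phi>).
        Poly_Mapping.lookup (lie_cobr \<iota> L l \<phi>) p * fst p u * snd p v) = \<phi> (lie_br L u v)"
    unfolding lie_cobr_def by blast+
qed

lemma br_tens_homog: "y \<in> RL \<Longrightarrow> z \<in> RL \<Longrightarrow> homog S (fst y + fst z - 2) (br_tens \<phi> y z)"
  unfolding br_tens_def
  by (intro homog_closed) (auto simp: S_RL dual_V ce_deg_def simp flip: wrd_append intro!: homog_closed)

lemma br_tens_add_fun: "br_tens (\<lambda>x. \<phi> x + \<psi> x) y z = br_tens \<phi> y z + br_tens \<psi> y z"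
  by (simp add: br_tens_def cst_add distrib_right sum.distrib)

lemma br_tens_scale_fun: "br_tens (\<lambda>x. r * \<phi> x) y z = cst r * br_tens \<phi> y z"
  by (simp add: br_tens_def cst_mult mult.assoc sum_distrib_left)

lemma br_tens_add_vec:
  assumes "a \<in> red_piece C i" "b \<in> red_piece C i" "z \<in> RL"
  shows "br_tens \<phi> (i, a + b) z \<simeq>\<^sub>c br_tens \<phi> (i, a) z + br_tens \<phi> (i, b) z"
    "br_tens \<phi> z (i, a + b) \<simeq>\<^sub>c br_tens \<phi> z (i, a) + br_tens \<phi> z (i, b)"
proof -
  have "gen (dual v, i, a + b) * gen (dual u, z) \<simeq>\<^sub>c (gen (dual v, i, a) + gen (dual v, i, b)) * gen (dual u, z)"
    "gen (dual v, z) * gen (dual u, i, a + b) \<simeq>\<^sub>c gen (dual v, z) * (gen (dual u, i, a) + gen (dual u, i, b))" for u v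
    using assms by (auto intro!: eqv_left eqv_right gen_add_vec gen_falg simp: dual_V S_RL)
  then have "(\<Sum>v\<in>\<B>. \<Sum>u\<in>\<B>. cst (\<phi> (lie_br L v u)) * (gen (dual v, i, a + b) * gen (dual u, z))) \<simeq>\<^sub>c
      (\<Sum>v\<in>\<B>. \<Sum>u\<in>\<B>. cst (\<phi> (lie_br L v u)) * ((gen (dual v, i, a) + gen (dual v, i, b)) * gen (dual u, z)))"
    "(\<Sum>v\<in>\<B>. \<Sum>u\<in>\<B>. cst (\<phi> (lie_br L v u)) * (gen (dual v, z) * gen (dual u, i, a + b))) \<simeq>\<^sub>c
      (\<Sum>v\<in>\<B>. \<Sum>u\<in>\<B>. cst (\<phi> (lie_br L v u)) * (gen (dual v, z) * (gen (dual u, i, a) + gen (dual u, i, b))))"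
    by (intro eqv_sum eqv_cst; blast)+
  then show "br_tens \<phi> (i, a + b) z \<simeq>\<^sub>c br_tens \<phi> (i, a) z + br_tens \<phi> (i, b) z"
    "br_tens \<phi> z (i, a + b) \<simeq>\<^sub>c br_tens \<phi> z (i, a) + br_tens \<phi> z (i, b)"
    by (simp_all add: br_tens_def distrib_left distrib_right sum.distrib)
qed

lemma br_tens_scale_vec:
  assumes "a \<in> red_piece C i" "z \<in> RL"
  shows "br_tens \<phi> (i, co_scale C s a) z \<simeq>\<^sub>c cst (\<iota> s) * br_tens \<phi> (i, a) z"
    "br_tens \<phi> z (i, co_scale C s a) \<simeq>\<^sub>c cst (\<iota> s) * br_tens \<phi> z (i, a)"
proof -
  have "gen (dual v, i, co_scale C s a) * gen (dual u, z) \<simeq>\<^sub>c (cst (\<iota> s) * gen (dual v, i, a)) * gen (dual u, z)"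
    "gen (dual v, z) * gen (dual u, i, co_scale C s a) \<simeq>\<^sub>c gen (dual v, z) * (cst (\<iota> s) * gen (dual u, i, a))" for u v
    using assms by (auto intro!: eqv_left eqv_right gen_scale_vec gen_falg simp: dual_V S_RL)
  then have "(\<Sum>v\<in>\<B>. \<Sum>u\<in>\<B>. cst (\<phi> (lie_br L v u)) * (gen (dual v, i, co_scale C s a) * gen (dual u, z))) \<simeq>\<^sub>c
      (\<Sum>v\<in>\<B>. \<Sum>u\<in>\<B>. cst (\<phi> (lie_br L v u)) * ((cst (\<iota> s) * gen (dual v, i, a)) * gen (dual u, z)))"
    "(\<Sum>v\<in>\<B>. \<Sum>u\<in>\<B>. cst (\<phi> (lie_br L v u)) * (gen (dual v, z) * gen (dual u, i, co_scale C s a))) \<simeq>\<^sub>c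
      (\<Sum>v\<in>\<B>. \<Sum>u\<in>\<B>. cst (\<phi> (lie_br L v u)) * (gen (dual v, z) * (cst (\<iota> s) * gen (dual u, i, a))))"
    by (intro eqv_sum eqv_cst; blast)+
  then show "br_tens \<phi> (i, co_scale C s a) z \<simeq>\<^sub>c cst (\<iota> s) * br_tens \<phi> (i, a) z"
    "br_tens \<phi> z (i, co_scale C s a) \<simeq>\<^sub>c cst (\<iota> s) * br_tens \<phi> z (i, a)"
    by (simp_all add: br_tens_def sum_distrib_left cst_collect)
qed

lemma lt_proj:
  assumes "a \<in> co_piece C i"
  shows "lt_proj C (i, a) \<in> RL" "fst (lt_proj C (i, a)) = i"
proof -
  have "co_unit C (a - co_scale C (co_unit C a) (co_aug C)) = 0" if "i = 0"
  proof -
    have "a - co_scale C (co_unit C a) (co_aug C) = a + co_scale C (- co_unit C a) (co_aug C)"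
      by simp
    moreover have aug: "co_aug C \<in> co_piece C 0"
      by (rule coaug_conilp_cocomm_dg_coalgebra.aug_in[OF C])
    moreover have "co_unit C (a + co_scale C (- co_unit C a) (co_aug C)) = co_unit C a + (- co_unit C a) * co_unit C (co_aug C)"
      using assms that co(2)[OF _ piece_closed(3)[OF aug]] co(3)[OF aug] by metis
    ultimately show ?thesis
      using coaug_conilp_cocomm_dg_coalgebra.aug_unit[OF C] by simp
  qed
  then show "lt_proj C (i, a) \<in> RL"
    using assms coaug_conilp_cocomm_dg_coalgebra.aug_in[OF C]
    by (auto simp: lt_proj_def red_piece_def lt_unit_def intro!: piece_closed)
qed (simp add: lt_proj_def)

lemma lt_proj_add:
  assumes "a \<in> co_piece C i" "b \<in> co_piece C i"
  shows "lt_proj C (i, a + b) = (i, snd (lt_proj C (i, a)) + snd (lt_proj C (i, b)))"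
  using assms co(2) by (auto simp: lt_proj_def cvs.scale_left_distrib)

lemma lt_proj_scale:
  assumes "a \<in> co_piece C i"
  shows "lt_proj C (i, co_scale C r a) = (i, co_scale C r (snd (lt_proj C (i, a))))"
  using assms co(3) by (auto simp: lt_proj_def cvs.scale_right_diff_distrib)

lemma lt_mult_keys:
  assumes "x \<in> co_letters C" "w \<in> Poly_Mapping.keys (lt_mult C x)"
  obtains p a q b where "w = [(p, a), (q, b)]" "p + q = fst x" "a \<in> co_piece C p" "b \<in> co_piece C q"
  using assms coaug_conilp_cocomm_dg_coalgebra.mult_in[OF C, of "snd x" "fst x"]
  by (fastforce simp: lt_mult_def co_letters_def)

lemma RL_co: "x \<in> RL \<Longrightarrow> x \<in> co_letters C"
  by (auto simp: red_letters_def co_letters_def red_piece_def)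

lemma red_mult_keys:
  assumes x: "x \<in> RL" and w: "w \<in> Poly_Mapping.keys (red_mult C x)"
  obtains y z where "w = [y, z]" "y \<in> RL" "z \<in> RL" "fst y + fst z = fst x"
proof -
  have "red_mult C x = (\<Sum>v\<in>Poly_Mapping.keys (lt_mult C x).
      cst (Poly_Mapping.lookup (lt_mult C x) v) * wrd [lt_proj C (v ! 0), lt_proj C (v ! 1)])"
    by (simp add: red_mult_def on2_def linext_def wrd_pair)
  then obtain v where v: "v \<in> Poly_Mapping.keys (lt_mult C x)"
    "w \<in> Poly_Mapping.keys (cst (Poly_Mapping.lookup (lt_mult C x) v) * wrd [lt_proj C (v ! 0), lt_proj C (v ! 1)])"
    using w keys_sum[of "\<lambda>v. cst (Poly_Mapping.lookup (lt_mult C x) v) * wrd [lt_proj C (v ! 0), lt_proj C (v ! 1)]"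
        "Poly_Mapping.keys (lt_mult C x)"] by auto
  then have "w = [lt_proj C (v ! 0), lt_proj C (v ! 1)]"
    by (auto simp: cst_wrd split: if_splits)
  moreover obtain p a q b where "v = [(p, a), (q, b)]" "p + q = fst x" "a \<in> co_piece C p" "b \<in> co_piece C q"
    using lt_mult_keys[OF RL_co[OF x] v(1)] .
  ultimately show thesis
    by (intro that[of "lt_proj C (p, a)" "lt_proj C (q, b)"]) (simp_all add: lt_proj)
qed

section \<open>The Chevalley-Eilenberg differential modulo the relations\<close>

definition br_word :: "('g \<Rightarrow> 'r) \<Rightarrow> (int \<times> 'c) list \<Rightarrow> ('g, 'r, 'c) ce_letter list \<Rightarrow>\<^sub>0 'r"
  where "br_word \<phi> w = cst (ksgn (fst (w ! 0)) / 2) * br_tens \<phi> (w ! 0) (w ! 1)"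

text \<open>The quadratic part with the chosen cobracket tensor replaced by \<open>br_tens\<close>.
  It agrees with \<open>ce_d2\<close> modulo the relations and is exactly linear in the functional,
  not just up to congruence.\<close>

definition ce_d2' :: "('g, 'r, 'c) ce_letter \<Rightarrow> ('g, 'r, 'c) ce_letter list \<Rightarrow>\<^sub>0 'r"
  where "ce_d2' x = - linext \<iota> (br_word (fst x)) (red_mult C (snd x))"

lemma linext_eqv:
  assumes "\<And>w. w \<in> Poly_Mapping.keys p \<Longrightarrow> f w \<simeq>\<^sub>c g w"
  shows "linext \<iota> f p \<simeq>\<^sub>c linext \<iota> g p"
  unfolding linext_def using assms by (intro eqv_sum eqv_cst)

lemma linext_homog:
  assumes "\<And>w. w \<in> Poly_Mapping.keys p \<Longrightarrow> homog S n (f w)"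
  shows "homog S n (linext \<iota> f p)"
  unfolding linext_def using assms by (intro homog_closed)

lemma ce_d2_eqv:
  assumes "x \<in> S"
  shows "ce_d2 \<iota> L l C x \<simeq>\<^sub>c ce_d2' x" "homog S (ce_deg x - 1) (ce_d2 \<iota> L l C x)"
proof -
  obtain \<phi> u where x: "x = (\<phi>, u)" "\<phi> \<in> V" "u \<in> RL"
    using assms by (cases x) (auto simp: S_RL)
  note cobr = lie_cobr[OF x(2)]
  let ?t = "lie_cobr \<iota> L l \<phi>"
  show "ce_d2 \<iota> L l C x \<simeq>\<^sub>c ce_d2' x"
    unfolding ce_d2_def ce_d2'_def x fst_conv snd_conv
  proof (intro eqv_uminus linext_eqv)
    fix w assume "w \<in> Poly_Mapping.keys (red_mult C u)"
    then obtain y z where w: "w = [y, z]" "y \<in> RL" "z \<in> RL"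
      using red_mult_keys[OF x(3)] by metis
    have "(\<Sum>p\<in>Poly_Mapping.keys ?t. cst (Poly_Mapping.lookup ?t p) * (gen (fst p, y) * gen (snd p, z))) \<simeq>\<^sub>c br_tens \<phi> y z"
      by (rule tens_br_tens) (use cobr w in auto)
    then have "cst (ksgn (fst y) / 2) * (\<Sum>p\<in>Poly_Mapping.keys ?t. cst (Poly_Mapping.lookup ?t p) * (gen (fst p, y) * gen (snd p, z))) \<simeq>\<^sub>c br_word \<phi> w"
      by (simp add: br_word_def w eqv_cst)
    moreover have "cst (ksgn (fst y) / 2) * (\<Sum>p\<in>Poly_Mapping.keys ?t. cst (Poly_Mapping.lookup ?t p) * (gen (fst p, y) * gen (snd p, z))) =
        (\<Sum>p\<in>Poly_Mapping.keys ?t. cst (Poly_Mapping.lookup ?t p * ksgn (fst y) / 2) * gen (fst p, y) * gen (snd p, z))"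
      by (simp add: sum_distrib_left cst_collect)
    ultimately show "(\<Sum>p\<in>Poly_Mapping.keys ?t. cst (Poly_Mapping.lookup ?t p * ksgn (fst (w ! 0)) / 2) * gen (fst p, w ! 0) * gen (snd p, w ! 1)) \<simeq>\<^sub>c br_word \<phi> w"
      by (simp add: w)
  qed
  show "homog S (ce_deg x - 1) (ce_d2 \<iota> L l C x)"
    unfolding ce_d2_def x fst_conv snd_conv mult.assoc
  proof (intro homog_closed linext_homog)
    fix w p assume "w \<in> Poly_Mapping.keys (red_mult C u)" and p: "p \<in> Poly_Mapping.keys ?t"
    then obtain y z where w: "w = [y, z]" "y \<in> RL" "z \<in> RL" "fst y + fst z = fst u"
      using red_mult_keys[OF x(3)] by metis
    have "gen (fst p, y) * gen (snd p, z) = (wrd [(fst p, y), (snd p, z)] :: ('g, 'r, 'c) ce_letter list \<Rightarrow>\<^sub>0 'r)"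
      by (simp add: wrd_pair)
    moreover have "homog S (ce_deg (\<phi>, u) - 1) (wrd [(fst p, y), (snd p, z)])"
      by (rule homog_closed) (use cobr(1) p w in \<open>auto simp: S_RL ce_deg_def\<close>)
    ultimately show "homog S (ce_deg (\<phi>, u) - 1) (gen (fst p, w ! 0) * gen (snd p, w ! 1))"
      by (simp add: w)
  qed
qed

text \<open>
  The differential \<open>ce_d2'\<close> factors through the unreduced comultiplication by \<open>br_co\<close>, and \<open>br_co\<close>
  kills the relations of the tensor product.  Hence it does not depend on the representative
  \<open>lt_mult\<close> of the comultiplication.
\<close>

definition br_co :: "('g \<Rightarrow> 'r) \<Rightarrow> ((int \<times> 'c) list \<Rightarrow>\<^sub>0 'k) \<Rightarrow> ('g, 'r, 'c) ce_letter list \<Rightarrow>\<^sub>0 'r"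
  where "br_co \<phi> = linext \<iota> (\<lambda>w. if length w = 2 then br_word \<phi> [lt_proj C (w ! 0), lt_proj C (w ! 1)] else 0)"

lemmas br_co_simps = semilinearD[OF linext_semilinear[OF \<iota>], of "\<lambda>w. if length w = 2 then br_word \<phi> [lt_proj C (w ! 0), lt_proj C (w ! 1)] else 0" for \<phi>,
  folded br_co_def]

lemma br_co_wrd: "br_co \<phi> (wrd w) = (if length w = 2 then br_word \<phi> [lt_proj C (w ! 0), lt_proj C (w ! 1)] else 0)"
  unfolding br_co_def by (rule linext_wrd[OF \<iota>])

lemma ce_d2'_br_co:
  assumes "x \<in> RL"
  shows "ce_d2' (\<phi>, x) = - br_co \<phi> (lt_mult C x)"
proof -
  note lin = semilinearD[OF linext_semilinear[OF \<iota>, of "br_word \<phi>"]]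
  have "linext \<iota> (br_word \<phi>) (red_mult C x) = (\<Sum>w\<in>Poly_Mapping.keys (lt_mult C x).
      cst (\<iota> (Poly_Mapping.lookup (lt_mult C x) w)) * linext \<iota> (br_word \<phi>) (wrd [lt_proj C (w ! 0), lt_proj C (w ! 1)]))"
    by (simp add: red_mult_def on2_def linext_def[of id] lin wrd_pair)
  also have "\<dots> = br_co \<phi> (lt_mult C x)"
    unfolding br_co_def linext_def[of \<iota> _ "lt_mult C x"]
  proof (intro sum.cong refl)
    fix w assume "w \<in> Poly_Mapping.keys (lt_mult C x)"
    then have "length w = 2"
      by (rule lt_mult_keys[OF RL_co[OF assms]]) simp
    then show "cst (\<iota> (Poly_Mapping.lookup (lt_mult C x) w)) * linext \<iota> (br_word \<phi>) (wrd [lt_proj C (w ! 0), lt_proj C (w ! 1)]) =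
        cst (\<iota> (Poly_Mapping.lookup (lt_mult C x) w)) * (if length w = 2 then br_word \<phi> [lt_proj C (w ! 0), lt_proj C (w ! 1)] else 0)"
      by (simp add: linext_wrd[OF \<iota>])
  qed
  finally show ?thesis
    by (simp add: ce_d2'_def)
qed

lemma br_co_tens_rel:
  assumes "p \<in> tens_rel C"
  shows "br_co \<phi> p \<in> I"
proof -
  define T where "T = {gen (i, a + b) - gen (i, a) - gen (i, b) | i a b. a \<in> co_piece C i \<and> b \<in> co_piece C i} \<union>
      {gen (i, co_scale C r a) - cst r * gen (i, a) | i r a. a \<in> co_piece C i}"
  have T: "T \<subseteq> falg (co_letters C)"
    by (auto simp: T_def co_letters_def piece_closed intro!: falg_closed)
  have two: "length u + length v = 1 \<longleftrightarrow> (\<exists>y. (u = [] \<and> v = [y]) \<or> (u = [y] \<and> v = []))" for u v :: "(int \<times> 'c) list"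
    by (cases u; cases v) auto
  have RLp: "lt_proj C y \<in> RL" if "y \<in> co_letters C" for y
    using that lt_proj(1)[of "snd y" "fst y"] by (auto simp: co_letters_def)
  have RLs: "snd (lt_proj C (i, a)) \<in> red_piece C i" "lt_proj C (i, a) = (i, snd (lt_proj C (i, a)))" if "a \<in> co_piece C i" for i a
    using lt_proj[OF that] by (auto simp: red_letters_def prod_eq_iff)
  \<comment> \<open>Words on both sides let the induction absorb left and right multiples. As
    \<open>br_co\<close> vanishes off words of length two, a generator contributes only if
    \<open>u\<close> and \<open>v\<close> together have exactly one letter.\<close>
  have "\<forall>u\<in>lists (co_letters C). \<forall>v\<in>lists (co_letters C). br_co \<phi> (wrd u * p * wrd v) \<in> I"
    using T assms unfolding tens_rel_def T_def[symmetric]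
  proof (induction rule: Idl_induct)
    case (gen g)
    then consider (add) i a b where "g = gen (i, a + b) - gen (i, a) - gen (i, b)" "a \<in> co_piece C i" "b \<in> co_piece C i"
      | (scale) i r a where "g = gen (i, co_scale C r a) - cst r * gen (i, a)" "a \<in> co_piece C i"
      by (auto simp: T_def)
    then show ?case
    proof cases
      case add
      show ?thesis
      proof (intro ballI)
        fix u v assume uv: "u \<in> lists (co_letters C)" "v \<in> lists (co_letters C)"
        have eq: "wrd u * g * wrd v = wrd (u @ (i, a + b) # v) - wrd (u @ (i, a) # v) - wrd (u @ (i, b) # v)"
          by (simp add: add(1) algebra_simps wrd_append wrd_Cons[of _ v])
        show "br_co \<phi> (wrd u * g * wrd v) \<in> I"
        proof (cases "length u + length v = 1")
          case False
          then show ?thesis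
            unfolding eq by (simp add: br_co_simps br_co_wrd ID)
        next
          case True
          then obtain y where y: "(u = [] \<and> v = [y]) \<or> (u = [y] \<and> v = [])"
            using two by blast
          then have "lt_proj C y \<in> RL"
            using uv by (intro RLp) auto
          with y show ?thesis
            unfolding eq
            using eqv_cst[OF br_tens_add_vec(1)[OF RLs(1)[OF add(2)] RLs(1)[OF add(3)]], of "lt_proj C y" "ksgn i / 2"]
              eqv_cst[OF br_tens_add_vec(2)[OF RLs(1)[OF add(2)] RLs(1)[OF add(3)]], of "lt_proj C y" "ksgn (fst (lt_proj C y)) / 2"]
              RLs(2)[OF add(2)] RLs(2)[OF add(3)]
            by (auto simp: br_co_simps br_co_wrd br_word_def lt_proj_add[OF add(2,3)] lt_proj(2)[OF add(2)] lt_proj(2)[OF add(3)] eqv_def diff_diff_eq distrib_left)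
        qed
      qed
    next
      case scale
      show ?thesis
      proof (intro ballI)
        fix u v assume uv: "u \<in> lists (co_letters C)" "v \<in> lists (co_letters C)"
        have eq: "wrd u * g * wrd v = wrd (u @ (i, co_scale C r a) # v) - cst r * wrd (u @ (i, a) # v)"
          by (simp add: scale(1) right_diff_distrib left_diff_distrib wrd_append wrd_Cons[of _ v] mult.assoc wrd_cst_commute)
        show "br_co \<phi> (wrd u * g * wrd v) \<in> I"
        proof (cases "length u + length v = 1")
          case False
          then show ?thesis
            unfolding eq by (simp add: br_co_simps br_co_wrd ID)
        next
          case True
          then obtain y where y: "(u = [] \<and> v = [y]) \<or> (u = [y] \<and> v = [])"
            using two by blast
          then have "lt_proj C y \<in> RL"
            using uv by (intro RLp) auto
          with y show ?thesis
            unfolding eq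
            using eqv_cst[OF br_tens_scale_vec(1)[OF RLs(1)[OF scale(2)]], of "lt_proj C y" "ksgn i / 2"]
              eqv_cst[OF br_tens_scale_vec(2)[OF RLs(1)[OF scale(2)]], of "lt_proj C y" "ksgn (fst (lt_proj C y)) / 2"]
              RLs(2)[OF scale(2)]
            by (auto simp: br_co_simps br_co_wrd br_word_def lt_proj_scale[OF scale(2)] lt_proj(2)[OF scale(2)] eqv_def cst_collect)
        qed
      qed
    qed
  next
    case zero
    then show ?case
      by (simp add: br_co_simps ID)
  next
    case (add x y)
    then show ?case
      by (simp add: br_co_simps ID distrib_left distrib_right)
  next
    case (left a x)
    show ?case
    proof (intro ballI)
      fix u v assume uv: "u \<in> lists (co_letters C)" "v \<in> lists (co_letters C)"
      from left(1) show "br_co \<phi> (wrd u * (a * x) * wrd v) \<in> I"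
      proof (induction rule: falg_induct)
        case (word r w)
        have "wrd u * (cst r * wrd w * x) * wrd v = cst r * (wrd (u @ w) * x * wrd v)"
          by (simp add: wrd_append mult.assoc wrd_cst_commute)
        then show ?case
          using left(3) uv word by (simp add: br_co_simps ID)
      qed (simp_all add: br_co_simps ID distrib_left distrib_right)
    qed
  next
    case (right a x)
    show ?case
    proof (intro ballI)
      fix u v assume uv: "u \<in> lists (co_letters C)" "v \<in> lists (co_letters C)"
      from right(1) show "br_co \<phi> (wrd u * (x * a) * wrd v) \<in> I"
      proof (induction rule: falg_induct)
        case (word r w)
        have "wrd u * (x * (cst r * wrd w)) * wrd v = cst r * (wrd u * x * wrd (w @ v))"
          by (simp add: wrd_append mult.assoc wrd_cst_commute cst_left_commute[of x])
        then show ?case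
          using right(3) uv word by (simp add: br_co_simps ID)
      qed (simp_all add: br_co_simps ID distrib_left distrib_right)
    qed
  qed
  from this[rule_format, of "[]" "[]"] show ?thesis
    by simp
qed

lemma br_co_tens_eq: "tens_eq C s t \<Longrightarrow> br_co \<phi> s \<simeq>\<^sub>c br_co \<phi> t"
  using br_co_tens_rel[of "s - t" \<phi>] by (simp add: tens_eq_def eqv_def br_co_simps)

lemma lt_diff_RL: "x \<in> RL \<Longrightarrow> lt_diff C x \<in> RL"
  using coaug_conilp_cocomm_dg_coalgebra.diff_in[OF C, of "snd x" "fst x"]
    coaug_conilp_cocomm_dg_coalgebra.unit_diff[OF C, of "snd x"]
  by (auto simp: red_letters_def red_piece_def lt_diff_def lt_unit_def)

definition ce_dl :: "('g, 'r, 'c) ce_letter \<Rightarrow> ('g, 'r, 'c) ce_letter list \<Rightarrow>\<^sub>0 'r"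
  where "ce_dl x = ce_d1 C x + ce_d2 \<iota> L l C x"

lemma ce_dl_homog:
  assumes "x \<in> S"
  shows "homog S (ce_deg x + (- 1)) (ce_dl x)"
proof -
  obtain \<phi> u where x: "x = (\<phi>, u)" "\<phi> \<in> V" "u \<in> RL"
    using assms by (cases x) (auto simp: S_RL)
  have "homog S (ce_deg x - 1) (ce_d1 C x)"
    unfolding ce_d1_def
    by (intro homog_closed) (use x lt_diff_RL[OF x(3)] in \<open>auto simp: S_RL ce_deg_def lt_diff_def\<close>)
  then show ?thesis
    using ce_d2_eqv(2)[OF assms] by (simp add: ce_dl_def homog_closed)
qed

lemma ce_dl_eqv: "x \<in> S \<Longrightarrow> ce_dl x \<simeq>\<^sub>c ce_d1 C x + ce_d2' x"
  unfolding ce_dl_def by (intro eqv_add eqv_refl ce_d2_eqv)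

lemma ce_d2'_add_fun: "ce_d2' (\<lambda>x. \<phi> x + \<psi> x, y) = ce_d2' (\<phi>, y) + ce_d2' (\<psi>, y)"
  by (simp add: ce_d2'_def linext_def br_word_def[abs_def] br_tens_add_fun distrib_left sum.distrib)

lemma ce_d2'_scale_fun: "ce_d2' (\<lambda>x. r * \<phi> x, y) = cst r * ce_d2' (\<phi>, y)"
  by (simp add: ce_d2'_def linext_def br_word_def[abs_def] br_tens_scale_fun sum_distrib_left cst_collect)

text \<open>The differential descends to the quotient. Linearity in the coalgebra variable is the
  delicate point: comultiplication is linear only up to \<open>tens_eq\<close>, and
  \<open>br_co\<close> turns this into congruence modulo \<open>I\<close>.\<close>

lemma ce_d_I: "p \<in> I \<Longrightarrow> ce_der (- 1) ce_dl p \<in> I"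
proof (rule ce_der_I)
  show "homog S (ce_deg x + - 1) (ce_dl x)" if "x \<in> S" for x
    using ce_dl_homog[OF that] .
  fix \<phi> i c assume \<phi>: "\<phi> \<in> V" and c: "c \<in> red_piece C i"
  then have x: "(\<phi>, i, c) \<in> S"
    by (simp add: S_iff)
  have dc: "co_diff C i c \<in> red_piece C (i - 1)"
    using lt_diff_RL[of "(i, c)"] c by (simp add: lt_diff_def)
  show "ce_dl (\<lambda>x. \<phi> x + \<psi> x, i, c) \<simeq>\<^sub>c ce_dl (\<phi>, i, c) + ce_dl (\<psi>, i, c)" if \<psi>: "\<psi> \<in> V" for \<psi>
  proof -
    have "ce_dl (\<lambda>x. \<phi> x + \<psi> x, i, c) \<simeq>\<^sub>c ce_d1 C (\<lambda>x. \<phi> x + \<psi> x, i, c) + ce_d2' (\<lambda>x. \<phi> x + \<psi> x, i, c)"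
      using \<phi> \<psi> c by (intro ce_dl_eqv) (simp add: S_iff V_closed)
    also have "\<dots> \<simeq>\<^sub>c - (gen (\<phi>, i - 1, co_diff C i c) + gen (\<psi>, i - 1, co_diff C i c)) + (ce_d2' (\<phi>, i, c) + ce_d2' (\<psi>, i, c))"
      unfolding ce_d2'_add_fun ce_d1_def lt_diff_def fst_conv snd_conv
      by (intro eqv_add eqv_uminus gen_add_fun eqv_refl \<phi> \<psi> dc)
    also have "\<dots> = (ce_d1 C (\<phi>, i, c) + ce_d2' (\<phi>, i, c)) + (ce_d1 C (\<psi>, i, c) + ce_d2' (\<psi>, i, c))"
      by (simp add: ce_d1_def lt_diff_def)
    also have "\<dots> \<simeq>\<^sub>c ce_dl (\<phi>, i, c) + ce_dl (\<psi>, i, c)"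
      using \<phi> \<psi> c by (intro eqv_add eqv_sym[OF ce_dl_eqv]) (simp_all add: S_iff)
    finally show ?thesis .
  qed
  show "ce_dl (\<lambda>x. r * \<phi> x, i, c) \<simeq>\<^sub>c cst r * ce_dl (\<phi>, i, c)" for r
  proof -
    have "ce_dl (\<lambda>x. r * \<phi> x, i, c) \<simeq>\<^sub>c ce_d1 C (\<lambda>x. r * \<phi> x, i, c) + ce_d2' (\<lambda>x. r * \<phi> x, i, c)"
      using \<phi> c by (intro ce_dl_eqv) (simp add: S_iff V_closed)
    also have "\<dots> \<simeq>\<^sub>c - (cst r * gen (\<phi>, i - 1, co_diff C i c)) + cst r * ce_d2' (\<phi>, i, c)"
      unfolding ce_d2'_scale_fun ce_d1_def lt_diff_def fst_conv snd_conv
      by (intro eqv_add eqv_uminus gen_scale_fun eqv_refl \<phi> dc)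
    also have "\<dots> = cst r * (ce_d1 C (\<phi>, i, c) + ce_d2' (\<phi>, i, c))"
      by (simp add: ce_d1_def lt_diff_def algebra_simps)
    also have "\<dots> \<simeq>\<^sub>c cst r * ce_dl (\<phi>, i, c)"
      by (intro eqv_cst eqv_sym[OF ce_dl_eqv] x)
    finally show ?thesis .
  qed
  show "ce_dl (\<phi>, i, c + b) \<simeq>\<^sub>c ce_dl (\<phi>, i, c) + ce_dl (\<phi>, i, b)" if b: "b \<in> red_piece C i" for b
  proof -
    have cb: "c \<in> co_piece C i" "b \<in> co_piece C i"
      using c b by (auto simp: red_piece_def)
    have db: "co_diff C i b \<in> red_piece C (i - 1)"
      using lt_diff_RL[of "(i, b)"] b by (simp add: lt_diff_def)
    have "br_co \<phi> (lt_mult C (i, c + b)) \<simeq>\<^sub>c br_co \<phi> (lt_mult C (i, c) + lt_mult C (i, b))"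
      using coaug_conilp_cocomm_dg_coalgebra.mult_add[OF C cb] by (intro br_co_tens_eq) (simp add: lt_mult_def)
    then have d2: "ce_d2' (\<phi>, i, c + b) \<simeq>\<^sub>c ce_d2' (\<phi>, i, c) + ce_d2' (\<phi>, i, b)"
      using eqv_uminus c b by (fastforce simp: ce_d2'_br_co br_co_simps red_closed)
    have "ce_dl (\<phi>, i, c + b) \<simeq>\<^sub>c ce_d1 C (\<phi>, i, c + b) + ce_d2' (\<phi>, i, c + b)"
      using \<phi> c b by (intro ce_dl_eqv) (simp add: S_iff red_closed)
    also have "\<dots> \<simeq>\<^sub>c - (gen (\<phi>, i - 1, co_diff C i c) + gen (\<phi>, i - 1, co_diff C i b)) + (ce_d2' (\<phi>, i, c) + ce_d2' (\<phi>, i, b))"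
      unfolding ce_d1_def lt_diff_def fst_conv snd_conv coaug_conilp_cocomm_dg_coalgebra.diff_add[OF C cb]
      by (intro eqv_add eqv_uminus gen_add_vec d2 \<phi> dc db)
    also have "\<dots> = (ce_d1 C (\<phi>, i, c) + ce_d2' (\<phi>, i, c)) + (ce_d1 C (\<phi>, i, b) + ce_d2' (\<phi>, i, b))"
      by (simp add: ce_d1_def lt_diff_def)
    also have "\<dots> \<simeq>\<^sub>c ce_dl (\<phi>, i, c) + ce_dl (\<phi>, i, b)"
      using \<phi> b c by (intro eqv_add eqv_sym[OF ce_dl_eqv]) (simp_all add: S_iff)
    finally show ?thesis .
  qed
  show "ce_dl (\<phi>, i, co_scale C s c) \<simeq>\<^sub>c cst (\<iota> s) * ce_dl (\<phi>, i, c)" for s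
  proof -
    have cb: "c \<in> co_piece C i"
      using c by (auto simp: red_piece_def)
    have "br_co \<phi> (lt_mult C (i, co_scale C s c)) \<simeq>\<^sub>c br_co \<phi> (cst s * lt_mult C (i, c))"
      using coaug_conilp_cocomm_dg_coalgebra.mult_scale[OF C cb] by (intro br_co_tens_eq) (simp add: lt_mult_def)
    then have d2: "ce_d2' (\<phi>, i, co_scale C s c) \<simeq>\<^sub>c cst (\<iota> s) * ce_d2' (\<phi>, i, c)"
      using eqv_uminus c by (fastforce simp: ce_d2'_br_co br_co_simps red_closed)
    have "ce_dl (\<phi>, i, co_scale C s c) \<simeq>\<^sub>c ce_d1 C (\<phi>, i, co_scale C s c) + ce_d2' (\<phi>, i, co_scale C s c)"
      using \<phi> c by (intro ce_dl_eqv) (simp add: S_iff red_closed)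
    also have "\<dots> \<simeq>\<^sub>c - (cst (\<iota> s) * gen (\<phi>, i - 1, co_diff C i c)) + cst (\<iota> s) * ce_d2' (\<phi>, i, c)"
      unfolding ce_d1_def lt_diff_def fst_conv snd_conv coaug_conilp_cocomm_dg_coalgebra.diff_scale[OF C cb]
      by (intro eqv_add eqv_uminus gen_scale_vec d2 \<phi> dc)
    also have "\<dots> = cst (\<iota> s) * (ce_d1 C (\<phi>, i, c) + ce_d2' (\<phi>, i, c))"
      by (simp add: ce_d1_def lt_diff_def algebra_simps)
    also have "\<dots> \<simeq>\<^sub>c cst (\<iota> s) * ce_dl (\<phi>, i, c)"
      by (intro eqv_cst eqv_sym[OF ce_dl_eqv] x)
    finally show ?thesis .
  qed
qed

lemma ce_d_falg: "p \<in> falg S \<Longrightarrow> ce_der (- 1) ce_dl p \<in> falg S"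
  using ce_dl_homog by (intro ce_der_falg) (auto simp: homog_def)

section \<open>The coadjoint action and its commutation with the differential\<close>

definition coad_der :: "'g \<Rightarrow> (('g, 'r, 'c) ce_letter list \<Rightarrow>\<^sub>0 'r) \<Rightarrow> ('g, 'r, 'c) ce_letter list \<Rightarrow>\<^sub>0 'r"
  where "coad_der z = ce_der 0 (\<lambda>x. gen (coad L l z (fst x), snd x))"

lemma coad_der_semilinear: "semilinear id (coad_der z)"
  unfolding coad_der_def by (rule ce_der_semilinear)

lemmas coad_der_simps = semilinearD[OF coad_der_semilinear, unfolded id_apply]

lemma coad_der_cst [simp]: "coad_der z (cst r) = 0"
  by (simp add: coad_der_def)

lemma coad_der_mult: "coad_der z (p * q) = coad_der z p * q + p * coad_der z q"
  by (simp add: coad_der_def ce_der_mult)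

lemma coad_V:
  assumes z: "z \<in> l" and \<phi>: "\<phi> \<in> V"
  shows "coad L l z \<phi> \<in> V"
  using z l_closed
  by (auto simp: lie_dual_def coad_def lie.br_add_right lie.br_scale_right VD(1,2)[OF \<phi>])

lemma coad_add: "coad L l z (\<lambda>x. \<phi> x + \<psi> x) = (\<lambda>x. coad L l z \<phi> x + coad L l z \<psi> x)"
  by (auto simp: coad_def)

lemma coad_scale: "coad L l z (\<lambda>x. r * \<phi> x) = (\<lambda>x. r * coad L l z \<phi> x)"
  by (auto simp: coad_def)

lemma coad_der_I:
  assumes z: "z \<in> l" and p: "p \<in> I"
  shows "coad_der z p \<in> I"
  unfolding coad_der_def
proof (rule ce_der_I[OF _ _ _ _ _ p])
  show "homog S (ce_deg x + 0) (gen (coad L l z (fst x), snd x))" if "x \<in> S" for x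
    using that by (intro homog_closed) (cases x; simp add: S_iff coad_V[OF z] ce_deg_def)+
qed (simp_all add: coad_add coad_scale coad_V[OF z] gen_add_fun gen_scale_fun gen_add_vec gen_scale_vec)

text \<open>The Jacobi identity in dual form: the cobracket is equivariant for the coadjoint
  action.\<close>

lemma coad_br:
  assumes z: "z \<in> l" and u: "u \<in> l" and v: "v \<in> l" and \<phi>: "\<phi> \<in> V"
  shows "- \<phi> (lie_br L (lie_br L z u) v) - \<phi> (lie_br L u (lie_br L z v)) = coad L l z \<phi> (lie_br L u v)"
proof -
  have anti: "lie_br L x y = - lie_br L y x" for x y
    using lie.br_self[of "x + y"] lie.br_self[of x] lie.br_self[of y]
    by (simp add: lie.br_add_left lie.br_add_right add_eq_0_iff2)
  have neg: "lie_br L x (- y) = - lie_br L x y" for x y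
    using lie.br_add_right[of x y "- y"] lie.br_add_right[of x 0 0]
    by (simp add: add_eq_0_iff2 minus_equation_iff[of "lie_br L x y"])
  have "lie_br L z (lie_br L u v) + lie_br L u (lie_br L v z) + lie_br L v (lie_br L z u) = 0"
    by (rule lie.jacobi)
  moreover have "lie_br L u (lie_br L v z) = - lie_br L u (lie_br L z v)"
    using anti[of v z] neg by simp
  moreover have "lie_br L v (lie_br L z u) = - lie_br L (lie_br L z u) v"
    by (rule anti)
  ultimately have "lie_br L z (lie_br L u v) = lie_br L (lie_br L z u) v + lie_br L u (lie_br L z v)"
    by (simp add: algebra_simps)
  then show ?thesis
    using z u v by (simp add: coad_def l_closed VD(1)[OF \<phi>])
qed

lemma coad_br_tens:
  assumes z: "z \<in> l" and \<phi>: "\<phi> \<in> V" and y: "y \<in> RL" and x: "x \<in> RL"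
  shows "coad_der z (br_tens \<phi> y x) \<simeq>\<^sub>c br_tens (coad L l z \<phi>) y x"
proof -
  let ?F = "\<lambda>b. coad L l z (dual b)"
  \<comment> \<open>\<open>A1\<close> and \<open>A2\<close> are the coefficients in the dual basis
    of the cobracket after the coadjoint action on its first and on its second factor.\<close>
  define A1 where "A1 b b' = (\<Sum>a\<in>\<B> \<times> \<B>. \<phi> (lie_br L (fst a) (snd a)) * ?F (fst a) b * dual (snd a) b')" for b b'
  define A2 where "A2 b b' = (\<Sum>a\<in>\<B> \<times> \<B>. \<phi> (lie_br L (fst a) (snd a)) * dual (fst a) b * ?F (snd a) b')" for b b'
  have gen: "coad_der z (gen (\<psi>, w)) = gen (coad L l z \<psi>, w)" for \<psi> w
    by (simp add: coad_der_def)
  have "coad_der z (br_tens \<phi> y x) =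
      (\<Sum>(b, b')\<in>\<B> \<times> \<B>. cst (\<phi> (lie_br L b b')) * (gen (?F b, y) * gen (dual b', x))) +
      (\<Sum>(b, b')\<in>\<B> \<times> \<B>. cst (\<phi> (lie_br L b b')) * (gen (dual b, y) * gen (?F b', x)))"
    by (simp add: br_tens_def sum.cartesian_product case_prod_unfold coad_der_simps coad_der_mult gen distrib_left sum.distrib)
  also have "\<dots> \<simeq>\<^sub>c
      (\<Sum>b\<in>\<B>. \<Sum>b'\<in>\<B>. cst (A1 b b') * (gen (dual b, y) * gen (dual b', x))) +
      (\<Sum>b\<in>\<B>. \<Sum>b'\<in>\<B>. cst (A2 b b') * (gen (dual b, y) * gen (dual b', x)))"
    unfolding case_prod_unfold A1_def A2_def
    by (intro eqv_add tens_expand) (auto simp: dual_V coad_V z x y)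
  also have "\<dots> = br_tens (coad L l z \<phi>) y x"
  proof -
    have "A1 b b' + A2 b b' = coad L l z \<phi> (lie_br L b b')" if b: "b \<in> \<B>" "b' \<in> \<B>" for b b'
    proof -
      have "A1 b b' = - \<phi> (lie_br L (lie_br L z b) b')"
        using br_expand[OF \<phi>, of "lie_br L z b" b'] b
        by (simp add: A1_def coad_def basis_l l_closed z case_prod_unfold sum_negf mult.assoc)
      moreover have "A2 b b' = - \<phi> (lie_br L b (lie_br L z b'))"
        using br_expand[OF \<phi>, of b "lie_br L z b'"] b
        by (simp add: A2_def coad_def basis_l l_closed z case_prod_unfold sum_negf mult.assoc)
      ultimately show ?thesis
        using coad_br[OF z basis_l basis_l \<phi>, of b b'] b by simp
    qed
    then have "br_tens (coad L l z \<phi>) y x =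
        (\<Sum>b\<in>\<B>. \<Sum>b'\<in>\<B>. cst (A1 b b' + A2 b b') * (gen (dual b, y) * gen (dual b', x)))"
      unfolding br_tens_def by (intro sum.cong refl) simp
    then show ?thesis
      by (simp add: cst_add distrib_right sum.distrib)
  qed
  finally show ?thesis .
qed

lemma br_word_eqv_cong:
  assumes "w \<in> Poly_Mapping.keys (red_mult C y)" "y \<in> RL"
    and "\<And>u v. u \<in> RL \<Longrightarrow> v \<in> RL \<Longrightarrow> h (br_tens \<phi> u v) \<simeq>\<^sub>c br_tens \<psi> u v"
    and "\<And>r p. h (cst r * p) = cst r * h p"
  shows "h (br_word \<phi> w) \<simeq>\<^sub>c br_word \<psi> w"
proof -
  obtain u v where w: "w = [u, v]" "u \<in> RL" "v \<in> RL"
    using red_mult_keys[OF assms(2,1)] by metis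
  then show ?thesis
    by (simp add: br_word_def assms eqv_cst)
qed

lemma coad_ce_dl:
  assumes z: "z \<in> l" and x: "x \<in> S"
  shows "coad_der z (ce_dl x) \<simeq>\<^sub>c ce_dl (coad L l z (fst x), snd x)"
proof -
  obtain \<phi> y where xy: "x = (\<phi>, y)" "\<phi> \<in> V" "y \<in> RL"
    using x by (cases x) (auto simp: S_RL)
  have "coad_der z (ce_dl x) - coad_der z (ce_d1 C x + ce_d2' x) \<in> I"
    using coad_der_I[OF z] ce_dl_eqv[OF x] by (simp add: eqv_def flip: coad_der_simps(5))
  then have "coad_der z (ce_dl x) \<simeq>\<^sub>c coad_der z (ce_d1 C x) + coad_der z (ce_d2' x)"
    by (simp add: eqv_def coad_der_simps)
  also have "\<dots> \<simeq>\<^sub>c ce_d1 C (coad L l z \<phi>, y) + ce_d2' (coad L l z \<phi>, y)"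
  proof (rule eqv_add)
    show "coad_der z (ce_d1 C x) \<simeq>\<^sub>c ce_d1 C (coad L l z \<phi>, y)"
      by (simp add: ce_d1_def xy coad_der_simps) (simp add: coad_der_def)
    have "coad_der z (ce_d2' x) = - linext \<iota> (\<lambda>w. coad_der z (br_word \<phi> w)) (red_mult C y)"
      by (simp add: ce_d2'_def xy linext_def coad_der_simps)
    moreover have "\<dots> \<simeq>\<^sub>c ce_d2' (coad L l z \<phi>, y)"
      unfolding ce_d2'_def fst_conv snd_conv
      by (intro eqv_uminus linext_eqv br_word_eqv_cong) (auto simp: xy coad_br_tens z coad_der_simps)
    ultimately show "coad_der z (ce_d2' x) \<simeq>\<^sub>c ce_d2' (coad L l z \<phi>, y)"
      by simp
  qed
  also have "\<dots> \<simeq>\<^sub>c ce_dl (coad L l z \<phi>, y)"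
    using xy by (intro eqv_sym[OF ce_dl_eqv]) (simp add: S_RL coad_V z)
  finally show ?thesis
    by (simp add: xy)
qed

text \<open>This makes the Lie invariants a complex. Both composites obey the same recursion on
  words: the coadjoint derivation has degree 0 and preserves the degree of letters, so no sign
  separates them.\<close>

lemma coad_d_comm:
  assumes z: "z \<in> l" and p: "p \<in> falg S"
  shows "coad_der z (ce_der (- 1) ce_dl p) \<simeq>\<^sub>c ce_der (- 1) ce_dl (coad_der z p)"
  unfolding eqv_def
proof (rule semilinear_congruent[OF _ _ ideal_I _ p])
  show "semilinear (\<lambda>r. id (id r)) (\<lambda>p. coad_der z (ce_der (- 1) ce_dl p))"
    "semilinear (\<lambda>r. id (id r)) (\<lambda>p. ce_der (- 1) ce_dl (coad_der z p))"
    by (rule semilinear_compose[OF ce_der_semilinear coad_der_semilinear],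
        rule semilinear_compose[OF coad_der_semilinear ce_der_semilinear])
  let ?d = "ce_der (- 1) ce_dl"
  fix w assume "w \<in> lists S"
  then show "coad_der z (?d (wrd w)) - ?d (coad_der z (wrd w)) \<in> I"
  proof (induction w)
    case (Cons x w)
    let ?x = "(coad L l z (fst x), snd x)"
    let ?s = "cst (ksgn (- ce_deg x)) :: ('g, 'r, 'c) ce_letter list \<Rightarrow>\<^sub>0 'r"
    have xS: "x \<in> S" and w: "wrd w \<in> falg S" and IH: "coad_der z (?d (wrd w)) \<simeq>\<^sub>c ?d (coad_der z (wrd w))"
      using Cons by (auto simp: eqv_def intro: falg_closed)
    have x'S: "?x \<in> S"
      using xS by (cases x) (simp add: S_iff coad_V z)
    have deg: "ce_deg ?x = ce_deg x"
      by (simp add: ce_deg_def)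
    have gx: "coad_der z (gen x) = gen ?x"
      by (simp add: coad_der_def)
    have dx: "?d (gen y * q) = ce_dl y * q + cst (ksgn (- ce_deg y)) * (gen y * ?d q)" for y q
      by (simp add: ce_der_mult gsgn_wrd mult.assoc)
    have "coad_der z (?d (wrd (x # w))) =
        (coad_der z (ce_dl x) * wrd w + ce_dl x * coad_der z (wrd w)) +
        ?s * (gen ?x * ?d (wrd w) + gen x * coad_der z (?d (wrd w)))"
      by (simp add: wrd_Cons[of x w] dx coad_der_simps coad_der_mult gx)
    also have "\<dots> \<simeq>\<^sub>c (ce_dl ?x * wrd w + ce_dl x * coad_der z (wrd w)) +
        ?s * (gen ?x * ?d (wrd w) + gen x * ?d (coad_der z (wrd w)))"
      by (intro eqv_add eqv_cst eqv_right eqv_left eqv_refl coad_ce_dl z xS IH w gen_falg)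
    also have "\<dots> = ?d (coad_der z (wrd (x # w)))"
      by (simp add: wrd_Cons[of x w] coad_der_mult gx ce_der_simps dx deg distrib_left)
    finally show ?case
      by (simp add: eqv_def)
  qed (simp add: coad_der_simps coad_der_def ce_der_simps ID)
qed

end

section \<open>Functoriality\<close>

text \<open>The common pattern of restriction, extension of scalars and conjugation:
  \<open>F\<close> acts on the functional and the coalgebra variable stays fixed. The equation for
  \<open>\<kappa>\<close> and \<open>\<iota>\<close> makes scalars from the ground field act
  compatibly on both sides.\<close>

locale ce_letter_map =
  src: ce_setup \<iota> L l C + tgt: ce_setup \<iota>' L l' C
  for \<iota> :: "'k::field \<Rightarrow> 'r::field" and \<iota>' :: "'k \<Rightarrow> 's::field"
    and L :: "('k, 'g::ab_group_add) lie_alg" and l l' :: "'g set"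
    and C :: "('k, 'c::ab_group_add) coalg" +
  fixes \<kappa> :: "'r \<Rightarrow> 's" and F :: "('g \<Rightarrow> 'r) \<Rightarrow> 'g \<Rightarrow> 's"
  assumes \<kappa>: "field_hom \<kappa>" and \<kappa>\<iota>: "\<kappa> (\<iota> a) = \<iota>' a"
    and F_V: "\<phi> \<in> lie_dual \<iota> L l \<Longrightarrow> F \<phi> \<in> lie_dual \<iota>' L l'"
    and F_add: "\<phi> \<in> lie_dual \<iota> L l \<Longrightarrow> \<psi> \<in> lie_dual \<iota> L l \<Longrightarrow> F (\<lambda>x. \<phi> x + \<psi> x) = (\<lambda>x. F \<phi> x + F \<psi> x)"
    and F_scale: "\<phi> \<in> lie_dual \<iota> L l \<Longrightarrow> F (\<lambda>x. r * \<phi> x) = (\<lambda>x. \<kappa> r * F \<phi> x)"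
begin

definition lm :: "(('g, 'r, 'c) ce_letter list \<Rightarrow>\<^sub>0 'r) \<Rightarrow> ('g, 's, 'c) ce_letter list \<Rightarrow>\<^sub>0 's"
  where "lm = letter_map \<kappa> (\<lambda>x. (F (fst x), snd x))"

lemma lm_semilinear: "semilinear \<kappa> lm"
  unfolding lm_def by (rule letter_map(1)[OF \<kappa>])

lemma lm_mult: "lm 1 = 1" "lm (cst r) = cst (\<kappa> r)" "lm (p * q) = lm p * lm q"
  unfolding lm_def by (simp_all add: letter_map[OF \<kappa>])

lemmas lm_simps = semilinearD[OF lm_semilinear] lm_mult

lemma lm_wrd: "lm (wrd w) = wrd (map (\<lambda>x. (F (fst x), snd x)) w)"
  unfolding lm_def by (rule letter_map(2)[OF \<kappa>])

lemma lm_gen: "lm (gen x) = gen (F (fst x), snd x)"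
  by (simp add: lm_wrd)

lemma letter_S: "x \<in> src.S \<Longrightarrow> (F (fst x), snd x) \<in> tgt.S"
  by (cases x) (auto simp: src.S_iff tgt.S_iff F_V)

lemma lm_falg: "p \<in> falg src.S \<Longrightarrow> lm p \<in> falg tgt.S"
  unfolding lm_def by (rule letter_map_falg[OF \<kappa> letter_S])

lemma ce_deg_letter [simp]: "ce_deg (F (fst x), snd x) = ce_deg x"
  by (simp add: ce_deg_def)

lemma lm_gproj: "lm (gproj n p) = gproj n (lm p)"
proof -
  have deg: "ce_word_deg (map (\<lambda>x. (F (fst x), snd x)) w) = ce_word_deg w" for w
    by (induction w) auto
  show ?thesis
    using falg_UNIV[of p]
    by (induction rule: falg_induct) (auto simp: gproj_simps lm_simps gproj_wrd lm_wrd deg)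
qed

lemma lm_I: "p \<in> src.I \<Longrightarrow> lm p \<in> tgt.I"
proof (induction rule: src.I_induct)
  case (add_fun \<phi> \<psi> i c)
  then show ?case
    using tgt.gen_add_fun[OF F_V F_V, of \<phi> \<psi> c i] by (simp add: lm_simps lm_gen F_add tgt.eqv_def diff_diff_eq)
next
  case (scale_fun r \<phi> i c)
  then show ?case
    using tgt.gen_scale_fun[OF F_V, of \<phi> c i] by (simp add: lm_simps lm_gen F_scale tgt.eqv_def)
next
  case (add_vec \<phi> i a b)
  then show ?case
    using tgt.gen_add_vec[OF F_V, of \<phi> a i b] by (simp add: lm_simps lm_gen tgt.eqv_def diff_diff_eq)
next
  case (scale_vec s \<phi> i c)
  then show ?case
    using tgt.gen_scale_vec[OF F_V, of \<phi> c i] by (simp add: lm_simps lm_gen \<kappa>\<iota> tgt.eqv_def)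
next
  case (comm x y)
  then show ?case
    using tgt.gen_comm[OF letter_S letter_S, of x y]
    by (simp add: lm_simps lm_gen tgt.eqv_def mult.assoc field_homD(8)[OF \<kappa>])
qed (simp_all add: lm_simps tgt.ID lm_falg)

text \<open>The hypothesis says that \<open>F\<close>, applied to both factors of the cobracket of
  \<open>\<phi>\<close> in the source basis, gives a tensor representing \<open>F \<phi>\<close>
  composed with the bracket. By \<open>tens_br_tens\<close> any such tensor may stand for the target
  cobracket.\<close>

lemma lm_ce_dl:
  assumes F_br: "\<And>\<phi> u v. \<phi> \<in> src.V \<Longrightarrow> u \<in> l' \<Longrightarrow> v \<in> l' \<Longrightarrow>
      (\<Sum>(b, b')\<in>src.\<B> \<times> src.\<B>. \<kappa> (\<phi> (lie_br L b b')) * F (src.dual b) u * F (src.dual b') v) = F \<phi> (lie_br L u v)"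
    and x: "x \<in> src.S"
  shows "tgt.eqv (lm (src.ce_dl x)) (tgt.ce_dl (F (fst x), snd x))"
proof -
  obtain \<phi> y where xy: "x = (\<phi>, y)" "\<phi> \<in> src.V" "y \<in> src.RL"
    using x by (cases x) (auto simp: src.S_RL)
  have br: "tgt.eqv (lm (src.br_tens \<phi> u v)) (tgt.br_tens (F \<phi>) u v)" if uv: "u \<in> src.RL" "v \<in> src.RL" for u v
  proof -
    have "lm (src.br_tens \<phi> u v) = (\<Sum>a\<in>src.\<B> \<times> src.\<B>. cst (\<kappa> (\<phi> (lie_br L (fst a) (snd a)))) *
        (gen (F (src.dual (fst a)), u) * gen (F (src.dual (snd a)), v)))"
      by (simp add: src.br_tens_def lm_simps lm_gen sum.cartesian_product case_prod_unfold)
    moreover have "tgt.eqv \<dots> (tgt.br_tens (F \<phi>) u v)"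
      by (rule tgt.tens_br_tens) (use F_br[OF xy(2)] uv in \<open>auto simp: F_V src.dual_V case_prod_unfold\<close>)
    ultimately show ?thesis
      by simp
  qed
  have "lm (src.ce_dl x) - lm (ce_d1 C x + src.ce_d2' x) \<in> tgt.I"
    using lm_I src.ce_dl_eqv[OF x] by (simp add: src.eqv_def flip: lm_simps(5))
  then have "tgt.eqv (lm (src.ce_dl x)) (lm (ce_d1 C x) + lm (src.ce_d2' x))"
    by (simp add: tgt.eqv_def lm_simps)
  also have "tgt.eqv \<dots> (ce_d1 C (F \<phi>, y) + tgt.ce_d2' (F \<phi>, y))"
  proof (rule tgt.eqv_add)
    show "tgt.eqv (lm (ce_d1 C x)) (ce_d1 C (F \<phi>, y))"
      by (simp add: ce_d1_def xy lm_simps lm_gen)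
    have "lm (src.ce_d2' x) = - linext \<iota>' (\<lambda>w. lm (src.br_word \<phi> w)) (red_mult C y)"
      by (simp add: src.ce_d2'_def xy linext_def lm_simps \<kappa>\<iota>)
    moreover have "tgt.eqv \<dots> (tgt.ce_d2' (F \<phi>, y))"
      unfolding tgt.ce_d2'_def fst_conv snd_conv
    proof (intro tgt.eqv_uminus tgt.linext_eqv)
      fix w assume "w \<in> Poly_Mapping.keys (red_mult C y)"
      then obtain u v where w: "w = [u, v]" "u \<in> src.RL" "v \<in> src.RL"
        using src.red_mult_keys[OF xy(3)] by metis
      \<comment> \<open>The coefficient 1/2 of the quadratic part must be fixed by
        \<open>\<kappa>\<close>.\<close>
      have "\<kappa> 2 = 2"
        using field_homD(10)[OF \<kappa>, of 2] by simp
      then have k: "\<kappa> (ksgn (fst u) / 2) = ksgn (fst u) / 2"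
        unfolding field_homD(9)[OF \<kappa>] field_homD(8)[OF \<kappa>] by simp
      show "tgt.eqv (lm (src.br_word \<phi> w)) (tgt.br_word (F \<phi>) w)"
        using br[OF w(2,3)] by (simp add: src.br_word_def tgt.br_word_def w lm_simps k tgt.eqv_cst)
    qed
    ultimately show "tgt.eqv (lm (src.ce_d2' x)) (tgt.ce_d2' (F \<phi>, y))"
      by simp
  qed
  also have "tgt.eqv \<dots> (tgt.ce_dl (F \<phi>, y))"
    using xy by (intro tgt.eqv_sym[OF tgt.ce_dl_eqv]) (simp add: tgt.S_RL F_V)
  finally show ?thesis
    by (simp add: xy)
qed

lemma lm_d:
  assumes F_br: "\<And>\<phi> u v. \<phi> \<in> src.V \<Longrightarrow> u \<in> l' \<Longrightarrow> v \<in> l' \<Longrightarrow>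
      (\<Sum>(b, b')\<in>src.\<B> \<times> src.\<B>. \<kappa> (\<phi> (lie_br L b b')) * F (src.dual b) u * F (src.dual b') v) = F \<phi> (lie_br L u v)"
    and p: "p \<in> falg src.S"
  shows "tgt.eqv (lm (ce_der (- 1) src.ce_dl p)) (ce_der (- 1) tgt.ce_dl (lm p))"
  unfolding tgt.eqv_def
proof (rule semilinear_congruent[OF _ _ tgt.ideal_I _ p])
  show "semilinear (\<lambda>r. \<kappa> (id r)) (\<lambda>p. lm (ce_der (- 1) src.ce_dl p))"
    by (rule semilinear_compose[OF ce_der_semilinear lm_semilinear])
  have "semilinear (\<lambda>r. id (\<kappa> r)) (\<lambda>p. ce_der (- 1) tgt.ce_dl (lm p))"
    by (rule semilinear_compose[OF lm_semilinear ce_der_semilinear])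
  then show "semilinear (\<lambda>r. \<kappa> (id r)) (\<lambda>p. ce_der (- 1) tgt.ce_dl (lm p))"
    by simp
  fix w assume "w \<in> lists src.S"
  then show "lm (ce_der (- 1) src.ce_dl (wrd w)) - ce_der (- 1) tgt.ce_dl (lm (wrd w)) \<in> tgt.I"
  proof (induction w)
    case (Cons x w)
    let ?x = "(F (fst x), snd x)"
    have xS: "x \<in> src.S" and w: "lm (wrd w) \<in> falg tgt.S"
      and IH: "tgt.eqv (lm (ce_der (- 1) src.ce_dl (wrd w))) (ce_der (- 1) tgt.ce_dl (lm (wrd w)))"
      using Cons by (auto simp: tgt.eqv_def intro: falg_closed lm_falg)
    have "lm (ce_der (- 1) src.ce_dl (wrd (x # w))) =
        lm (src.ce_dl x) * lm (wrd w) + cst (ksgn (- ce_deg x)) * (gen ?x * lm (ce_der (- 1) src.ce_dl (wrd w)))"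
      by (simp add: ce_der_Cons lm_simps lm_gen field_homD(8)[OF \<kappa>])
    also have "tgt.eqv \<dots> (tgt.ce_dl ?x * lm (wrd w) + cst (ksgn (- ce_deg x)) * (gen ?x * ce_der (- 1) tgt.ce_dl (lm (wrd w))))"
      by (intro tgt.eqv_add tgt.eqv_cst tgt.eqv_right tgt.eqv_left lm_ce_dl F_br xS IH w tgt.gen_falg letter_S)
    also have "\<dots> = ce_der (- 1) tgt.ce_dl (lm (wrd (x # w)))"
      by (simp add: lm_wrd ce_der_Cons)
    finally show ?case
      by (simp add: tgt.eqv_def)
  qed (simp add: lm_simps tgt.ID)
qed

end

section \<open>Invariance under the group\<close>

lemma mat_scale_mult:
  "A ** mat_scale c B = mat_scale c (A ** B)" "mat_scale c A ** B = mat_scale c (A ** B)"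
  by (simp_all add: matrix_matrix_mult_def mat_scale_def vec_eq_iff sum_distrib_left mult_ac)

lemma mat_mult_distrib:
  fixes A B D :: "'a::field ^ 'm ^ 'm"
  shows "A ** (B + D) = A ** B + A ** D" "(A + B) ** D = A ** D + B ** D"
    "A ** (B - D) = A ** B - A ** D" "(A - B) ** D = A ** D - B ** D"
  by (simp_all add: matrix_matrix_mult_def vec_eq_iff sum.distrib sum_subtractf algebra_simps)

text \<open>The cofactor form makes the entries visibly polynomial, while on invertible matrices the
  adjugate is the inverse multiplied by the determinant.\<close>

definition adjugate :: "'a::field ^ 'm ^ 'm \<Rightarrow> 'a ^ 'm ^ 'm"
  where "adjugate A = (\<chi> i k. det (\<chi> r. if r = k then axis i 1 else row r A))"

text \<open>By linearity of \<open>det\<close> in row \<open>k\<close>, the entry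
  \<open>(j, k)\<close> of the product is the determinant of \<open>A\<close> with row
  \<open>k\<close> replaced by row \<open>j\<close>. It is 0 for \<open>j \<noteq> k\<close>, since
  two rows coincide.\<close>

lemma mult_adjugate: "A ** adjugate A = mat_scale (det A) (mat 1)"
proof -
  have "(\<Sum>i\<in>UNIV. A $ j $ i * det (\<chi> r. if r = k then axis i 1 else row r A)) = (if j = k then det A else 0)" for j k
  proof -
    have "(\<Sum>i\<in>UNIV. A $ j $ i * det (\<chi> r. if r = k then axis i 1 else row r A)) =
        (\<Sum>i\<in>UNIV. det (\<chi> r. if r = k then A $ j $ i *s axis i 1 else row r A))"
      using det_row_mul[of k "A $ j $ _" "\<lambda>r. axis _ 1" "\<lambda>r. row r A"] by simp
    also have "\<dots> = det (\<chi> r. if r = k then (\<Sum>i\<in>UNIV. A $ j $ i *s axis i 1) else row r A)"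
      by (rule det_linear_row_sum[symmetric]) simp
    also have "(\<Sum>i\<in>UNIV. A $ j $ i *s axis i 1) = (\<Sum>i\<in>UNIV. axis j 1 $ i *s row i A)"
      by (simp add: vec_eq_iff axis_def row_def if_distrib if_distribR cong: if_cong)
    also have "det (\<chi> r. if r = k then \<dots> else row r A) = axis j 1 $ k * det A"
      by (rule cramer_lemma_transpose)
    finally show ?thesis
      by (simp add: axis_def)
  qed
  then show ?thesis
    by (simp add: adjugate_def matrix_matrix_mult_def mat_scale_def mat_def vec_eq_iff)
qed

lemma adjugate_inverse:
  assumes "invertible A"
  shows "adjugate A = mat_scale (det A) (matrix_inv A)"
proof -
  have "adjugate A = matrix_inv A ** (A ** adjugate A)"
    by (simp add: matrix_mul_assoc matrix_inv_works[OF assms])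
  also have "\<dots> = mat_scale (det A) (matrix_inv A)"
    by (simp add: mult_adjugate mat_scale_mult)
  finally show ?thesis .
qed

lemma polyfun_adjugate: "(\<lambda>A. adjugate A $ i $ k) \<in> polyfun"
proof -
  have "(\<lambda>A. (if r = k then axis i 1 else row r A) $ s) \<in> polyfun" for r s
    by (cases "r = k") (auto simp: row_def intro: polyfun.intros)
  then show ?thesis
    by (auto simp: adjugate_def det_def intro!: polyfun_sum polyfun_cmult polyfun_prod)
qed

text \<open>The identity of \<open>mult_adjugate\<close> is differentiated along the field of
  \<open>Y\<close>, under which \<open>A\<close> has derivative \<open>A ** Y\<close>, and
  \<open>A\<close> is then cancelled on the left.\<close>

lemma pder_adjugate:
  fixes A Y :: "'a::field_char_0 ^ 'm ^ 'm"
  assumes A: "invertible A"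
  shows "pder Y (\<lambda>A. adjugate A $ i $ k) A =
    (mat_scale (pder Y det (mat 1)) (adjugate A) - Y ** adjugate A) $ i $ k"
proof -
  define D where "D = (\<chi> i k. pder Y (\<lambda>A. adjugate A $ i $ k) A)"
  let ?c = "pder Y det (mat 1)"
  have det: "det A \<noteq> 0"
    using A by (simp add: invertible_det_nz)
  have "A ** Y ** adjugate A + A ** D = mat_scale (?c * det A) (mat 1)"
  proof -
    have "(A ** Y ** adjugate A + A ** D) $ j $ k = mat_scale (?c * det A) (mat 1) $ j $ k" for j k
    proof -
      have "(\<lambda>A :: 'a ^ 'm ^ 'm. \<Sum>i\<in>UNIV. A $ j $ i * adjugate A $ i $ k) = (\<lambda>A. mat 1 $ j $ k * det A)"
      proof (rule ext)
        fix A :: "'a ^ 'm ^ 'm"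
        have "(A ** adjugate A) $ j $ k = mat_scale (det A) (mat 1) $ j $ k"
          by (simp add: mult_adjugate)
        then show "(\<Sum>i\<in>UNIV. A $ j $ i * adjugate A $ i $ k) = mat 1 $ j $ k * det A"
          by (simp add: matrix_matrix_mult_def mat_scale_def)
      qed
      then have "pder Y (\<lambda>A. \<Sum>i\<in>UNIV. A $ j $ i * adjugate A $ i $ k) A = pder Y (\<lambda>A. mat 1 $ j $ k * det A) A"
        by simp
      then have "(\<Sum>i\<in>UNIV. (A ** Y) $ j $ i * adjugate A $ i $ k + A $ j $ i * D $ i $ k) = mat 1 $ j $ k * (?c * det A)"
        by (simp add: pder_sum pder_mult polyfun.intros polyfun_adjugate pder_cmult polyfun_det pder_det[of Y A] D_def)
      then show ?thesis
        by (simp add: matrix_matrix_mult_def[of _ "adjugate A"] matrix_matrix_mult_def[of _ D] mat_scale_def sum.distrib mult.commute)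
    qed
    then show ?thesis
      by (simp add: vec_eq_iff)
  qed
  then have "matrix_inv A ** (A ** Y ** adjugate A + A ** D) = matrix_inv A ** mat_scale (?c * det A) (mat 1)"
    by simp
  then have "Y ** adjugate A + D = mat_scale ?c (adjugate A)"
    by (simp add: mat_mult_distrib matrix_mul_assoc matrix_inv_works[OF A] mat_scale_mult adjugate_inverse[OF A])
  then have "D = mat_scale ?c (adjugate A) - Y ** adjugate A"
    by (simp add: algebra_simps)
  then have "D $ i $ k = (mat_scale ?c (adjugate A) - Y ** adjugate A) $ i $ k"
    by simp
  then show ?thesis
    by (simp add: D_def)
qed

lemma polyfun_right: "p \<in> polyfun \<Longrightarrow> (\<lambda>A. p (A ** B)) \<in> polyfun"
  by (induction rule: polyfun.induct) (auto intro: polyfun.intros polyfun_coord_mult)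

text \<open>If \<open>p\<close> vanishes on \<open>G\<close>, so does its composite with conjugation
  by the inverse of \<open>A\<close>, and the derivative of that composite along \<open>Y\<close> is
  the derivative of \<open>p\<close> along the conjugate of \<open>Y\<close>.\<close>

lemma group_lie_conj:
  fixes G :: "('a::{field_char_0, alg_closed_field} ^ 'm ^ 'm) set"
  assumes G: "linear_alg_group G" and A: "A \<in> G" and Y: "Y \<in> group_lie G"
  shows "matrix_inv A ** Y ** A \<in> group_lie G"
  unfolding group_lie_iff
proof (intro ballI impI)
  note GD = linear_alg_groupD[OF G]
  fix p :: "'a ^ 'm ^ 'm \<Rightarrow> 'a" assume p: "p \<in> polyfun" "\<forall>A\<in>G. p A = 0"
  let ?q = "\<lambda>M. p (matrix_inv A ** (M ** A))"
  have "?q \<in> polyfun"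
    using polyfun_right[OF polyfun_left[OF p(1), of "matrix_inv A"], of A] .
  moreover have "\<forall>M\<in>G. ?q M = 0"
    using p(2) GD(2)[OF GD(4)[OF A] GD(2)[OF _ A]] by blast
  ultimately have "pder Y ?q (mat 1) = 0"
    using Y[unfolded group_lie_iff, rule_format, of ?q] by blast
  moreover have "matrix_inv A ** ((mat 1 + mat_scale t Y) ** A) = mat 1 + mat_scale t (matrix_inv A ** Y ** A)" for t
    by (simp add: mat_mult_distrib mat_scale_mult matrix_mul_assoc matrix_inv_works[OF GD(3)[OF A]])
  ultimately show "pder (matrix_inv A ** Y ** A) p (mat 1) = 0"
    by (simp add: pder_def)
qed

lemma lie_subalgebra_UNIV:
  assumes "fd_lie_algebra L"
  shows "lie_subalgebra L UNIV"
proof -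
  interpret vector_space "lie_scale L"
    by (rule fd_lie_algebra.vs[OF assms])
  show ?thesis
    by (simp add: lie_subalgebra_def)
qed

section \<open>Functionals on the Lie algebra of a matrix group and their conjugates\<close>

locale group_setup =
  fixes L :: "('k::field_char_0, 'g::ab_group_add) lie_alg"
    and C :: "('k, 'c::ab_group_add) coalg"
    and G :: "('k alg_closure ^ 'm ^ 'm) set"
    and \<rho> :: "'g \<Rightarrow> 'k alg_closure ^ 'm ^ 'm"
  assumes L: "fd_lie_algebra L" and C: "coaug_conilp_cocomm_dg_coalgebra C"
    and G: "linear_alg_group G" "zariski_connected G" and \<rho>: "lie_alg_of_group L G \<rho>"
begin

sublocale U: ce_setup to_ac L UNIV C
  by (rule ce_setup.intro[OF field_hom_to_ac L lie_subalgebra_UNIV[OF L] C])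

lemmas GD = linear_alg_groupD[OF G(1)]

lemma \<rho>_simps:
  "\<rho> (x + y) = \<rho> x + \<rho> y" "\<rho> (lie_scale L r x) = mat_scale (to_ac r) (\<rho> x)"
  "\<rho> (lie_br L x y) = \<rho> x ** \<rho> y - \<rho> y ** \<rho> x"
  using \<rho> by (auto simp: lie_alg_of_group_def)

lemma \<rho>_0: "\<rho> 0 = 0"
  using \<rho>_simps(1)[of 0 0] by simp

lemma \<rho>_sum: "\<rho> (sum f A) = (\<Sum>i\<in>A. \<rho> (f i))"
  by (induction A rule: infinite_finite_induct) (auto simp: \<rho>_0 \<rho>_simps)

lemma \<rho>_basis:
  obtains B where "finite B" "U.lvs.independent B" "U.lvs.span B = UNIV" "inj_on \<rho> B"
    "mat_vs.independent (\<rho> ` B)" "mat_vs.span (\<rho> ` B) = group_lie G"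
proof -
  obtain B where B: "U.lvs.independent B" "U.lvs.span B = UNIV" "inj_on \<rho> B"
    "mat_vs.independent (\<rho> ` B)" "mat_vs.span (\<rho> ` B) = group_lie G"
    using \<rho> by (auto simp: lie_alg_of_group_def)
  obtain B0 where "finite B0" "U.lvs.span B0 = UNIV"
    using U.lie.fin_dim by blast
  then have "finite B"
    using U.lvs.independent_span_bound[OF _ B(1), of B0] by auto
  then show thesis
    using that B by blast
qed

lemma ext_span_UNIV: "ext_span \<rho> UNIV = group_lie G"
proof -
  obtain B where B: "U.lvs.span B = UNIV" "mat_vs.span (\<rho> ` B) = group_lie G"
    using \<rho>_basis by metis
  have "\<rho> x \<in> mat_vs.span (\<rho> ` B)" for x
  proof -
    have "x \<in> U.lvs.span B"
      using B(1) by simp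
    then show ?thesis
    proof (induction rule: U.lvs.span_induct_alt)
      case base
      then show ?case
        by (simp add: \<rho>_0 mat_vs.span_zero)
    next
      case (step c x y)
      then show ?case
        by (simp add: \<rho>_simps mat_vs.span_add mat_vs.span_scale mat_vs.span_base)
    qed
  qed
  then have "mat_vs.span (\<rho> ` UNIV) \<subseteq> mat_vs.span (\<rho> ` B)"
    by (intro mat_vs.span_minimal) auto
  moreover have "mat_vs.span (\<rho> ` B) \<subseteq> mat_vs.span (\<rho> ` UNIV)"
    by (intro mat_vs.span_mono) auto
  ultimately show ?thesis
    using B(2) by (auto simp: ext_span_def)
qed

text \<open>The images under \<open>\<rho>\<close> of a basis of \<open>L\<close> are independent
  over the closure, so prescribed values there extend to a linear form on all matrices.\<close>

lemma functional_extension_UNIV: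
  assumes \<phi>: "\<phi> \<in> lie_dual to_ac L UNIV"
  shows "\<exists>\<psi>. Vector_Spaces.linear mat_scale (*) \<psi> \<and> (\<forall>y. \<psi> (\<rho> y) = \<phi> y)"
proof -
  interpret vector_space_pair mat_scale "(*) :: 'k alg_closure \<Rightarrow> 'k alg_closure \<Rightarrow> 'k alg_closure"
    by unfold_locales
  obtain B where B: "U.lvs.span B = UNIV" "inj_on \<rho> B" "mat_vs.independent (\<rho> ` B)"
    using \<rho>_basis by metis
  obtain \<psi> where \<psi>: "Vector_Spaces.linear mat_scale (*) \<psi>" "\<forall>M\<in>\<rho> ` B. \<psi> M = \<phi> (the_inv_into B \<rho> M)"
    using linear_independent_extend[OF B(3), of "\<lambda>M. \<phi> (the_inv_into B \<rho> M)"] by blast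
  interpret \<psi>: Vector_Spaces.linear mat_scale "(*)" \<psi>
    by (rule \<psi>(1))
  have "\<psi> (\<rho> y) = \<phi> y" for y
  proof -
    have "y \<in> U.lvs.span B"
      using B(1) by simp
    then show ?thesis
    proof (induction rule: U.lvs.span_induct_alt)
      case base
      then show ?case
        using U.VD(4)[OF \<phi>] by (simp add: \<rho>_0 \<psi>.zero)
    next
      case (step c x y)
      then show ?case
        using \<psi>(2) B(2) U.VD(1,2)[OF \<phi>]
        by (simp add: \<rho>_simps \<psi>.add \<psi>.scale the_inv_into_f_f)
    qed
  qed
  then show ?thesis
    using \<psi>(1) by blast
qed

text \<open>Two extensions are composed: from \<open>l\<close> to \<open>L\<close>, linear over the
  ground field, which acts on its closure through \<open>to_ac\<close>, and then from
  \<open>L\<close> to matrices, linear over the closure.\<close>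

lemma functional_extension:
  assumes l: "lie_subalgebra L l" and \<phi>: "\<phi> \<in> lie_dual to_ac L l"
  shows "\<exists>\<psi>. Vector_Spaces.linear mat_scale (*) \<psi> \<and> (\<forall>y\<in>l. \<psi> (\<rho> y) = \<phi> y)"
proof -
  interpret H: ce_setup to_ac L l C
    by (rule ce_setup.intro[OF field_hom_to_ac L l C])
  interpret K: vector_space "\<lambda>r (a::'k alg_closure). to_ac r * a"
    by standard (simp_all add: algebra_simps)
  interpret vector_space_pair "lie_scale L" "\<lambda>r (a::'k alg_closure). to_ac r * a"
    by unfold_locales
  obtain \<Phi> where \<Phi>: "Vector_Spaces.linear (lie_scale L) (\<lambda>r a. to_ac r * a) \<Phi>" "\<forall>b\<in>H.\<B>. \<Phi> b = \<phi> b"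
    using linear_independent_extend[OF H.basis(2), of \<phi>] by blast
  interpret \<Phi>: Vector_Spaces.linear "lie_scale L" "\<lambda>r a. to_ac r * a" \<Phi>
    by (rule \<Phi>(1))
  have "\<Phi> \<in> lie_dual to_ac L UNIV"
    by (auto simp: lie_dual_def \<Phi>.add \<Phi>.scale)
  moreover have "\<Phi> x = \<phi> x" if x: "x \<in> l" for x
  proof -
    have "\<Phi> x = \<Phi> (\<Sum>b\<in>H.\<B>. lie_scale L (lie_coord L l b x) b)"
      using H.coord_expand[OF x] by simp
    also have "\<dots> = (\<Sum>b\<in>H.\<B>. \<phi> b * H.dual b x)"
      using \<Phi>(2) by (simp add: \<Phi>.sum \<Phi>.scale H.dual_def mult.commute)
    finally show ?thesis
      using H.V_expand[OF \<phi> x] by simp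
  qed
  ultimately show ?thesis
    using functional_extension_UNIV[of \<Phi>] by auto
qed

text \<open>All linear extensions of \<open>\<phi>\<close> agree on \<open>ext_span\<close>, so the
  one chosen inside \<open>norm_act\<close> may be replaced by a convenient
  \<open>\<psi>\<close>.\<close>

lemma norm_act_eq:
  assumes \<psi>: "Vector_Spaces.linear mat_scale (*) \<psi>" "\<forall>y\<in>l. \<psi> (\<rho> y) = \<phi> y"
    and x: "x \<in> l" and M: "matrix_inv A ** \<rho> x ** A \<in> ext_span \<rho> l"
  shows "norm_act \<rho> l A \<phi> x = \<psi> (matrix_inv A ** \<rho> x ** A)"
proof -
  interpret vector_space_pair mat_scale "(*) :: 'k alg_closure \<Rightarrow> 'k alg_closure \<Rightarrow> 'k alg_closure"
    by unfold_locales
  let ?P = "\<lambda>\<psi>. Vector_Spaces.linear mat_scale (*) \<psi> \<and> (\<forall>y\<in>l. \<psi> (\<rho> y) = \<phi> y)"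
  have P: "?P (SOME \<psi>. ?P \<psi>)"
    by (rule someI[of ?P \<psi>]) (use \<psi> in auto)
  have "(SOME \<psi>. ?P \<psi>) (matrix_inv A ** \<rho> x ** A) = \<psi> (matrix_inv A ** \<rho> x ** A)"
    by (rule linear_eq_on[of _ _ _ "\<rho> ` l"]) (use P \<psi> M in \<open>auto simp: ext_span_def\<close>)
  then show ?thesis
    using x by (simp add: norm_act_def)
qed

text \<open>A general stable subalgebra \<open>l\<close> is allowed, to serve both the whole algebra
  with \<open>A\<close> in \<open>G\<close> and \<open>h\<close> with \<open>A\<close> in the
  normalizer.\<close>

lemma norm_act_letter_map:
  assumes l: "lie_subalgebra L l" and A: "invertible A"
    and stable: "\<And>x. x \<in> l \<Longrightarrow> matrix_inv A ** \<rho> x ** A \<in> ext_span \<rho> l"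
  shows "ce_letter_map to_ac to_ac L l l C id (norm_act \<rho> l A)"
proof -
  interpret H: ce_setup to_ac L l C
    by (rule ce_setup.intro[OF field_hom_to_ac L l C])
  note ext = functional_extension[OF l]
  have out: "norm_act \<rho> l A \<phi> x = 0" if "x \<notin> l" for \<phi> x
    using that by (simp add: norm_act_def)
  show ?thesis
  proof (intro ce_letter_map.intro H.ce_setup_axioms ce_letter_map_axioms.intro)
    fix \<phi> assume \<phi>: "\<phi> \<in> H.V"
    obtain \<psi> where \<psi>: "Vector_Spaces.linear mat_scale (*) \<psi>" "\<forall>y\<in>l. \<psi> (\<rho> y) = \<phi> y"
      using ext[OF \<phi>] by blast
    interpret \<psi>: Vector_Spaces.linear mat_scale "(*)" \<psi>
      by (rule \<psi>(1))
    note eq = norm_act_eq[OF \<psi> _ stable]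
    show "norm_act \<rho> l A \<phi> \<in> H.V"
      by (auto simp: lie_dual_def out eq H.l_closed \<rho>_simps mat_mult_distrib mat_scale_mult \<psi>.add \<psi>.scale)
    show "norm_act \<rho> l A (\<lambda>x. \<phi> x + \<phi>' x) = (\<lambda>x. norm_act \<rho> l A \<phi> x + norm_act \<rho> l A \<phi>' x)" if \<phi>': "\<phi>' \<in> H.V" for \<phi>'
    proof
      fix x
      obtain \<psi>' where \<psi>': "Vector_Spaces.linear mat_scale (*) \<psi>'" "\<forall>y\<in>l. \<psi>' (\<rho> y) = \<phi>' y"
        using ext[OF \<phi>'] by blast
      interpret \<psi>': Vector_Spaces.linear mat_scale "(*)" \<psi>'
        by (rule \<psi>'(1))
      have lin: "Vector_Spaces.linear mat_scale (*) (\<lambda>M. \<psi> M + \<psi>' M)"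
        by unfold_locales (simp_all add: \<psi>.add \<psi>.scale \<psi>'.add \<psi>'.scale algebra_simps)
      show "norm_act \<rho> l A (\<lambda>x. \<phi> x + \<phi>' x) x = norm_act \<rho> l A \<phi> x + norm_act \<rho> l A \<phi>' x"
      proof (cases "x \<in> l")
        case True
        have "norm_act \<rho> l A (\<lambda>x. \<phi> x + \<phi>' x) x = \<psi> (matrix_inv A ** \<rho> x ** A) + \<psi>' (matrix_inv A ** \<rho> x ** A)"
          by (rule norm_act_eq[OF lin _ True stable[OF True]]) (use \<psi> \<psi>' in auto)
        then show ?thesis
          by (simp add: eq[OF True True] norm_act_eq[OF \<psi>' True stable[OF True]])
      qed (simp add: out)
    qed
    show "norm_act \<rho> l A (\<lambda>x. r * \<phi> x) = (\<lambda>x. id r * norm_act \<rho> l A \<phi> x)" for r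
    proof
      fix x
      have lin: "Vector_Spaces.linear mat_scale (*) (\<lambda>M. r * \<psi> M)"
        by unfold_locales (simp_all add: \<psi>.add \<psi>.scale algebra_simps)
      show "norm_act \<rho> l A (\<lambda>x. r * \<phi> x) x = id r * norm_act \<rho> l A \<phi> x"
      proof (cases "x \<in> l")
        case True
        have "norm_act \<rho> l A (\<lambda>x. r * \<phi> x) x = r * \<psi> (matrix_inv A ** \<rho> x ** A)"
          by (rule norm_act_eq[OF lin _ True stable[OF True]]) (use \<psi> in auto)
        then show ?thesis
          by (simp add: eq[OF True True])
      qed (simp add: out)
    qed
  qed (simp_all add: field_hom_id)
qed

text \<open>Conjugation respects commutators; written in a dual basis this is the hypothesis of
  \<open>lm_d\<close> on the cobracket.\<close>

lemma norm_act_br: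
  assumes l: "lie_subalgebra L l" and A: "invertible A"
    and stable: "\<And>x. x \<in> l \<Longrightarrow> matrix_inv A ** \<rho> x ** A \<in> ext_span \<rho> l"
    and \<phi>: "\<phi> \<in> lie_dual to_ac L l" and u: "u \<in> l" and v: "v \<in> l"
  shows "(\<Sum>(b, b')\<in>lie_basis L l \<times> lie_basis L l. id (\<phi> (lie_br L b b')) *
      norm_act \<rho> l A (ce_setup.dual to_ac L l b) u * norm_act \<rho> l A (ce_setup.dual to_ac L l b') v) =
    norm_act \<rho> l A \<phi> (lie_br L u v)"
proof -
  interpret H: ce_setup to_ac L l C
    by (rule ce_setup.intro[OF field_hom_to_ac L l C])
  interpret vector_space_pair mat_scale "(*) :: 'k alg_closure \<Rightarrow> 'k alg_closure \<Rightarrow> 'k alg_closure"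
    by unfold_locales
  obtain \<psi> where \<psi>: "Vector_Spaces.linear mat_scale (*) \<psi>" "\<forall>y\<in>l. \<psi> (\<rho> y) = \<phi> y"
    using functional_extension[OF l \<phi>] by blast
  interpret \<psi>: Vector_Spaces.linear mat_scale "(*)" \<psi>
    by (rule \<psi>(1))
  define M where "M x = matrix_inv A ** \<rho> x ** A" for x
  have "\<forall>b. \<exists>\<delta>. Vector_Spaces.linear mat_scale (*) \<delta> \<and> (\<forall>y\<in>l. \<delta> (\<rho> y) = H.dual b y)"
    using functional_extension[OF l H.dual_V] by blast
  then obtain \<delta> where \<delta>: "\<And>b. Vector_Spaces.linear mat_scale (*) (\<delta> b)" "\<And>b y. y \<in> l \<Longrightarrow> \<delta> b (\<rho> y) = H.dual b y"
    by metis
  \<comment> \<open>The forms \<open>\<delta> b\<close> extend the dual basis to matrices and act as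
    coordinates on the span of the image of \<open>l\<close> over the closure.\<close>
  have expand: "N = (\<Sum>b\<in>H.\<B>. mat_scale (\<delta> b N) (\<rho> b))" if "N \<in> mat_vs.span (\<rho> ` l)" for N
    using that
  proof (induction rule: mat_vs.span_induct_alt)
    case base
    show ?case
      using linear_0[OF \<delta>(1)] by simp
  next
    case (step c x y)
    then obtain w where w: "x = \<rho> w" "w \<in> l"
      by blast
    have "\<rho> w = \<rho> (\<Sum>b\<in>H.\<B>. lie_scale L (lie_coord L l b w) b)"
      using H.coord_expand[OF w(2)] by simp
    then have x: "x = (\<Sum>b\<in>H.\<B>. mat_scale (\<delta> b x) (\<rho> b))"
      using \<delta>(2)[OF w(2)] by (simp add: w \<rho>_sum \<rho>_simps H.dual_def)
    have "mat_scale c x + y = mat_scale c (\<Sum>b\<in>H.\<B>. mat_scale (\<delta> b x) (\<rho> b)) + (\<Sum>b\<in>H.\<B>. mat_scale (\<delta> b y) (\<rho> b))"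
      using x step(2) by simp
    also have "\<dots> = (\<Sum>b\<in>H.\<B>. mat_scale (\<delta> b (mat_scale c x + y)) (\<rho> b))"
      by (simp add: linear_add[OF \<delta>(1)] linear_scale[OF \<delta>(1)] mat_vs.scale_sum_right mat_vs.scale_left_distrib sum.distrib)
    finally show ?case .
  qed
  have Mx: "M x = (\<Sum>b\<in>H.\<B>. mat_scale (norm_act \<rho> l A (H.dual b) x) (\<rho> b))" if x: "x \<in> l" for x
  proof -
    have "norm_act \<rho> l A (H.dual b) x = \<delta> b (M x)" for b
      unfolding M_def by (rule norm_act_eq[OF \<delta>(1) _ x stable[OF x]]) (use \<delta>(2) in auto)
    then show ?thesis
      using expand[of "M x"] stable[OF x] by (simp add: M_def ext_span_def)
  qed
  have M_br: "M (lie_br L u v) = M u ** M v - M v ** M u"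
  proof -
    have "matrix_inv A ** \<rho> u ** A ** (matrix_inv A ** \<rho> v ** A) = matrix_inv A ** (\<rho> u ** \<rho> v) ** A" for u v
      using matrix_inv_works(1)[OF A] by (metis matrix_mul_assoc matrix_mul_rid)
    then show ?thesis
      by (simp add: M_def \<rho>_simps mat_mult_distrib)
  qed
  let ?a = "\<lambda>b x. norm_act \<rho> l A (H.dual b) x"
  have MM: "M x ** M y = (\<Sum>b\<in>H.\<B>. \<Sum>b'\<in>H.\<B>. mat_scale (?a b x * ?a b' y) (\<rho> b ** \<rho> b'))" if "x \<in> l" "y \<in> l" for x y
  proof -
    have sum_left: "sum f S ** N = (\<Sum>i\<in>S. f i ** N)" for f :: "'g \<Rightarrow> 'k alg_closure ^ 'm ^ 'm" and S and N :: "'k alg_closure ^ 'm ^ 'm"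
      by (induction S rule: infinite_finite_induct) (auto simp: mat_mult_distrib)
    have sum_right: "N ** sum f S = (\<Sum>i\<in>S. N ** f i)" for f :: "'g \<Rightarrow> 'k alg_closure ^ 'm ^ 'm" and S and N :: "'k alg_closure ^ 'm ^ 'm"
      by (induction S rule: infinite_finite_induct) (auto simp: mat_mult_distrib)
    show ?thesis
      unfolding Mx[OF that(1)] Mx[OF that(2)]
      unfolding sum_left unfolding sum_right
      by (simp add: mat_scale_mult mult.commute)
  qed
  have "norm_act \<rho> l A \<phi> (lie_br L u v) = \<psi> (M (lie_br L u v))"
    unfolding M_def using u v by (intro norm_act_eq[OF \<psi>] stable) (auto intro: H.l_closed)
  also have "M (lie_br L u v) = (\<Sum>b\<in>H.\<B>. \<Sum>b'\<in>H.\<B>. mat_scale (?a b u * ?a b' v) (\<rho> b ** \<rho> b')) -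
      (\<Sum>b\<in>H.\<B>. \<Sum>b'\<in>H.\<B>. mat_scale (?a b v * ?a b' u) (\<rho> b ** \<rho> b'))"
    by (simp add: M_br MM u v)
  also have "(\<Sum>b\<in>H.\<B>. \<Sum>b'\<in>H.\<B>. mat_scale (?a b v * ?a b' u) (\<rho> b ** \<rho> b')) =
      (\<Sum>b\<in>H.\<B>. \<Sum>b'\<in>H.\<B>. mat_scale (?a b u * ?a b' v) (\<rho> b' ** \<rho> b))"
    by (subst sum.swap) (simp add: mult.commute)
  also have "(\<Sum>b\<in>H.\<B>. \<Sum>b'\<in>H.\<B>. mat_scale (?a b u * ?a b' v) (\<rho> b ** \<rho> b')) - \<dots> =
      (\<Sum>b\<in>H.\<B>. \<Sum>b'\<in>H.\<B>. mat_scale (?a b u * ?a b' v) (\<rho> (lie_br L b b')))"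
    by (simp add: \<rho>_simps mat_vs.scale_right_diff_distrib sum_subtractf)
  also have "\<psi> \<dots> = (\<Sum>b\<in>H.\<B>. \<Sum>b'\<in>H.\<B>. \<phi> (lie_br L b b') * ?a b u * ?a b' v)"
    using \<psi>(2) by (simp add: \<psi>.sum \<psi>.scale H.basis_l H.l_closed mult_ac)
  finally show ?thesis
    by (simp add: sum.cartesian_product)
qed

end

section \<open>Polynomial families over the group and their derivatives\<close>

lemma vector_space_list_algebra:
  "vector_space (\<lambda>r (p :: 'x list \<Rightarrow>\<^sub>0 'r::field). cst r * p)"
  by standard (simp_all add: cst_add cst_mult distrib_left distrib_right mult.assoc)

context group_setup
begin

text \<open>
  A family \<open>\<Theta>\<close> of elements of the free algebra that modulo the relations depends polynomially on
  a matrix in \<open>G\<close>, with its derivatives \<open>\<Theta>' z\<close> along the left invariant vector fields \<open>\<rho> z\<close>.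
\<close>

inductive poly_family ::
    "('k alg_closure ^ 'm ^ 'm \<Rightarrow> ('g, 'k alg_closure, 'c) ce_letter list \<Rightarrow>\<^sub>0 'k alg_closure)
      \<Rightarrow> ('g \<Rightarrow> 'k alg_closure ^ 'm ^ 'm \<Rightarrow> ('g, 'k alg_closure, 'c) ce_letter list \<Rightarrow>\<^sub>0 'k alg_closure) \<Rightarrow> bool"
  where
    single: "p \<in> polyfun \<Longrightarrow> u \<in> falg U.S \<Longrightarrow> poly_family (\<lambda>A. cst (p A) * u) (\<lambda>z A. cst (pder (\<rho> z) p A) * u)"
  | add: "poly_family \<Theta> \<Theta>' \<Longrightarrow> poly_family \<Xi> \<Xi>' \<Longrightarrow> poly_family (\<lambda>A. \<Theta> A + \<Xi> A) (\<lambda>z A. \<Theta>' z A + \<Xi>' z A)"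
  | congr: "poly_family \<Theta> \<Theta>' \<Longrightarrow> (\<And>A. A \<in> G \<Longrightarrow> U.eqv (\<Xi> A) (\<Theta> A)) \<Longrightarrow>
      (\<And>z A. A \<in> G \<Longrightarrow> U.eqv (\<Xi>' z A) (\<Theta>' z A)) \<Longrightarrow> poly_family \<Xi> \<Xi>'"

lemma eqv_falg: "U.eqv p q \<Longrightarrow> q \<in> falg U.S \<Longrightarrow> p \<in> falg U.S"
  using U.ID(8)[of "p - q"] falg_closed(4)[of "p - q" U.S q] by (simp add: U.eqv_def)

lemma poly_family_falg:
  assumes "poly_family \<Theta> \<Theta>'" "A \<in> G"
  shows "\<Theta> A \<in> falg U.S \<and> \<Theta>' z A \<in> falg U.S"
  using assms(1)
proof induction
  case (congr \<Theta> \<Theta>' \<Xi> \<Xi>')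
  then show ?case
    using assms(2) eqv_falg by blast
qed (auto intro: falg_closed)

text \<open>Leibniz rule by nested induction: the outer one fixes the first family to be a
  polynomial times a constant element, the inner one does the same for the second.\<close>

lemma poly_family_mult:
  assumes "poly_family \<Theta> \<Theta>'" "poly_family \<Xi> \<Xi>'"
  shows "poly_family (\<lambda>A. \<Theta> A * \<Xi> A) (\<lambda>z A. \<Theta>' z A * \<Xi> A + \<Theta> A * \<Xi>' z A)"
  using assms(1)
proof induction
  case (single p u)
  from assms(2) show ?case
  proof induction
    case (single q v)
    have "poly_family (\<lambda>A. cst (p A * q A) * (u * v)) (\<lambda>z A. cst (pder (\<rho> z) (\<lambda>A. p A * q A) A) * (u * v))"
      by (intro poly_family.single polyfun.intros falg_closed \<open>p \<in> polyfun\<close> \<open>u \<in> falg U.S\<close> single)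
    moreover have "cst (p A * q A) * (u * v) = cst (p A) * u * (cst (q A) * v)" for A
      by (simp add: cst_mult mult.assoc cst_left_commute[of u])
    moreover have "cst (pder (\<rho> z) (\<lambda>A. p A * q A) A) * (u * v) =
        cst (pder (\<rho> z) p A) * u * (cst (q A) * v) + cst (p A) * u * (cst (pder (\<rho> z) q A) * v)" for z A
      by (simp add: pder_mult[OF \<open>p \<in> polyfun\<close> single(1)] cst_add cst_mult distrib_right mult.assoc cst_left_commute[of u])
    ultimately show ?case
      by simp
  next
    case (add \<Theta> \<Theta>' \<Xi> \<Xi>')
    from poly_family.add[OF add.IH] show ?case
      by (simp add: algebra_simps)
  next
    case (congr \<Theta> \<Theta>' \<Xi> \<Xi>')
    show ?case
      by (rule poly_family.congr[OF congr.IH])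
        (intro U.eqv_add U.eqv_left congr falg_closed \<open>u \<in> falg U.S\<close>; assumption)+
  qed
next
  case (add \<Theta> \<Theta>' \<Xi> \<Xi>')
  from poly_family.add[OF add.IH] show ?case
    by (simp add: algebra_simps)
next
  case (congr \<Theta> \<Theta>' \<Psi> \<Psi>')
  show ?case
    by (rule poly_family.congr[OF congr.IH])
      (intro U.eqv_add U.eqv_right congr poly_family_falg[OF assms(2), THEN conjunct1] poly_family_falg[OF assms(2), THEN conjunct2]; assumption)+
qed

text \<open>A linear form that kills the relations turns a family into the values on
  \<open>G\<close> of a polynomial function, and its formal derivative into the derivative along
  \<open>\<rho> z\<close>. Congruences in a family are required on \<open>G\<close>, hence so is the
  agreement.\<close>

lemma poly_family_functional:
  assumes "poly_family \<Theta> \<Theta>'"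
    and add: "\<And>p q. f (p + q) = f p + (f q :: 'k alg_closure)" and scale: "\<And>r p. f (cst r * p) = r * f p"
    and I: "\<And>p. p \<in> U.I \<Longrightarrow> f p = 0"
  shows "\<exists>P\<in>polyfun. \<forall>A\<in>G. f (\<Theta> A) = P A \<and> (\<forall>z. f (\<Theta>' z A) = pder (\<rho> z) P A)"
  using assms(1)
proof induction
  case (single p u)
  have "(\<lambda>A. p A * f u) \<in> polyfun"
    by (intro polyfun.intros single)
  moreover have "pder (\<rho> z) (\<lambda>A. p A * f u) A = pder (\<rho> z) p A * f u" for z A
    by (subst pder_mult) (auto intro: single polyfun.intros)
  ultimately show ?case
    by (intro bexI[of _ "\<lambda>A. p A * f u"]) (auto simp: scale)
next
  case (add \<Theta> \<Theta>' \<Xi> \<Xi>')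
  then obtain P Q where PQ: "P \<in> polyfun" "Q \<in> polyfun"
    "\<And>A. A \<in> G \<Longrightarrow> f (\<Theta> A) = P A" "\<And>z A. A \<in> G \<Longrightarrow> f (\<Theta>' z A) = pder (\<rho> z) P A"
    "\<And>A. A \<in> G \<Longrightarrow> f (\<Xi> A) = Q A" "\<And>z A. A \<in> G \<Longrightarrow> f (\<Xi>' z A) = pder (\<rho> z) Q A"
    by metis
  then show ?case
    by (intro bexI[of _ "\<lambda>A. P A + Q A"]) (auto simp: assms(2) pder_add intro: polyfun.intros)
next
  case (congr \<Theta> \<Theta>' \<Xi> \<Xi>')
  have "f p = f q" if "U.eqv p q" for p q
    using I[of "p - q"] add[of "p - q" q] that by (simp add: U.eqv_def)
  moreover obtain P where "P \<in> polyfun" "\<And>A. A \<in> G \<Longrightarrow> f (\<Theta> A) = P A" "\<And>z A. A \<in> G \<Longrightarrow> f (\<Theta>' z A) = pder (\<rho> z) P A"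
    using congr.IH by blast
  ultimately show ?case
    using congr.hyps(2,3) by (intro bexI[of _ P]) metis+
qed

lemma conj_stable:
  assumes "A \<in> G"
  shows "matrix_inv A ** \<rho> x ** A \<in> ext_span \<rho> UNIV"
proof -
  have "\<rho> x \<in> group_lie G"
    using ext_span_UNIV mat_vs.span_base[of "\<rho> x" "range \<rho>"] by (simp add: ext_span_def)
  then show ?thesis
    using group_lie_conj[OF G(1) assms] by (simp add: ext_span_UNIV)
qed

lemma group_letter_map: "A \<in> G \<Longrightarrow> ce_letter_map to_ac to_ac L UNIV UNIV C id (norm_act \<rho> UNIV A)"
  using conj_stable GD(3) by (intro norm_act_letter_map lie_subalgebra_UNIV L) auto

abbreviation det_weight :: "'g \<Rightarrow> 'k alg_closure"
  where "det_weight z \<equiv> pder (\<rho> z) det (mat 1)"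

text \<open>When \<open>A\<close> moves along the field of \<open>\<rho> z\<close>, the conjugate N
  of \<open>\<rho> x\<close> by the inverse of \<open>A\<close> changes by
  \<open>N ** \<rho> z - \<rho> z ** N\<close>. That gives the coadjoint term; the first term is the
  derivative of the factor \<open>det A\<close>.\<close>

lemma poly_family_letter:
  assumes \<phi>: "\<phi> \<in> U.V" and y: "y \<in> U.RL"
  shows "poly_family (\<lambda>A. cst (det A) * gen (norm_act \<rho> UNIV A \<phi>, y))
    (\<lambda>z A. cst (det_weight z) * (cst (det A) * gen (norm_act \<rho> UNIV A \<phi>, y)) +
      cst (det A) * gen (norm_act \<rho> UNIV A (coad L UNIV z \<phi>), y))"
proof -
  obtain \<psi> where \<psi>: "Vector_Spaces.linear mat_scale (*) \<psi>" "\<And>x. \<psi> (\<rho> x) = \<phi> x"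
    using functional_extension_UNIV[OF \<phi>] by blast
  interpret \<psi>: Vector_Spaces.linear mat_scale "(*)" \<psi>
    by (rule \<psi>(1))
  obtain i c where ic: "y = (i, c)" "c \<in> red_piece C i"
    using y by (cases y) auto
  \<comment> \<open>The matrix entries of \<open>\<rho>\<close> are functionals on \<open>L\<close>
    that do not involve \<open>A\<close>; expanding in them moves the whole dependence on
    \<open>A\<close> into the coefficients \<open>p a\<close>.\<close>
  define e where "e a x = \<rho> x $ fst a $ snd a" for a :: "'m \<times> 'm" and x
  have e: "e a \<in> U.V" for a
    by (simp add: e_def lie_dual_def \<rho>_simps mat_scale_def)
  \<comment> \<open>The coefficient of \<open>e a\<close> in the functional sending \<open>x\<close>
    to \<open>\<psi> (adjugate A ** \<rho> x ** A)\<close>, found by expanding \<open>\<psi>\<close>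
    in matrix units.\<close>
  define p where "p a A = (\<Sum>k\<in>UNIV. \<Sum>l\<in>UNIV. \<psi> (mat_unit k l) * (adjugate A $ k $ fst a * A $ snd a $ l))"
    for a :: "'m \<times> 'm" and A
  have p: "p a \<in> polyfun" for a
    unfolding p_def by (intro polyfun_sum polyfun_cmult polyfun.intros polyfun_adjugate)
  have trip: "(\<Sum>a\<in>UNIV. (\<Sum>k\<in>UNIV. \<Sum>l\<in>UNIV. \<psi> (mat_unit k l) * (M $ k $ fst a * N $ snd a $ l)) * e a x) = \<psi> (M ** \<rho> x ** N)"
    for M N x
  proof -
    have "(\<Sum>a\<in>UNIV. (\<Sum>k\<in>UNIV. \<Sum>l\<in>UNIV. \<psi> (mat_unit k l) * (M $ k $ fst a * N $ snd a $ l)) * e a x) =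
        (\<Sum>a\<in>UNIV. \<Sum>k\<in>UNIV. \<Sum>l\<in>UNIV. \<psi> (mat_unit k l) * (M $ k $ fst a * e a x * N $ snd a $ l))"
      unfolding sum_distrib_right by (intro sum.cong refl) (simp add: mult_ac)
    also have "\<dots> = (\<Sum>k\<in>UNIV. \<Sum>a\<in>UNIV. \<Sum>l\<in>UNIV. \<psi> (mat_unit k l) * (M $ k $ fst a * e a x * N $ snd a $ l))"
      by (rule sum.swap)
    also have "\<dots> = (\<Sum>k\<in>UNIV. \<Sum>l\<in>UNIV. \<Sum>a\<in>UNIV. \<psi> (mat_unit k l) * (M $ k $ fst a * e a x * N $ snd a $ l))"
      by (intro sum.cong refl sum.swap)
    also have "\<dots> = (\<Sum>k\<in>UNIV. \<Sum>l\<in>UNIV. \<psi> (mat_unit k l) * (M ** \<rho> x ** N) $ k $ l)"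
    proof (intro sum.cong refl)
      fix k l
      have "(\<Sum>a\<in>UNIV. M $ k $ fst a * e a x * N $ snd a $ l) = (\<Sum>b\<in>UNIV. \<Sum>a\<in>UNIV. M $ k $ b * \<rho> x $ b $ a * N $ a $ l)"
        by (simp add: e_def sum.cartesian_product case_prod_unfold flip: UNIV_Times_UNIV)
      also have "\<dots> = (\<Sum>a\<in>UNIV. \<Sum>b\<in>UNIV. M $ k $ b * \<rho> x $ b $ a * N $ a $ l)"
        by (rule sum.swap)
      also have "\<dots> = (M ** \<rho> x ** N) $ k $ l"
        by (simp add: matrix_matrix_mult_def sum_distrib_right)
      finally show "(\<Sum>a\<in>UNIV. \<psi> (mat_unit k l) * (M $ k $ fst a * e a x * N $ snd a $ l)) = \<psi> (mat_unit k l) * (M ** \<rho> x ** N) $ k $ l"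
        by (simp flip: sum_distrib_left)
    qed
    also have "\<dots> = \<psi> (M ** \<rho> x ** N)"
      by (rule linear_mat_expand[OF \<psi>(1), symmetric])
    finally show ?thesis .
  qed
  have adj: "adjugate A ** N ** A = mat_scale (det A) (matrix_inv A ** N ** A)" if "A \<in> G" for A N
    by (simp add: adjugate_inverse[OF GD(3)[OF that]] mat_scale_mult)
  have na: "norm_act \<rho> UNIV A \<phi> x = \<psi> (matrix_inv A ** \<rho> x ** A)" if "A \<in> G" for A x
    using norm_act_eq[OF \<psi>(1) _ UNIV_I conj_stable[OF that]] \<psi>(2) by simp
  \<comment> \<open>The form sending \<open>M\<close> to
    \<open>- \<psi> (\<rho> z ** M - M ** \<rho> z)\<close> is an extension of
    \<open>coad L UNIV z \<phi>\<close> to matrices.\<close>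
  have nac: "norm_act \<rho> UNIV A (coad L UNIV z \<phi>) x = - \<psi> (\<rho> z ** (matrix_inv A ** \<rho> x ** A) - (matrix_inv A ** \<rho> x ** A) ** \<rho> z)"
    if "A \<in> G" for A x z
  proof (rule norm_act_eq[OF _ _ UNIV_I conj_stable[OF that]])
    show "Vector_Spaces.linear mat_scale (*) (\<lambda>M. - \<psi> (\<rho> z ** M - M ** \<rho> z))"
      by unfold_locales
        (simp_all add: mat_mult_distrib mat_scale_mult \<psi>.add \<psi>.diff \<psi>.scale algebra_simps)
    show "\<forall>x\<in>UNIV. - \<psi> (\<rho> z ** \<rho> x - \<rho> x ** \<rho> z) = coad L UNIV z \<phi> x"
      using \<psi>(2)[of "lie_br L z _"] by (simp add: coad_def \<rho>_simps)
  qed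
  have fam: "poly_family (\<lambda>A. \<Sum>a\<in>T. cst (p a A) * gen (e a, y)) (\<lambda>z A. \<Sum>a\<in>T. cst (pder (\<rho> z) (p a) A) * gen (e a, y))" for T
  proof (induction T rule: infinite_finite_induct)
    case (insert a T)
    have "poly_family (\<lambda>A. cst (p a A) * gen (e a, y)) (\<lambda>z A. cst (pder (\<rho> z) (p a) A) * gen (e a, y))"
      by (intro single p U.gen_falg) (simp add: U.S_RL e y)
    from add[OF this insert.IH] show ?case
      using insert.hyps by simp
  qed (use single[OF polyfun.intros(1)[of 0] falg_closed(1)] in simp_all)
  show ?thesis
  proof (rule congr[OF fam[of UNIV]])
    fix A assume A: "A \<in> G"
    have inv: "invertible A"
      by (rule GD(3)[OF A])
    have V: "norm_act \<rho> UNIV A \<theta> \<in> U.V" if "\<theta> \<in> U.V" for \<theta>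
      by (rule ce_letter_map.F_V[OF group_letter_map[OF A] that])
    have "(\<Sum>a\<in>UNIV. p a A * e a x) = det A * norm_act \<rho> UNIV A \<phi> x" for x
      unfolding p_def trip by (simp add: adj[OF A] na[OF A] \<psi>.scale)
    then have eq: "(\<lambda>x. \<Sum>a\<in>UNIV. p a A * e a x) = (\<lambda>x. det A * norm_act \<rho> UNIV A \<phi> x)"
      by simp
    have "U.eqv (cst (det A) * gen (norm_act \<rho> UNIV A \<phi>, i, c)) (gen (\<lambda>x. det A * norm_act \<rho> UNIV A \<phi> x, i, c))"
      by (intro U.eqv_sym[OF U.gen_scale_fun] V \<phi> ic)
    also have "U.eqv \<dots> (\<Sum>a\<in>UNIV. cst (p a A) * gen (e a, i, c))"
      unfolding eq[symmetric] by (intro U.gen_sum_fun e ic)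
    finally show "U.eqv (cst (det A) * gen (norm_act \<rho> UNIV A \<phi>, y)) (\<Sum>a\<in>UNIV. cst (p a A) * gen (e a, y))"
      by (simp add: ic)
    fix z
    define D where "D = mat_scale (det_weight z) (adjugate A) - \<rho> z ** adjugate A"
    have "pder (\<rho> z) (p a) A = (\<Sum>k\<in>UNIV. \<Sum>l\<in>UNIV. \<psi> (mat_unit k l) * (D $ k $ fst a * A $ snd a $ l)) +
        (\<Sum>k\<in>UNIV. \<Sum>l\<in>UNIV. \<psi> (mat_unit k l) * (adjugate A $ k $ fst a * (A ** \<rho> z) $ snd a $ l))" for a
      unfolding p_def D_def
      by (simp add: pder_sum pder_cmult pder_mult polyfun_sum polyfun_cmult polyfun.intros polyfun_adjugate
          pder_adjugate[OF inv] distrib_left sum.distrib)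
    then have "(\<Sum>a\<in>UNIV. pder (\<rho> z) (p a) A * e a x) = \<psi> (D ** \<rho> x ** A) + \<psi> (adjugate A ** \<rho> x ** (A ** \<rho> z))" for x
      by (simp add: distrib_right sum.distrib trip)
    also have "\<psi> (D ** \<rho> x ** A) + \<psi> (adjugate A ** \<rho> x ** (A ** \<rho> z)) =
        det_weight z * (det A * norm_act \<rho> UNIV A \<phi> x) + det A * norm_act \<rho> UNIV A (coad L UNIV z \<phi>) x" for x
    proof -
      let ?N = "matrix_inv A ** \<rho> x ** A"
      have "D ** \<rho> x ** A = mat_scale (det_weight z) (adjugate A ** \<rho> x ** A) - \<rho> z ** (adjugate A ** \<rho> x ** A)"
        by (simp add: D_def mat_mult_distrib mat_scale_mult matrix_mul_assoc)
      then have 1: "D ** \<rho> x ** A = mat_scale (det A) (mat_scale (det_weight z) ?N - \<rho> z ** ?N)"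
        by (simp add: adj[OF A] mat_scale_mult mat_vs.scale_right_diff_distrib mat_vs.scale_left_commute)
      have "adjugate A ** \<rho> x ** (A ** \<rho> z) = (adjugate A ** \<rho> x ** A) ** \<rho> z"
        by (simp add: matrix_mul_assoc)
      then have 2: "adjugate A ** \<rho> x ** (A ** \<rho> z) = mat_scale (det A) (?N ** \<rho> z)"
        by (simp add: adj[OF A] mat_scale_mult)
      show ?thesis
        unfolding 1 2 na[OF A] nac[OF A] by (simp add: \<psi>.scale \<psi>.diff algebra_simps)
    qed
    finally have eq': "(\<lambda>x. \<Sum>a\<in>UNIV. pder (\<rho> z) (p a) A * e a x) =
        (\<lambda>x. (det_weight z * det A) * norm_act \<rho> UNIV A \<phi> x + det A * norm_act \<rho> UNIV A (coad L UNIV z \<phi>) x)"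
      by (simp add: mult.assoc)
    have cV: "coad L UNIV z \<phi> \<in> U.V"
      by (intro U.coad_V \<phi> UNIV_I)
    have "U.eqv (gen (\<lambda>x. (det_weight z * det A) * norm_act \<rho> UNIV A \<phi> x + det A * norm_act \<rho> UNIV A (coad L UNIV z \<phi>) x, i, c))
        (gen (\<lambda>x. (det_weight z * det A) * norm_act \<rho> UNIV A \<phi> x, i, c) + gen (\<lambda>x. det A * norm_act \<rho> UNIV A (coad L UNIV z \<phi>) x, i, c))"
      by (intro U.gen_add_fun U.V_closed V \<phi> cV ic)
    also have "U.eqv \<dots> (cst (det_weight z * det A) * gen (norm_act \<rho> UNIV A \<phi>, i, c) + cst (det A) * gen (norm_act \<rho> UNIV A (coad L UNIV z \<phi>), i, c))"
      by (intro U.eqv_add U.gen_scale_fun V \<phi> cV ic)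
    finally have "U.eqv (cst (det_weight z * det A) * gen (norm_act \<rho> UNIV A \<phi>, i, c) + cst (det A) * gen (norm_act \<rho> UNIV A (coad L UNIV z \<phi>), i, c))
        (gen (\<lambda>x. (det_weight z * det A) * norm_act \<rho> UNIV A \<phi> x + det A * norm_act \<rho> UNIV A (coad L UNIV z \<phi>) x, i, c))"
      by (rule U.eqv_sym)
    also have "U.eqv \<dots> (\<Sum>a\<in>UNIV. cst (pder (\<rho> z) (p a) A) * gen (e a, i, c))"
      unfolding eq'[symmetric] by (intro U.gen_sum_fun e ic)
    finally show "U.eqv (cst (det_weight z) * (cst (det A) * gen (norm_act \<rho> UNIV A \<phi>, y)) + cst (det A) * gen (norm_act \<rho> UNIV A (coad L UNIV z \<phi>), y))
        (\<Sum>a\<in>UNIV. cst (pder (\<rho> z) (p a) A) * gen (e a, y))"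
      by (simp add: ic cst_mult mult.assoc)
  qed
qed

definition act :: "'k alg_closure ^ 'm ^ 'm \<Rightarrow> (('g, 'k alg_closure, 'c) ce_letter list \<Rightarrow>\<^sub>0 'k alg_closure)
    \<Rightarrow> ('g, 'k alg_closure, 'c) ce_letter list \<Rightarrow>\<^sub>0 'k alg_closure"
  where "act A = letter_map id (\<lambda>x. (norm_act \<rho> UNIV A (fst x), snd x))"

lemma act_simps:
  "act A (p + q) = act A p + act A q" "act A (cst r * p) = cst r * act A p" "act A 0 = 0"
  "act A (wrd w) = wrd (map (\<lambda>x. (norm_act \<rho> UNIV A (fst x), snd x)) w)"
  "act A 1 = 1" "act A (cst r) = cst r" "act A (p * q) = act A p * act A q"
  unfolding act_def
  by (simp_all add: semilinearD[OF letter_map(1)[OF field_hom_id]] letter_map(2-5)[OF field_hom_id])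

lemma pder_det_power: "pder Y (\<lambda>A. det A ^ n) A = of_nat n * pder Y det (mat 1) * (det A ^ n :: 'k alg_closure)"
  by (rule pder_power_eigen[OF polyfun_det pder_det])

text \<open>Each letter consumes one factor \<open>det A\<close> to become polynomial, and surplus
  factors stay with the empty word. Every one of the \<open>n\<close> factors adds
  \<open>det_weight z\<close> to the weight.\<close>

lemma poly_family_word:
  assumes "w \<in> lists U.S" "n \<ge> length w"
  shows "poly_family (\<lambda>A. cst (det A ^ n) * act A (wrd w))
    (\<lambda>z A. cst (of_nat n * det_weight z) * (cst (det A ^ n) * act A (wrd w)) + cst (det A ^ n) * act A (U.coad_der z (wrd w)))"
  using assms
proof (induction w arbitrary: n rule: list.induct)
  case Nil
  have "poly_family (\<lambda>A. cst (det A ^ n) * 1) (\<lambda>z A. cst (pder (\<rho> z) (\<lambda>A. det A ^ n) A) * 1)"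
    by (intro single polyfun_power polyfun_det falg_closed)
  then show ?case
    by (simp add: pder_det_power act_simps U.coad_der_def cst_mult mult.assoc)
next
  case (Cons x w)
  obtain m where n: "n = Suc m" "m \<ge> length w"
    using Cons.prems(2) by (cases n) auto
  obtain \<phi> y where x: "x = (\<phi>, y)" "\<phi> \<in> U.V" "y \<in> U.RL"
    using Cons.prems(1) by (cases x) (auto simp: U.S_RL)
  have w: "w \<in> lists U.S"
    using Cons.prems(1) by simp
  note wC = wrd_Cons[of x w, unfolded x(1)]
  have gx: "U.coad_der z (gen (\<phi>, y)) = gen (coad L UNIV z \<phi>, y)" for z
    by (simp add: U.coad_der_def)
  have ag: "act A (gen (\<psi>, y)) = gen (norm_act \<rho> UNIV A \<psi>, y)" for \<psi> A
    by (simp add: act_simps)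
  have eq1: "cst (det A ^ n) * act A (wrd (x # w)) = (cst (det A) * gen (norm_act \<rho> UNIV A \<phi>, y)) * (cst (det A ^ m) * act A (wrd w))" for A
    by (simp only: x(1) wC ag act_simps(7) n power_Suc cst_mult mult.assoc cst_left_commute[of "gen (norm_act \<rho> UNIV A \<phi>, y)"])
  have eq2: "cst (of_nat n * det_weight z) * (cst (det A ^ n) * act A (wrd (x # w))) + cst (det A ^ n) * act A (U.coad_der z (wrd (x # w))) =
      (cst (det_weight z) * (cst (det A) * gen (norm_act \<rho> UNIV A \<phi>, y)) + cst (det A) * gen (norm_act \<rho> UNIV A (coad L UNIV z \<phi>), y)) *
        (cst (det A ^ m) * act A (wrd w)) +
      (cst (det A) * gen (norm_act \<rho> UNIV A \<phi>, y)) *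
        (cst (of_nat m * det_weight z) * (cst (det A ^ m) * act A (wrd w)) + cst (det A ^ m) * act A (U.coad_der z (wrd w)))" for A z
  proof -
    define g :: "('g, 'k alg_closure, 'c) ce_letter list \<Rightarrow>\<^sub>0 'k alg_closure" where "g = gen (norm_act \<rho> UNIV A \<phi>, y)"
    define g' :: "('g, 'k alg_closure, 'c) ce_letter list \<Rightarrow>\<^sub>0 'k alg_closure" where "g' = gen (norm_act \<rho> UNIV A (coad L UNIV z \<phi>), y)"
    define a where "a = act A (wrd w)"
    define a' where "a' = act A (U.coad_der z (wrd w))"
    have "act A (wrd (x # w)) = g * a"
      by (simp only: x(1) wC ag act_simps(7) g_def a_def)
    moreover have "act A (U.coad_der z (wrd (x # w))) = g' * a + g * a'"
      by (simp only: x(1) wC U.coad_der_mult gx act_simps(1,7) ag g_def g'_def a_def a'_def)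
    ultimately show ?thesis
      unfolding g_def[symmetric] g'_def[symmetric] a_def[symmetric] a'_def[symmetric]
      by (simp add: n distrib_left distrib_right cst_add cst_mult mult.assoc cst_left_commute[of g] cst_left_commute[of g'])
        (simp add: cst_collect)
  qed
  show ?case
    unfolding eq2 unfolding eq1
    by (rule poly_family_mult[OF poly_family_letter[OF x(2,3)] Cons.IH[OF w n(2)]])
qed

text \<open>The words of \<open>u\<close> may differ in length. Claiming all exponents from some
  bound on lets summands share an exponent.\<close>

lemma poly_family_act:
  assumes "u \<in> falg U.S"
  shows "\<exists>N. \<forall>n\<ge>N. poly_family (\<lambda>A. cst (det A ^ n) * act A u)
    (\<lambda>z A. cst (of_nat n * det_weight z) * (cst (det A ^ n) * act A u) + cst (det A ^ n) * act A (U.coad_der z u))"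
  using assms
proof (induction rule: falg_induct)
  case zero
  show ?case
    using single[OF polyfun.intros(1)[of 0] falg_closed(1)]
    by (simp add: act_simps U.coad_der_simps)
next
  case (word r w)
  have "poly_family (\<lambda>A. cst (det A ^ n) * act A (cst r * wrd w))
      (\<lambda>z A. cst (of_nat n * det_weight z) * (cst (det A ^ n) * act A (cst r * wrd w)) + cst (det A ^ n) * act A (U.coad_der z (cst r * wrd w)))"
    if "n \<ge> length w" for n
  proof -
    have "poly_family (\<lambda>A. cst r * 1) (\<lambda>z A. cst (pder (\<rho> z) (\<lambda>A. r) A) * 1)"
      by (intro single polyfun.intros falg_closed)
    from poly_family_mult[OF this poly_family_word[OF word that]]
    show ?thesis
      by (simp add: act_simps U.coad_der_simps distrib_left cst_collect)
  qed
  then show ?case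
    by blast
next
  case (add a b)
  then obtain N M where NM: "\<And>n. n \<ge> N \<Longrightarrow> poly_family (\<lambda>A. cst (det A ^ n) * act A a)
      (\<lambda>z A. cst (of_nat n * det_weight z) * (cst (det A ^ n) * act A a) + cst (det A ^ n) * act A (U.coad_der z a))"
    "\<And>n. n \<ge> M \<Longrightarrow> poly_family (\<lambda>A. cst (det A ^ n) * act A b)
      (\<lambda>z A. cst (of_nat n * det_weight z) * (cst (det A ^ n) * act A b) + cst (det A ^ n) * act A (U.coad_der z b))"
    by blast
  have "poly_family (\<lambda>A. cst (det A ^ n) * act A (a + b))
      (\<lambda>z A. cst (of_nat n * det_weight z) * (cst (det A ^ n) * act A (a + b)) + cst (det A ^ n) * act A (U.coad_der z (a + b)))"
    if "n \<ge> max N M" for n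
    using poly_family.add[OF NM(1)[of n] NM(2)[of n]] that
    by (simp add: act_simps U.coad_der_simps distrib_left add_ac)
  then show ?case
    by blast
qed

lemma act_one:
  assumes "u \<in> falg U.S"
  shows "act (mat 1) u = u"
proof -
  have na: "norm_act \<rho> UNIV (mat 1) \<phi> = \<phi>" if \<phi>: "\<phi> \<in> U.V" for \<phi>
  proof
    fix x
    obtain \<psi> where \<psi>: "Vector_Spaces.linear mat_scale (*) \<psi>" "\<forall>x\<in>UNIV. \<psi> (\<rho> x) = \<phi> x"
      using functional_extension_UNIV[OF \<phi>] by blast
    have "matrix_inv (mat 1 :: 'k alg_closure ^ 'm ^ 'm) = mat 1"
      using matrix_inv_works(1)[OF GD(3)[OF GD(1)]] by simp
    then show "norm_act \<rho> UNIV (mat 1) \<phi> x = \<phi> x"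
      using norm_act_eq[OF \<psi> UNIV_I conj_stable[OF GD(1)]] \<psi>(2) by simp
  qed
  have "map (\<lambda>x. (norm_act \<rho> UNIV (mat 1) (fst x), snd x)) w = w" if "w \<in> lists U.S" for w
    using that by (induction w) (auto simp: U.S_RL na)
  with assms show ?thesis
    by (induction rule: falg_induct) (simp_all add: act_simps)
qed

text \<open>
  The coordinates of \<open>det(A)\<^sup>n A \<cdot> u\<close> are semi-invariants of the same weight as \<open>det(A)\<^sup>n\<close>.
\<close>

proposition lie_invariant_imp_group_invariant:
  assumes u: "u \<in> falg U.S" and inv: "\<And>z. U.coad_der z u \<in> U.I" and A: "A \<in> G"
  shows "U.eqv (act A u) u"
proof (rule ccontr)
  assume neq: "\<not> U.eqv (act A u) u"
  interpret F: vector_space "\<lambda>r (p :: ('g, 'k alg_closure, 'c) ce_letter list \<Rightarrow>\<^sub>0 'k alg_closure). cst r * p"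
    by (rule vector_space_list_algebra)
  have "F.subspace U.I"
    by (rule F.subspaceI) (auto intro: U.ID)
  then obtain f where f: "Vector_Spaces.linear (\<lambda>r p. cst r * p) (*) f" "\<And>p. p \<in> U.I \<Longrightarrow> f p = 0" "f (act A u - u) = 1"
    \<comment> \<open>The form \<open>f\<close> kills the relations but not the class of
      \<open>act A u - u\<close>, so a single scalar function on \<open>G\<close> will decide the
      matter.\<close>
    using F.separating_functional[of U.I "act A u - u"] neq by (auto simp: U.eqv_def)
  interpret f: Vector_Spaces.linear "\<lambda>r p. cst r * p" "(*)" f
    by (rule f(1))
  obtain n where fam: "poly_family (\<lambda>A. cst (det A ^ n) * act A u)
    (\<lambda>z A. cst (of_nat n * det_weight z) * (cst (det A ^ n) * act A u) + cst (det A ^ n) * act A (U.coad_der z u))"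
    using poly_family_act[OF u] by blast
  obtain P where P0: "P \<in> polyfun" "\<forall>A\<in>G. f (cst (det A ^ n) * act A u) = P A \<and>
      (\<forall>z. f (cst (of_nat n * det_weight z) * (cst (det A ^ n) * act A u) + cst (det A ^ n) * act A (U.coad_der z u)) = pder (\<rho> z) P A)"
    using poly_family_functional[OF fam f.add f.scale f(2)] by blast
  then have P: "P \<in> polyfun" "\<And>A. A \<in> G \<Longrightarrow> f (cst (det A ^ n) * act A u) = P A"
    "\<And>z A. A \<in> G \<Longrightarrow> f (cst (of_nat n * det_weight z) * (cst (det A ^ n) * act A u) + cst (det A ^ n) * act A (U.coad_der z u)) = pder (\<rho> z) P A"
    by blast+
  obtain B where B: "finite B" "mat_vs.independent (\<rho> ` B)" "mat_vs.span (\<rho> ` B) = group_lie G"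
    using \<rho>_basis by metis
  \<comment> \<open>The substitution \<open>act A\<close> preserves the relations, so infinitesimal
    invariance at 1 spreads over \<open>G\<close> and only the weight term of the derivative
    survives.\<close>
  have "f (act A (U.coad_der z u)) = 0" if "A \<in> G" for A z
    using ce_letter_map.lm_I[OF group_letter_map[OF that] inv] by (simp add: f(2) act_def ce_letter_map.lm_def[OF group_letter_map[OF that]])
  then have eigen: "pder (\<rho> z) P A = of_nat n * det_weight z * P A" if "A \<in> G" for A z
  proof -
    have "pder (\<rho> z) P A = of_nat n * det_weight z * f (cst (det A ^ n) * act A u)"
      using P(3)[OF that, of z] that \<open>\<And>A z. A \<in> G \<Longrightarrow> f (act A (U.coad_der z u)) = 0\<close>
      by (simp only: f.add f.scale mult_zero_right add_0_right)
    then show ?thesis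
      by (simp only: P(2)[OF that])
  qed
  \<comment> \<open>The comparison function is the power of \<open>det\<close>, which has no zeros
    on \<open>G\<close>; at 1 it has value 1, and \<open>P\<close> has value
    \<open>f u\<close>.\<close>
  have "P A * det (mat 1 :: 'k alg_closure ^ 'm ^ 'm) ^ n = P (mat 1) * det A ^ n"
  proof (rule semi_invariant_ratio_constant[OF G finite_imageI[OF B(1)] B(2,3) P(1) polyfun_power[OF polyfun_det] _ _ A])
    show "det A ^ n \<noteq> 0" if "A \<in> G" for A
      using GD(3)[OF that] by (simp add: invertible_det_nz)
    show "\<exists>c. \<forall>A\<in>G. pder Y P A = c * P A \<and> pder Y (\<lambda>A. det A ^ n) A = c * det A ^ n" if Y: "Y \<in> \<rho> ` B" for Y
    proof -
      obtain z where z: "Y = \<rho> z"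
        using Y by blast
      show ?thesis
        unfolding z by (intro exI[of _ "of_nat n * det_weight z"] ballI conjI eigen pder_det_power)
    qed
  qed
  moreover have "P A = det A ^ n * f (act A u)" "P (mat 1) = f u"
    using P(2)[OF A] P(2)[OF GD(1)] by (simp_all add: f.scale act_one[OF u])
  moreover have "det A ^ n \<noteq> 0"
    using GD(3)[OF A] by (simp add: invertible_det_nz)
  ultimately have "f (act A u) = f u"
    by auto
  then show False
    using f(3) by (simp add: f.diff)
qed

end

section \<open>Invariance under the Weyl group\<close>

lemma letter_map_cong:
  assumes \<kappa>: "field_hom \<kappa>" and fg: "\<And>x. x \<in> S \<Longrightarrow> f x = g x" and p: "p \<in> falg S"
  shows "letter_map \<kappa> f p = letter_map \<kappa> g p"
  using p
proof (induction rule: falg_induct)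
  case (word r w)
  then have "map f w = map g w"
    by (intro map_cong refl fg) auto
  then show ?case
    by (simp only: semilinearD[OF letter_map(1)[OF \<kappa>]] letter_map(2)[OF \<kappa>])
qed (simp_all add: semilinearD[OF letter_map(1)[OF \<kappa>]])

lemma letter_map_compose:
  assumes \<kappa>: "field_hom \<kappa>" and \<mu>: "field_hom \<mu>" and \<nu>: "field_hom \<nu>" "\<And>r. \<nu> r = \<mu> (\<kappa> r)"
  shows "letter_map \<mu> g (letter_map \<kappa> f p) = letter_map \<nu> (\<lambda>x. g (f x)) p"
proof -
  note lin = semilinearD[OF letter_map(1)[OF \<kappa>]] semilinearD[OF letter_map(1)[OF \<mu>]] semilinearD[OF letter_map(1)[OF \<nu>(1)]]
    letter_map(2)[OF \<kappa>] letter_map(2)[OF \<mu>] letter_map(2)[OF \<nu>(1)]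
  show ?thesis
    using falg_UNIV[of p]
  proof (induction rule: falg_induct)
    case (word r w)
    have "map g (map f w) = map (\<lambda>x. g (f x)) w"
      by simp
    then show ?case
      by (simp only: lin) (simp only: \<nu>(2)[of r])
  qed (simp_all only: lin)
qed

text \<open>Lie invariance is transported by restriction and by extension of scalars through this
  identity, since both commute with the coadjoint action on letters.\<close>

lemma letter_map_letter_der:
  assumes \<kappa>: "field_hom \<kappa>" and fg: "\<And>x. x \<in> S \<Longrightarrow> f (g x) = g' (f x)" and p: "p \<in> falg S"
  shows "letter_map \<kappa> f (ce_der 0 (\<lambda>x. gen (g x)) p) = ce_der 0 (\<lambda>x. gen (g' x)) (letter_map \<kappa> f p)"
proof -
  note lin = semilinearD[OF letter_map(1)[OF \<kappa>]] letter_map(2-5)[OF \<kappa>]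
  have w: "letter_map \<kappa> f (ce_der 0 (\<lambda>x. gen (g x)) (wrd w)) = ce_der 0 (\<lambda>x. gen (g' x)) (letter_map \<kappa> f (wrd w))"
    if "w \<in> lists S" for w
    using that
  proof (induction w rule: list.induct)
    case (Cons x w)
    then have "x \<in> S" "w \<in> lists S"
      by auto
    then show ?case
      using Cons.IH by (simp add: ce_der_Cons lin fg)
  qed (simp add: lin)
  show ?thesis
    using p
  proof (induction rule: falg_induct)
    case (word r u)
    then show ?case
      using w by (simp add: ce_der_simps lin(1-6))
  qed (simp_all add: ce_der_simps lin(1-6))
qed

section \<open>The DG algebra of cosets and its Lie invariants\<close>

context ce_setup
begin

abbreviation cls where "cls x \<equiv> I +>\<^bsub>free_alg S\<^esub> x"

lemma cls_eq: "cls x = cls y \<longleftrightarrow> x \<simeq>\<^sub>c y"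
  unfolding eqv_def by (rule coset_eq_iff[OF ideal_I])

lemma cls_eq_zero: "cls x = I \<longleftrightarrow> x \<in> I"
  using cls_eq[of x 0] by (simp add: coset_zero eqv_zero_iff)

lemma ce_alg_simps:
  "carrier (ce_alg \<iota> L l C) = cls ` falg S"
  "\<zero>\<^bsub>ce_alg \<iota> L l C\<^esub> = I" "\<one>\<^bsub>ce_alg \<iota> L l C\<^esub> = cls 1"
  "x \<in> falg S \<Longrightarrow> y \<in> falg S \<Longrightarrow> cls x \<oplus>\<^bsub>ce_alg \<iota> L l C\<^esub> cls y = cls (x + y)"
  "x \<in> falg S \<Longrightarrow> y \<in> falg S \<Longrightarrow> cls x \<otimes>\<^bsub>ce_alg \<iota> L l C\<^esub> cls y = cls (x * y)"
  "dg_smult (ce_alg \<iota> L l C) r (cls x) = cls (cst r * x)"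
  "dg_piece (ce_alg \<iota> L l C) n = cls ` {x. homog S n x}"
  "dg_diff (ce_alg \<iota> L l C) (cls x) = cls (ce_der (- 1) ce_dl x)"
proof -
  note Q = Quot_simps[OF ideal_I]
  note defs = ce_alg_def Let_def ring.extend_def dg_alg.fields_def
  show "carrier (ce_alg \<iota> L l C) = cls ` falg S" "\<zero>\<^bsub>ce_alg \<iota> L l C\<^esub> = I" "\<one>\<^bsub>ce_alg \<iota> L l C\<^esub> = cls 1"
    using Q(1-3) by (simp_all add: defs)
  show "x \<in> falg S \<Longrightarrow> y \<in> falg S \<Longrightarrow> cls x \<oplus>\<^bsub>ce_alg \<iota> L l C\<^esub> cls y = cls (x + y)"
    "x \<in> falg S \<Longrightarrow> y \<in> falg S \<Longrightarrow> cls x \<otimes>\<^bsub>ce_alg \<iota> L l C\<^esub> cls y = cls (x * y)"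
    using Q(4,5)[of x y] by (simp_all add: defs)
  show "dg_piece (ce_alg \<iota> L l C) n = cls ` {x. homog S n x}"
    by (auto simp: defs homog_def)
  have "dg_smult (ce_alg \<iota> L l C) r = ce_map \<iota> L l C (\<lambda>x. cst r * x)"
    by (simp add: defs)
  then show "dg_smult (ce_alg \<iota> L l C) r (cls x) = cls (cst r * x)"
    unfolding ce_map_def by (simp add: quot_map_coset[OF ideal_I ideal_I] distrib_left ID)
  have "dg_diff (ce_alg \<iota> L l C) = ce_map \<iota> L l C (ce_der (- 1) ce_dl)"
    by (simp add: defs ce_dl_def[abs_def])
  then show "dg_diff (ce_alg \<iota> L l C) (cls x) = cls (ce_der (- 1) ce_dl x)"
    unfolding ce_map_def by (simp add: quot_map_coset[OF ideal_I ideal_I] ce_der_simps ce_d_I)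
qed

lemma ce_lie_act_cls:
  assumes "z \<in> l"
  shows "ce_lie_act \<iota> L l C z (cls x) = cls (coad_der z x)"
proof -
  have "ce_lie_act \<iota> L l C z = ce_map \<iota> L l C (coad_der z)"
    by (simp add: ce_lie_act_def coad_der_def[abs_def])
  then show ?thesis
    unfolding ce_map_def
    by (simp add: quot_map_coset[OF ideal_I ideal_I] coad_der_simps coad_der_I[OF assms])
qed

text \<open>Representatives of the Lie invariant classes; closure properties are shown for them and
  then transferred to cosets.\<close>

definition linv :: "(('g, 'r, 'c) ce_letter list \<Rightarrow>\<^sub>0 'r) set"
  where "linv = {p \<in> falg S. \<forall>z\<in>l. coad_der z p \<in> I}"

lemma invariants_eq: "{A \<in> carrier (ce_alg \<iota> L l C). \<forall>z\<in>l. ce_lie_act \<iota> L l C z A = \<zero>\<^bsub>ce_alg \<iota> L l C\<^esub>} = cls ` linv"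
proof -
  have "(\<forall>z\<in>l. ce_lie_act \<iota> L l C z (cls x) = \<zero>\<^bsub>ce_alg \<iota> L l C\<^esub>) \<longleftrightarrow> (\<forall>z\<in>l. coad_der z x \<in> I)" for x
    by (simp add: ce_lie_act_cls ce_alg_simps cls_eq_zero)
  then show ?thesis
    unfolding ce_alg_simps(1) linv_def by blast
qed

text \<open>The coadjoint action replaces a letter by one of the same degree. Hence homogeneous
  components of invariants are invariant.\<close>

lemma coad_der_gproj: "coad_der z (gproj n p) = gproj n (coad_der z p)"
proof -
  have w: "gproj n (coad_der z (wrd w)) = (if ce_word_deg w = n then coad_der z (wrd w) else 0)" for w n
  proof (induction w arbitrary: n)
    case (Cons x w)
    let ?x = "(coad L l z (fst x), snd x)"
    have "coad_der z (wrd (x # w)) = gen ?x * wrd w + gen x * coad_der z (wrd w)"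
      by (simp add: coad_der_def ce_der_Cons)
    also have "gen ?x * wrd w = (wrd (?x # w) :: ('g, 'r, 'c) ce_letter list \<Rightarrow>\<^sub>0 'r)"
      by (rule wrd_Cons[symmetric])
    finally have "coad_der z (wrd (x # w)) = wrd (?x # w) + gen x * coad_der z (wrd w)" .
    moreover have "ce_word_deg (?x # w) = ce_word_deg (x # w)"
      by (simp add: ce_deg_def)
    ultimately show ?case
      using Cons.IH by (auto simp: gproj_simps gproj_wrd gproj_wrd_mult)
  qed (simp add: coad_der_def gproj_simps)
  show ?thesis
    using falg_UNIV[of p]
    by (induction rule: falg_induct) (auto simp: gproj_simps coad_der_simps gproj_wrd w)
qed

lemma linv_closed:
  "0 \<in> linv" "1 \<in> linv" "p \<in> linv \<Longrightarrow> q \<in> linv \<Longrightarrow> p + q \<in> linv" "p \<in> linv \<Longrightarrow> q \<in> linv \<Longrightarrow> p * q \<in> linv"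
  "p \<in> linv \<Longrightarrow> cst r * p \<in> linv" "p \<in> linv \<Longrightarrow> ce_der (- 1) ce_dl p \<in> linv" "p \<in> linv \<Longrightarrow> gproj n p \<in> linv"
proof -
  show "0 \<in> linv" "p \<in> linv \<Longrightarrow> q \<in> linv \<Longrightarrow> p + q \<in> linv" "p \<in> linv \<Longrightarrow> cst r * p \<in> linv"
    by (auto simp: linv_def coad_der_simps ID intro: falg_closed)
  show "1 \<in> linv"
    by (simp add: linv_def coad_der_def falg_closed ID)
  show "p \<in> linv \<Longrightarrow> q \<in> linv \<Longrightarrow> p * q \<in> linv"
    by (auto simp: linv_def coad_der_mult falg_closed intro!: ID(2)[OF ID(6) ID(5)])
  show "p \<in> linv \<Longrightarrow> gproj n p \<in> linv"
    by (simp add: linv_def gproj_falg coad_der_gproj gproj_I)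
  show "ce_der (- 1) ce_dl p \<in> linv" if p: "p \<in> linv"
  proof -
    have "coad_der z (ce_der (- 1) ce_dl p) \<in> I" if "z \<in> l" for z
    proof -
      have "coad_der z (ce_der (- 1) ce_dl p) \<simeq>\<^sub>c ce_der (- 1) ce_dl (coad_der z p)"
        using p that by (intro coad_d_comm) (auto simp: linv_def)
      also have "\<dots> \<simeq>\<^sub>c 0"
        using p that by (auto simp: linv_def eqv_zero_iff ce_d_I)
      finally show ?thesis
        by (simp add: eqv_zero_iff)
    qed
    then show ?thesis
      using p by (auto simp: linv_def ce_d_falg)
  qed
qed

end

context ce_letter_map
begin

lemma ce_map_lm: "ce_map \<iota>' L l' C lm (src.cls x) = tgt.cls (lm x)"
  unfolding ce_map_def
  by (rule quot_map_coset[OF src.ideal_I tgt.ideal_I]) (simp_all add: lm_simps lm_I)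

lemma lm_eqv: "src.eqv p q \<Longrightarrow> tgt.eqv (lm p) (lm q)"
  using lm_I[of "p - q"] by (simp add: src.eqv_def tgt.eqv_def lm_simps)

end

lemma rel_ce_alg_simps:
  assumes "ce_setup id L l C"
  shows "carrier (rel_ce_alg L l C) = (\<lambda>x. ce_rel id L l C +>\<^bsub>free_alg (ce_letters id L l C)\<^esub> x) ` ce_setup.linv id L l C"
    "\<zero>\<^bsub>rel_ce_alg L l C\<^esub> = \<zero>\<^bsub>ce_alg id L l C\<^esub>" "\<one>\<^bsub>rel_ce_alg L l C\<^esub> = \<one>\<^bsub>ce_alg id L l C\<^esub>"
    "add (rel_ce_alg L l C) = add (ce_alg id L l C)" "monoid.mult (rel_ce_alg L l C) = monoid.mult (ce_alg id L l C)"
    "dg_smult (rel_ce_alg L l C) = dg_smult (ce_alg id L l C)" "dg_diff (rel_ce_alg L l C) = dg_diff (ce_alg id L l C)"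
    "dg_piece (rel_ce_alg L l C) n = dg_piece (ce_alg id L l C) n \<inter> carrier (rel_ce_alg L l C)"
proof -
  interpret ce_setup id L l C
    by fact
  show "carrier (rel_ce_alg L l C) = cls ` linv"
    unfolding rel_ce_alg_def dg_restrict_def invariants_eq[symmetric] by simp
qed (simp_all add: rel_ce_alg_def dg_restrict_def)

text \<open>Recursion for \<open>finsum\<close> is available in an abelian monoid, so those axioms
  are first checked on representatives; the sum is then taken in the free algebra.\<close>

lemma rel_ce_alg_finsum:
  assumes "ce_setup id L l C" and "finite N" and "\<And>n. n \<in> N \<Longrightarrow> f n \<in> ce_setup.linv id L l C"
  shows "(\<Oplus>\<^bsub>rel_ce_alg L l C\<^esub>n\<in>N. ce_rel id L l C +>\<^bsub>free_alg (ce_letters id L l C)\<^esub> f n) =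
    ce_rel id L l C +>\<^bsub>free_alg (ce_letters id L l C)\<^esub> (\<Sum>n\<in>N. f n)"
proof -
  interpret ce_setup id L l C
    by fact
  note R = rel_ce_alg_simps[OF assms(1)]
  have falg: "p \<in> linv \<Longrightarrow> p \<in> falg S" for p
    by (simp add: linv_def)
  have zero: "\<zero>\<^bsub>rel_ce_alg L l C\<^esub> = cls 0"
    unfolding R(2) ce_alg_simps(2) coset_zero ..
  have add: "cls p \<oplus>\<^bsub>rel_ce_alg L l C\<^esub> cls q = cls (p + q)" if "p \<in> linv" "q \<in> linv" for p q
    unfolding R(4) by (rule ce_alg_simps(4)[OF falg[OF that(1)] falg[OF that(2)]])
  interpret abelian_monoid "rel_ce_alg L l C"
    by (rule abelian_monoidI) (auto simp: R(1) zero add linv_closed add_ac)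
  have "(\<Oplus>\<^bsub>rel_ce_alg L l C\<^esub>n\<in>N. cls (f n)) = cls (\<Sum>n\<in>N. f n) \<and> (\<Sum>n\<in>N. f n) \<in> linv"
    using assms(2,3)
  proof (induction N rule: finite_induct)
    case empty
    show ?case
      unfolding finsum_empty sum.empty by (intro conjI zero linv_closed)
  next
    case (insert n N)
    have IH: "(\<Oplus>\<^bsub>rel_ce_alg L l C\<^esub>n\<in>N. cls (f n)) = cls (\<Sum>n\<in>N. f n)" and N: "(\<Sum>n\<in>N. f n) \<in> linv"
      using insert.IH insert.prems by blast+
    have "(\<Oplus>\<^bsub>rel_ce_alg L l C\<^esub>n\<in>insert n N. cls (f n)) = cls (f n) \<oplus>\<^bsub>rel_ce_alg L l C\<^esub> (\<Oplus>\<^bsub>rel_ce_alg L l C\<^esub>n\<in>N. cls (f n))"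
      by (rule finsum_insert[OF insert.hyps])
        (unfold R(1), use insert.prems in blast, rule imageI[OF insert.prems[OF insertI1]])
    also have "\<dots> = cls (f n + (\<Sum>n\<in>N. f n))"
      unfolding IH by (rule add[OF insert.prems[OF insertI1] N])
    finally show ?case
      unfolding sum.insert[OF insert.hyps] using linv_closed(3)[OF insert.prems[OF insertI1] N] by blast
  qed
  then show ?thesis ..
qed

section \<open>The normalizer action and Weyl invariants\<close>

locale weyl_setup = group_setup L C G \<rho>
  for L :: "('k::field_char_0, 'g::ab_group_add) lie_alg"
    and C :: "('k, 'c::ab_group_add) coalg"
    and G :: "('k alg_closure ^ 'm ^ 'm) set"
    and \<rho> :: "'g \<Rightarrow> 'k alg_closure ^ 'm ^ 'm" +
  fixes h :: "'g set"
  assumes h: "lie_subalgebra L h"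
begin

sublocale H: ce_setup to_ac L h C
  by (rule ce_setup.intro[OF field_hom_to_ac L h C])

sublocale H0: ce_setup id L h C
  by (rule ce_setup.intro[OF field_hom_id L h C])

sublocale U0: ce_setup id L UNIV C
  by (rule ce_setup.intro[OF field_hom_id L lie_subalgebra_UNIV[OF L] C])

definition res :: "('g \<Rightarrow> 'r::zero) \<Rightarrow> 'g \<Rightarrow> 'r"
  where "res \<phi> = (\<lambda>y. if y \<in> h then \<phi> y else 0)"

text \<open>The sides of a square: \<open>bc\<close> and \<open>bcU\<close> extend scalars,
  \<open>r0\<close> and \<open>rK\<close> restrict functionals to \<open>h\<close>.\<close>

sublocale bc: ce_letter_map id to_ac L h h C to_ac "\<lambda>\<phi>. to_ac \<circ> \<phi>"
  by (intro ce_letter_map.intro H.ce_setup_axioms H0.ce_setup_axioms ce_letter_map_axioms.intro field_hom_to_ac)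
    (auto simp: lie_dual_def fun_eq_iff)

sublocale bcU: ce_letter_map id to_ac L UNIV UNIV C to_ac "\<lambda>\<phi>. to_ac \<circ> \<phi>"
  by (intro ce_letter_map.intro U.ce_setup_axioms U0.ce_setup_axioms ce_letter_map_axioms.intro field_hom_to_ac)
    (auto simp: lie_dual_def fun_eq_iff)

sublocale r0: ce_letter_map id id L UNIV h C id res
  by (intro ce_letter_map.intro H0.ce_setup_axioms U0.ce_setup_axioms ce_letter_map_axioms.intro field_hom_id)
    (auto simp: lie_dual_def fun_eq_iff res_def H.l_closed)

sublocale rK: ce_letter_map to_ac to_ac L UNIV h C id res
  by (intro ce_letter_map.intro H.ce_setup_axioms U.ce_setup_axioms ce_letter_map_axioms.intro field_hom_id)
    (auto simp: lie_dual_def fun_eq_iff res_def H.l_closed)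

text \<open>The normalizer is defined by equality of the span with its image, which gives stability
  under the inverse conjugation too.\<close>

lemma normalizer_stable:
  assumes A: "A \<in> cartan_normalizer G \<rho> h" and x: "x \<in> h"
  shows "matrix_inv A ** \<rho> x ** A \<in> ext_span \<rho> h"
proof -
  have "\<rho> x \<in> ext_span \<rho> h"
    unfolding ext_span_def using x by (intro mat_vs.span_base) auto
  then obtain Y where Y: "Y \<in> ext_span \<rho> h" "\<rho> x = A ** Y ** matrix_inv A"
    using A by (auto simp: cartan_normalizer_def)
  have "matrix_inv A ** (A ** Y ** matrix_inv A) ** A = (matrix_inv A ** A) ** Y ** (matrix_inv A ** A)"
    by (simp add: matrix_mul_assoc)
  then show ?thesis
    using Y matrix_inv_works(2)[OF GD(3)[of A]] A by (simp add: cartan_normalizer_def)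
qed

lemma normalizer_G: "A \<in> cartan_normalizer G \<rho> h \<Longrightarrow> A \<in> G"
  by (simp add: cartan_normalizer_def)

lemma normalizer_letter_map:
  "A \<in> cartan_normalizer G \<rho> h \<Longrightarrow> ce_letter_map to_ac to_ac L h h C id (norm_act \<rho> h A)"
  using normalizer_stable GD(3) normalizer_G by (intro norm_act_letter_map h) auto

lemma matrix_inv_unique: "A ** B = mat 1 \<Longrightarrow> B ** A = mat 1 \<Longrightarrow> matrix_inv A = (B :: 'a::field ^ 'm ^ 'm)"
  using matrix_inv_works(2)[of A] by (metis invertible_def matrix_mul_assoc matrix_mul_lid matrix_mul_rid)

text \<open>The action of a class uses an arbitrary member \<open>Z ** A0\<close> of it. Since
  \<open>Z\<close> fixes the span pointwise, this member conjugates the span exactly as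
  \<open>A0\<close> does and so belongs to the normalizer.\<close>

lemma weyl_representative:
  assumes w: "w \<in> carrier (weyl_group G \<rho> h)"
  shows "(SOME A. A \<in> w) \<in> cartan_normalizer G \<rho> h"
proof -
  obtain A0 where A0: "A0 \<in> cartan_normalizer G \<rho> h" "w = (\<lambda>Z. Z ** A0) ` cartan_centralizer G \<rho> h"
    using w by (auto simp: weyl_group_def FactGroup_def RCOSETS_def r_coset_def mat_group_def)
  have "mat 1 \<in> cartan_centralizer G \<rho> h"
    using GD(1) matrix_inv_works(1)[OF GD(3)[OF GD(1)]] by (simp add: cartan_centralizer_def)
  then have "w \<noteq> {}"
    using A0 by auto
  then have "(SOME A. A \<in> w) \<in> w"
    by (simp add: some_in_eq)
  then obtain Z where Z: "Z \<in> cartan_centralizer G \<rho> h" "(SOME A. A \<in> w) = Z ** A0"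
    using A0 by auto
  have ZG: "Z \<in> G" "A0 \<in> G"
    using Z A0 by (auto simp: cartan_centralizer_def cartan_normalizer_def)
  note invs = matrix_inv_works[OF GD(3)[OF ZG(1)]] matrix_inv_works[OF GD(3)[OF ZG(2)]]
  have inv: "matrix_inv (Z ** A0) = matrix_inv A0 ** matrix_inv Z"
    by (rule matrix_inv_unique) (metis invs matrix_mul_assoc matrix_mul_lid matrix_mul_rid)+
  have "Z ** A0 ** Y ** matrix_inv (Z ** A0) = A0 ** Y ** matrix_inv A0" if Y: "Y \<in> ext_span \<rho> h" for Y
  proof -
    have "A0 ** Y ** matrix_inv A0 \<in> ext_span \<rho> h"
      using A0(1) Y by (auto simp: cartan_normalizer_def)
    then have "Z ** (A0 ** Y ** matrix_inv A0) ** matrix_inv Z = A0 ** Y ** matrix_inv A0"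
      using Z(1) by (simp add: cartan_centralizer_def)
    then show ?thesis
      by (simp add: inv matrix_mul_assoc)
  qed
  then have "(\<lambda>Y. Z ** A0 ** Y ** matrix_inv (Z ** A0)) ` ext_span \<rho> h = ext_span \<rho> h"
    using A0(1) by (simp add: cartan_normalizer_def cong: image_cong_simp)
  then show ?thesis
    using Z(2) GD(2)[OF ZG] by (simp add: cartan_normalizer_def)
qed

definition nact :: "'k alg_closure ^ 'm ^ 'm \<Rightarrow> (('g, 'k alg_closure, 'c) ce_letter list \<Rightarrow>\<^sub>0 'k alg_closure)
    \<Rightarrow> ('g, 'k alg_closure, 'c) ce_letter list \<Rightarrow>\<^sub>0 'k alg_closure"
  where "nact A = letter_map id (\<lambda>x. (norm_act \<rho> h A (fst x), snd x))"

definition winv :: "(('g, 'k, 'c) ce_letter list \<Rightarrow>\<^sub>0 'k) set"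
  where "winv = {p \<in> H0.linv. \<forall>w\<in>carrier (weyl_group G \<rho> h). H.eqv (nact (SOME A. A \<in> w) (bc.lm p)) (bc.lm p)}"

lemma nact_simps:
  "nact A (p + q) = nact A p + nact A q" "nact A (cst r * p) = cst r * nact A p" "nact A 0 = 0"
  "nact A 1 = 1" "nact A (p * q) = nact A p * nact A q"
  unfolding nact_def
  by (simp_all add: semilinearD[OF letter_map(1)[OF field_hom_id]] letter_map(2-5)[OF field_hom_id])

lemma nact_lm: "A \<in> cartan_normalizer G \<rho> h \<Longrightarrow> ce_letter_map.lm id (norm_act \<rho> h A) = nact A"
  using ce_letter_map.lm_def[OF normalizer_letter_map] unfolding nact_def by blast

lemma weyl_act_cls:
  assumes "w \<in> carrier (weyl_group G \<rho> h)"
  shows "weyl_act L h C \<rho> w (H.cls p) = H.cls (nact (SOME A. A \<in> w) p)"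
proof -
  interpret N: ce_letter_map to_ac to_ac L h h C id "norm_act \<rho> h (SOME A. A \<in> w)"
    by (rule normalizer_letter_map[OF weyl_representative[OF assms]])
  have "weyl_act L h C \<rho> w = ce_map to_ac L h C N.lm"
    unfolding weyl_act_def N.lm_def letter_map_def ..
  then show ?thesis
    using N.ce_map_lm[of p] unfolding nact_lm[OF weyl_representative[OF assms]] by (simp only:)
qed

lemma ce_base_change_cls: "ce_base_change L h C (H0.cls p) = H.cls (bc.lm p)"
proof -
  have "ce_base_change L h C = ce_map to_ac L h C bc.lm"
    unfolding ce_base_change_def bc.lm_def letter_map_def ..
  then show ?thesis
    by (simp add: bc.ce_map_lm)
qed

lemma weyl_invariants_eq: "weyl_invariants L h C G \<rho> = H0.cls ` winv"
proof -
  have "(\<forall>w\<in>carrier (weyl_group G \<rho> h). weyl_act L h C \<rho> w (ce_base_change L h C (H0.cls p)) = ce_base_change L h C (H0.cls p)) \<longleftrightarrow>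
      (\<forall>w\<in>carrier (weyl_group G \<rho> h). H.eqv (nact (SOME A. A \<in> w) (bc.lm p)) (bc.lm p))" for p
    unfolding ce_base_change_cls by (simp add: weyl_act_cls H.cls_eq)
  then show ?thesis
    unfolding weyl_invariants_def rel_ce_alg_simps(1)[OF H0.ce_setup_axioms] winv_def by blast
qed

text \<open>Needed because the differential of the Weyl invariants lives over the ground field while
  their invariance is tested over the closure.\<close>

lemma bc_d: "p \<in> falg H0.S \<Longrightarrow> H.eqv (bc.lm (ce_der (- 1) H0.ce_dl p)) (ce_der (- 1) H.ce_dl (bc.lm p))"
proof (rule bc.lm_d)
  fix \<phi> u v assume "\<phi> \<in> H0.V" "u \<in> h" "v \<in> h"
  from arg_cong[OF H0.br_expand[OF this], of to_ac]
  show "(\<Sum>(b, b')\<in>H0.\<B> \<times> H0.\<B>. to_ac (\<phi> (lie_br L b b')) * (to_ac \<circ> H0.dual b) u * (to_ac \<circ> H0.dual b') v) = (to_ac \<circ> \<phi>) (lie_br L u v)"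
    by (simp add: to_ac_sum case_prod_unfold mult.assoc)
qed

lemma winv_closed:
  "0 \<in> winv" "1 \<in> winv" "p \<in> winv \<Longrightarrow> q \<in> winv \<Longrightarrow> p + q \<in> winv" "p \<in> winv \<Longrightarrow> q \<in> winv \<Longrightarrow> p * q \<in> winv"
  "p \<in> winv \<Longrightarrow> cst r * p \<in> winv" "p \<in> winv \<Longrightarrow> ce_der (- 1) H0.ce_dl p \<in> winv" "p \<in> winv \<Longrightarrow> gproj n p \<in> winv"
proof -
  \<comment> \<open>Weyl classes are replaced by single elements of the normalizer; \<open>P\<close>
    collects the elements whose invariance is already known.\<close>
  have closed: "f \<in> winv" if "f \<in> H0.linv"
    and "\<And>A. A \<in> cartan_normalizer G \<rho> h \<Longrightarrow>
      (\<And>p. p \<in> P \<Longrightarrow> H.eqv (nact A (bc.lm p)) (bc.lm p)) \<Longrightarrow> H.eqv (nact A (bc.lm f)) (bc.lm f)"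
    and "P \<subseteq> winv" for f P
    using that weyl_representative unfolding winv_def by blast
  have linv: "p \<in> winv \<Longrightarrow> p \<in> H0.linv" and falg: "p \<in> winv \<Longrightarrow> p \<in> falg H0.S" for p
    by (auto simp: winv_def H0.linv_def)
  have nfalg: "nact A p \<in> falg H.S" if "A \<in> cartan_normalizer G \<rho> h" "p \<in> falg H.S" for A p
    using ce_letter_map.lm_falg[OF normalizer_letter_map[OF that(1)] that(2)]
    unfolding nact_lm[OF that(1)] .
  show "0 \<in> winv"
    by (rule closed[of _ "{}"]) (simp_all add: H0.linv_closed bc.lm_simps nact_simps)
  show "1 \<in> winv"
    by (rule closed[of _ "{}"]) (simp_all add: H0.linv_closed bc.lm_simps nact_simps)
  show "p + q \<in> winv" if "p \<in> winv" "q \<in> winv"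
    by (rule closed[of _ "{p, q}"])
      (use that linv in \<open>auto simp: H0.linv_closed bc.lm_simps nact_simps intro!: H.eqv_add\<close>)
  show "p * q \<in> winv" if "p \<in> winv" "q \<in> winv"
  proof (rule closed[of _ "{p, q}"])
    show "p * q \<in> H0.linv"
      using that linv by (simp add: H0.linv_closed)
    fix A assume A: "A \<in> cartan_normalizer G \<rho> h" and eq: "\<And>r. r \<in> {p, q} \<Longrightarrow> H.eqv (nact A (bc.lm r)) (bc.lm r)"
    have "H.eqv (nact A (bc.lm p) * nact A (bc.lm q)) (bc.lm p * bc.lm q)"
      using that by (intro H.eqv_mult eq nfalg A bc.lm_falg falg) auto
    then show "H.eqv (nact A (bc.lm (p * q))) (bc.lm (p * q))"
      by (simp add: bc.lm_simps nact_simps)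
  qed (use that in auto)
  show "cst r * p \<in> winv" if "p \<in> winv"
    by (rule closed[of _ "{p}"])
      (use that linv in \<open>auto simp: H0.linv_closed bc.lm_simps(2) nact_simps(2) intro!: H.eqv_cst\<close>)
  show "gproj n p \<in> winv" if "p \<in> winv"
  proof (rule closed[of _ "{p}"])
    show "gproj n p \<in> H0.linv"
      using that linv by (simp add: H0.linv_closed)
    fix A assume A: "A \<in> cartan_normalizer G \<rho> h" and eq: "\<And>r. r \<in> {p} \<Longrightarrow> H.eqv (nact A (bc.lm r)) (bc.lm r)"
    interpret N: ce_letter_map to_ac to_ac L h h C id "norm_act \<rho> h A"
      by (rule normalizer_letter_map[OF A])
    have "gproj n (nact A (bc.lm p) - bc.lm p) \<in> H.I"
      using eq[of p] by (intro H.gproj_I) (simp add: H.eqv_def)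
    moreover have "nact A (gproj n q) = gproj n (nact A q)" for q
      using N.lm_gproj[of n q] unfolding nact_lm[OF A] .
    ultimately show "H.eqv (nact A (bc.lm (gproj n p))) (bc.lm (gproj n p))"
      unfolding H.eqv_def bc.lm_gproj by (simp add: gproj_simps)
  qed (use that in auto)
  show "ce_der (- 1) H0.ce_dl p \<in> winv" if p: "p \<in> winv"
  proof (rule closed[of _ "{p}"])
    show "ce_der (- 1) H0.ce_dl p \<in> H0.linv"
      using p linv by (simp add: H0.linv_closed)
    fix A assume A: "A \<in> cartan_normalizer G \<rho> h" and eq: "\<And>r. r \<in> {p} \<Longrightarrow> H.eqv (nact A (bc.lm r)) (bc.lm r)"
    interpret N: ce_letter_map to_ac to_ac L h h C id "norm_act \<rho> h A"
      by (rule normalizer_letter_map[OF A])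
    have N: "N.lm = nact A"
      by (rule nact_lm[OF A])
    \<comment> \<open>The normalizer acts over the closure, so the differential is moved there by
      base change, exchanged with the action, and moved back.\<close>
    let ?e = "ce_der (- 1) H0.ce_dl" and ?d = "ce_der (- 1) H.ce_dl"
    have bcd: "H.eqv (bc.lm (?e p)) (?d (bc.lm p))"
      by (rule bc_d[OF falg[OF p]])
    have "H.eqv (nact A (bc.lm (?e p))) (nact A (?d (bc.lm p)))"
      using N.lm_eqv[OF bcd] by (simp add: N)
    also have "H.eqv \<dots> (?d (nact A (bc.lm p)))"
      unfolding N[symmetric]
      by (rule N.lm_d[OF norm_act_br[OF h GD(3)[OF normalizer_G[OF A]] normalizer_stable[OF A]]])
        (use bc.lm_falg[OF falg[OF p]] in auto)
    also have "H.eqv \<dots> (?d (bc.lm p))"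
      using H.ce_d_I[of "nact A (bc.lm p) - bc.lm p"] eq by (simp add: H.eqv_def ce_der_simps)
    also have "H.eqv \<dots> (bc.lm (?e p))"
      by (rule H.eqv_sym[OF bcd])
    finally show "H.eqv (nact A (bc.lm (?e p))) (bc.lm (?e p))" .
  qed (use p in auto)
qed

lemma dg_subalgebra_weyl_invariants: "dg_subalgebra (rel_ce_alg L h C) (weyl_invariants L h C G \<rho>)"
proof -
  note R = rel_ce_alg_simps[OF H0.ce_setup_axioms]
  have linv: "p \<in> winv \<Longrightarrow> p \<in> H0.linv" and falg: "p \<in> winv \<Longrightarrow> p \<in> falg H0.S" for p
    by (auto simp: winv_def H0.linv_def)
  have "\<exists>N y. finite N \<and> (\<forall>n\<in>N. y n \<in> dg_piece (rel_ce_alg L h C) n \<inter> H0.cls ` winv) \<and>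
      H0.cls p = (\<Oplus>\<^bsub>rel_ce_alg L h C\<^esub>n\<in>N. y n)" if p: "p \<in> winv" for p
  proof (intro exI conjI ballI)
    \<comment> \<open>The degrees of the words of \<open>p\<close>; the components in these degrees
      already add up to \<open>p\<close>.\<close>
    let ?N = "ce_word_deg ` Poly_Mapping.keys p"
    show "finite ?N"
      by simp
    show "H0.cls (gproj n p) \<in> dg_piece (rel_ce_alg L h C) n \<inter> H0.cls ` winv" for n
      using winv_closed(7)[OF p, of n] linv homog_gproj[OF falg[OF p], of n]
      by (auto simp: R(1,8) H0.ce_alg_simps)
    show "H0.cls p = (\<Oplus>\<^bsub>rel_ce_alg L h C\<^esub>n\<in>?N. H0.cls (gproj n p))"
      using rel_ce_alg_finsum[OF H0.ce_setup_axioms, of ?N "\<lambda>n. gproj n p"] winv_closed(7)[OF p] linv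
      by (simp add: gproj_sum)
  qed
  moreover have "H0.I \<in> H0.cls ` winv"
    using imageI[OF winv_closed(1), of "\<lambda>x. H0.cls x"] unfolding coset_zero .
  ultimately show ?thesis
    unfolding dg_subalgebra_def weyl_invariants_eq
    using linv winv_closed
    by (auto simp: R H0.ce_alg_simps falg intro!: imageI)
qed

text \<open>Group invariance is available for the extension of scalars of an element on all of
  \<open>L\<close>. The square of restriction and base change identifies the restriction of that
  element to \<open>h\<close> with the one on which \<open>winv\<close> tests invariance.\<close>

lemma ce_restrict_weyl_invariant:
  "ce_restrict L h C ` carrier (rel_ce_alg L UNIV C) \<subseteq> weyl_invariants L h C G \<rho>"
proof -
  have "ce_restrict L h C (U0.cls q) \<in> H0.cls ` winv" if q: "q \<in> U0.linv" for q
  proof -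
    have qS: "q \<in> falg U0.S" and qI: "\<And>z. U0.coad_der z q \<in> U0.I"
      using q by (auto simp: U0.linv_def)
    have "ce_restrict L h C = ce_map id L h C r0.lm"
      by (simp add: ce_restrict_def[abs_def] r0.lm_def letter_map_def[abs_def] res_def)
    then have "ce_restrict L h C (U0.cls q) = H0.cls (r0.lm q)"
      by (simp add: r0.ce_map_lm)
    moreover have "r0.lm q \<in> winv"
      unfolding winv_def
    proof (intro CollectI conjI ballI)
      have "H0.coad_der z (r0.lm q) \<in> H0.I" if z: "z \<in> h" for z
      proof -
        have "r0.lm (U0.coad_der z q) = H0.coad_der z (r0.lm q)"
          unfolding r0.lm_def U0.coad_der_def H0.coad_der_def
          by (rule letter_map_letter_der[OF field_hom_id _ qS])
            (auto simp: res_def coad_def fun_eq_iff H.l_closed z)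
        then show ?thesis
          using r0.lm_I[OF qI[of z]] by simp
      qed
      then show "r0.lm q \<in> H0.linv"
        by (simp add: H0.linv_def r0.lm_falg qS)
      fix w assume w: "w \<in> carrier (weyl_group G \<rho> h)"
      define A where "A = (SOME A. A \<in> w)"
      have A: "A \<in> cartan_normalizer G \<rho> h"
        unfolding A_def by (rule weyl_representative[OF w])
      have bcr: "bc.lm (r0.lm q) = rK.lm (bcU.lm q)"
      proof -
        have "bc.lm (r0.lm q) = letter_map to_ac (\<lambda>x. (to_ac \<circ> res (fst x), snd x)) q"
          unfolding bc.lm_def r0.lm_def
          by (subst letter_map_compose[OF field_hom_id field_hom_to_ac field_hom_to_ac]) auto
        also have "(\<lambda>x. (to_ac \<circ> res (fst x), snd x)) = (\<lambda>x :: ('g, 'k, 'c) ce_letter. (res (to_ac \<circ> fst x), snd x))"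
          by (auto simp: res_def fun_eq_iff)
        also have "letter_map to_ac \<dots> q = rK.lm (bcU.lm q)"
          unfolding bcU.lm_def rK.lm_def
          by (subst letter_map_compose[OF field_hom_to_ac field_hom_id field_hom_to_ac]) auto
        finally show ?thesis .
      qed
      have uS: "bcU.lm q \<in> falg U.S"
        by (rule bcU.lm_falg[OF qS])
      have "U.coad_der z (bcU.lm q) \<in> U.I" for z
      proof -
        have "bcU.lm (U0.coad_der z q) = U.coad_der z (bcU.lm q)"
          unfolding bcU.lm_def U0.coad_der_def U.coad_der_def
          by (rule letter_map_letter_der[OF field_hom_to_ac _ qS]) (auto simp: coad_def fun_eq_iff)
        then show ?thesis
          using bcU.lm_I[OF qI[of z]] by simp
      qed
      then have "U.eqv (act A (bcU.lm q)) (bcU.lm q)"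
        by (rule lie_invariant_imp_group_invariant[OF uS _ normalizer_G[OF A]])
      then have "H.eqv (rK.lm (act A (bcU.lm q))) (rK.lm (bcU.lm q))"
        by (rule rK.lm_eqv)
      moreover have "nact A (rK.lm (bcU.lm q)) = rK.lm (act A (bcU.lm q))"
      proof -
        \<comment> \<open>One linear form \<open>\<psi>\<close> on matrices computes both
          conjugation actions, on functionals on \<open>L\<close> and on their restrictions to
          \<open>h\<close>.\<close>
        have na: "norm_act \<rho> h A (res \<phi>) = res (norm_act \<rho> UNIV A \<phi>)" if \<phi>: "\<phi> \<in> U.V" for \<phi>
        proof
          fix x
          obtain \<psi> where \<psi>: "Vector_Spaces.linear mat_scale (*) \<psi>" "\<forall>x\<in>UNIV. \<psi> (\<rho> x) = \<phi> x"
            using functional_extension_UNIV[OF \<phi>] by blast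
          show "norm_act \<rho> h A (res \<phi>) x = res (norm_act \<rho> UNIV A \<phi>) x"
          proof (cases "x \<in> h")
            case True
            have "norm_act \<rho> h A (res \<phi>) x = \<psi> (matrix_inv A ** \<rho> x ** A)"
              by (rule norm_act_eq[OF \<psi>(1) _ True normalizer_stable[OF A True]]) (use \<psi>(2) in \<open>simp add: res_def\<close>)
            moreover have "norm_act \<rho> UNIV A \<phi> x = \<psi> (matrix_inv A ** \<rho> x ** A)"
              by (rule norm_act_eq[OF \<psi> UNIV_I conj_stable[OF normalizer_G[OF A]]])
            ultimately show ?thesis
              using True by (simp add: res_def)
          qed (simp add: res_def norm_act_def)
        qed
        have "nact A (rK.lm (bcU.lm q)) = letter_map id (\<lambda>x. (norm_act \<rho> h A (res (fst x)), snd x)) (bcU.lm q)"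
          unfolding nact_def rK.lm_def
          by (subst letter_map_compose[OF field_hom_id field_hom_id field_hom_id]) auto
        also have "\<dots> = letter_map id (\<lambda>x. (res (norm_act \<rho> UNIV A (fst x)), snd x)) (bcU.lm q)"
          by (rule letter_map_cong[OF field_hom_id _ uS]) (auto simp: U.S_iff na)
        also have "\<dots> = rK.lm (act A (bcU.lm q))"
          unfolding act_def rK.lm_def
          by (subst letter_map_compose[OF field_hom_id field_hom_id field_hom_id]) auto
        finally show ?thesis .
      qed
      ultimately show "H.eqv (nact (SOME A. A \<in> w) (bc.lm (r0.lm q))) (bc.lm (r0.lm q))"
        by (simp add: bcr A_def)
    qed
    ultimately show ?thesis
      by simp
  qed
  then show ?thesis
    unfolding rel_ce_alg_simps(1)[OF U0.ce_setup_axioms] weyl_invariants_eq by auto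
qed

end

theorem proposition7p1:
  fixes L :: "('k::field_char_0, 'g::ab_group_add) lie_alg"
    and h :: "'g set"
    and C :: "('k, 'c::ab_group_add) coalg"
    and G :: "('k alg_closure ^ 'm ^ 'm) set"
    and \<rho> :: "'g \<Rightarrow> 'k alg_closure ^ 'm ^ 'm"
  assumes "fd_lie_algebra L" and "reductive_lie L" and "cartan_subalgebra L h"
    and "coaug_conilp_cocomm_dg_coalgebra C"
    and "reductive_group G" and "lie_alg_of_group L G \<rho>"
  shows "dg_subalgebra (rel_ce_alg L h C) (weyl_invariants L h C G \<rho>) \<and>
    ce_restrict L h C ` carrier (rel_ce_alg L UNIV C) \<subseteq> weyl_invariants L h C G \<rho>"
proof -
  interpret weyl_setup L C G \<rho> h
    by (intro weyl_setup.intro group_setup.intro weyl_setup_axioms.intro)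
      (use assms in \<open>auto simp: reductive_group_def cartan_subalgebra_def\<close>)
  show ?thesis
    using dg_subalgebra_weyl_invariants ce_restrict_weyl_invariant by blast
qed

end
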